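(* The polynomial 2-functor $\mathbb F\mathrm{am}\colon\mathbf{VDBL}\to\mathbf{VDBL}$ (the families construction for virtual double categories) is familial.
   Context: Size: fix Grothendieck universes $\mathcal U_1\in\mathcal U_2$; small means in $\mathcal U_1$, large means in $\mathcal U_2$. $\mathbf{Set}$ and $\mathbf{Set}_\ast$ are the categories of small sets and small pointed sets; slices are strict slice 2-categories. Virtual double categories. A virtual double category $\mathbb A$ consists of: a category $\mathbb A_{\mathrm{vert}}$, whose objects and morphisms are the objects and vertical morphisms of $\mathbb A$; for each pair of objects a set of horizontal morphisms $\Gamma\colon A\nrightarrow A'$; for each $n\ge0$, each path of horizontal morphisms $\Gamma_i\colon A_{i-1}\nrightarrow A_i$ ($1\le i\le n$), each $\Delta\colon B\nrightarrow B'$ and vertical $u\colon A_0\to B$, $u'\colon A_n\to B'$, a set of multicells, written $\theta\colon(\Gamma_1,\dots,\Gamma_n)\Rightarrow\Delta$ over $(u,u')$ (for $n=0$ the top is a single object $A_0$; a cell is a multicell with $n=1$); identity cells $\mathrm{id}_\Gamma\colon(\Gamma)\Rightarrow\Gamma$ over identities; composites: for $\theta_i\colon(\Gamma_{i,1},\dots,\Gamma_{i,n_i})\Rightarrow\Delta_i$ over $(u_{i-1},u_i)$ ($1\le i\le m$) and $\kappa\colon(\Delta_1,\dots,\Delta_m)\Rightarrow\Lambda$ over $(v,v')$, a multicell $\kappa\circ(\theta_1,\dots,\theta_m)\colon(\Gamma_{1,1},\dots,\Gamma_{m,n_m})\Rightarrow\Lambda$ over $(vu_0,v'u_m)$; for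 $m=0$, given $\kappa\colon()\Rightarrow\Lambda$ over $(v,v')$ with top $B$ and vertical $u\colon A\to B$, a composite $\kappa\circ(u)$ over $(vu,v'u)$. Evident unit and associativity axioms hold. A virtual double functor $F\colon\mathbb A\to\mathbb B$ sends objects, vertical and horizontal morphisms and multicells to those of $\mathbb B$, compatibly with boundaries, functorially on vertical morphisms, and preserving identity cells and composites. A vertical transformation $\alpha\colon F\to G$ consists of a natural transformation $F_{\mathrm{vert}}\to G_{\mathrm{vert}}$ with components $\alpha_A\colon FA\to GA$, and cells $\alpha_\Gamma\colon(F\Gamma)\Rightarrow G\Gamma$ over $(\alpha_A,\alpha_{A'})$ for $\Gamma\colon A\nrightarrow A'$, with $\alpha_\Gamma\circ(F\theta)=G\theta\circ(\alpha_{\Gamma_1},\dots,\alpha_{\Gamma_n})$ for each multicell $\theta\colon(\Gamma_1,\dots,\Gamma_n)\Rightarrow\Gamma$ (for $n=0$ the right side is $G\theta\circ(\alpha_{A_0})$). Large virtual double categories, virtual double functors and vertical transformations form the 2-category $\mathbf{VDBL}$. Spans. For a category $\mathcal C$ with pullbacks, $\mathbb S\mathrm{pan}(\mathcal C)$ is the virtual double category with vertical category $\mathcal C$, horizontal morphisms $I\nrightarrow I'$ the spans $I\leftarrow S\to I'$ in $\mathcal C$, and multicells $(S_1,\dots,S_n)\Rightarrow S$ over $(v,v')$ the morphisms $m\colon S_1\times_{I_1}S_2\times_{I_2}\cdots\times_{I_{n-1}}S_n\to S$ (domain $I_0$ if $n=0$) compatible with the legs along $v$ and $v'$. $\mathbb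 S\mathrm{pan}=\mathbb S\mathrm{pan}(\mathbf{Set})$, $\mathbb S\mathrm{pan}_\ast=\mathbb S\mathrm{pan}(\mathbf{Set}_\ast)$, and $Q\colon\mathbb S\mathrm{pan}_\ast\to\mathbb S\mathrm{pan}$ is induced by the forgetful functor $\mathbf{Set}_\ast\to\mathbf{Set}$. The 2-functor $\mathbb F\mathrm{am}$. The pullback 2-functor $Q^\ast\colon\mathbf{VDBL}/\mathbb S\mathrm{pan}\to\mathbf{VDBL}/\mathbb S\mathrm{pan}_\ast$ has a right 2-adjoint $\prod_Q$, and $\mathbb F\mathrm{am}$ is the composite of $\mathbb S\mathrm{pan}_\ast\times(-)\colon\mathbf{VDBL}\to\mathbf{VDBL}/\mathbb S\mathrm{pan}_\ast$, $\prod_Q$, and the forgetful 2-functor $\mathbf{VDBL}/\mathbb S\mathrm{pan}\to\mathbf{VDBL}$. Explicitly, $\mathbb F\mathrm{am}(\mathbb A)$ has: objects $(I,(A_i)_{i\in I})$ with $I$ a small set and $A_i\in\mathbb A$; vertical morphisms $(I,(A_i))\to(I',(A'_{i'}))$ given by a function $v\colon I\to I'$ and vertical $f_i\colon A_i\to A'_{v(i)}$; horizontal morphisms $(I,(A_i))\nrightarrow(I',(A'_{i'}))$ given by a span $I\xleftarrow{(-)_-}S\xrightarrow{(-)_+}I'$ of small sets and horizontal morphisms $\Gamma_s\colon A_{s_-}\nrightarrow A'_{s_+}$ ($s\in S$); multicells $((S_k,\Gamma_k))_{k=1}^n\Rightarrow(S,\Gamma)$ over $((v,f),(v',f'))$ given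 by a multicell $m\colon(S_1,\dots,S_n)\Rightarrow S$ over $(v,v')$ in $\mathbb S\mathrm{pan}$ and, for each $(s_1,\dots,s_n)\in S_1\times_{I_1}\cdots\times_{I_{n-1}}S_n$, a multicell $(\Gamma_{1,s_1},\dots,\Gamma_{n,s_n})\Rightarrow\Gamma_{m(s_1,\dots,s_n)}$ over $(f_{(s_1)_-},f'_{(s_n)_+})$ in $\mathbb A$ (for $n=0$, a family indexed by $I_0$). Familial 2-functors. Let $\mathscr K$ be a 2-category with a terminal object $1$. A 2-functor $R\colon\mathscr K\to\mathscr L$ is a parametric right 2-adjoint if the 2-functor $R_1\colon\mathscr K\to\mathscr L/R1$, $K\mapsto(R!_K\colon RK\to R1)$, has a left 2-adjoint. A split fibration in a 2-category $\mathscr L$ is a morphism $p\colon E\to B$ such that each functor $\mathscr L(X,p)\colon\mathscr L(X,E)\to\mathscr L(X,B)$ is equipped with the structure of a split fibration (chosen functorial cartesian lifts) and, for each $f\colon Y\to X$, the functor $\mathscr L(f,E)$ preserves chosen cartesian lifts. $\mathrm{Spl}(B)$ is the 2-category of split fibrations over $B$, morphisms over $B$ preserving chosen cartesian lifts, and 2-cells as in $\mathscr L/B$; there is a forgetful 2-functor $U_B\colon\mathrm{Spl}(B)\to\mathscr L/B$. The 2-functor $R$ is familial if it is a parametric right 2-adjoint and $R_1$ factorizes as $\mathscr K\to\mathrm{Spl}(R1)\xrightarrow{U_{R1}}\mathscr L/R1$ for some 2-functor $\mathscr K\to\mathrm{Spl}(R1)$. *)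

theory Defs
  imports "HOL-Library.FuncSet"
begin

section \<open>Strict 2-categories\<close>

text \<open>Composites are written in applicative order: \<open>cmp1 K g f\<close> is \<open>g\<close> after \<open>f\<close>, and likewise for the
  vertical composite \<open>vcmp2\<close> and the horizontal composite \<open>hcmp2\<close> of 2-cells.\<close>

record ('o, 'a, 'c) twocat =
  Objs :: "'o set"
  Arrs :: "'a set"
  Cells :: "'c set"
  dom1 :: "'a \<Rightarrow> 'o"
  cod1 :: "'a \<Rightarrow> 'o"
  src2 :: "'c \<Rightarrow> 'a"
  tgt2 :: "'c \<Rightarrow> 'a"
  ide1 :: "'o \<Rightarrow> 'a"
  cmp1 :: "'a \<Rightarrow> 'a \<Rightarrow> 'a"
  ide2 :: "'a \<Rightarrow> 'c"
  vcmp2 :: "'c \<Rightarrow> 'c \<Rightarrow> 'c"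
  hcmp2 :: "'c \<Rightarrow> 'c \<Rightarrow> 'c"

definition arr_in :: "('o, 'a, 'c) twocat \<Rightarrow> 'a \<Rightarrow> 'o \<Rightarrow> 'o \<Rightarrow> bool" where
  "arr_in K f x y \<longleftrightarrow> f \<in> Arrs K \<and> dom1 K f = x \<and> cod1 K f = y"

definition cell_in :: "('o, 'a, 'c) twocat \<Rightarrow> 'c \<Rightarrow> 'a \<Rightarrow> 'a \<Rightarrow> bool" where
  "cell_in K \<alpha> f g \<longleftrightarrow> \<alpha> \<in> Cells K \<and> src2 K \<alpha> = f \<and> tgt2 K \<alpha> = g"

locale two_category =
  fixes K :: "('o, 'a, 'c) twocat"
  assumes dom1_cod1: "f \<in> Arrs K \<Longrightarrow> dom1 K f \<in> Objs K \<and> cod1 K f \<in> Objs K"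
    and src2_tgt2: "\<alpha> \<in> Cells K \<Longrightarrow> src2 K \<alpha> \<in> Arrs K \<and> tgt2 K \<alpha> \<in> Arrs K
        \<and> dom1 K (src2 K \<alpha>) = dom1 K (tgt2 K \<alpha>) \<and> cod1 K (src2 K \<alpha>) = cod1 K (tgt2 K \<alpha>)"
    and ide1: "x \<in> Objs K \<Longrightarrow> arr_in K (ide1 K x) x x"
    and cmp1: "arr_in K f x y \<Longrightarrow> arr_in K g y z \<Longrightarrow> arr_in K (cmp1 K g f) x z"
    and cmp1_ide1: "arr_in K f x y \<Longrightarrow> cmp1 K f (ide1 K x) = f \<and> cmp1 K (ide1 K y) f = f"
    and cmp1_assoc: "arr_in K f w x \<Longrightarrow> arr_in K g x y \<Longrightarrow> arr_in K h y z
        \<Longrightarrow> cmp1 K (cmp1 K h g) f = cmp1 K h (cmp1 K g f)"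
    and ide2: "f \<in> Arrs K \<Longrightarrow> cell_in K (ide2 K f) f f"
    and vcmp2: "cell_in K \<alpha> f g \<Longrightarrow> cell_in K \<beta> g h \<Longrightarrow> cell_in K (vcmp2 K \<beta> \<alpha>) f h"
    and vcmp2_ide2: "cell_in K \<alpha> f g \<Longrightarrow> vcmp2 K \<alpha> (ide2 K f) = \<alpha> \<and> vcmp2 K (ide2 K g) \<alpha> = \<alpha>"
    and vcmp2_assoc: "cell_in K \<alpha> f g \<Longrightarrow> cell_in K \<beta> g h \<Longrightarrow> cell_in K \<gamma> h k
        \<Longrightarrow> vcmp2 K (vcmp2 K \<gamma> \<beta>) \<alpha> = vcmp2 K \<gamma> (vcmp2 K \<beta> \<alpha>)"
    and hcmp2: "cell_in K \<alpha> f f' \<Longrightarrow> cell_in K \<beta> g g' \<Longrightarrow> cod1 K f = dom1 K g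
        \<Longrightarrow> cell_in K (hcmp2 K \<beta> \<alpha>) (cmp1 K g f) (cmp1 K g' f')"
    and hcmp2_ide2: "arr_in K f x y \<Longrightarrow> arr_in K g y z
        \<Longrightarrow> hcmp2 K (ide2 K g) (ide2 K f) = ide2 K (cmp1 K g f)"
    and interchange: "cell_in K \<alpha> f f' \<Longrightarrow> cell_in K \<alpha>' f' f'' \<Longrightarrow> cell_in K \<beta> g g'
        \<Longrightarrow> cell_in K \<beta>' g' g'' \<Longrightarrow> cod1 K f = dom1 K g
        \<Longrightarrow> hcmp2 K (vcmp2 K \<beta>' \<beta>) (vcmp2 K \<alpha>' \<alpha>) = vcmp2 K (hcmp2 K \<beta>' \<alpha>') (hcmp2 K \<beta> \<alpha>)"
    and hcmp2_unit: "cell_in K \<alpha> f g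
        \<Longrightarrow> hcmp2 K \<alpha> (ide2 K (ide1 K (dom1 K f))) = \<alpha>
          \<and> hcmp2 K (ide2 K (ide1 K (cod1 K f))) \<alpha> = \<alpha>"
    and hcmp2_assoc: "cell_in K \<alpha> f f' \<Longrightarrow> cell_in K \<beta> g g' \<Longrightarrow> cell_in K \<gamma> h h'
        \<Longrightarrow> cod1 K f = dom1 K g \<Longrightarrow> cod1 K g = dom1 K h
        \<Longrightarrow> hcmp2 K (hcmp2 K \<gamma> \<beta>) \<alpha> = hcmp2 K \<gamma> (hcmp2 K \<beta> \<alpha>)"

definition terminal2 :: "('o, 'a, 'c) twocat \<Rightarrow> 'o \<Rightarrow> bool" where
  "terminal2 K t \<longleftrightarrow> t \<in> Objs K \<and>
     (\<forall>x\<in>Objs K. (\<exists>!f. arr_in K f x t) \<and>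
        (\<forall>f g. arr_in K f x t \<longrightarrow> arr_in K g x t \<longrightarrow> (\<exists>!\<alpha>. cell_in K \<alpha> f g)))"

definition bang :: "('o, 'a, 'c) twocat \<Rightarrow> 'o \<Rightarrow> 'o \<Rightarrow> 'a" where
  "bang K t x = (THE f. arr_in K f x t)"

record ('o, 'a, 'c, 'p, 'b, 'd) twofun =
  map0 :: "'o \<Rightarrow> 'p"
  map1 :: "'a \<Rightarrow> 'b"
  map2c :: "'c \<Rightarrow> 'd"

definition two_functor ::
    "('o, 'a, 'c) twocat \<Rightarrow> ('p, 'b, 'd) twocat \<Rightarrow> ('o, 'a, 'c, 'p, 'b, 'd) twofun \<Rightarrow> bool" where
  "two_functor K L R \<longleftrightarrow>
     (\<forall>x\<in>Objs K. map0 R x \<in> Objs L \<and> map1 R (ide1 K x) = ide1 L (map0 R x)) \<and>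
     (\<forall>f x y. arr_in K f x y \<longrightarrow> arr_in L (map1 R f) (map0 R x) (map0 R y)
        \<and> map2c R (ide2 K f) = ide2 L (map1 R f)) \<and>
     (\<forall>\<alpha> f g. cell_in K \<alpha> f g \<longrightarrow> cell_in L (map2c R \<alpha>) (map1 R f) (map1 R g)) \<and>
     (\<forall>f g x y z. arr_in K f x y \<longrightarrow> arr_in K g y z
        \<longrightarrow> map1 R (cmp1 K g f) = cmp1 L (map1 R g) (map1 R f)) \<and>
     (\<forall>\<alpha> \<beta> f g h. cell_in K \<alpha> f g \<longrightarrow> cell_in K \<beta> g h
        \<longrightarrow> map2c R (vcmp2 K \<beta> \<alpha>) = vcmp2 L (map2c R \<beta>) (map2c R \<alpha>)) \<and>
     (\<forall>\<alpha> \<beta> f f' g g'. cell_in K \<alpha> f f' \<longrightarrow> cell_in K \<beta> g g' \<longrightarrow> cod1 K f = dom1 K g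
        \<longrightarrow> map2c R (hcmp2 K \<beta> \<alpha>) = hcmp2 L (map2c R \<beta>) (map2c R \<alpha>))"

definition twofun_id :: "('o, 'a, 'c, 'o, 'a, 'c) twofun" where
  "twofun_id = \<lparr>map0 = (\<lambda>x. x), map1 = (\<lambda>f. f), map2c = (\<lambda>\<alpha>. \<alpha>)\<rparr>"

definition twofun_comp ::
    "('p, 'b, 'd, 'q, 'e, 'f) twofun \<Rightarrow> ('o, 'a, 'c, 'p, 'b, 'd) twofun
      \<Rightarrow> ('o, 'a, 'c, 'q, 'e, 'f) twofun" where
  "twofun_comp G F =
     \<lparr>map0 = map0 G \<circ> map0 F, map1 = map1 G \<circ> map1 F, map2c = map2c G \<circ> map2c F\<rparr>"

text \<open>Equality of 2-functors out of K; values outside the carriers are irrelevant.\<close>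

definition twofun_eq ::
    "('o, 'a, 'c) twocat \<Rightarrow> ('o, 'a, 'c, 'p, 'b, 'd) twofun \<Rightarrow> ('o, 'a, 'c, 'p, 'b, 'd) twofun \<Rightarrow> bool"
  where
  "twofun_eq K F G \<longleftrightarrow> (\<forall>x\<in>Objs K. map0 F x = map0 G x)
     \<and> (\<forall>f\<in>Arrs K. map1 F f = map1 G f) \<and> (\<forall>\<alpha>\<in>Cells K. map2c F \<alpha> = map2c G \<alpha>)"

definition two_natural ::
    "('o, 'a, 'c) twocat \<Rightarrow> ('p, 'b, 'd) twocat \<Rightarrow> ('o, 'a, 'c, 'p, 'b, 'd) twofun
      \<Rightarrow> ('o, 'a, 'c, 'p, 'b, 'd) twofun \<Rightarrow> ('o \<Rightarrow> 'b) \<Rightarrow> bool" where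
  "two_natural K L F G \<eta> \<longleftrightarrow>
     (\<forall>x\<in>Objs K. arr_in L (\<eta> x) (map0 F x) (map0 G x)) \<and>
     (\<forall>f x y. arr_in K f x y \<longrightarrow> cmp1 L (map1 G f) (\<eta> x) = cmp1 L (\<eta> y) (map1 F f)) \<and>
     (\<forall>\<alpha> f g x y. cell_in K \<alpha> f g \<longrightarrow> arr_in K f x y \<longrightarrow>
        hcmp2 L (map2c G \<alpha>) (ide2 L (\<eta> x)) = hcmp2 L (ide2 L (\<eta> y)) (map2c F \<alpha>))"

text \<open>\<open>F\<close> is left 2-adjoint to \<open>G : K \<rightarrow> L\<close>, with unit \<open>\<eta>\<close> and counit \<open>\<epsilon>\<close>.\<close>

definition two_adjunction ::
    "('o, 'a, 'c) twocat \<Rightarrow> ('p, 'b, 'd) twocat \<Rightarrow> ('p, 'b, 'd, 'o, 'a, 'c) twofun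
      \<Rightarrow> ('o, 'a, 'c, 'p, 'b, 'd) twofun \<Rightarrow> ('p \<Rightarrow> 'b) \<Rightarrow> ('o \<Rightarrow> 'a) \<Rightarrow> bool" where
  "two_adjunction K L F G \<eta> \<epsilon> \<longleftrightarrow>
     two_functor L K F \<and> two_functor K L G \<and>
     two_natural L L twofun_id (twofun_comp G F) \<eta> \<and>
     two_natural K K (twofun_comp F G) twofun_id \<epsilon> \<and>
     (\<forall>x\<in>Objs L. cmp1 K (\<epsilon> (map0 F x)) (map1 F (\<eta> x)) = ide1 K (map0 F x)) \<and>
     (\<forall>y\<in>Objs K. cmp1 L (map1 G (\<epsilon> y)) (\<eta> (map0 G y)) = ide1 L (map0 G y))"

definition has_left_two_adjoint ::
    "('o, 'a, 'c) twocat \<Rightarrow> ('p, 'b, 'd) twocat \<Rightarrow> ('o, 'a, 'c, 'p, 'b, 'd) twofun \<Rightarrow> bool" where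
  "has_left_two_adjoint K L G \<longleftrightarrow> (\<exists>F \<eta> \<epsilon>. two_adjunction K L F G \<eta> \<epsilon>)"


section \<open>Strict slices and split fibrations\<close>

text \<open>An object of the slice over \<open>B\<close> is an arrow into \<open>B\<close>; 1-cells and 2-cells of the slice carry
  their source and target object: \<open>(f, h, g)\<close> is \<open>h\<close> regarded as a 1-cell from \<open>f\<close> to \<open>g\<close>.\<close>

definition slice2 :: "('o, 'a, 'c) twocat \<Rightarrow> 'o \<Rightarrow> ('a, 'a \<times> 'a \<times> 'a, 'a \<times> 'c \<times> 'a) twocat" where
  "slice2 L B =
    \<lparr>Objs = {f \<in> Arrs L. cod1 L f = B},
     Arrs = {(f, h, g). f \<in> Arrs L \<and> cod1 L f = B \<and> g \<in> Arrs L \<and> cod1 L g = B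
               \<and> arr_in L h (dom1 L f) (dom1 L g) \<and> cmp1 L g h = f},
     Cells = {(f, \<alpha>, g). f \<in> Arrs L \<and> cod1 L f = B \<and> g \<in> Arrs L \<and> cod1 L g = B
               \<and> \<alpha> \<in> Cells L
               \<and> arr_in L (src2 L \<alpha>) (dom1 L f) (dom1 L g) \<and> cmp1 L g (src2 L \<alpha>) = f
               \<and> arr_in L (tgt2 L \<alpha>) (dom1 L f) (dom1 L g) \<and> cmp1 L g (tgt2 L \<alpha>) = f
               \<and> hcmp2 L (ide2 L g) \<alpha> = ide2 L f},
     dom1 = (\<lambda>(f, h, g). f),
     cod1 = (\<lambda>(f, h, g). g),
     src2 = (\<lambda>(f, \<alpha>, g). (f, src2 L \<alpha>, g)),
     tgt2 = (\<lambda>(f, \<alpha>, g). (f, tgt2 L \<alpha>, g)),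
     ide1 = (\<lambda>f. (f, ide1 L (dom1 L f), f)),
     cmp1 = (\<lambda>(g', k, l) (f, h, g). (f, cmp1 L k h, l)),
     ide2 = (\<lambda>(f, h, g). (f, ide2 L h, g)),
     vcmp2 = (\<lambda>(f', \<beta>, g') (f, \<alpha>, g). (f, vcmp2 L \<beta> \<alpha>, g)),
     hcmp2 = (\<lambda>(g', \<beta>, l) (f, \<alpha>, g). (f, hcmp2 L \<beta> \<alpha>, l))\<rparr>"

text \<open>A lifting problem at stage \<open>X = dom1 L e\<close>: an object \<open>e\<close> of \<open>L(X, E)\<close> and a morphism
  \<open>\<beta> : b \<Rightarrow> p e\<close> of \<open>L(X, B)\<close>.\<close>

definition lift_problem :: "('o, 'a, 'c) twocat \<Rightarrow> 'a \<Rightarrow> 'a \<Rightarrow> 'c \<Rightarrow> bool" where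
  "lift_problem L p e \<beta> \<longleftrightarrow> e \<in> Arrs L \<and> cod1 L e = dom1 L p
     \<and> \<beta> \<in> Cells L \<and> tgt2 L \<beta> = cmp1 L p e"

text \<open>\<open>\<phi>\<close>, a morphism of \<open>L(X, E)\<close>, is cartesian for the functor \<open>L(X, p)\<close>.\<close>

definition cartesian_cell :: "('o, 'a, 'c) twocat \<Rightarrow> 'a \<Rightarrow> 'c \<Rightarrow> bool" where
  "cartesian_cell L p \<phi> \<longleftrightarrow>
     (\<forall>\<gamma> \<delta>. \<gamma> \<in> Cells L \<and> tgt2 L \<gamma> = tgt2 L \<phi>
        \<and> cell_in L \<delta> (cmp1 L p (src2 L \<gamma>)) (cmp1 L p (src2 L \<phi>))
        \<and> vcmp2 L (hcmp2 L (ide2 L p) \<phi>) \<delta> = hcmp2 L (ide2 L p) \<gamma>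
        \<longrightarrow> (\<exists>!\<delta>'. cell_in L \<delta>' (src2 L \<gamma>) (src2 L \<phi>)
               \<and> hcmp2 L (ide2 L p) \<delta>' = \<delta> \<and> vcmp2 L \<phi> \<delta>' = \<gamma>))"

text \<open>\<open>lft e \<beta>\<close> is the chosen lift of \<open>\<beta>\<close> at \<open>e\<close>, normalised to \<open>undefined\<close> where there is no
  lifting problem.\<close>

definition split_fibration :: "('o, 'a, 'c) twocat \<Rightarrow> 'a \<Rightarrow> ('a \<Rightarrow> 'c \<Rightarrow> 'c) \<Rightarrow> bool" where
  "split_fibration L p lft \<longleftrightarrow>
     p \<in> Arrs L \<and>
     (\<forall>e \<beta>. \<not> lift_problem L p e \<beta> \<longrightarrow> lft e \<beta> = undefined) \<and>
     (\<forall>e \<beta>. lift_problem L p e \<beta> \<longrightarrow>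
        lft e \<beta> \<in> Cells L \<and> tgt2 L (lft e \<beta>) = e \<and> hcmp2 L (ide2 L p) (lft e \<beta>) = \<beta>
        \<and> cartesian_cell L p (lft e \<beta>)) \<and>
     (\<forall>e. e \<in> Arrs L \<and> cod1 L e = dom1 L p \<longrightarrow> lft e (ide2 L (cmp1 L p e)) = ide2 L e) \<and>
     (\<forall>e \<beta> \<beta>'. lift_problem L p e \<beta> \<and> \<beta>' \<in> Cells L \<and> tgt2 L \<beta>' = src2 L \<beta> \<longrightarrow>
        lft e (vcmp2 L \<beta> \<beta>') = vcmp2 L (lft e \<beta>) (lft (src2 L (lft e \<beta>)) \<beta>')) \<and>
     (\<forall>e \<beta> f. lift_problem L p e \<beta> \<and> f \<in> Arrs L \<and> cod1 L f = dom1 L e \<longrightarrow>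
        hcmp2 L (lft e \<beta>) (ide2 L f) = lft (cmp1 L e f) (hcmp2 L \<beta> (ide2 L f)))"

definition preserves_lifts ::
    "('o, 'a, 'c) twocat \<Rightarrow> 'a \<times> ('a \<Rightarrow> 'c \<Rightarrow> 'c) \<Rightarrow> 'a \<Rightarrow> 'a \<times> ('a \<Rightarrow> 'c \<Rightarrow> 'c) \<Rightarrow> bool" where
  "preserves_lifts L E h E' \<longleftrightarrow>
     (\<forall>e \<beta>. lift_problem L (fst E) e \<beta> \<longrightarrow>
        hcmp2 L (ide2 L h) (snd E e \<beta>) = snd E' (cmp1 L h e) \<beta>)"

type_synonym ('a, 'c) splobj = "'a \<times> ('a \<Rightarrow> 'c \<Rightarrow> 'c)"

definition Spl :: "('o, 'a, 'c) twocat \<Rightarrow> 'o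
    \<Rightarrow> (('a, 'c) splobj, ('a, 'c) splobj \<times> 'a \<times> ('a, 'c) splobj,
        ('a, 'c) splobj \<times> 'c \<times> ('a, 'c) splobj) twocat" where
  "Spl L B =
    \<lparr>Objs = {E. fst E \<in> Objs (slice2 L B) \<and> split_fibration L (fst E) (snd E)},
     Arrs = {(E, h, E'). split_fibration L (fst E) (snd E) \<and> split_fibration L (fst E') (snd E')
               \<and> (fst E, h, fst E') \<in> Arrs (slice2 L B) \<and> preserves_lifts L E h E'},
     Cells = {(E, \<alpha>, E'). split_fibration L (fst E) (snd E) \<and> split_fibration L (fst E') (snd E')
               \<and> (fst E, \<alpha>, fst E') \<in> Cells (slice2 L B)
               \<and> preserves_lifts L E (src2 L \<alpha>) E' \<and> preserves_lifts L E (tgt2 L \<alpha>) E'},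
     dom1 = (\<lambda>(E, h, E'). E),
     cod1 = (\<lambda>(E, h, E'). E'),
     src2 = (\<lambda>(E, \<alpha>, E'). (E, src2 L \<alpha>, E')),
     tgt2 = (\<lambda>(E, \<alpha>, E'). (E, tgt2 L \<alpha>, E')),
     ide1 = (\<lambda>E. (E, ide1 L (dom1 L (fst E)), E)),
     cmp1 = (\<lambda>(G', k, H) (E, h, G). (E, cmp1 L k h, H)),
     ide2 = (\<lambda>(E, h, E'). (E, ide2 L h, E')),
     vcmp2 = (\<lambda>(G, \<beta>, G') (E, \<alpha>, E'). (E, vcmp2 L \<beta> \<alpha>, E')),
     hcmp2 = (\<lambda>(G', \<beta>, H) (E, \<alpha>, G). (E, hcmp2 L \<beta> \<alpha>, H))\<rparr>"

definition Spl_forget ::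
    "(('a, 'c) splobj, ('a, 'c) splobj \<times> 'a \<times> ('a, 'c) splobj,
      ('a, 'c) splobj \<times> 'c \<times> ('a, 'c) splobj, 'a, 'a \<times> 'a \<times> 'a, 'a \<times> 'c \<times> 'a) twofun" where
  "Spl_forget =
    \<lparr>map0 = fst, map1 = (\<lambda>(E, h, E'). (fst E, h, fst E')), map2c = (\<lambda>(E, \<alpha>, E'). (fst E, \<alpha>, fst E'))\<rparr>"


section \<open>Familial 2-functors\<close>

text \<open>The 2-functor \<open>R\<^sub>1\<close> into the slice over \<open>R t\<close>, where \<open>t\<close> is a terminal object of \<open>K\<close>.\<close>

definition slice_lift ::
    "('o, 'a, 'c) twocat \<Rightarrow> 'o \<Rightarrow> ('o, 'a, 'c, 'p, 'b, 'd) twofun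
      \<Rightarrow> ('o, 'a, 'c, 'b, 'b \<times> 'b \<times> 'b, 'b \<times> 'd \<times> 'b) twofun" where
  "slice_lift K t R =
    \<lparr>map0 = (\<lambda>x. map1 R (bang K t x)),
     map1 = (\<lambda>f. (map1 R (bang K t (dom1 K f)), map1 R f, map1 R (bang K t (cod1 K f)))),
     map2c = (\<lambda>\<alpha>. (map1 R (bang K t (dom1 K (src2 K \<alpha>))), map2c R \<alpha>,
                   map1 R (bang K t (cod1 K (src2 K \<alpha>)))))\<rparr>"

definition parametric_right_two_adjoint ::
    "('o, 'a, 'c) twocat \<Rightarrow> 'o \<Rightarrow> ('p, 'b, 'd) twocat \<Rightarrow> ('o, 'a, 'c, 'p, 'b, 'd) twofun \<Rightarrow> bool" where
  "parametric_right_two_adjoint K t L R \<longleftrightarrow>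
     has_left_two_adjoint K (slice2 L (map0 R t)) (slice_lift K t R)"

text \<open>The choice of terminal object is immaterial, since any two are isomorphic.\<close>

definition familial ::
    "('o, 'a, 'c) twocat \<Rightarrow> ('p, 'b, 'd) twocat \<Rightarrow> ('o, 'a, 'c, 'p, 'b, 'd) twofun \<Rightarrow> bool" where
  "familial K L R \<longleftrightarrow>
     two_category K \<and> two_category L \<and> two_functor K L R \<and>
     (\<exists>t. terminal2 K t \<and>
        parametric_right_two_adjoint K t L R \<and>
        (\<exists>S. two_functor K (Spl L (map0 R t)) S \<and>
             twofun_eq K (twofun_comp Spl_forget S) (slice_lift K t R)))"


section \<open>Virtual double categories\<close>

text \<open>Horizontal morphisms and multicells carry their boundary. For a multicell \<open>\<theta>\<close>, \<open>ctop\<close> is the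
  list of its top horizontal morphisms and \<open>cleft\<close>, \<open>cright\<close> its vertical sides; when \<open>ctop\<close> is
  empty the top object is the common domain of the sides.

  \<open>ccmp A \<kappa> u [\<theta>\<^sub>1, \<dots>, \<theta>\<^sub>m]\<close> is the composite of \<open>\<kappa>\<close> with \<open>(\<theta>\<^sub>1, \<dots>, \<theta>\<^sub>m)\<close>, where \<open>u\<close> is the left side of
  \<open>\<theta>\<^sub>1\<close>; for \<open>m = 0\<close> it is the composite of \<open>\<kappa>\<close> with the vertical morphism \<open>u\<close>. So \<open>u\<close> is redundant
  unless \<open>m = 0\<close>, and both kinds of composite are subject to the same axioms.\<close>

record 'v vdc =
  Obj :: "'v set"
  Ver :: "'v set"
  Hor :: "'v set"
  Cel :: "'v set"
  vdom :: "'v \<Rightarrow> 'v"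
  vcod :: "'v \<Rightarrow> 'v"
  vide :: "'v \<Rightarrow> 'v"
  vcmp :: "'v \<Rightarrow> 'v \<Rightarrow> 'v"
  hdom :: "'v \<Rightarrow> 'v"
  hcod :: "'v \<Rightarrow> 'v"
  ctop :: "'v \<Rightarrow> 'v list"
  cbot :: "'v \<Rightarrow> 'v"
  cleft :: "'v \<Rightarrow> 'v"
  cright :: "'v \<Rightarrow> 'v"
  cide :: "'v \<Rightarrow> 'v"
  ccmp :: "'v \<Rightarrow> 'v \<Rightarrow> 'v list \<Rightarrow> 'v"

fun hpath :: "'v set \<Rightarrow> 'v set \<Rightarrow> ('v \<Rightarrow> 'v) \<Rightarrow> ('v \<Rightarrow> 'v) \<Rightarrow> 'v \<Rightarrow> 'v list \<Rightarrow> 'v \<Rightarrow> bool" where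
  "hpath Ob Ho d c a [] b \<longleftrightarrow> a \<in> Ob \<and> a = b"
| "hpath Ob Ho d c a (\<Gamma> # \<Gamma>s) b \<longleftrightarrow> \<Gamma> \<in> Ho \<and> d \<Gamma> = a \<and> hpath Ob Ho d c (c \<Gamma>) \<Gamma>s b"

fun cell_path :: "'v vdc \<Rightarrow> 'v \<Rightarrow> 'v list \<Rightarrow> bool" where
  "cell_path A u [] \<longleftrightarrow> u \<in> Ver A"
| "cell_path A u (\<theta> # \<theta>s) \<longleftrightarrow> \<theta> \<in> Cel A \<and> cleft A \<theta> = u \<and> cell_path A (cright A \<theta>) \<theta>s"

definition cell_path_end :: "'v vdc \<Rightarrow> 'v \<Rightarrow> 'v list \<Rightarrow> 'v" where
  "cell_path_end A u \<theta>s = (if \<theta>s = [] then u else cright A (last \<theta>s))"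

definition composable :: "'v vdc \<Rightarrow> 'v \<Rightarrow> 'v \<Rightarrow> 'v list \<Rightarrow> bool" where
  "composable A \<kappa> u \<theta>s \<longleftrightarrow> \<kappa> \<in> Cel A \<and> cell_path A u \<theta>s \<and> vcod A u = vdom A (cleft A \<kappa>)
     \<and> map (cbot A) \<theta>s = ctop A \<kappa>"

text \<open>\<open>ccmp_blocks A w \<theta>s \<xi>ss\<close> composes each \<open>\<theta>\<^sub>i\<close> with the block \<open>\<xi>ss\<^sub>i\<close>, where the concatenation of
  the blocks is a path of cells starting at the vertical morphism \<open>w\<close>.\<close>

fun ccmp_blocks :: "'v vdc \<Rightarrow> 'v \<Rightarrow> 'v list \<Rightarrow> 'v list list \<Rightarrow> 'v list" where
  "ccmp_blocks A w (\<theta> # \<theta>s) (\<xi>s # \<xi>ss)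
     = ccmp A \<theta> w \<xi>s # ccmp_blocks A (cell_path_end A w \<xi>s) \<theta>s \<xi>ss"
| "ccmp_blocks A w _ _ = []"

text \<open>Normalises all operations to \<open>undefined\<close> outside their domains, so that equality of records is
  equality of virtual double categories.\<close>

definition vdc_restrict :: "'v vdc \<Rightarrow> 'v vdc" where
  "vdc_restrict A = \<lparr>Obj = Obj A, Ver = Ver A, Hor = Hor A, Cel = Cel A,
     vdom = restrict (vdom A) (Ver A), vcod = restrict (vcod A) (Ver A),
     vide = restrict (vide A) (Obj A),
     vcmp = (\<lambda>g f. if g \<in> Ver A \<and> f \<in> Ver A \<and> vcod A f = vdom A g then vcmp A g f else undefined),
     hdom = restrict (hdom A) (Hor A), hcod = restrict (hcod A) (Hor A),
     ctop = restrict (ctop A) (Cel A), cbot = restrict (cbot A) (Cel A),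
     cleft = restrict (cleft A) (Cel A), cright = restrict (cright A) (Cel A),
     cide = restrict (cide A) (Hor A),
     ccmp = (\<lambda>\<kappa> u \<theta>s. if composable A \<kappa> u \<theta>s then ccmp A \<kappa> u \<theta>s else undefined)\<rparr>"

locale virtual_double_category =
  fixes A :: "'v vdc"
  assumes restricted: "vdc_restrict A = A"
    and vdom_vcod: "u \<in> Ver A \<Longrightarrow> vdom A u \<in> Obj A \<and> vcod A u \<in> Obj A"
    and vide: "a \<in> Obj A \<Longrightarrow> vide A a \<in> Ver A \<and> vdom A (vide A a) = a \<and> vcod A (vide A a) = a"
    and vcmp: "f \<in> Ver A \<Longrightarrow> g \<in> Ver A \<Longrightarrow> vcod A f = vdom A g
        \<Longrightarrow> vcmp A g f \<in> Ver A \<and> vdom A (vcmp A g f) = vdom A f \<and> vcod A (vcmp A g f) = vcod A g"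
    and vcmp_vide: "f \<in> Ver A
        \<Longrightarrow> vcmp A f (vide A (vdom A f)) = f \<and> vcmp A (vide A (vcod A f)) f = f"
    and vcmp_assoc: "f \<in> Ver A \<Longrightarrow> g \<in> Ver A \<Longrightarrow> h \<in> Ver A \<Longrightarrow> vcod A f = vdom A g
        \<Longrightarrow> vcod A g = vdom A h \<Longrightarrow> vcmp A (vcmp A h g) f = vcmp A h (vcmp A g f)"
    and hdom_hcod: "\<Gamma> \<in> Hor A \<Longrightarrow> hdom A \<Gamma> \<in> Obj A \<and> hcod A \<Gamma> \<in> Obj A"
    and boundary: "\<theta> \<in> Cel A \<Longrightarrow>
        cleft A \<theta> \<in> Ver A \<and> cright A \<theta> \<in> Ver A \<and> cbot A \<theta> \<in> Hor A
        \<and> hpath (Obj A) (Hor A) (hdom A) (hcod A)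
            (vdom A (cleft A \<theta>)) (ctop A \<theta>) (vdom A (cright A \<theta>))
        \<and> vcod A (cleft A \<theta>) = hdom A (cbot A \<theta>) \<and> vcod A (cright A \<theta>) = hcod A (cbot A \<theta>)"
    and cide: "\<Gamma> \<in> Hor A \<Longrightarrow> cide A \<Gamma> \<in> Cel A \<and> ctop A (cide A \<Gamma>) = [\<Gamma>] \<and> cbot A (cide A \<Gamma>) = \<Gamma>
        \<and> cleft A (cide A \<Gamma>) = vide A (hdom A \<Gamma>) \<and> cright A (cide A \<Gamma>) = vide A (hcod A \<Gamma>)"
    and ccmp: "composable A \<kappa> u \<theta>s \<Longrightarrow> ccmp A \<kappa> u \<theta>s \<in> Cel A
        \<and> ctop A (ccmp A \<kappa> u \<theta>s) = concat (map (ctop A) \<theta>s) \<and> cbot A (ccmp A \<kappa> u \<theta>s) = cbot A \<kappa>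
        \<and> cleft A (ccmp A \<kappa> u \<theta>s) = vcmp A (cleft A \<kappa>) u
        \<and> cright A (ccmp A \<kappa> u \<theta>s) = vcmp A (cright A \<kappa>) (cell_path_end A u \<theta>s)"
    and ccmp_cide_left: "\<theta> \<in> Cel A \<Longrightarrow> ccmp A (cide A (cbot A \<theta>)) (cleft A \<theta>) [\<theta>] = \<theta>"
    and ccmp_cide_right: "\<theta> \<in> Cel A
        \<Longrightarrow> ccmp A \<theta> (vide A (vdom A (cleft A \<theta>))) (map (cide A) (ctop A \<theta>)) = \<theta>"
    and ccmp_assoc: "composable A \<kappa> u \<theta>s \<Longrightarrow> cell_path A w (concat \<xi>ss) \<Longrightarrow> vcod A w = vdom A u
        \<Longrightarrow> list_all2 (\<lambda>\<theta> \<xi>s. map (cbot A) \<xi>s = ctop A \<theta>) \<theta>s \<xi>ss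
        \<Longrightarrow> ccmp A (ccmp A \<kappa> u \<theta>s) w (concat \<xi>ss) = ccmp A \<kappa> (vcmp A u w) (ccmp_blocks A w \<theta>s \<xi>ss)"

record 'v vdfun =
  fdom :: "'v vdc"
  fcod :: "'v vdc"
  fobj :: "'v \<Rightarrow> 'v"
  fver :: "'v \<Rightarrow> 'v"
  fhor :: "'v \<Rightarrow> 'v"
  fcel :: "'v \<Rightarrow> 'v"

definition vdfun_restrict :: "'v vdfun \<Rightarrow> 'v vdfun" where
  "vdfun_restrict F = F\<lparr>fobj := restrict (fobj F) (Obj (fdom F)), fver := restrict (fver F) (Ver (fdom F)),
     fhor := restrict (fhor F) (Hor (fdom F)), fcel := restrict (fcel F) (Cel (fdom F))\<rparr>"

definition virtual_double_functor :: "'v vdfun \<Rightarrow> bool" where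
  "virtual_double_functor F \<longleftrightarrow> (let A = fdom F; B = fcod F in
     virtual_double_category A \<and> virtual_double_category B \<and> vdfun_restrict F = F \<and>
     (\<forall>a\<in>Obj A. fobj F a \<in> Obj B \<and> fver F (vide A a) = vide B (fobj F a)) \<and>
     (\<forall>u\<in>Ver A. fver F u \<in> Ver B \<and> vdom B (fver F u) = fobj F (vdom A u)
        \<and> vcod B (fver F u) = fobj F (vcod A u)) \<and>
     (\<forall>f\<in>Ver A. \<forall>g\<in>Ver A. vcod A f = vdom A g
        \<longrightarrow> fver F (vcmp A g f) = vcmp B (fver F g) (fver F f)) \<and>
     (\<forall>\<Gamma>\<in>Hor A. fhor F \<Gamma> \<in> Hor B \<and> hdom B (fhor F \<Gamma>) = fobj F (hdom A \<Gamma>)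
        \<and> hcod B (fhor F \<Gamma>) = fobj F (hcod A \<Gamma>) \<and> fcel F (cide A \<Gamma>) = cide B (fhor F \<Gamma>)) \<and>
     (\<forall>\<theta>\<in>Cel A. fcel F \<theta> \<in> Cel B \<and> ctop B (fcel F \<theta>) = map (fhor F) (ctop A \<theta>)
        \<and> cbot B (fcel F \<theta>) = fhor F (cbot A \<theta>)
        \<and> cleft B (fcel F \<theta>) = fver F (cleft A \<theta>) \<and> cright B (fcel F \<theta>) = fver F (cright A \<theta>)) \<and>
     (\<forall>\<kappa> u \<theta>s. composable A \<kappa> u \<theta>s
        \<longrightarrow> fcel F (ccmp A \<kappa> u \<theta>s) = ccmp B (fcel F \<kappa>) (fver F u) (map (fcel F) \<theta>s)))"

text \<open>Composite of the multicell \<open>\<kappa>\<close>, with a single top horizontal morphism, and \<open>\<theta>\<close>.\<close>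

abbreviation ccmp1 :: "'v vdc \<Rightarrow> 'v \<Rightarrow> 'v \<Rightarrow> 'v" where
  "ccmp1 A \<kappa> \<theta> \<equiv> ccmp A \<kappa> (cleft A \<theta>) [\<theta>]"

record 'v vdtrans =
  tsrc :: "'v vdfun"
  ttgt :: "'v vdfun"
  tobj :: "'v \<Rightarrow> 'v"
  thor :: "'v \<Rightarrow> 'v"

definition vdtrans_restrict :: "'v vdtrans \<Rightarrow> 'v vdtrans" where
  "vdtrans_restrict \<alpha> = \<alpha>\<lparr>tobj := restrict (tobj \<alpha>) (Obj (fdom (tsrc \<alpha>))),
     thor := restrict (thor \<alpha>) (Hor (fdom (tsrc \<alpha>)))\<rparr>"

definition vertical_transformation :: "'v vdtrans \<Rightarrow> bool" where
  "vertical_transformation \<alpha> \<longleftrightarrow>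
    (let F = tsrc \<alpha>; G = ttgt \<alpha>; A = fdom F; B = fcod F in
     virtual_double_functor F \<and> virtual_double_functor G \<and> fdom G = A \<and> fcod G = B \<and>
     vdtrans_restrict \<alpha> = \<alpha> \<and>
     (\<forall>a\<in>Obj A. tobj \<alpha> a \<in> Ver B \<and> vdom B (tobj \<alpha> a) = fobj F a \<and> vcod B (tobj \<alpha> a) = fobj G a) \<and>
     (\<forall>u\<in>Ver A. vcmp B (tobj \<alpha> (vcod A u)) (fver F u) = vcmp B (fver G u) (tobj \<alpha> (vdom A u))) \<and>
     (\<forall>\<Gamma>\<in>Hor A. thor \<alpha> \<Gamma> \<in> Cel B \<and> ctop B (thor \<alpha> \<Gamma>) = [fhor F \<Gamma>] \<and> cbot B (thor \<alpha> \<Gamma>) = fhor G \<Gamma>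
        \<and> cleft B (thor \<alpha> \<Gamma>) = tobj \<alpha> (hdom A \<Gamma>) \<and> cright B (thor \<alpha> \<Gamma>) = tobj \<alpha> (hcod A \<Gamma>)) \<and>
     (\<forall>\<theta>\<in>Cel A. ccmp1 B (thor \<alpha> (cbot A \<theta>)) (fcel F \<theta>)
        = ccmp B (fcel G \<theta>) (tobj \<alpha> (vdom A (cleft A \<theta>))) (map (thor \<alpha>) (ctop A \<theta>))))"

definition vdfun_id :: "'v vdc \<Rightarrow> 'v vdfun" where
  "vdfun_id A = vdfun_restrict \<lparr>fdom = A, fcod = A,
     fobj = (\<lambda>a. a), fver = (\<lambda>u. u), fhor = (\<lambda>\<Gamma>. \<Gamma>), fcel = (\<lambda>\<theta>. \<theta>)\<rparr>"

definition vdfun_comp :: "'v vdfun \<Rightarrow> 'v vdfun \<Rightarrow> 'v vdfun" where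
  "vdfun_comp G F = vdfun_restrict \<lparr>fdom = fdom F, fcod = fcod G, fobj = fobj G \<circ> fobj F,
     fver = fver G \<circ> fver F, fhor = fhor G \<circ> fhor F, fcel = fcel G \<circ> fcel F\<rparr>"

definition vdtrans_id :: "'v vdfun \<Rightarrow> 'v vdtrans" where
  "vdtrans_id F = vdtrans_restrict \<lparr>tsrc = F, ttgt = F,
     tobj = (\<lambda>a. vide (fcod F) (fobj F a)), thor = (\<lambda>\<Gamma>. cide (fcod F) (fhor F \<Gamma>))\<rparr>"

definition vdtrans_vcomp :: "'v vdtrans \<Rightarrow> 'v vdtrans \<Rightarrow> 'v vdtrans" where
  "vdtrans_vcomp \<beta> \<alpha> = vdtrans_restrict \<lparr>tsrc = tsrc \<alpha>, ttgt = ttgt \<beta>,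
     tobj = (\<lambda>a. vcmp (fcod (tsrc \<alpha>)) (tobj \<beta> a) (tobj \<alpha> a)),
     thor = (\<lambda>\<Gamma>. ccmp1 (fcod (tsrc \<alpha>)) (thor \<beta> \<Gamma>) (thor \<alpha> \<Gamma>))\<rparr>"

definition vdtrans_hcomp :: "'v vdtrans \<Rightarrow> 'v vdtrans \<Rightarrow> 'v vdtrans" where
  "vdtrans_hcomp \<beta> \<alpha> = vdtrans_restrict
     \<lparr>tsrc = vdfun_comp (tsrc \<beta>) (tsrc \<alpha>), ttgt = vdfun_comp (ttgt \<beta>) (ttgt \<alpha>),
      tobj = (\<lambda>a. vcmp (fcod (tsrc \<beta>)) (tobj \<beta> (fobj (ttgt \<alpha>) a)) (fver (tsrc \<beta>) (tobj \<alpha> a))),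
      thor = (\<lambda>\<Gamma>. ccmp1 (fcod (tsrc \<beta>)) (thor \<beta> (fhor (ttgt \<alpha>) \<Gamma>)) (fcel (tsrc \<beta>) (thor \<alpha> \<Gamma>)))\<rparr>"


section \<open>Two Grothendieck universes\<close>

text \<open>\<open>elts x\<close> is the set of elements of the set coded by \<open>x\<close>.\<close>

definition grothendieck_universe :: "('v \<Rightarrow> 'v set) \<Rightarrow> 'v set \<Rightarrow> bool" where
  "grothendieck_universe elts U \<longleftrightarrow>
     (\<forall>x\<in>U. elts x \<subseteq> U) \<and>
     (\<forall>x\<in>U. \<forall>y\<in>U. \<exists>z\<in>U. elts z = {x, y}) \<and>
     (\<forall>x\<in>U. \<exists>z\<in>U. elts ` elts z = Pow (elts x)) \<and>
     (\<forall>I\<in>U. \<forall>f. f ` elts I \<subseteq> U \<longrightarrow> (\<exists>z\<in>U. elts z = (\<Union>i\<in>elts I. elts (f i)))) \<and>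
     (\<exists>x\<in>U. infinite (elts x))"

text \<open>The type \<open>'v\<close> is the larger universe: its elements are the elements of \<open>\<U>\<^sub>2\<close>, with membership
  given by \<open>elts\<close>; the large sets are those coded by some element. The smaller universe is the
  element \<open>U1\<close>.\<close>

locale universes =
  fixes elts :: "'v \<Rightarrow> 'v set" and U1 :: 'v
  assumes extensionality: "inj elts"
    and foundation: "wf {(x, y). x \<in> elts y}"
    and universe2: "grothendieck_universe elts UNIV"
    and universe1: "grothendieck_universe elts (elts U1)"
begin

definition large :: "'v set \<Rightarrow> bool" where
  "large X \<longleftrightarrow> X \<in> range elts"

definition VDBL :: "('v vdc, 'v vdfun, 'v vdtrans) twocat" where
  "VDBL =
    (let lvdc = {A. virtual_double_category A
                    \<and> large (Obj A) \<and> large (Ver A) \<and> large (Hor A) \<and> large (Cel A)}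
     in \<lparr>Objs = lvdc,
         Arrs = {F. virtual_double_functor F \<and> fdom F \<in> lvdc \<and> fcod F \<in> lvdc},
         Cells = {\<alpha>. vertical_transformation \<alpha> \<and> fdom (tsrc \<alpha>) \<in> lvdc \<and> fcod (tsrc \<alpha>) \<in> lvdc},
         dom1 = fdom, cod1 = fcod, src2 = tsrc, tgt2 = ttgt,
         ide1 = vdfun_id, cmp1 = vdfun_comp,
         ide2 = vdtrans_id, vcmp2 = vdtrans_vcomp, hcmp2 = vdtrans_hcomp\<rparr>)"

text \<open>Tuples and functions as sets: Kuratowski pairs, lists as iterated pairs ending in the empty
  set, and functions as graphs.\<close>

definition set_of :: "'v set \<Rightarrow> 'v" where
  "set_of X = (THE x. elts x = X)"

definition vpair :: "'v \<Rightarrow> 'v \<Rightarrow> 'v" where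
  "vpair x y = set_of {set_of {x}, set_of {x, y}}"

fun tup :: "'v list \<Rightarrow> 'v" where
  "tup [] = set_of {}"
| "tup (x # xs) = vpair x (tup xs)"

definition untup :: "'v \<Rightarrow> 'v list" where
  "untup x = (THE xs. tup xs = x)"

definition proj :: "'v \<Rightarrow> nat \<Rightarrow> 'v" where
  "proj x k = untup x ! k"

definition lam :: "'v \<Rightarrow> ('v \<Rightarrow> 'v) \<Rightarrow> 'v" where
  "lam I f = set_of ((\<lambda>i. vpair i (f i)) ` elts I)"

definition app :: "'v \<Rightarrow> 'v \<Rightarrow> 'v" where
  "app f x = (THE y. vpair x y \<in> elts f)"


section \<open>The families construction\<close>

subsection \<open>Objects, vertical and horizontal morphisms\<close>

definition fam_obj :: "'v vdc \<Rightarrow> 'v set" where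
  "fam_obj A = {tup [I, lam I a] | I a. I \<in> elts U1 \<and> (\<forall>i\<in>elts I. a i \<in> Obj A)}"

definition idx :: "'v \<Rightarrow> 'v" where "idx X = proj X 0"
definition memb :: "'v \<Rightarrow> 'v \<Rightarrow> 'v" where "memb X i = app (proj X 1) i"

definition fam_ver :: "'v vdc \<Rightarrow> 'v set" where
  "fam_ver A = {tup [X, X', lam (idx X) v, lam (idx X) f] | X X' v f.
     X \<in> fam_obj A \<and> X' \<in> fam_obj A \<and>
     (\<forall>i\<in>elts (idx X). v i \<in> elts (idx X') \<and> f i \<in> Ver A
        \<and> vdom A (f i) = memb X i \<and> vcod A (f i) = memb X' (v i))}"

definition ver_dom :: "'v \<Rightarrow> 'v" where "ver_dom u = proj u 0"
definition ver_cod :: "'v \<Rightarrow> 'v" where "ver_cod u = proj u 1"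
definition ver_fun :: "'v \<Rightarrow> 'v \<Rightarrow> 'v" where "ver_fun u i = app (proj u 2) i"
definition ver_memb :: "'v \<Rightarrow> 'v \<Rightarrow> 'v" where "ver_memb u i = app (proj u 3) i"

definition fam_hor :: "'v vdc \<Rightarrow> 'v set" where
  "fam_hor A = {tup [X, X', S, lam S l, lam S r, lam S g] | X X' S l r g.
     X \<in> fam_obj A \<and> X' \<in> fam_obj A \<and> S \<in> elts U1 \<and>
     (\<forall>s\<in>elts S. l s \<in> elts (idx X) \<and> r s \<in> elts (idx X') \<and> g s \<in> Hor A
        \<and> hdom A (g s) = memb X (l s) \<and> hcod A (g s) = memb X' (r s))}"

definition hor_dom :: "'v \<Rightarrow> 'v" where "hor_dom \<Gamma> = proj \<Gamma> 0"
definition hor_cod :: "'v \<Rightarrow> 'v" where "hor_cod \<Gamma> = proj \<Gamma> 1"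
definition hor_apex :: "'v \<Rightarrow> 'v" where "hor_apex \<Gamma> = proj \<Gamma> 2"
definition hor_left :: "'v \<Rightarrow> 'v \<Rightarrow> 'v" where "hor_left \<Gamma> s = app (proj \<Gamma> 3) s"
definition hor_right :: "'v \<Rightarrow> 'v \<Rightarrow> 'v" where "hor_right \<Gamma> s = app (proj \<Gamma> 4) s"
definition hor_memb :: "'v \<Rightarrow> 'v \<Rightarrow> 'v" where "hor_memb \<Gamma> s = app (proj \<Gamma> 5) s"

subsection \<open>Multicells\<close>

text \<open>An element of the iterated pullback of the spans \<open>\<Gamma>s\<close> is a list \<open>i # ss\<close> where \<open>ss\<close> is a
  compatible family of elements of the apices starting at \<open>i\<close>; \<open>i\<close> is determined by \<open>ss\<close> unless
  \<open>\<Gamma>s\<close> is empty, when the iterated pullback is the index set of the starting object \<open>X\<close>.\<close>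

fun walk :: "'v \<Rightarrow> 'v list \<Rightarrow> 'v list \<Rightarrow> bool" where
  "walk i [] [] \<longleftrightarrow> True"
| "walk i (\<Gamma> # \<Gamma>s) (s # ss) \<longleftrightarrow> s \<in> elts (hor_apex \<Gamma>) \<and> hor_left \<Gamma> s = i \<and> walk (hor_right \<Gamma> s) \<Gamma>s ss"
| "walk i _ _ \<longleftrightarrow> False"

definition walk_end :: "'v \<Rightarrow> 'v list \<Rightarrow> 'v list \<Rightarrow> 'v" where
  "walk_end i \<Gamma>s ss = (if ss = [] then i else hor_right (last \<Gamma>s) (last ss))"

definition span_prod :: "'v \<Rightarrow> 'v list \<Rightarrow> 'v" where
  "span_prod X \<Gamma>s = set_of {tup (i # ss) | i ss. i \<in> elts (idx X) \<and> walk i \<Gamma>s ss}"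

definition fam_cel :: "'v vdc \<Rightarrow> 'v set" where
  "fam_cel A = {tup [tup \<Gamma>s, \<Delta>, u, u',
        lam (span_prod (ver_dom u) \<Gamma>s) m, lam (span_prod (ver_dom u) \<Gamma>s) \<phi>] | \<Gamma>s \<Delta> u u' m \<phi>.
     u \<in> fam_ver A \<and> u' \<in> fam_ver A \<and> \<Delta> \<in> fam_hor A \<and>
     hpath (fam_obj A) (fam_hor A) hor_dom hor_cod (ver_dom u) \<Gamma>s (ver_dom u') \<and>
     ver_cod u = hor_dom \<Delta> \<and> ver_cod u' = hor_cod \<Delta> \<and>
     (\<forall>i ss. i \<in> elts (idx (ver_dom u)) \<and> walk i \<Gamma>s ss \<longrightarrow>
        (let p = tup (i # ss); i' = walk_end i \<Gamma>s ss in
         m p \<in> elts (hor_apex \<Delta>) \<and>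
         hor_left \<Delta> (m p) = ver_fun u i \<and> hor_right \<Delta> (m p) = ver_fun u' i' \<and>
         \<phi> p \<in> Cel A \<and> ctop A (\<phi> p) = map2 hor_memb \<Gamma>s ss \<and> cbot A (\<phi> p) = hor_memb \<Delta> (m p) \<and>
         cleft A (\<phi> p) = ver_memb u i \<and> cright A (\<phi> p) = ver_memb u' i'))}"

definition cel_top :: "'v \<Rightarrow> 'v list" where "cel_top \<theta> = untup (proj \<theta> 0)"
definition cel_bot :: "'v \<Rightarrow> 'v" where "cel_bot \<theta> = proj \<theta> 1"
definition cel_left :: "'v \<Rightarrow> 'v" where "cel_left \<theta> = proj \<theta> 2"
definition cel_right :: "'v \<Rightarrow> 'v" where "cel_right \<theta> = proj \<theta> 3"
definition cel_fun :: "'v \<Rightarrow> 'v \<Rightarrow> 'v" where "cel_fun \<theta> p = app (proj \<theta> 4) p"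
definition cel_memb :: "'v \<Rightarrow> 'v \<Rightarrow> 'v" where "cel_memb \<theta> p = app (proj \<theta> 5) p"

subsection \<open>Identities and composites\<close>

definition fam_vide :: "'v vdc \<Rightarrow> 'v \<Rightarrow> 'v" where
  "fam_vide A X = tup [X, X, lam (idx X) (\<lambda>i. i), lam (idx X) (\<lambda>i. vide A (memb X i))]"

definition fam_vcmp :: "'v vdc \<Rightarrow> 'v \<Rightarrow> 'v \<Rightarrow> 'v" where
  "fam_vcmp A w u = (let I = idx (ver_dom u) in
     tup [ver_dom u, ver_cod w, lam I (\<lambda>i. ver_fun w (ver_fun u i)),
          lam I (\<lambda>i. vcmp A (ver_memb w (ver_fun u i)) (ver_memb u i))])"

text \<open>The element of the unary iterated pullback of \<open>\<Gamma>\<close> given by \<open>s\<close> is \<open>p = tup [i, s]\<close>, whence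
  \<open>s = proj p 1\<close>.\<close>

definition fam_cide :: "'v vdc \<Rightarrow> 'v \<Rightarrow> 'v" where
  "fam_cide A \<Gamma> = (let P = span_prod (hor_dom \<Gamma>) [\<Gamma>] in
     tup [tup [\<Gamma>], \<Gamma>, fam_vide A (hor_dom \<Gamma>), fam_vide A (hor_cod \<Gamma>),
          lam P (\<lambda>p. proj p 1), lam P (\<lambda>p. cide A (hor_memb \<Gamma> (proj p 1)))])"

text \<open>Splits an element \<open>i # ss\<close> of the iterated pullback of the concatenated tops of \<open>\<theta>s\<close> into
  elements of the iterated pullbacks of the tops of the individual \<open>\<theta>s\<close>.\<close>

fun walk_blocks :: "'v list \<Rightarrow> 'v \<Rightarrow> 'v list \<Rightarrow> ('v \<times> 'v) list" where
  "walk_blocks [] i ss = []"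
| "walk_blocks (\<theta> # \<theta>s) i ss =
     (let n = length (cel_top \<theta>); b = take n ss in
      (\<theta>, tup (i # b)) # walk_blocks \<theta>s (walk_end i (cel_top \<theta>) b) (drop n ss))"

definition fam_ccmp :: "'v vdc \<Rightarrow> 'v \<Rightarrow> 'v \<Rightarrow> 'v list \<Rightarrow> 'v" where
  "fam_ccmp A \<kappa> u \<theta>s =
    (let \<Gamma>s = concat (map cel_top \<theta>s);
         P = span_prod (ver_dom u) \<Gamma>s;
         bl = (\<lambda>p. walk_blocks \<theta>s (hd (untup p)) (tl (untup p)));
         q = (\<lambda>p. tup (ver_fun u (hd (untup p)) # map (\<lambda>(\<theta>, b). cel_fun \<theta> b) (bl p)))
     in tup [tup \<Gamma>s, cel_bot \<kappa>, fam_vcmp A (cel_left \<kappa>) u,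
             fam_vcmp A (cel_right \<kappa>) (if \<theta>s = [] then u else cel_right (last \<theta>s)),
             lam P (\<lambda>p. cel_fun \<kappa> (q p)),
             lam P (\<lambda>p. ccmp A (cel_memb \<kappa> (q p)) (ver_memb u (hd (untup p)))
                          (map (\<lambda>(\<theta>, b). cel_memb \<theta> b) (bl p)))])"

definition fam :: "'v vdc \<Rightarrow> 'v vdc" where
  "fam A = vdc_restrict
     \<lparr>Obj = fam_obj A, Ver = fam_ver A, Hor = fam_hor A, Cel = fam_cel A,
      vdom = ver_dom, vcod = ver_cod, vide = fam_vide A, vcmp = fam_vcmp A,
      hdom = hor_dom, hcod = hor_cod,
      ctop = cel_top, cbot = cel_bot, cleft = cel_left, cright = cel_right,
      cide = fam_cide A, ccmp = fam_ccmp A\<rparr>"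

subsection \<open>Action on virtual double functors and vertical transformations\<close>

definition famF_obj :: "'v vdfun \<Rightarrow> 'v \<Rightarrow> 'v" where
  "famF_obj F X = tup [idx X, lam (idx X) (\<lambda>i. fobj F (memb X i))]"

definition famF_ver :: "'v vdfun \<Rightarrow> 'v \<Rightarrow> 'v" where
  "famF_ver F u = tup [famF_obj F (ver_dom u), famF_obj F (ver_cod u), proj u 2,
     lam (idx (ver_dom u)) (\<lambda>i. fver F (ver_memb u i))]"

definition famF_hor :: "'v vdfun \<Rightarrow> 'v \<Rightarrow> 'v" where
  "famF_hor F \<Gamma> = tup [famF_obj F (hor_dom \<Gamma>), famF_obj F (hor_cod \<Gamma>), hor_apex \<Gamma>, proj \<Gamma> 3, proj \<Gamma> 4,
     lam (hor_apex \<Gamma>) (\<lambda>s. fhor F (hor_memb \<Gamma> s))]"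

definition famF_cel :: "'v vdfun \<Rightarrow> 'v \<Rightarrow> 'v" where
  "famF_cel F \<theta> = tup [tup (map (famF_hor F) (cel_top \<theta>)), famF_hor F (cel_bot \<theta>),
     famF_ver F (cel_left \<theta>), famF_ver F (cel_right \<theta>), proj \<theta> 4,
     lam (span_prod (ver_dom (cel_left \<theta>)) (cel_top \<theta>)) (\<lambda>p. fcel F (cel_memb \<theta> p))]"

definition famF :: "'v vdfun \<Rightarrow> 'v vdfun" where
  "famF F = vdfun_restrict \<lparr>fdom = fam (fdom F), fcod = fam (fcod F), fobj = famF_obj F,
     fver = famF_ver F, fhor = famF_hor F, fcel = famF_cel F\<rparr>"

definition famT_obj :: "'v vdtrans \<Rightarrow> 'v \<Rightarrow> 'v" where
  "famT_obj \<alpha> X = tup [famF_obj (tsrc \<alpha>) X, famF_obj (ttgt \<alpha>) X,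
     lam (idx X) (\<lambda>i. i), lam (idx X) (\<lambda>i. tobj \<alpha> (memb X i))]"

definition famT_hor :: "'v vdtrans \<Rightarrow> 'v \<Rightarrow> 'v" where
  "famT_hor \<alpha> \<Gamma> = (let P = span_prod (hor_dom \<Gamma>) [\<Gamma>] in
     tup [tup [famF_hor (tsrc \<alpha>) \<Gamma>], famF_hor (ttgt \<alpha>) \<Gamma>,
          famT_obj \<alpha> (hor_dom \<Gamma>), famT_obj \<alpha> (hor_cod \<Gamma>),
          lam P (\<lambda>p. proj p 1), lam P (\<lambda>p. thor \<alpha> (hor_memb \<Gamma> (proj p 1)))])"

definition famT :: "'v vdtrans \<Rightarrow> 'v vdtrans" where
  "famT \<alpha> = vdtrans_restrict \<lparr>tsrc = famF (tsrc \<alpha>), ttgt = famF (ttgt \<alpha>),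
     tobj = famT_obj \<alpha>, thor = famT_hor \<alpha>\<rparr>"

definition Fam :: "('v vdc, 'v vdfun, 'v vdtrans, 'v vdc, 'v vdfun, 'v vdtrans) twofun" where
  "Fam = \<lparr>map0 = fam, map1 = famF, map2c = famT\<rparr>"

end

end

theory Submission
  imports Defs
begin

text \<open>
  Why \<open>fam\<close> is familial. Let \<open>one\<close> be the terminal virtual double category; the virtual double
  category \<open>fam one\<close> is that of spans. A virtual double functor \<open>H : X \<rightarrow> fam A\<close> assigns spans of small
  sets to the data of \<open>X\<close>, which amounts to a functor \<open>G : X \<rightarrow> fam one\<close>, and a datum of \<open>A\<close> to each
  element of these spans. The elements form a virtual double category \<open>el G\<close>, and the second part of
  \<open>H\<close> is a functor \<open>ev A H : el G \<rightarrow> A\<close>. Likewise a transformation \<open>H \<Rightarrow> H'\<close> is a transformation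
  \<open>\<nu> : G \<Rightarrow> G'\<close> together with a transformation \<open>ev A H \<Rightarrow> ev A H' \<circ> elT \<nu>\<close>, where \<open>elT \<nu> : el G \<rightarrow> el G'\<close>
  is induced by \<open>\<nu>\<close>. So the category of functors \<open>X \<rightarrow> fam A\<close> is the Grothendieck construction of
  \<open>G \<mapsto> VDBL(el G, A)\<close>, and both parts of familiality can be read off from this description.

  Parametric right adjoint: the fibre over \<open>G\<close> is \<open>VDBL(el G, A)\<close>, so morphisms from \<open>G\<close> to
  \<open>fam A \<rightarrow> fam one\<close> in the slice are functors \<open>el G \<rightarrow> A\<close>, and similarly for 2-cells. The left 2-adjoint is
  therefore \<open>el\<close>, with unit \<open>unit G\<close>: the family whose members are the elements of \<open>G\<close> themselves
  (\<open>ex1_famF_unit\<close>, \<open>ex1_famT_unit\<close>). It is enough to give \<open>el\<close> on objects,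
  since \<open>has_left_two_adjointI\<close> makes an adjunction out of universal arrows.

  Split fibration: the lift of \<open>\<nu> : b \<Rightarrow> p \<circ> e\<close> at \<open>e : X \<rightarrow> fam A\<close> has as source the family with spans \<open>b\<close>
  and members \<open>ev A e \<circ> elT \<nu>\<close>, and the members of the lifting transformation are identities. Being a
  transformation over \<open>\<nu>\<close> into \<open>e\<close> with identity members determines the lift (\<open>unit_lift_unique\<close>), and
  transformations with identity members are closed under composition, whiskering and application of a
  functor to all members. So each law of a split fibration, and the preservation of the chosen lifts by
  \<open>famF F\<close>, holds because both sides have identity members and lie over the same transformation.

  The inverse of \<open>H \<mapsto> (G, ev A H)\<close> is the transposition \<open>tr\<close>, with \<open>trT\<close> for transformations. Since only
  the spans of \<open>G\<close> matter for \<open>el G\<close>, the functor \<open>G\<close> is allowed to take values in any \<open>fam B\<close>; then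
  \<open>famF F\<close> is itself a transpose, of \<open>F \<circ> ev A id\<close>, and its functoriality is an instance of that of
  transposes. Throughout, \<open>d\<close> denotes a multicell, \<open>h\<close> a horizontal morphism, and \<open>i # ss\<close> a point of an
  iterated pullback of spans.
\<close>

section \<open>Left 2-adjoints from universal arrows\<close>

lemma arr_inD: "arr_in K f x y ==> f \<in> Arrs K \<and> dom1 K f = x \<and> cod1 K f = y"
  by (simp add: arr_in_def)

lemma cell_inD: "cell_in K \<mu> f g ==> \<mu> \<in> Cells K \<and> src2 K \<mu> = f \<and> tgt2 K \<mu> = g"
  by (simp add: cell_in_def)

context two_category
begin

lemma arr_obj: "arr_in K f x y ==> x \<in> Objs K \<and> y \<in> Objs K"
  using dom1_cod1 by (auto simp: arr_in_def)

lemma cell_arr: "cell_in K \<mu> f g ==> arr_in K f x y \<longleftrightarrow> arr_in K g x y"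
  using src2_tgt2 by (auto simp: arr_in_def cell_in_def)

lemma cell_arrs: "cell_in K \<mu> f g ==> arr_in K f (dom1 K f) (cod1 K f) \<and> arr_in K g (dom1 K f) (cod1 K f)"
  using src2_tgt2 by (auto simp: arr_in_def cell_in_def)

lemma ide2_cell: "arr_in K f x y ==> cell_in K (ide2 K f) f f"
  using ide2 by (auto simp: arr_in_def)

lemma hcmp_cell:
  "cell_in K \<mu> f f' ==> arr_in K f x y ==> cell_in K \<nu> g g' ==> arr_in K g y z
    ==> cell_in K (hcmp2 K \<nu> \<mu>) (cmp1 K g f) (cmp1 K g' f')"
  using hcmp2 by (auto simp: arr_in_def)

lemma hcmp_assoc:
  "cell_in K \<mu> f f' ==> arr_in K f w x ==> cell_in K \<nu> g g' ==> arr_in K g x y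
    ==> cell_in K \<gamma> h h' ==> arr_in K h y z
    ==> hcmp2 K (hcmp2 K \<gamma> \<nu>) \<mu> = hcmp2 K \<gamma> (hcmp2 K \<nu> \<mu>)"
  using hcmp2_assoc by (auto simp: arr_in_def)

lemma hcmp_unit:
  "cell_in K \<mu> f g ==> arr_in K f x y
    ==> hcmp2 K \<mu> (ide2 K (ide1 K x)) = \<mu> \<and> hcmp2 K (ide2 K (ide1 K y)) \<mu> = \<mu>"
  using hcmp2_unit by (auto simp: arr_in_def)

lemma whisker_vcmp:
  assumes "cell_in K \<mu> f g" "cell_in K \<nu> g h" "arr_in K f x y" "arr_in K k y z"
  shows "hcmp2 K (ide2 K k) (vcmp2 K \<nu> \<mu>) = vcmp2 K (hcmp2 K (ide2 K k) \<nu>) (hcmp2 K (ide2 K k) \<mu>)"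
  using interchange[OF assms(1,2) ide2_cell[OF assms(4)] ide2_cell[OF assms(4)]]
    vcmp2_ide2[OF ide2_cell[OF assms(4)]] assms by (simp add: arr_in_def)

lemma vcmp_whisker:
  assumes "cell_in K \<mu> f g" "cell_in K \<nu> g h" "arr_in K f x y" "arr_in K k w x"
  shows "hcmp2 K (vcmp2 K \<nu> \<mu>) (ide2 K k) = vcmp2 K (hcmp2 K \<nu> (ide2 K k)) (hcmp2 K \<mu> (ide2 K k))"
  using interchange[OF ide2_cell[OF assms(4)] ide2_cell[OF assms(4)] assms(1,2)]
    vcmp2_ide2[OF ide2_cell[OF assms(4)]] assms by (simp add: arr_in_def)

end

lemma two_functorD:
  assumes "two_functor K L R"
  shows "x \<in> Objs K ==> map0 R x \<in> Objs L"
    and "x \<in> Objs K ==> map1 R (ide1 K x) = ide1 L (map0 R x)"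
    and "arr_in K f x y ==> arr_in L (map1 R f) (map0 R x) (map0 R y)"
    and "arr_in K f x y ==> map2c R (ide2 K f) = ide2 L (map1 R f)"
    and "cell_in K \<mu> f g ==> cell_in L (map2c R \<mu>) (map1 R f) (map1 R g)"
    and "arr_in K f x y ==> arr_in K g y z ==> map1 R (cmp1 K g f) = cmp1 L (map1 R g) (map1 R f)"
    and "cell_in K \<mu> f g ==> cell_in K \<nu> g h
        ==> map2c R (vcmp2 K \<nu> \<mu>) = vcmp2 L (map2c R \<nu>) (map2c R \<mu>)"
    and "cell_in K \<mu> f f' ==> cell_in K \<nu> g g' ==> cod1 K f = dom1 K g
        ==> map2c R (hcmp2 K \<nu> \<mu>) = hcmp2 L (map2c R \<nu>) (map2c R \<mu>)"
proof -
  note R = assms[unfolded two_functor_def]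
  show "x \<in> Objs K ==> map0 R x \<in> Objs L" using R by simp
  show "x \<in> Objs K ==> map1 R (ide1 K x) = ide1 L (map0 R x)" using R by simp
  show "arr_in K f x y ==> arr_in L (map1 R f) (map0 R x) (map0 R y)" using R by simp
  show "arr_in K f x y ==> map2c R (ide2 K f) = ide2 L (map1 R f)"
    by (rule R[THEN conjunct2, THEN conjunct1, rule_format, THEN conjunct2])
  show "cell_in K \<mu> f g ==> cell_in L (map2c R \<mu>) (map1 R f) (map1 R g)" using R by simp
  show "arr_in K f x y ==> arr_in K g y z ==> map1 R (cmp1 K g f) = cmp1 L (map1 R g) (map1 R f)"
    by (rule R[THEN conjunct2, THEN conjunct2, THEN conjunct2, THEN conjunct1, rule_format])
  show "cell_in K \<mu> f g ==> cell_in K \<nu> g h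
        ==> map2c R (vcmp2 K \<nu> \<mu>) = vcmp2 L (map2c R \<nu>) (map2c R \<mu>)"
    by (rule R[THEN conjunct2, THEN conjunct2, THEN conjunct2, THEN conjunct2, THEN conjunct1, rule_format])
  show "cell_in K \<mu> f f' ==> cell_in K \<nu> g g' ==> cod1 K f = dom1 K g
        ==> map2c R (hcmp2 K \<nu> \<mu>) = hcmp2 L (map2c R \<nu>) (map2c R \<mu>)"
    by (rule R[THEN conjunct2, THEN conjunct2, THEN conjunct2, THEN conjunct2, THEN conjunct2, rule_format])
qed

lemma two_functor_hcmp:
  assumes "two_functor K L R" "cell_in K \<mu> f f'" "arr_in K f x y" "cell_in K \<nu> g g'" "arr_in K g y z"
  shows "map2c R (hcmp2 K \<nu> \<mu>) = hcmp2 L (map2c R \<nu>) (map2c R \<mu>)"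
  using two_functorD(8)[OF assms(1,2,4)] assms(3,5) by (simp add: arr_in_def)

text \<open>If every object \<open>x\<close> has an arrow \<open>\<eta> x : x \<rightarrow> G (F0 x)\<close> composition with which is an
  isomorphism of categories \<open>K(F0 x, y) \<cong> L(x, G y)\<close>, then \<open>F0\<close> extends uniquely to a left
  2-adjoint. Each axiom for it compares two 1-cells or 2-cells out of some \<open>F0 x\<close>, so it suffices
  that their transposes agree.\<close>

lemma has_left_two_adjointI:
  fixes K :: "('o, 'a, 'c) twocat" and L :: "('p, 'b, 'd) twocat"
    and F0 :: "'p => 'o" and \<eta> :: "'p => 'b"
  assumes K: "two_category K" and L: "two_category L" and G: "two_functor K L G"
    and F0: "\<And>x. x \<in> Objs L ==> F0 x \<in> Objs K"
    and \<eta>: "\<And>x. x \<in> Objs L ==> arr_in L (\<eta> x) x (map0 G (F0 x))"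
    and ex1: "\<And>x y f. x \<in> Objs L ==> y \<in> Objs K ==> arr_in L f x (map0 G y)
        ==> \<exists>!h. arr_in K h (F0 x) y \<and> cmp1 L (map1 G h) (\<eta> x) = f"
    and ex2: "\<And>x y h k \<mu>. x \<in> Objs L ==> y \<in> Objs K ==> arr_in K h (F0 x) y ==> arr_in K k (F0 x) y
        ==> cell_in L \<mu> (cmp1 L (map1 G h) (\<eta> x)) (cmp1 L (map1 G k) (\<eta> x))
        ==> \<exists>!\<nu>. cell_in K \<nu> h k \<and> hcmp2 L (map2c G \<nu>) (ide2 L (\<eta> x)) = \<mu>"
  shows "has_left_two_adjoint K L G"
proof -
  interpret K: two_category K by (rule K)
  interpret L: two_category L by (rule L)
  note G0 = two_functorD(1)[OF G] and Gid = two_functorD(2)[OF G] and G1 = two_functorD(3)[OF G]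
    and Gid2 = two_functorD(4)[OF G] and G2 = two_functorD(5)[OF G] and Gc = two_functorD(6)[OF G]
    and Gv = two_functorD(7)[OF G] and Gh = two_functor_hcmp[OF G]
  let ?T = "\<lambda>x h. cmp1 L (map1 G h) (\<eta> x)"
  let ?W = "\<lambda>x \<nu>. hcmp2 L (map2c G \<nu>) (ide2 L (\<eta> x))"
  have u1: "h = k" if "x \<in> Objs L" "arr_in K h (F0 x) y" "arr_in K k (F0 x) y" "?T x h = ?T x k" for x y h k
  proof -
    have y: "y \<in> Objs K" using that K.arr_obj by blast
    have "arr_in L (?T x h) x (map0 G y)" using that \<eta> G1 L.cmp1 by blast
    from ex1[OF that(1) y this] that show ?thesis by auto
  qed
  have u2: "\<nu> = \<gamma>" if "x \<in> Objs L" "arr_in K h (F0 x) y" "cell_in K \<nu> h k" "cell_in K \<gamma> h k" "?W x \<nu> = ?W x \<gamma>"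
    for x y h k \<nu> \<gamma>
  proof -
    have y: "y \<in> Objs K" using that K.arr_obj by blast
    have k: "arr_in K k (F0 x) y" using that K.cell_arr by blast
    have "cell_in L (?W x \<nu>) (?T x h) (?T x k)"
      using L.hcmp_cell[OF L.ide2_cell[OF \<eta>] \<eta> G2 G1] that by blast
    from ex2[OF that(1) y that(2) k this] that show ?thesis by auto
  qed
  define F1 where "F1 f = (THE h. arr_in K h (F0 (dom1 L f)) (F0 (cod1 L f))
      \<and> ?T (dom1 L f) h = cmp1 L (\<eta> (cod1 L f)) f)" for f
  define F2 where "F2 \<mu> = (THE \<nu>. cell_in K \<nu> (F1 (src2 L \<mu>)) (F1 (tgt2 L \<mu>))
      \<and> ?W (dom1 L (src2 L \<mu>)) \<nu> = hcmp2 L (ide2 L (\<eta> (cod1 L (src2 L \<mu>)))) \<mu>)" for \<mu>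
  define \<epsilon> where "\<epsilon> y = (THE h. arr_in K h (F0 (map0 G y)) y \<and> ?T (map0 G y) h = ide1 L (map0 G y))" for y
  have F1: "arr_in K (F1 f) (F0 x) (F0 y)" "?T x (F1 f) = cmp1 L (\<eta> y) f" if f: "arr_in L f x y" for f x y
  proof -
    have xy: "x \<in> Objs L" "y \<in> Objs L" using f L.arr_obj by blast+
    have "arr_in L (cmp1 L (\<eta> y) f) x (map0 G (F0 y))" using f \<eta>[OF xy(2)] L.cmp1 by blast
    from theI'[OF ex1[OF xy(1) F0[OF xy(2)] this]] f
    show "arr_in K (F1 f) (F0 x) (F0 y)" "?T x (F1 f) = cmp1 L (\<eta> y) f"
      unfolding F1_def by (simp_all add: arr_in_def)
  qed
  have F2: "cell_in K (F2 \<mu>) (F1 f) (F1 g)" "?W x (F2 \<mu>) = hcmp2 L (ide2 L (\<eta> y)) \<mu>"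
    if \<mu>: "cell_in L \<mu> f g" and f: "arr_in L f x y" for \<mu> f g x y
  proof -
    have g: "arr_in L g x y" using \<mu> f L.cell_arr by blast
    have xy: "x \<in> Objs L" "y \<in> Objs L" using f L.arr_obj by blast+
    have "cell_in L (hcmp2 L (ide2 L (\<eta> y)) \<mu>) (?T x (F1 f)) (?T x (F1 g))"
      using L.hcmp_cell[OF \<mu> f L.ide2_cell[OF \<eta>[OF xy(2)]] \<eta>[OF xy(2)]] F1 f g by simp
    from theI'[OF ex2[OF xy(1) F0[OF xy(2)] F1(1)[OF f] F1(1)[OF g] this]] f \<mu>
    show "cell_in K (F2 \<mu>) (F1 f) (F1 g)" "?W x (F2 \<mu>) = hcmp2 L (ide2 L (\<eta> y)) \<mu>"
      unfolding F2_def by (simp_all add: arr_in_def cell_in_def)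
  qed
  have \<epsilon>: "arr_in K (\<epsilon> y) (F0 (map0 G y)) y" "?T (map0 G y) (\<epsilon> y) = ide1 L (map0 G y)"
    if y: "y \<in> Objs K" for y
  proof -
    show "arr_in K (\<epsilon> y) (F0 (map0 G y)) y" "?T (map0 G y) (\<epsilon> y) = ide1 L (map0 G y)"
      using theI'[OF ex1[OF G0[OF y] y L.ide1[OF G0[OF y]]]] unfolding \<epsilon>_def by blast+
  qed
  have Tc: "?T x (cmp1 K k h) = cmp1 L (map1 G k) (?T x h)"
    if "x \<in> Objs L" "arr_in K h (F0 x) y" "arr_in K k y z" for x h k y z
    using Gc[OF that(2,3)] L.cmp1_assoc[OF \<eta>[OF that(1)] G1[OF that(2)] G1[OF that(3)]] by simp
  have Wid: "?W x (ide2 K h) = ide2 L (?T x h)" if "x \<in> Objs L" "arr_in K h (F0 x) y" for x h y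
    using Gid2[OF that(2)] L.hcmp2_ide2[OF \<eta>[OF that(1)] G1[OF that(2)]] by simp
  have Wv: "?W x (vcmp2 K \<gamma> \<nu>) = vcmp2 L (?W x \<gamma>) (?W x \<nu>)"
    if "x \<in> Objs L" "arr_in K h (F0 x) y" "cell_in K \<nu> h k" "cell_in K \<gamma> k l" for x y h k l \<nu> \<gamma>
    using Gv[OF that(3,4)] L.vcmp_whisker[OF G2[OF that(3)] G2[OF that(4)] G1[OF that(2)] \<eta>[OF that(1)]] by simp
  have Wh: "?W x (hcmp2 K \<gamma> \<nu>) = hcmp2 L (map2c G \<gamma>) (?W x \<nu>)"
    if "x \<in> Objs L" "arr_in K h (F0 x) y" "cell_in K \<nu> h h'" "cell_in K \<gamma> k k'" "arr_in K k y z"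
    for x y z h h' k k' \<nu> \<gamma>
    using Gh[OF that(3,2,4,5)]
      L.hcmp_assoc[OF L.ide2_cell[OF \<eta>[OF that(1)]] \<eta>[OF that(1)] G2[OF that(3)] G1[OF that(2)] G2[OF that(4)] G1[OF that(5)]]
    by simp
  have cF: "F1 (cmp1 L g f) = cmp1 K (F1 g) (F1 f)" if f: "arr_in L f x y" and g: "arr_in L g y z" for f g x y z
  proof -
    have xyz: "x \<in> Objs L" "y \<in> Objs L" "z \<in> Objs L" using f g L.arr_obj by blast+
    show ?thesis
    proof (rule u1[OF xyz(1) F1(1)[OF L.cmp1[OF f g]] K.cmp1[OF F1(1)[OF f] F1(1)[OF g]]])
      show "?T x (F1 (cmp1 L g f)) = ?T x (cmp1 K (F1 g) (F1 f))"
        using F1(2)[OF L.cmp1[OF f g]] Tc[OF xyz(1) F1(1)[OF f] F1(1)[OF g]] F1(2)[OF f] F1(2)[OF g]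
          L.cmp1_assoc[OF f g \<eta>[OF xyz(3)]] L.cmp1_assoc[OF f \<eta>[OF xyz(2)] G1[OF F1(1)[OF g]]] by simp
    qed
  qed
  define F where "F = \<lparr>map0 = F0, map1 = F1, map2c = F2\<rparr>"
  have Fs: "map0 F = F0" "map1 F = F1" "map2c F = F2" by (simp_all add: F_def)
  have F: "two_functor L K F"
    unfolding two_functor_def Fs
  proof (intro conjI allI ballI impI)
    fix x assume x: "x \<in> Objs L"
    show "F0 x \<in> Objs K" using F0 x .
    show "F1 (ide1 L x) = ide1 K (F0 x)"
      using F1[OF L.ide1[OF x]] K.ide1[OF F0[OF x]] Gid[OF F0[OF x]] L.cmp1_ide1[OF \<eta>[OF x]]
      by (intro u1[OF x]) auto
  next
    fix f x y assume f: "arr_in L f x y"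
    then have xy: "x \<in> Objs L" "y \<in> Objs L" using L.arr_obj by blast+
    show "arr_in K (F1 f) (F0 x) (F0 y)" using F1 f by blast
    show "F2 (ide2 L f) = ide2 K (F1 f)"
    proof (rule u2[OF xy(1) F1(1)[OF f] F2(1)[OF L.ide2_cell[OF f] f] K.ide2_cell[OF F1(1)[OF f]]])
      show "?W x (F2 (ide2 L f)) = ?W x (ide2 K (F1 f))"
        using F2(2)[OF L.ide2_cell[OF f] f] Wid[OF xy(1) F1(1)[OF f]] F1(2)[OF f]
          L.hcmp2_ide2[OF f \<eta>[OF xy(2)]] by simp
    qed
  next
    fix \<mu> f g assume \<mu>: "cell_in L \<mu> f g"
    then show "cell_in K (F2 \<mu>) (F1 f) (F1 g)" using F2(1) L.cell_arrs by blast
  next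
    fix f g x y z assume f: "arr_in L f x y" and g: "arr_in L g y z"
    then show "F1 (cmp1 L g f) = cmp1 K (F1 g) (F1 f)" by (rule cF)
  next
    fix \<mu> \<nu> f g h assume \<mu>: "cell_in L \<mu> f g" and \<nu>: "cell_in L \<nu> g h"
    obtain x y where f: "arr_in L f x y" using \<mu> L.cell_arrs by blast
    then have g: "arr_in L g x y" using \<mu> L.cell_arr by blast
    have xy: "x \<in> Objs L" "y \<in> Objs L" using f L.arr_obj by blast+
    show "F2 (vcmp2 L \<nu> \<mu>) = vcmp2 K (F2 \<nu>) (F2 \<mu>)"
    proof (rule u2[OF xy(1) F1(1)[OF f] F2(1)[OF L.vcmp2[OF \<mu> \<nu>] f] K.vcmp2[OF F2(1)[OF \<mu> f] F2(1)[OF \<nu> g]]])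
      show "?W x (F2 (vcmp2 L \<nu> \<mu>)) = ?W x (vcmp2 K (F2 \<nu>) (F2 \<mu>))"
        using F2(2)[OF L.vcmp2[OF \<mu> \<nu>] f] Wv[OF xy(1) F1(1)[OF f] F2(1)[OF \<mu> f] F2(1)[OF \<nu> g]]
          F2(2)[OF \<mu> f] F2(2)[OF \<nu> g] L.whisker_vcmp[OF \<mu> \<nu> f \<eta>[OF xy(2)]] by simp
    qed
  next
    fix \<mu> \<nu> f f' g g' assume \<mu>: "cell_in L \<mu> f f'" and \<nu>: "cell_in L \<nu> g g'" and c: "cod1 L f = dom1 L g"
    obtain x y where f: "arr_in L f x y" using \<mu> L.cell_arrs by blast
    obtain z where g: "arr_in L g y z" using \<nu> L.cell_arrs c f by (metis arr_inD)
    have xyz: "x \<in> Objs L" "y \<in> Objs L" "z \<in> Objs L" using f g L.arr_obj by blast+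
    note h = L.hcmp_cell[OF \<mu> f \<nu> g] and gf = L.cmp1[OF f g]
    have f': "arr_in L f' x y" and g': "arr_in L g' y z" using \<mu> \<nu> f g L.cell_arr by blast+
    have hF: "cell_in K (hcmp2 K (F2 \<nu>) (F2 \<mu>)) (F1 (cmp1 L g f)) (F1 (cmp1 L g' f'))"
      using K.hcmp_cell[OF F2(1)[OF \<mu> f] F1(1)[OF f] F2(1)[OF \<nu> g] F1(1)[OF g]] cF[OF f g] cF[OF f' g'] by simp
    show "F2 (hcmp2 L \<nu> \<mu>) = hcmp2 K (F2 \<nu>) (F2 \<mu>)"
    proof (rule u2[OF xyz(1) F1(1)[OF gf] F2(1)[OF h gf] hF])
      note \<eta>y = \<eta>[OF xyz(2)] and \<eta>z = \<eta>[OF xyz(3)]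
      note ae = L.hcmp_assoc[OF \<mu> f L.ide2_cell[OF \<eta>y] \<eta>y G2[OF F2(1)[OF \<nu> g]] G1[OF F1(1)[OF g]]]
        and ae' = L.hcmp_assoc[OF \<mu> f \<nu> g L.ide2_cell[OF \<eta>z] \<eta>z]
      show "?W x (F2 (hcmp2 L \<nu> \<mu>)) = ?W x (hcmp2 K (F2 \<nu>) (F2 \<mu>))"
        using F2(2)[OF h gf] Wh[OF xyz(1) F1(1)[OF f] F2(1)[OF \<mu> f] F2(1)[OF \<nu> g] F1(1)[OF g]]
          F2(2)[OF \<mu> f] F2(2)[OF \<nu> g] ae ae' by simp
    qed
  qed
  have nat\<eta>: "two_natural L L twofun_id (twofun_comp G F) \<eta>"
    unfolding two_natural_def twofun_id_def twofun_comp_def Fs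
  proof (simp, intro conjI allI ballI impI)
    fix x assume "x \<in> Objs L" then show "arr_in L (\<eta> x) x (map0 G (F0 x))" by (rule \<eta>)
  next
    fix f x y assume "arr_in L f x y" then show "?T x (F1 f) = cmp1 L (\<eta> y) f" by (rule F1)
  next
    fix \<mu> f x y assume "\<exists>g. cell_in L \<mu> f g" "arr_in L f x y"
    then show "?W x (F2 \<mu>) = hcmp2 L (ide2 L (\<eta> y)) \<mu>" using F2(2) by blast
  qed
  have nat: "cmp1 K f (\<epsilon> x) = cmp1 K (\<epsilon> y) (F1 (map1 G f))" if f: "arr_in K f x y" for f x y
  proof -
    have xy: "x \<in> Objs K" "y \<in> Objs K" using f K.arr_obj by blast+
    note Gx = G0[OF xy(1)] and Gf = G1[OF f] and FG = F1(1)[OF G1[OF f]]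
    show ?thesis
    proof (rule u1[OF Gx K.cmp1[OF \<epsilon>(1)[OF xy(1)] f] K.cmp1[OF FG \<epsilon>(1)[OF xy(2)]]])
      show "?T (map0 G x) (cmp1 K f (\<epsilon> x)) = ?T (map0 G x) (cmp1 K (\<epsilon> y) (F1 (map1 G f)))"
        using Tc[OF Gx \<epsilon>(1)[OF xy(1)] f] Tc[OF Gx FG \<epsilon>(1)[OF xy(2)]] \<epsilon>(2)[OF xy(1)] \<epsilon>(2)[OF xy(2)]
          F1(2)[OF Gf] L.cmp1_ide1[OF Gf]
          L.cmp1_assoc[OF Gf \<eta>[OF G0[OF xy(2)]] G1[OF \<epsilon>(1)[OF xy(2)]]] by simp
    qed
  qed
  have nat\<epsilon>: "two_natural K K (twofun_comp F G) twofun_id \<epsilon>"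
    unfolding two_natural_def twofun_id_def twofun_comp_def Fs
  proof (simp, intro conjI allI ballI impI)
    fix y assume "y \<in> Objs K" then show "arr_in K (\<epsilon> y) (F0 (map0 G y)) y" by (rule \<epsilon>)
  next
    fix f x y assume f: "arr_in K f x y"
    then show "cmp1 K f (\<epsilon> x) = cmp1 K (\<epsilon> y) (F1 (map1 G f))" by (rule nat)
  next
    fix \<mu> f x y assume "\<exists>g. cell_in K \<mu> f g" and f: "arr_in K f x y"
    then obtain g where \<mu>: "cell_in K \<mu> f g" by blast
    have g: "arr_in K g x y" using \<mu> f K.cell_arr by blast
    have xy: "x \<in> Objs K" "y \<in> Objs K" using f K.arr_obj by blast+
    note ex = \<epsilon>(1)[OF xy(1)] and ey = \<epsilon>(1)[OF xy(2)]
    note Gx = G0[OF xy(1)] and Gy = G0[OF xy(2)] and Ga = G2[OF \<mu>] and Gf = G1[OF f]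
    note FG = F1(1)[OF Gf] and FGa = F2(1)[OF Ga Gf]
    have c1: "cell_in K (hcmp2 K \<mu> (ide2 K (\<epsilon> x))) (cmp1 K f (\<epsilon> x)) (cmp1 K g (\<epsilon> x))"
      using K.hcmp_cell[OF K.ide2_cell[OF ex] ex \<mu> f] .
    have c2: "cell_in K (hcmp2 K (ide2 K (\<epsilon> y)) (F2 (map2c G \<mu>))) (cmp1 K f (\<epsilon> x)) (cmp1 K g (\<epsilon> x))"
      using K.hcmp_cell[OF FGa FG K.ide2_cell[OF ey] ey] nat[OF f] nat[OF g] by simp
    show "hcmp2 K \<mu> (ide2 K (\<epsilon> x)) = hcmp2 K (ide2 K (\<epsilon> y)) (F2 (map2c G \<mu>))"
    proof (rule u2[OF Gx K.cmp1[OF ex f] c1 c2])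
      have "?W (map0 G x) (hcmp2 K \<mu> (ide2 K (\<epsilon> x))) = map2c G \<mu>"
        using Wh[OF Gx ex K.ide2_cell[OF ex] \<mu> f] Wid[OF Gx ex] \<epsilon>(2)[OF xy(1)] L.hcmp_unit[OF Ga Gf] by simp
      moreover have "?W (map0 G x) (hcmp2 K (ide2 K (\<epsilon> y)) (F2 (map2c G \<mu>))) = map2c G \<mu>"
        using Wh[OF Gx FG FGa K.ide2_cell[OF ey] ey] F2(2)[OF Ga Gf] Gid2[OF ey]
          L.hcmp_assoc[OF Ga Gf L.ide2_cell[OF \<eta>[OF Gy]] \<eta>[OF Gy] L.ide2_cell[OF G1[OF ey]] G1[OF ey]]
          L.hcmp2_ide2[OF \<eta>[OF Gy] G1[OF ey]] \<epsilon>(2)[OF xy(2)] L.hcmp_unit[OF Ga Gf] by simp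
      ultimately show "?W (map0 G x) (hcmp2 K \<mu> (ide2 K (\<epsilon> x)))
          = ?W (map0 G x) (hcmp2 K (ide2 K (\<epsilon> y)) (F2 (map2c G \<mu>)))" by simp
    qed
  qed
  have t1: "cmp1 K (\<epsilon> (F0 x)) (F1 (\<eta> x)) = ide1 K (F0 x)" if x: "x \<in> Objs L" for x
  proof -
    note \<eta>x = \<eta>[OF x] and e = \<epsilon>(1)[OF F0[OF x]]
    show ?thesis
    proof (rule u1[OF x K.cmp1[OF F1(1)[OF \<eta>x] e] K.ide1[OF F0[OF x]]])
      show "?T x (cmp1 K (\<epsilon> (F0 x)) (F1 (\<eta> x))) = ?T x (ide1 K (F0 x))"
        using Tc[OF x F1(1)[OF \<eta>x] e] F1(2)[OF \<eta>x] \<epsilon>(2)[OF F0[OF x]] Gid[OF F0[OF x]]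
          L.cmp1_assoc[OF \<eta>x \<eta>[OF G0[OF F0[OF x]]] G1[OF e]] by simp
    qed
  qed
  have "two_adjunction K L F G \<eta> \<epsilon>"
    unfolding two_adjunction_def Fs using F G nat\<eta> nat\<epsilon> t1 \<epsilon>(2) by blast
  then show ?thesis unfolding has_left_two_adjoint_def by blast
qed

section \<open>Slices\<close>

lemma arr_in_slice2:
  "arr_in (slice2 L B) p f g \<longleftrightarrow> (\<exists>h. p = (f, h, g) \<and> arr_in L f (dom1 L f) B
      \<and> arr_in L g (dom1 L g) B \<and> arr_in L h (dom1 L f) (dom1 L g) \<and> cmp1 L g h = f)"
  by (auto simp: arr_in_def slice2_def)

lemma cell_in_slice2:
  "cell_in (slice2 L B) p q r \<longleftrightarrow> (\<exists>f g \<mu> h k. p = (f, \<mu>, g) \<and> q = (f, h, g) \<and> r = (f, k, g)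
      \<and> arr_in L f (dom1 L f) B \<and> arr_in L g (dom1 L g) B \<and> cell_in L \<mu> h k
      \<and> arr_in L h (dom1 L f) (dom1 L g) \<and> cmp1 L g h = f \<and> arr_in L k (dom1 L f) (dom1 L g) \<and> cmp1 L g k = f
      \<and> hcmp2 L (ide2 L g) \<mu> = ide2 L f)"
  by (auto simp: cell_in_def arr_in_def slice2_def)

lemma slice2_ops:
  "ide1 (slice2 L B) = (\<lambda>f. (f, ide1 L (dom1 L f), f))"
  "cmp1 (slice2 L B) = (\<lambda>(g', k, l) (f, h, g). (f, cmp1 L k h, l))"
  "ide2 (slice2 L B) = (\<lambda>(f, h, g). (f, ide2 L h, g))"
  "vcmp2 (slice2 L B) = (\<lambda>(f', \<nu>, g') (f, \<mu>, g). (f, vcmp2 L \<nu> \<mu>, g))"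
  "hcmp2 (slice2 L B) = (\<lambda>(g', \<nu>, l) (f, \<mu>, g). (f, hcmp2 L \<nu> \<mu>, l))"
  "dom1 (slice2 L B) = (\<lambda>(f, h, g). f)" "cod1 (slice2 L B) = (\<lambda>(f, h, g). g)"
  by (simp_all add: slice2_def)

text \<open>The axioms are inherited, as the operations are those of \<open>L\<close> on the middle components; what has to be
  checked is that composites stay over \<open>B\<close>.\<close>

lemma two_category_slice2:
  fixes L :: "('o, 'a, 'c) twocat"
  assumes L: "two_category L"
  shows "two_category (slice2 L B)"
proof -
  interpret L: two_category L by (rule L)
  let ?S = "slice2 L B"
  note arr = arr_in_slice2 and cell = cell_in_slice2 and ops = slice2_ops
  show ?thesis
  proof
    fix f assume "f \<in> Arrs ?S"
    then show "dom1 ?S f \<in> Objs ?S \<and> cod1 ?S f \<in> Objs ?S"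
      by (auto simp: slice2_def)
  next
    fix \<mu> assume "\<mu> \<in> Cells ?S"
    then show "src2 ?S \<mu> \<in> Arrs ?S \<and> tgt2 ?S \<mu> \<in> Arrs ?S \<and>
         dom1 ?S (src2 ?S \<mu>) = dom1 ?S (tgt2 ?S \<mu>) \<and>
         cod1 ?S (src2 ?S \<mu>) = cod1 ?S (tgt2 ?S \<mu>)"
      by (auto simp: slice2_def)
  next
    fix x assume "x \<in> Objs ?S"
    then have x: "arr_in L x (dom1 L x) B" by (simp add: slice2_def arr_in_def)
    then have "dom1 L x \<in> Objs L" using L.arr_obj by blast
    then show "arr_in ?S (ide1 ?S x) x x"
      unfolding arr ops using x L.ide1 L.cmp1_ide1 by blast
  next
    fix f g x y z assume "arr_in ?S f x y" "arr_in ?S g y z"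
    then obtain h k where hk: "f = (x, h, y)" "g = (y, k, z)" "arr_in L x (dom1 L x) B" "arr_in L z (dom1 L z) B"
      "arr_in L h (dom1 L x) (dom1 L y)" "cmp1 L y h = x" "arr_in L k (dom1 L y) (dom1 L z)" "cmp1 L z k = y"
      unfolding arr by blast
    then show "arr_in ?S (cmp1 ?S g f) x z"
      unfolding arr ops using L.cmp1[OF hk(5,7)] L.cmp1_assoc[OF hk(5,7,4)] by auto
  next
    fix f x y assume "arr_in ?S f x y"
    then show "cmp1 ?S f (ide1 ?S x) = f \<and> cmp1 ?S (ide1 ?S y) f = f"
      unfolding arr ops using L.cmp1_ide1 by auto
  next
    fix f w x g y h z
    assume "arr_in ?S f w x" "arr_in ?S g x y" "arr_in ?S h y z"
    then obtain f' g' h' where e: "f = (w, f', x)" "g = (x, g', y)" "h = (y, h', z)" and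
      a: "arr_in L f' (dom1 L w) (dom1 L x)" "arr_in L g' (dom1 L x) (dom1 L y)" "arr_in L h' (dom1 L y) (dom1 L z)"
      unfolding arr by blast
    show "cmp1 ?S (cmp1 ?S h g) f = cmp1 ?S h (cmp1 ?S g f)"
      unfolding e ops using L.cmp1_assoc[OF a] by simp
  next
    fix f assume "f \<in> Arrs ?S"
    then obtain x y where "arr_in ?S f x y" by (auto simp: arr_in_def)
    then show "cell_in ?S (ide2 ?S f) f f"
      unfolding arr cell ops using L.ide2_cell L.hcmp2_ide2 by fastforce
  next
    fix \<mu> \<nu> f g h assume "cell_in ?S \<mu> f g" "cell_in ?S \<nu> g h"
    then obtain x y a b h1 h2 h3 where *: "\<mu> = (x, a, y)" "\<nu> = (x, b, y)" "f = (x, h1, y)" "g = (x, h2, y)"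
      "h = (x, h3, y)" "cell_in L a h1 h2" "cell_in L b h2 h3" "arr_in L x (dom1 L x) B" "arr_in L y (dom1 L y) B"
      "arr_in L h1 (dom1 L x) (dom1 L y)" "cmp1 L y h1 = x" "arr_in L h3 (dom1 L x) (dom1 L y)" "cmp1 L y h3 = x"
      "hcmp2 L (ide2 L y) a = ide2 L x" "hcmp2 L (ide2 L y) b = ide2 L x"
      unfolding cell by blast
    have "hcmp2 L (ide2 L y) (vcmp2 L b a) = ide2 L x"
      using L.whisker_vcmp[OF *(6,7,10,9)] *(14,15) L.vcmp2_ide2[OF L.ide2_cell[OF *(8)]] by simp
    then show "cell_in ?S (vcmp2 ?S \<nu> \<mu>) f h"
      unfolding cell ops using * L.vcmp2 by auto
  next
    fix \<mu> f g assume "cell_in ?S \<mu> f g"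
    then show "vcmp2 ?S \<mu> (ide2 ?S f) = \<mu> \<and> vcmp2 ?S (ide2 ?S g) \<mu> = \<mu>"
      unfolding cell ops using L.vcmp2_ide2 by auto
  next
    fix \<mu> f g \<nu> h \<gamma> k
    assume "cell_in ?S \<mu> f g" "cell_in ?S \<nu> g h" "cell_in ?S \<gamma> h k"
    then obtain x y a b c f' g' h' k' where e: "\<mu> = (x, a, y)" "\<nu> = (x, b, y)" "\<gamma> = (x, c, y)" and
      a: "cell_in L a f' g'" "cell_in L b g' h'" "cell_in L c h' k'"
      unfolding cell by blast
    show "vcmp2 ?S (vcmp2 ?S \<gamma> \<nu>) \<mu> = vcmp2 ?S \<gamma> (vcmp2 ?S \<nu> \<mu>)"
      unfolding e ops using L.vcmp2_assoc[OF a] by simp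
  next
    fix \<mu> f f' \<nu> g g' assume "cell_in ?S \<mu> f f'" "cell_in ?S \<nu> g g'"
      "cod1 ?S f = dom1 ?S g"
    then obtain x y z a b h1 h2 k1 k2 where *: "\<mu> = (x, a, y)" "\<nu> = (y, b, z)" "f = (x, h1, y)" "f' = (x, h2, y)"
      "g = (y, k1, z)" "g' = (y, k2, z)"
      "cell_in L a h1 h2" "cell_in L b k1 k2" "arr_in L x (dom1 L x) B" "arr_in L y (dom1 L y) B" "arr_in L z (dom1 L z) B"
      "arr_in L h1 (dom1 L x) (dom1 L y)" "cmp1 L y h1 = x" "arr_in L h2 (dom1 L x) (dom1 L y)" "cmp1 L y h2 = x"
      "arr_in L k1 (dom1 L y) (dom1 L z)" "cmp1 L z k1 = y" "arr_in L k2 (dom1 L y) (dom1 L z)" "cmp1 L z k2 = y"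
      "hcmp2 L (ide2 L y) a = ide2 L x" "hcmp2 L (ide2 L z) b = ide2 L y"
      unfolding cell ops by auto
    have h: "cell_in L (hcmp2 L b a) (cmp1 L k1 h1) (cmp1 L k2 h2)" by (rule L.hcmp_cell[OF *(7,12,8,16)])
    have "hcmp2 L (ide2 L z) (hcmp2 L b a) = ide2 L x"
      using L.hcmp_assoc[OF *(7,12,8,16) L.ide2_cell[OF *(11)] *(11)] *(20,21) by simp
    moreover have "cmp1 L z (cmp1 L k1 h1) = x" "cmp1 L z (cmp1 L k2 h2) = x"
      using L.cmp1_assoc[OF *(12,16,11)] L.cmp1_assoc[OF *(14,18,11)] * by simp_all
    ultimately show "cell_in ?S (hcmp2 ?S \<nu> \<mu>) (cmp1 ?S g f) (cmp1 ?S g' f')"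
      unfolding cell ops using * h L.cmp1[OF *(12,16)] L.cmp1[OF *(14,18)] by simp
  next
    fix f x y g z assume "arr_in ?S f x y" "arr_in ?S g y z"
    then show "hcmp2 ?S (ide2 ?S g) (ide2 ?S f) = ide2 ?S (cmp1 ?S g f)"
      unfolding arr ops using L.hcmp2_ide2 by auto
  next
    fix \<mu> f f' \<mu>' f'' \<nu> g g' \<nu>' g''
    assume "cell_in ?S \<mu> f f'" "cell_in ?S \<mu>' f' f''" "cell_in ?S \<nu> g g'"
      "cell_in ?S \<nu>' g' g''" "cod1 ?S f = dom1 ?S g"
    then obtain x y z a b c d f1 f2 f3 g1 g2 g3 where e: "\<mu> = (x, a, y)" "\<mu>' = (x, b, y)" "\<nu> = (y, c, z)" "\<nu>' = (y, d, z)" and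
      a: "cell_in L a f1 f2" "cell_in L b f2 f3" "cell_in L c g1 g2" "cell_in L d g2 g3"
      and fg: "arr_in L f1 (dom1 L x) (dom1 L y)" "arr_in L g1 (dom1 L y) (dom1 L z)"
      unfolding cell ops by auto
    have "cod1 L f1 = dom1 L g1" using fg by (simp add: arr_in_def)
    then show "hcmp2 ?S (vcmp2 ?S \<nu>' \<nu>) (vcmp2 ?S \<mu>' \<mu>)
        = vcmp2 ?S (hcmp2 ?S \<nu>' \<mu>') (hcmp2 ?S \<nu> \<mu>)"
      unfolding e ops using L.interchange[OF a] by simp
  next
    fix \<mu> f g assume "cell_in ?S \<mu> f g"
    then show "hcmp2 ?S \<mu> (ide2 ?S (ide1 ?S (dom1 ?S f))) = \<mu> \<and>
       hcmp2 ?S (ide2 ?S (ide1 ?S (cod1 ?S f))) \<mu> = \<mu>"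
      unfolding cell ops using L.hcmp_unit by auto
  next
    fix \<mu> f f' \<nu> g g' \<gamma> h h'
    assume "cell_in ?S \<mu> f f'" "cell_in ?S \<nu> g g'" "cell_in ?S \<gamma> h h'"
      "cod1 ?S f = dom1 ?S g" "cod1 ?S g = dom1 ?S h"
    then obtain w x y z a b c f1 f2 g1 g2 h1 h2 where e: "\<mu> = (w, a, x)" "\<nu> = (x, b, y)" "\<gamma> = (y, c, z)" and
      a: "cell_in L a f1 f2" "arr_in L f1 (dom1 L w) (dom1 L x)" "cell_in L b g1 g2" "arr_in L g1 (dom1 L x) (dom1 L y)"
        "cell_in L c h1 h2" "arr_in L h1 (dom1 L y) (dom1 L z)"
      unfolding cell ops by auto
    show "hcmp2 ?S (hcmp2 ?S \<gamma> \<nu>) \<mu> = hcmp2 ?S \<gamma> (hcmp2 ?S \<nu> \<mu>)"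
      unfolding e ops using L.hcmp_assoc[OF a] by simp
  qed
qed

lemma bang_arr: "terminal2 K t ==> x \<in> Objs K ==> arr_in K (bang K t x) x t"
  unfolding bang_def by (rule theI') (simp add: terminal2_def)

lemma terminal2_arr_eq: "terminal2 K t ==> x \<in> Objs K ==> arr_in K f x t ==> arr_in K g x t ==> f = g"
  unfolding terminal2_def by blast

lemma terminal2_cell_eq:
  "terminal2 K t ==> x \<in> Objs K ==> arr_in K f x t ==> arr_in K g x t
    ==> cell_in K \<mu> f g ==> cell_in K \<nu> f g ==> \<mu> = \<nu>"
  unfolding terminal2_def by blast

text \<open>The triangles over \<open>R t\<close> commute since \<open>R\<close> preserves the triangles over \<open>t\<close>, which commute as \<open>t\<close> is
  terminal; the 2-dimensional part of terminality gives the condition on 2-cells.\<close>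

lemma two_functor_slice_lift:
  fixes K :: "('o, 'a, 'c) twocat" and L :: "('p, 'b, 'd) twocat"
  assumes K: "two_category K" and L: "two_category L" and R: "two_functor K L R" and t: "terminal2 K t"
  shows "two_functor K (slice2 L (map0 R t)) (slice_lift K t R)"
proof -
  interpret K: two_category K by (rule K)
  interpret L: two_category L by (rule L)
  let ?b = "\<lambda>x. map1 R (bang K t x)" and ?S = "slice2 L (map0 R t)"
  note b = bang_arr[OF t] and R0 = two_functorD(1)[OF R] and R1 = two_functorD(3)[OF R] and R2 = two_functorD(5)[OF R]
  have Kb: "cmp1 K (bang K t y) f = bang K t x" if f: "arr_in K f x y" for f x y
    using terminal2_arr_eq[OF t _ K.cmp1[OF f b] b] K.arr_obj[OF f] by simp
  have A: "cmp1 L (?b y) (map1 R f) = ?b x" if f: "arr_in K f x y" for f x y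
    using Kb[OF f] two_functorD(6)[OF R f b] K.arr_obj[OF f] by simp
  have C: "hcmp2 L (ide2 L (?b y)) (map2c R \<mu>) = ide2 L (?b x)"
    if \<mu>: "cell_in K \<mu> f g" and f: "arr_in K f x y" for \<mu> f g x y
  proof -
    have xy: "x \<in> Objs K" "y \<in> Objs K" using K.arr_obj[OF f] by auto
    have g: "arr_in K g x y" using \<mu> f K.cell_arr by blast
    note b' = b[OF xy(2)] and bx = b[OF xy(1)]
    have "cell_in K (hcmp2 K (ide2 K (bang K t y)) \<mu>) (bang K t x) (bang K t x)"
      using K.hcmp_cell[OF \<mu> f K.ide2_cell[OF b'] b'] Kb[OF f] Kb[OF g] by simp
    then have "hcmp2 K (ide2 K (bang K t y)) \<mu> = ide2 K (bang K t x)"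
      by (rule terminal2_cell_eq[OF t xy(1) bx bx _ K.ide2_cell[OF bx]])
    then show ?thesis
      using two_functor_hcmp[OF R \<mu> f K.ide2_cell[OF b'] b'] two_functorD(4)[OF R b'] two_functorD(4)[OF R bx] by simp
  qed
  have S: "map0 (slice_lift K t R) = (\<lambda>x. ?b x)"
    "map1 (slice_lift K t R) = (\<lambda>f. (?b (dom1 K f), map1 R f, ?b (cod1 K f)))"
    "map2c (slice_lift K t R) = (\<lambda>\<mu>. (?b (dom1 K (src2 K \<mu>)), map2c R \<mu>,
                   ?b (cod1 K (src2 K \<mu>))))"
    by (simp_all add: slice_lift_def)
  have B: "arr_in L (?b x) (map0 R x) (map0 R t)" if "x \<in> Objs K" for x
    using R1[OF b[OF that]] .
  have Bd: "dom1 L (?b x) = map0 R x" if "x \<in> Objs K" for x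
    using B[OF that] by (simp add: arr_in_def)
  show ?thesis
    unfolding two_functor_def S
  proof (intro conjI allI ballI impI)
    fix x assume x: "x \<in> Objs K"
    show "?b x \<in> Objs ?S" using B[OF x] by (simp add: slice2_def arr_in_def)
    show "(?b (dom1 K (ide1 K x)), map1 R (ide1 K x), ?b (cod1 K (ide1 K x)))
        = ide1 ?S (?b x)"
      using Bd[OF x] K.ide1[OF x] two_functorD(2)[OF R x] by (simp add: slice2_ops arr_in_def)
  next
    fix f x y assume f: "arr_in K f x y"
    then have xy: "x \<in> Objs K" "y \<in> Objs K" using K.arr_obj by blast+
    show "arr_in ?S (?b (dom1 K f), map1 R f, ?b (cod1 K f))
        (?b x) (?b y)"
      unfolding arr_in_slice2 using A[OF f] B xy Bd R1[OF f] arr_inD[OF f] by simp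
    show "(?b (dom1 K (src2 K (ide2 K f))), map2c R (ide2 K f), ?b (cod1 K (src2 K (ide2 K f))))
      = ide2 ?S (?b (dom1 K f), map1 R f, ?b (cod1 K f))"
      using K.ide2_cell[OF f] two_functorD(4)[OF R f] by (simp add: slice2_ops cell_in_def)
  next
    fix \<mu> f g assume \<mu>: "cell_in K \<mu> f g"
    then obtain x y where f: "arr_in K f x y" using K.cell_arrs by blast
    have g: "arr_in K g x y" using \<mu> f K.cell_arr by blast
    have xy: "x \<in> Objs K" "y \<in> Objs K" using f K.arr_obj by blast+
    show "cell_in ?S
        (?b (dom1 K (src2 K \<mu>)), map2c R \<mu>, ?b (cod1 K (src2 K \<mu>)))
        (?b (dom1 K f), map1 R f, ?b (cod1 K f))
        (?b (dom1 K g), map1 R g, ?b (cod1 K g))"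
      unfolding cell_in_slice2
      using A[OF f] A[OF g] C[OF \<mu> f] B xy Bd R1[OF f] R1[OF g] R2[OF \<mu>] arr_inD[OF f] arr_inD[OF g] cell_inD[OF \<mu>] by simp
  next
    fix f g x y z assume f: "arr_in K f x y" and g: "arr_in K g y z"
    show "(?b (dom1 K (cmp1 K g f)), map1 R (cmp1 K g f), ?b (cod1 K (cmp1 K g f)))
      = cmp1 ?S (?b (dom1 K g), map1 R g, ?b (cod1 K g))
        (?b (dom1 K f), map1 R f, ?b (cod1 K f))"
      using K.cmp1[OF f g] two_functorD(6)[OF R f g] arr_inD[OF f] arr_inD[OF g] by (simp add: slice2_ops arr_in_def)
  next
    fix \<mu> \<nu> f g h assume \<mu>: "cell_in K \<mu> f g" and \<nu>: "cell_in K \<nu> g h"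
    show "(?b (dom1 K (src2 K (vcmp2 K \<nu> \<mu>))), map2c R (vcmp2 K \<nu> \<mu>), ?b (cod1 K (src2 K (vcmp2 K \<nu> \<mu>))))
      = vcmp2 ?S (?b (dom1 K (src2 K \<nu>)), map2c R \<nu>, ?b (cod1 K (src2 K \<nu>)))
        (?b (dom1 K (src2 K \<mu>)), map2c R \<mu>, ?b (cod1 K (src2 K \<mu>)))"
      using K.vcmp2[OF \<mu> \<nu>] two_functorD(7)[OF R \<mu> \<nu>] cell_inD[OF \<mu>] by (simp add: slice2_ops cell_in_def)
  next
    fix \<mu> \<nu> f f' g g' assume \<mu>: "cell_in K \<mu> f f'" and \<nu>: "cell_in K \<nu> g g'" and c: "cod1 K f = dom1 K g"
    obtain x y where f: "arr_in K f x y" using \<mu> K.cell_arrs by blast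
    obtain z where g: "arr_in K g y z" using \<nu> K.cell_arrs c f by (metis arr_inD)
    show "(?b (dom1 K (src2 K (hcmp2 K \<nu> \<mu>))), map2c R (hcmp2 K \<nu> \<mu>), ?b (cod1 K (src2 K (hcmp2 K \<nu> \<mu>))))
      = hcmp2 ?S (?b (dom1 K (src2 K \<nu>)), map2c R \<nu>, ?b (cod1 K (src2 K \<nu>)))
        (?b (dom1 K (src2 K \<mu>)), map2c R \<mu>, ?b (cod1 K (src2 K \<mu>)))"
      using K.hcmp_cell[OF \<mu> f \<nu> g] K.cmp1[OF f g] two_functorD(8)[OF R \<mu> \<nu> c] cell_inD[OF \<mu>] cell_inD[OF \<nu>]
        arr_inD[OF f] arr_inD[OF g] by (simp add: slice2_ops cell_in_def arr_in_def)
  qed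
qed

text \<open>Since 2-cells of \<open>Spl\<close> are those of the slice, chosen lifts on the values of \<open>slice_lift\<close> that are
  preserved by its values on arrows are all that a factorization through \<open>Spl\<close> amounts to.\<close>

lemma slice_lift_factors_through_Spl:
  fixes K :: "('o, 'a, 'c) twocat" and L :: "('p, 'b, 'd) twocat" and lft :: "'o => 'b => 'd => 'd"
  assumes K: "two_category K" and L: "two_category L" and R: "two_functor K L R" and t: "terminal2 K t"
    and lft: "\<And>x. x \<in> Objs K ==> split_fibration L (map1 R (bang K t x)) (lft x)"
    and pres: "\<And>f x y. arr_in K f x y ==>
      preserves_lifts L (map1 R (bang K t x), lft x) (map1 R f) (map1 R (bang K t y), lft y)"
  shows "\<exists>S. two_functor K (Spl L (map0 R t)) S
      \<and> twofun_eq K (twofun_comp Spl_forget S) (slice_lift K t R)"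
proof -
  interpret K: two_category K by (rule K)
  let ?E = "\<lambda>x. (map1 R (bang K t x), lft x)"
  let ?P = "Spl L (map0 R t)"
  define S where "S = \<lparr>map0 = ?E, map1 = (\<lambda>f. (?E (dom1 K f), map1 R f, ?E (cod1 K f))),
    map2c = (\<lambda>\<mu>. (?E (dom1 K (src2 K \<mu>)), map2c R \<mu>, ?E (cod1 K (src2 K \<mu>))))\<rparr>"
  note sl = two_functor_slice_lift[OF K L R t]
  note slD = two_functorD[OF sl, unfolded slice_lift_def twofun.simps]
  have "two_functor K ?P S"
    unfolding two_functor_def
  proof (intro conjI allI ballI impI)
    fix x assume x: "x \<in> Objs K"
    show "map0 S x \<in> Objs ?P" using slD(1)[OF x] lft[OF x] by (simp add: S_def Spl_def)
    show "map1 S (ide1 K x) = ide1 ?P (map0 S x)"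
      using slD(2)[OF x] K.ide1[OF x] by (simp add: S_def Spl_def slice2_def arr_in_def)
  next
    fix f x y assume f: "arr_in K f x y"
    then have xy: "x \<in> Objs K" "y \<in> Objs K" using K.arr_obj by blast+
    show "arr_in ?P (map1 S f) (map0 S x) (map0 S y)"
      using slD(3)[OF f] lft xy pres[OF f] arr_inD[OF f] by (simp add: S_def Spl_def arr_in_def)
    show "map2c S (ide2 K f) = ide2 ?P (map1 S f)"
      using slD(4)[OF f] arr_inD[OF f] cell_inD[OF K.ide2_cell[OF f]] by (simp add: S_def Spl_def slice2_def)
  next
    fix \<mu> f g assume \<mu>: "cell_in K \<mu> f g"
    then obtain x y where f: "arr_in K f x y" using K.cell_arrs by blast
    have g: "arr_in K g x y" using \<mu> f K.cell_arr by blast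
    have xy: "x \<in> Objs K" "y \<in> Objs K" using f K.arr_obj by blast+
    show "cell_in ?P (map2c S \<mu>) (map1 S f) (map1 S g)"
      using slD(5)[OF \<mu>] lft xy pres[OF f] pres[OF g] arr_inD[OF f] arr_inD[OF g] cell_inD[OF \<mu>]
        cell_inD[OF two_functorD(5)[OF R \<mu>]] by (simp add: S_def Spl_def cell_in_def)
  next
    fix f g x y z assume f: "arr_in K f x y" and g: "arr_in K g y z"
    show "map1 S (cmp1 K g f) = cmp1 ?P (map1 S g) (map1 S f)"
      using slD(6)[OF f g] arr_inD[OF f] arr_inD[OF g] arr_inD[OF K.cmp1[OF f g]] by (simp add: S_def Spl_def slice2_def)
  next
    fix \<mu> \<nu> f g h assume \<mu>: "cell_in K \<mu> f g" and \<nu>: "cell_in K \<nu> g h"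
    show "map2c S (vcmp2 K \<nu> \<mu>) = vcmp2 ?P (map2c S \<nu>) (map2c S \<mu>)"
      using slD(7)[OF \<mu> \<nu>] cell_inD[OF \<mu>] cell_inD[OF \<nu>] cell_inD[OF K.vcmp2[OF \<mu> \<nu>]]
      by (simp add: S_def Spl_def slice2_def)
  next
    fix \<mu> \<nu> f f' g g' assume \<mu>: "cell_in K \<mu> f f'" and \<nu>: "cell_in K \<nu> g g'" and c: "cod1 K f = dom1 K g"
    obtain x y where f: "arr_in K f x y" using \<mu> K.cell_arrs by blast
    obtain z where g: "arr_in K g y z" using \<nu> K.cell_arrs c f by (metis arr_inD)
    show "map2c S (hcmp2 K \<nu> \<mu>) = hcmp2 ?P (map2c S \<nu>) (map2c S \<mu>)"
      using slD(8)[OF \<mu> \<nu> c] cell_inD[OF \<mu>] cell_inD[OF \<nu>] cell_inD[OF K.hcmp_cell[OF \<mu> f \<nu> g]]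
        arr_inD[OF f] arr_inD[OF g] arr_inD[OF K.cmp1[OF f g]] by (simp add: S_def Spl_def slice2_def)
  qed
  moreover have "twofun_eq K (twofun_comp Spl_forget S) (slice_lift K t R)"
    by (simp add: twofun_eq_def twofun_comp_def Spl_forget_def slice_lift_def S_def)
  ultimately show ?thesis by blast
qed

section \<open>Virtual double categories\<close>

text \<open>A path determines its end, which allows matching the right sides of two layers of multicells whose
  horizontal boundaries agree.\<close>

lemma hpath_unique: "hpath Ob Ho d c a hs b ==> hpath Ob Ho d c a hs b' ==> b = b'"
  by (induction hs arbitrary: a) auto

lemma hpath_set: "hpath Ob Ho d c a hs b ==> set hs \<subseteq> Ho"
  by (induction hs arbitrary: a) auto

lemma hpath_append:
  "hpath Ob Ho d c a hs x ==> hpath Ob Ho d c x \<Delta>s b ==> hpath Ob Ho d c a (hs @ \<Delta>s) b"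
  by (induction hs arbitrary: a) auto

lemma hpath_start:
  "hpath Ob Ho d c a hs b ==> (\<And>h. h \<in> Ho ==> d h \<in> Ob) ==> a \<in> Ob"
  by (cases hs) auto

lemma cell_path_end_Nil [simp]: "cell_path_end A u [] = u"
  by (simp add: cell_path_end_def)

lemma cell_path_end_Cons [simp]: "cell_path_end A u (d # ds) = cell_path_end A (cright A d) ds"
  by (simp add: cell_path_end_def)

lemma cell_path_end_append: "cell_path_end A u (ds @ ys) = cell_path_end A (cell_path_end A u ds) ys"
  by (simp add: cell_path_end_def)

lemma cell_path_set: "cell_path A u ds ==> set ds \<subseteq> Cel A"
  by (induction ds arbitrary: u) auto

abbreviation corner :: "'v vdc => 'v => 'v" where "corner A d \<equiv> vdom A (cleft A d)"

text \<open>The typing axioms, and all axioms, of a virtual double category, without the normalisation of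
  its operations. This is the form in which a structure given by explicit formulas is handled before
  \<open>vdc_restrict\<close> is applied to it.\<close>

locale vdc_ops =
  fixes A :: "'v vdc"
  assumes vdom_vcod: "u \<in> Ver A ==> vdom A u \<in> Obj A \<and> vcod A u \<in> Obj A"
    and vide: "a \<in> Obj A ==> vide A a \<in> Ver A \<and> vdom A (vide A a) = a \<and> vcod A (vide A a) = a"
    and vcmp: "f \<in> Ver A ==> g \<in> Ver A ==> vcod A f = vdom A g
        ==> vcmp A g f \<in> Ver A \<and> vdom A (vcmp A g f) = vdom A f \<and> vcod A (vcmp A g f) = vcod A g"
    and hdom_hcod: "h \<in> Hor A ==> hdom A h \<in> Obj A \<and> hcod A h \<in> Obj A"
    and boundary: "d \<in> Cel A ==>
        cleft A d \<in> Ver A \<and> cright A d \<in> Ver A \<and> cbot A d \<in> Hor A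
        \<and> hpath (Obj A) (Hor A) (hdom A) (hcod A)
            (corner A d) (ctop A d) (vdom A (cright A d))
        \<and> vcod A (cleft A d) = hdom A (cbot A d) \<and> vcod A (cright A d) = hcod A (cbot A d)"
    and cide: "h \<in> Hor A ==> cide A h \<in> Cel A \<and> ctop A (cide A h) = [h] \<and> cbot A (cide A h) = h
        \<and> cleft A (cide A h) = vide A (hdom A h) \<and> cright A (cide A h) = vide A (hcod A h)"
    and ccmp: "composable A k u ds ==> ccmp A k u ds \<in> Cel A
        \<and> ctop A (ccmp A k u ds) = concat (map (ctop A) ds) \<and> cbot A (ccmp A k u ds) = cbot A k
        \<and> cleft A (ccmp A k u ds) = vcmp A (cleft A k) u
        \<and> cright A (ccmp A k u ds) = vcmp A (cright A k) (cell_path_end A u ds)"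
begin

abbreviation path :: "'v => 'v list => 'v => bool" where
  "path \<equiv> hpath (Obj A) (Hor A) (hdom A) (hcod A)"

lemma top_path: "d \<in> Cel A ==> path (corner A d) (ctop A d) (vdom A (cright A d))"
  using boundary by blast

lemma top_set: "d \<in> Cel A ==> set (ctop A d) \<subseteq> Hor A"
  using hpath_set[OF top_path] .

lemma cell_path_start: "cell_path A u ds ==> u \<in> Ver A"
  using boundary by (cases ds) auto

lemma cell_path_end_in: "cell_path A u ds ==> cell_path_end A u ds \<in> Ver A"
  by (induction ds arbitrary: u) auto

lemma cell_path_append:
  "cell_path A u (ds @ ys) \<longleftrightarrow> cell_path A u ds \<and> cell_path A (cell_path_end A u ds) ys"
  by (induction ds arbitrary: u) (auto dest: cell_path_start)

lemma path_tops: "cell_path A u ds ==> path (vdom A u) (concat (map (ctop A) ds)) (vdom A (cell_path_end A u ds))"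
proof (induction ds arbitrary: u)
  case (Cons d ds)
  then show ?case using boundary[of d] hpath_append by fastforce
qed (simp add: vdom_vcod)

lemma path_bots: "cell_path A u ds ==> path (vcod A u) (map (cbot A) ds) (vcod A (cell_path_end A u ds))"
proof (induction ds arbitrary: u)
  case (Cons d ds)
  then show ?case using boundary[of d] Cons.IH[of "cright A d"] by auto
qed (simp add: vdom_vcod)

lemma composable_end:
  assumes "composable A k u ds"
  shows "vcod A (cell_path_end A u ds) = vdom A (cright A k)"
proof -
  have "path (corner A k) (ctop A k) (vcod A (cell_path_end A u ds))"
    using path_bots[of u ds] assms by (simp add: composable_def)
  then show ?thesis using boundary[of k] assms hpath_unique by (fastforce simp: composable_def)
qed

lemma ccmp_blocks_typing:
  assumes "list_all2 (\<lambda>d ys. map (cbot A) ys = ctop A d) ds yss"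
    and "cell_path A u ds" "cell_path A w (concat yss)" "vcod A w = vdom A u"
  shows "cell_path A (vcmp A u w) (ccmp_blocks A w ds yss)
    \<and> cell_path_end A (vcmp A u w) (ccmp_blocks A w ds yss)
        = vcmp A (cell_path_end A u ds) (cell_path_end A w (concat yss))
    \<and> map (cbot A) (ccmp_blocks A w ds yss) = map (cbot A) ds
    \<and> concat (map (ctop A) (ccmp_blocks A w ds yss)) = concat (map (ctop A) (concat yss))"
  using assms
proof (induction arbitrary: u w rule: list_all2_induct)
  case Nil
  then show ?case using vcmp by simp
next
  case (Cons d ds ys yss)
  have c: "composable A d w ys" using Cons by (simp add: composable_def cell_path_append)
  then show ?case
    using Cons.IH[of "cright A d" "cell_path_end A w ys"] Cons.prems ccmp[OF c] composable_end[OF c]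
    by (simp add: cell_path_append cell_path_end_append)
qed

lemma composable_blocks:
  assumes "composable A k u ds" "cell_path A w (concat yss)" "vcod A w = vdom A u"
    "list_all2 (\<lambda>d ys. map (cbot A) ys = ctop A d) ds yss"
  shows "composable A k (vcmp A u w) (ccmp_blocks A w ds yss)"
    and "composable A (ccmp A k u ds) w (concat yss)"
proof -
  have u: "u \<in> Ver A" "w \<in> Ver A" using assms cell_path_start by (auto simp: composable_def)
  show "composable A k (vcmp A u w) (ccmp_blocks A w ds yss)"
    using ccmp_blocks_typing[OF assms(4) _ assms(2,3)] assms(1) vcmp[OF u(2,1) assms(3)] by (simp add: composable_def)
  have "map (cbot A) (concat yss) = concat (map (ctop A) ds)"
    using assms(4) by (induction rule: list_all2_induct) auto
  then show "composable A (ccmp A k u ds) w (concat yss)"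
    using ccmp[OF assms(1)] assms u boundary[of k] vcmp[of u "cleft A k"] by (simp add: composable_def)
qed

text \<open>For a structure whose multicells are functions with a boundary, this reduces associativity to a comparison of
  values.\<close>

lemma ccmp_assoc_boundary:
  assumes "composable A k u ds" "cell_path A w (concat yss)" "vcod A w = vdom A u"
    "list_all2 (\<lambda>d ys. map (cbot A) ys = ctop A d) ds yss"
    and assoc: "\<And>f g h. f \<in> Ver A ==> g \<in> Ver A ==> h \<in> Ver A ==> vcod A f = vdom A g
        ==> vcod A g = vdom A h ==> vcmp A (vcmp A h g) f = vcmp A h (vcmp A g f)"
  defines "l \<equiv> ccmp A (ccmp A k u ds) w (concat yss)"
    and "r \<equiv> ccmp A k (vcmp A u w) (ccmp_blocks A w ds yss)"
  shows "l \<in> Cel A" "r \<in> Cel A" "ctop A l = ctop A r" "cbot A l = cbot A r"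
    "cleft A l = cleft A r" "cright A l = cright A r"
proof -
  have u: "u \<in> Ver A" "w \<in> Ver A" and k: "k \<in> Cel A" "vcod A u = corner A k" and p: "cell_path A u ds"
    using assms cell_path_start by (auto simp: composable_def)
  note b = composable_blocks[OF assms(1-4)] and t = ccmp_blocks_typing[OF assms(4) p assms(2,3)]
  note e1 = cell_path_end_in[OF p] and e2 = cell_path_end_in[OF assms(2)]
  show "l \<in> Cel A" "r \<in> Cel A" "ctop A l = ctop A r" "cbot A l = cbot A r"
    using ccmp[OF b(1)] ccmp[OF b(2)] ccmp[OF assms(1)] t by (simp_all add: l_def r_def)
  show "cleft A l = cleft A r"
    using ccmp[OF b(1)] ccmp[OF b(2)] ccmp[OF assms(1)] assoc[OF u(2,1) _ assms(3) k(2)] boundary[OF k(1)]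
    by (simp add: l_def r_def)
  have "vcod A (cell_path_end A w (concat yss)) = vdom A (cell_path_end A u ds)"
  proof -
    have "map (cbot A) (concat yss) = concat (map (ctop A) ds)"
      using assms(4) by (induction rule: list_all2_induct) auto
    then show ?thesis using path_bots[OF assms(2)] path_tops[OF p] assms(3) hpath_unique by metis
  qed
  then show "cright A l = cright A r"
    using ccmp[OF b(1)] ccmp[OF b(2)] ccmp[OF assms(1)] t boundary[OF k(1)] composable_end[OF assms(1)]
      assoc[OF e2 e1, of "cright A k"]
    by (simp add: l_def r_def)
qed

lemma composable1: "k \<in> Cel A ==> d \<in> Cel A ==> ctop A k = [cbot A d] ==> composable A k (cleft A d) [d]"
  using boundary[of k] boundary[of d] by (simp add: composable_def)

lemma ccmp1_typing:
  assumes "k \<in> Cel A" "d \<in> Cel A" "ctop A k = [cbot A d]"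
  shows "ccmp1 A k d \<in> Cel A \<and> ctop A (ccmp1 A k d) = ctop A d \<and> cbot A (ccmp1 A k d) = cbot A k
    \<and> cleft A (ccmp1 A k d) = vcmp A (cleft A k) (cleft A d)
    \<and> cright A (ccmp1 A k d) = vcmp A (cright A k) (cright A d)"
  using ccmp[OF composable1[OF assms]] by simp

end

locale vdc_laws = vdc_ops A for A :: "'v vdc" +
  assumes vcmp_vide: "f \<in> Ver A
        ==> vcmp A f (vide A (vdom A f)) = f \<and> vcmp A (vide A (vcod A f)) f = f"
    and vcmp_assoc: "f \<in> Ver A ==> g \<in> Ver A ==> h \<in> Ver A ==> vcod A f = vdom A g
        ==> vcod A g = vdom A h ==> vcmp A (vcmp A h g) f = vcmp A h (vcmp A g f)"
    and ccmp_cide_left: "d \<in> Cel A ==> ccmp A (cide A (cbot A d)) (cleft A d) [d] = d"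
    and ccmp_cide_right: "d \<in> Cel A
        ==> ccmp A d (vide A (corner A d)) (map (cide A) (ctop A d)) = d"
    and ccmp_assoc: "composable A k u ds ==> cell_path A w (concat yss) ==> vcod A w = vdom A u
        ==> list_all2 (\<lambda>d ys. map (cbot A) ys = ctop A d) ds yss
        ==> ccmp A (ccmp A k u ds) w (concat yss) = ccmp A k (vcmp A u w) (ccmp_blocks A w ds yss)"
begin

text \<open>The special cases of associativity in which one layer consists of multicells with a single top
  horizontal morphism.\<close>

lemma ccmp_assoc1:
  assumes "k \<in> Cel A" "ctop A k = [cbot A d]" "composable A d w ys"
  shows "ccmp A (ccmp1 A k d) w ys = ccmp1 A k (ccmp A d w ys)"
proof -
  have c: "composable A k (cleft A d) [d]" using composable1 assms by (simp add: composable_def)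
  then show ?thesis using ccmp_assoc[OF c, of w "[ys]"] assms(3) ccmp[OF assms(3)] by (simp add: composable_def)
qed

lemma ccmp_assoc_unary:
  assumes "composable A k u ds" "list_all2 (\<lambda>d y. ctop A d = [cbot A y]) ds ys" "cell_path A w ys" "vcod A w = vdom A u"
  shows "ccmp A (ccmp A k u ds) w ys = ccmp A k (vcmp A u w) (map2 (ccmp1 A) ds ys)"
proof -
  let ?s = "map (\<lambda>y. [y]) ys"
  have e: "concat ?s = ys" by (induction ys) auto
  have "ccmp_blocks A w ds ?s = map2 (ccmp1 A) ds ys"
    using assms(2,3) by (induction arbitrary: w rule: list_all2_induct) auto
  moreover have "list_all2 (\<lambda>d ys. map (cbot A) ys = ctop A d) ds ?s"
    using assms(2) by (induction rule: list_all2_induct) auto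
  ultimately show ?thesis using ccmp_assoc[OF assms(1), of w ?s] e assms by simp
qed

lemma ccmp1_cide:
  assumes "d \<in> Cel A"
  shows "ccmp1 A (cide A (cbot A d)) d = d" "ctop A d = [h] ==> ccmp1 A d (cide A h) = d"
proof -
  show "ccmp1 A (cide A (cbot A d)) d = d" using ccmp_cide_left[OF assms] .
  assume "ctop A d = [h]"
  then show "ccmp1 A d (cide A h) = d"
    using ccmp_cide_right[OF assms] boundary[OF assms] cide[of h] by simp
qed

lemma ccmp1_assoc:
  assumes "k \<in> Cel A" "d \<in> Cel A" "y \<in> Cel A" "ctop A k = [cbot A d]" "ctop A d = [cbot A y]"
  shows "ccmp1 A (ccmp1 A k d) y = ccmp1 A k (ccmp1 A d y)"
  using ccmp_assoc1[OF assms(1,4) composable1[OF assms(2,3,5)]] .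

text \<open>The middle four interchange in the form in which it is used for horizontal composites of
  transformations: a naturality square in the middle of a composite of four may be replaced by its other half.\<close>

lemma vcmp_mid:
  assumes "a \<in> Ver A" "b \<in> Ver A" "c \<in> Ver A" "d \<in> Ver A" "e \<in> Ver A" "f \<in> Ver A"
    "vcod A b = vdom A a" "vcod A c = vdom A b" "vcod A d = vdom A c" "vcod A e = vdom A a" "vcod A f = vdom A e"
    "vcod A d = vdom A f" "vcmp A b c = vcmp A e f"
  shows "vcmp A (vcmp A a b) (vcmp A c d) = vcmp A (vcmp A a e) (vcmp A f d)"
  using vcmp_assoc[of "vcmp A c d" b a] vcmp_assoc[of "vcmp A f d" e a] vcmp_assoc[of d c b] vcmp_assoc[of d f e]
    vcmp[of d c] vcmp[of d f] assms by simp

lemma ccmp1_mid: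
  assumes "a \<in> Cel A" "b \<in> Cel A" "c \<in> Cel A" "d \<in> Cel A" "e \<in> Cel A" "f \<in> Cel A"
    "ctop A a = [cbot A b]" "ctop A b = [cbot A c]" "ctop A c = [cbot A d]" "ctop A a = [cbot A e]" "ctop A e = [cbot A f]"
    "ctop A f = [cbot A d]" "ccmp1 A b c = ccmp1 A e f"
  shows "ccmp1 A (ccmp1 A a b) (ccmp1 A c d) = ccmp1 A (ccmp1 A a e) (ccmp1 A f d)"
  using ccmp1_assoc[of a b "ccmp1 A c d"] ccmp1_assoc[of a e "ccmp1 A f d"] ccmp1_assoc[of b c d] ccmp1_assoc[of e f d]
    ccmp1_typing[of c d] ccmp1_typing[of f d] assms by metis

end

lemma vdc_laws: "virtual_double_category A ==> vdc_laws A"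
  unfolding virtual_double_category_def vdc_laws_def vdc_ops_def vdc_laws_axioms_def
  by (elim conjE, intro conjI; assumption)

lemma virtual_double_categoryI: "vdc_laws A ==> vdc_restrict A = A ==> virtual_double_category A"
  unfolding virtual_double_category_def vdc_laws_def vdc_ops_def vdc_laws_axioms_def
  by (elim conjE, intro conjI; assumption)

subsection \<open>Normalisation of operations\<close>

lemma vdc_restrict_simps [simp]:
  "Obj (vdc_restrict A) = Obj A" "Ver (vdc_restrict A) = Ver A" "Hor (vdc_restrict A) = Hor A" "Cel (vdc_restrict A) = Cel A"
  "u \<in> Ver A ==> vdom (vdc_restrict A) u = vdom A u" "u \<in> Ver A ==> vcod (vdc_restrict A) u = vcod A u"
  "a \<in> Obj A ==> vide (vdc_restrict A) a = vide A a"
  "f \<in> Ver A ==> g \<in> Ver A ==> vcod A f = vdom A g ==> vcmp (vdc_restrict A) g f = vcmp A g f"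
  "h \<in> Hor A ==> hdom (vdc_restrict A) h = hdom A h" "h \<in> Hor A ==> hcod (vdc_restrict A) h = hcod A h"
  "d \<in> Cel A ==> ctop (vdc_restrict A) d = ctop A d" "d \<in> Cel A ==> cbot (vdc_restrict A) d = cbot A d"
  "d \<in> Cel A ==> cleft (vdc_restrict A) d = cleft A d" "d \<in> Cel A ==> cright (vdc_restrict A) d = cright A d"
  "h \<in> Hor A ==> cide (vdc_restrict A) h = cide A h"
  "composable A k u ds ==> ccmp (vdc_restrict A) k u ds = ccmp A k u ds"
  by (simp_all add: vdc_restrict_def)

lemma hpath_cong:
  "(\<And>h. h \<in> Ho ==> d h = d' h \<and> c h = c' h) ==> hpath Ob Ho d c a hs b = hpath Ob Ho d' c' a hs b"
  by (induction hs arbitrary: a) auto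

lemma cell_path_restrict [simp]: "cell_path (vdc_restrict A) u ds = cell_path A u ds"
  by (induction ds arbitrary: u) (simp_all cong: conj_cong)

lemma cell_path_end_restrict: "cell_path A u ds ==> cell_path_end (vdc_restrict A) u ds = cell_path_end A u ds"
  by (induction ds arbitrary: u) auto

lemma map_restrict:
  "set ds \<subseteq> Cel A ==> map (ctop (vdc_restrict A)) ds = map (ctop A) ds"
  "set ds \<subseteq> Cel A ==> map (cbot (vdc_restrict A)) ds = map (cbot A) ds"
  "set hs \<subseteq> Hor A ==> map (cide (vdc_restrict A)) hs = map (cide A) hs"
  by auto

context vdc_ops
begin

lemma composable_restrict [simp]: "composable (vdc_restrict A) k u ds = composable A k u ds"
proof -
  have "composable (vdc_restrict A) k u ds = composable A k u ds" if k: "k \<in> Cel A" "cell_path A u ds"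
    unfolding composable_def map_restrict(2)[OF cell_path_set[OF k(2)]]
    using k cell_path_start[OF k(2)] boundary[OF k(1)] by simp
  then show ?thesis by (auto simp: composable_def)
qed

lemma restrict_restrict: "vdc_restrict (vdc_restrict A) = vdc_restrict A"
proof -
  have "(if composable (vdc_restrict A) k u ds then ccmp (vdc_restrict A) k u ds else undefined) = ccmp (vdc_restrict A) k u ds"
    for k u ds by (simp, simp add: vdc_restrict_def)
  then show ?thesis
    by (subst (1) vdc_restrict_def) (intro vdc.equality ext; auto simp: vdc_restrict_def)
qed

lemma ccmp_blocks_restrict:
  assumes "list_all2 (\<lambda>d ys. map (cbot A) ys = ctop A d) ds yss"
    "cell_path A u ds" "cell_path A w (concat yss)" "vcod A w = vdom A u"
  shows "ccmp_blocks (vdc_restrict A) w ds yss = ccmp_blocks A w ds yss"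
  using assms
proof (induction arbitrary: u w rule: list_all2_induct)
  case (Cons d ds ys yss)
  have c: "composable A d w ys" using Cons by (simp add: composable_def cell_path_append)
  then show ?case
    using Cons.IH[of "cright A d" "cell_path_end A w ys"] Cons.prems composable_end[OF c] cell_path_end_restrict[of A w ys]
    by (simp add: cell_path_append cell_path_end_append)
qed simp

end

context vdc_laws
begin

text \<open>The axioms only evaluate operations on their domains, where normalisation changes nothing.\<close>

lemma virtual_double_category_restrict: "virtual_double_category (vdc_restrict A)"
proof (rule virtual_double_categoryI[OF _ restrict_restrict], unfold_locales)
  fix d assume d: "d \<in> Cel (vdc_restrict A)"
  note b = boundary[of d]
  have "hpath (Obj A) (Hor A) (hdom (vdc_restrict A)) (hcod (vdc_restrict A)) = path"
    by (intro ext hpath_cong) simp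
  with d b show "cleft (vdc_restrict A) d \<in> Ver (vdc_restrict A) \<and> cright (vdc_restrict A) d \<in> Ver (vdc_restrict A) \<and>
         cbot (vdc_restrict A) d \<in> Hor (vdc_restrict A) \<and>
         hpath (Obj (vdc_restrict A)) (Hor (vdc_restrict A)) (hdom (vdc_restrict A)) (hcod (vdc_restrict A))
          (corner (vdc_restrict A) d) (ctop (vdc_restrict A) d)
          (vdom (vdc_restrict A) (cright (vdc_restrict A) d)) \<and>
         vcod (vdc_restrict A) (cleft (vdc_restrict A) d) = hdom (vdc_restrict A) (cbot (vdc_restrict A) d) \<and>
         vcod (vdc_restrict A) (cright (vdc_restrict A) d) = hcod (vdc_restrict A) (cbot (vdc_restrict A) d)"
    by simp
  show "ccmp (vdc_restrict A) (cide (vdc_restrict A) (cbot (vdc_restrict A) d)) (cleft (vdc_restrict A) d) [d] = d"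
    using d b cide[of "cbot A d"] composable1[of "cide A (cbot A d)" d] ccmp_cide_left[of d] by simp
  have "cell_path A (vide A (corner A d)) (map (cide A) (ctop A d))"
  proof -
    have "cell_path A (vide A a) (map (cide A) hs)" if "path a hs b'" for a hs b'
      using that by (induction hs arbitrary: a) (auto simp: cide vide)
    from this[OF top_path] show ?thesis using d by simp
  qed
  moreover have "map (cbot A) (map (cide A) (ctop A d)) = ctop A d"
    using d top_set[of d] cide by (fastforce intro: map_idI)
  ultimately have "composable A d (vide A (corner A d)) (map (cide A) (ctop A d))"
    using d b vide[of "corner A d"] vdom_vcod by (simp add: composable_def)
  then show "ccmp (vdc_restrict A) d (vide (vdc_restrict A) (corner (vdc_restrict A) d))
        (map (cide (vdc_restrict A)) (ctop (vdc_restrict A) d)) = d"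
    using d b ccmp_cide_right[of d] vdom_vcod map_restrict(3)[of "ctop A d" A] top_set[of d] by (simp cong: map_cong)
next
  fix k u ds assume c: "composable (vdc_restrict A) k u ds"
  then have c': "composable A k u ds" by simp
  then have p: "cell_path A u ds" "k \<in> Cel A" "vcod A u = corner A k" by (auto simp: composable_def)
  show "ccmp (vdc_restrict A) k u ds \<in> Cel (vdc_restrict A) \<and>
       ctop (vdc_restrict A) (ccmp (vdc_restrict A) k u ds) = concat (map (ctop (vdc_restrict A)) ds) \<and>
       cbot (vdc_restrict A) (ccmp (vdc_restrict A) k u ds) = cbot (vdc_restrict A) k \<and>
       cleft (vdc_restrict A) (ccmp (vdc_restrict A) k u ds) = vcmp (vdc_restrict A) (cleft (vdc_restrict A) k) u \<and>
       cright (vdc_restrict A) (ccmp (vdc_restrict A) k u ds) =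
       vcmp (vdc_restrict A) (cright (vdc_restrict A) k) (cell_path_end (vdc_restrict A) u ds)"
    using c' ccmp[OF c'] p map_restrict(1)[OF cell_path_set[OF p(1)]] cell_path_end_restrict[OF p(1)]
      cell_path_start[OF p(1)] cell_path_end_in[OF p(1)] composable_end[OF c'] boundary[OF p(2)] by (simp cong: map_cong)
  fix w yss
  assume w: "cell_path (vdc_restrict A) w (concat yss)" "vcod (vdc_restrict A) w = vdom (vdc_restrict A) u"
    "list_all2 (\<lambda>d ys. map (cbot (vdc_restrict A)) ys = ctop (vdc_restrict A) d) ds yss"
  have w1: "cell_path A w (concat yss)" using w by simp
  have u: "w \<in> Ver A" "u \<in> Ver A" using w1 p cell_path_start by auto
  have w2: "vcod A w = vdom A u" using w u by simp
  have "list_all2 (\<lambda>d ys. map (cbot A) ys = ctop A d) ds yss"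
    unfolding list_all2_conv_all_nth
  proof (intro conjI allI impI)
    show l: "length ds = length yss" using w(3) by (rule list_all2_lengthD)
    fix k assume k: "k < length ds"
    have "ds ! k \<in> Cel A" using cell_path_set[OF p(1)] k by auto
    moreover have "yss ! k \<in> set yss" using k l by simp
    then have "set (yss ! k) \<subseteq> Cel A" using cell_path_set[OF w1] by auto
    ultimately show "map (cbot A) (yss ! k) = ctop A (ds ! k)"
      using list_all2_nthD[OF w(3) k] map_restrict(2)[of "yss ! k" A] by simp
  qed
  note w3 = this
  show "ccmp (vdc_restrict A) (ccmp (vdc_restrict A) k u ds) w (concat yss)
      = ccmp (vdc_restrict A) k (vcmp (vdc_restrict A) u w) (ccmp_blocks (vdc_restrict A) w ds yss)"
    using c' composable_blocks[OF c' w1 w2 w3] ccmp_assoc[OF c' w1 w2 w3] ccmp_blocks_restrict[OF w3 p(1) w1 w2] u w2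
    by simp
qed (use vdom_vcod vide vcmp hdom_hcod cide vcmp_vide vcmp_assoc in simp_all)

end

subsection \<open>Virtual double functors\<close>

text \<open>The functor axioms without the normalisation outside the domain.\<close>

definition vdfun_laws :: "'v vdfun => bool" where
  "vdfun_laws F \<longleftrightarrow> (let A = fdom F; B = fcod F in
     (\<forall>a\<in>Obj A. fobj F a \<in> Obj B \<and> fver F (vide A a) = vide B (fobj F a)) \<and>
     (\<forall>u\<in>Ver A. fver F u \<in> Ver B \<and> vdom B (fver F u) = fobj F (vdom A u)
        \<and> vcod B (fver F u) = fobj F (vcod A u)) \<and>
     (\<forall>f\<in>Ver A. \<forall>g\<in>Ver A. vcod A f = vdom A g
        \<longrightarrow> fver F (vcmp A g f) = vcmp B (fver F g) (fver F f)) \<and>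
     (\<forall>h\<in>Hor A. fhor F h \<in> Hor B \<and> hdom B (fhor F h) = fobj F (hdom A h)
        \<and> hcod B (fhor F h) = fobj F (hcod A h) \<and> fcel F (cide A h) = cide B (fhor F h)) \<and>
     (\<forall>d\<in>Cel A. fcel F d \<in> Cel B \<and> ctop B (fcel F d) = map (fhor F) (ctop A d)
        \<and> cbot B (fcel F d) = fhor F (cbot A d)
        \<and> cleft B (fcel F d) = fver F (cleft A d) \<and> cright B (fcel F d) = fver F (cright A d)) \<and>
     (\<forall>k u ds. composable A k u ds
        \<longrightarrow> fcel F (ccmp A k u ds) = ccmp B (fcel F k) (fver F u) (map (fcel F) ds)))"

lemma virtual_double_functor_iff:
  "virtual_double_functor F \<longleftrightarrow> virtual_double_category (fdom F) \<and> virtual_double_category (fcod F)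
    \<and> vdfun_restrict F = F \<and> vdfun_laws F"
  unfolding virtual_double_functor_def vdfun_laws_def Let_def by blast

lemma vdfun_restrict_simps [simp]:
  "fdom (vdfun_restrict F) = fdom F" "fcod (vdfun_restrict F) = fcod F"
  "a \<in> Obj (fdom F) ==> fobj (vdfun_restrict F) a = fobj F a"
  "u \<in> Ver (fdom F) ==> fver (vdfun_restrict F) u = fver F u"
  "h \<in> Hor (fdom F) ==> fhor (vdfun_restrict F) h = fhor F h"
  "d \<in> Cel (fdom F) ==> fcel (vdfun_restrict F) d = fcel F d"
  "vdfun_restrict (vdfun_restrict F) = vdfun_restrict F"
  by (simp_all add: vdfun_restrict_def)

lemma virtual_double_functor_restrict:
  assumes A: "virtual_double_category (fdom F)" and B: "virtual_double_category (fcod F)" and F: "vdfun_laws F"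
  shows "virtual_double_functor (vdfun_restrict F)"
proof -
  interpret A: vdc_laws "fdom F" by (rule vdc_laws[OF A])
  have m: "map (fhor (vdfun_restrict F)) (ctop (fdom F) d) = map (fhor F) (ctop (fdom F) d)" if "d \<in> Cel (fdom F)" for d
    using A.top_set[OF that] by auto
  have m': "map (fcel (vdfun_restrict F)) ds = map (fcel F) ds" if "composable (fdom F) k u ds" for k u ds
    using that cell_path_set[of "fdom F" u ds] by (auto simp: composable_def)
  have "vdfun_laws (vdfun_restrict F)"
    unfolding vdfun_laws_def Let_def
  proof (intro conjI ballI allI impI)
    fix k u ds assume c: "composable (fdom (vdfun_restrict F)) k u ds"
    then have c: "composable (fdom F) k u ds" by simp
    have "k \<in> Cel (fdom F)" "u \<in> Ver (fdom F)" using c A.cell_path_start by (auto simp: composable_def)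
    then show "fcel (vdfun_restrict F) (ccmp (fdom (vdfun_restrict F)) k u ds) =
       ccmp (fcod (vdfun_restrict F)) (fcel (vdfun_restrict F) k) (fver (vdfun_restrict F) u)
        (map (fcel (vdfun_restrict F)) ds)"
      using F c A.ccmp[OF c] m'[OF c] by (simp add: vdfun_laws_def Let_def cong: map_cong)
  qed (use F m A.vide A.vdom_vcod A.vcmp A.hdom_hcod A.boundary A.cide in \<open>simp_all add: vdfun_laws_def Let_def\<close>)
  then show ?thesis using A B by (simp add: virtual_double_functor_iff)
qed

lemma vdfun_eqI:
  assumes "virtual_double_functor F" "virtual_double_functor G" "fdom F = fdom G" "fcod F = fcod G"
    "\<And>a. a \<in> Obj (fdom G) ==> fobj F a = fobj G a" "\<And>u. u \<in> Ver (fdom G) ==> fver F u = fver G u"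
    "\<And>h. h \<in> Hor (fdom G) ==> fhor F h = fhor G h" "\<And>d. d \<in> Cel (fdom G) ==> fcel F d = fcel G d"
  shows "F = G"
proof -
  have "vdfun_restrict F = vdfun_restrict G"
    using assms(3-8) by (intro vdfun.equality) (auto simp: vdfun_restrict_def restrict_def)
  then show ?thesis using assms(1,2) by (simp add: virtual_double_functor_iff)
qed

locale vd_functor =
  fixes F :: "'v vdfun" and A B :: "'v vdc"
  assumes is_functor: "virtual_double_functor F" and fdom [simp]: "fdom F = A" and fcod [simp]: "fcod F = B"
begin

lemma A: "virtual_double_category A" and B: "virtual_double_category B"
  using is_functor by (auto simp: virtual_double_functor_iff)

sublocale A: vdc_laws A by (rule vdc_laws[OF A])
sublocale B: vdc_laws B by (rule vdc_laws[OF B])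

lemma laws: "vdfun_laws F" using is_functor by (simp add: virtual_double_functor_iff)

lemma obj: "a \<in> Obj A ==> fobj F a \<in> Obj B"
  and vid: "a \<in> Obj A ==> fver F (vide A a) = vide B (fobj F a)"
  and ver: "u \<in> Ver A ==> fver F u \<in> Ver B \<and> vdom B (fver F u) = fobj F (vdom A u) \<and> vcod B (fver F u) = fobj F (vcod A u)"
  and vcmp: "f \<in> Ver A ==> g \<in> Ver A ==> vcod A f = vdom A g ==> fver F (vcmp A g f) = vcmp B (fver F g) (fver F f)"
  and hor: "h \<in> Hor A ==> fhor F h \<in> Hor B \<and> hdom B (fhor F h) = fobj F (hdom A h) \<and> hcod B (fhor F h) = fobj F (hcod A h)"
  and cid: "h \<in> Hor A ==> fcel F (cide A h) = cide B (fhor F h)"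
  and cel: "d \<in> Cel A ==> fcel F d \<in> Cel B \<and> ctop B (fcel F d) = map (fhor F) (ctop A d)
        \<and> cbot B (fcel F d) = fhor F (cbot A d)
        \<and> cleft B (fcel F d) = fver F (cleft A d) \<and> cright B (fcel F d) = fver F (cright A d)"
  and ccmp: "composable A k u ds ==> fcel F (ccmp A k u ds) = ccmp B (fcel F k) (fver F u) (map (fcel F) ds)"
  using laws by (simp_all add: vdfun_laws_def Let_def)

lemma cell_path: "cell_path A u ds ==> cell_path B (fver F u) (map (fcel F) ds)
    \<and> cell_path_end B (fver F u) (map (fcel F) ds) = fver F (cell_path_end A u ds)"
proof (induction ds arbitrary: u)
  case (Cons d ds)
  then show ?case using cel[of d] by auto
qed (simp add: ver)

lemma composable:
  assumes c: "composable A k u ds"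
  shows "composable B (fcel F k) (fver F u) (map (fcel F) ds)"
proof -
  have *: "k \<in> Cel A" "cell_path A u ds" "vcod A u = corner A k" "map (cbot A) ds = ctop A k" "u \<in> Ver A"
    using c A.cell_path_start by (auto simp: composable_def)
  have "map (cbot B) (map (fcel F) ds) = map (fhor F) (map (cbot A) ds)"
    using cel cell_path_set[OF *(2)] by auto
  then show ?thesis
    using * cel[OF *(1)] cell_path[OF *(2)] ver A.boundary[OF *(1)] by (simp add: composable_def)
qed

lemma hpath: "hpath (Obj A) (Hor A) (hdom A) (hcod A) a hs b
    ==> hpath (Obj B) (Hor B) (hdom B) (hcod B) (fobj F a) (map (fhor F) hs) (fobj F b)"
  by (induction hs arbitrary: a) (auto simp: obj hor)

end

lemma vdfun_id_functor:
  assumes A: "virtual_double_category A"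
  shows "vd_functor (vdfun_id A) A A"
proof
  show "virtual_double_functor (vdfun_id A)"
    unfolding vdfun_id_def
    by (rule virtual_double_functor_restrict) (use A vdc_laws[OF A] in \<open>simp_all add: vdfun_laws_def vdc_laws_def vdc_ops_def\<close>)
qed (simp_all add: vdfun_id_def)

lemma vdfun_comp_functor:
  assumes "vd_functor F A B" "vd_functor G B C"
  shows "vd_functor (vdfun_comp G F) A C"
proof
  interpret F: vd_functor F A B by fact
  interpret G: vd_functor G B C by fact
  show "virtual_double_functor (vdfun_comp G F)"
    unfolding vdfun_comp_def
  proof (rule virtual_double_functor_restrict)
    show "vdfun_laws \<lparr>fdom = fdom F, fcod = fcod G, fobj = fobj G \<circ> fobj F,
     fver = fver G \<circ> fver F, fhor = fhor G \<circ> fhor F, fcel = fcel G \<circ> fcel F\<rparr>"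
      unfolding vdfun_laws_def Let_def
    proof (intro conjI ballI allI impI, goal_cases)
      case 16
      then show ?case using F.ccmp G.ccmp[OF F.composable] by simp
    qed (use F.obj G.obj F.vid G.vid F.ver G.ver F.vcmp G.vcmp F.hor G.hor F.cid G.cid F.cel G.cel in simp_all)
  qed (simp_all add: F.A G.B)
qed (simp_all add: vdfun_comp_def assms[unfolded vd_functor_def])

lemma vdfun_id_simps [simp]:
  "fdom (vdfun_id A) = A" "fcod (vdfun_id A) = A"
  "a \<in> Obj A ==> fobj (vdfun_id A) a = a" "u \<in> Ver A ==> fver (vdfun_id A) u = u"
  "h \<in> Hor A ==> fhor (vdfun_id A) h = h" "d \<in> Cel A ==> fcel (vdfun_id A) d = d"
  by (simp_all add: vdfun_id_def)

lemma vdfun_comp_simps [simp]: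
  "fdom (vdfun_comp G F) = fdom F" "fcod (vdfun_comp G F) = fcod G"
  "a \<in> Obj (fdom F) ==> fobj (vdfun_comp G F) a = fobj G (fobj F a)"
  "u \<in> Ver (fdom F) ==> fver (vdfun_comp G F) u = fver G (fver F u)"
  "h \<in> Hor (fdom F) ==> fhor (vdfun_comp G F) h = fhor G (fhor F h)"
  "d \<in> Cel (fdom F) ==> fcel (vdfun_comp G F) d = fcel G (fcel F d)"
  by (simp_all add: vdfun_comp_def)

subsection \<open>Vertical transformations\<close>

definition vdtrans_laws :: "'v vdtrans => bool" where
  "vdtrans_laws \<mu> \<longleftrightarrow>
    (let F = tsrc \<mu>; G = ttgt \<mu>; A = fdom F; B = fcod F in
     (\<forall>a\<in>Obj A. tobj \<mu> a \<in> Ver B \<and> vdom B (tobj \<mu> a) = fobj F a \<and> vcod B (tobj \<mu> a) = fobj G a) \<and>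
     (\<forall>u\<in>Ver A. vcmp B (tobj \<mu> (vcod A u)) (fver F u) = vcmp B (fver G u) (tobj \<mu> (vdom A u))) \<and>
     (\<forall>h\<in>Hor A. thor \<mu> h \<in> Cel B \<and> ctop B (thor \<mu> h) = [fhor F h] \<and> cbot B (thor \<mu> h) = fhor G h
        \<and> cleft B (thor \<mu> h) = tobj \<mu> (hdom A h) \<and> cright B (thor \<mu> h) = tobj \<mu> (hcod A h)) \<and>
     (\<forall>d\<in>Cel A. ccmp1 B (thor \<mu> (cbot A d)) (fcel F d)
        = ccmp B (fcel G d) (tobj \<mu> (corner A d)) (map (thor \<mu>) (ctop A d))))"

lemma vertical_transformation_iff:
  "vertical_transformation \<mu> \<longleftrightarrow> virtual_double_functor (tsrc \<mu>) \<and> virtual_double_functor (ttgt \<mu>)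
    \<and> fdom (ttgt \<mu>) = fdom (tsrc \<mu>) \<and> fcod (ttgt \<mu>) = fcod (tsrc \<mu>) \<and> vdtrans_restrict \<mu> = \<mu> \<and> vdtrans_laws \<mu>"
  unfolding vertical_transformation_def vdtrans_laws_def Let_def by blast

lemma vdtrans_restrict_simps [simp]:
  "tsrc (vdtrans_restrict \<mu>) = tsrc \<mu>" "ttgt (vdtrans_restrict \<mu>) = ttgt \<mu>"
  "a \<in> Obj (fdom (tsrc \<mu>)) ==> tobj (vdtrans_restrict \<mu>) a = tobj \<mu> a"
  "h \<in> Hor (fdom (tsrc \<mu>)) ==> thor (vdtrans_restrict \<mu>) h = thor \<mu> h"
  "vdtrans_restrict (vdtrans_restrict \<mu>) = vdtrans_restrict \<mu>"
  by (simp_all add: vdtrans_restrict_def)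

locale vd_trans =
  fixes \<mu> :: "'v vdtrans" and F G :: "'v vdfun" and A B :: "'v vdc"
  assumes trans: "vertical_transformation \<mu>" and tsrc [simp]: "tsrc \<mu> = F" and ttgt [simp]: "ttgt \<mu> = G"
    and fdom_src: "fdom F = A" and fcod_src: "fcod F = B"
begin

lemma F: "vd_functor F A B" and G: "vd_functor G A B"
  using trans fdom_src fcod_src by (auto simp: vertical_transformation_iff vd_functor_def)

sublocale F: vd_functor F A B by (rule F)
sublocale G: vd_functor G A B by (rule G)

lemma laws: "vdtrans_laws \<mu>" using trans by (simp add: vertical_transformation_iff)

lemma obj: "a \<in> Obj A ==> tobj \<mu> a \<in> Ver B \<and> vdom B (tobj \<mu> a) = fobj F a \<and> vcod B (tobj \<mu> a) = fobj G a"
  and ver: "u \<in> Ver A ==> vcmp B (tobj \<mu> (vcod A u)) (fver F u) = vcmp B (fver G u) (tobj \<mu> (vdom A u))"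
  and hor: "h \<in> Hor A ==> thor \<mu> h \<in> Cel B \<and> ctop B (thor \<mu> h) = [fhor F h] \<and> cbot B (thor \<mu> h) = fhor G h
        \<and> cleft B (thor \<mu> h) = tobj \<mu> (hdom A h) \<and> cright B (thor \<mu> h) = tobj \<mu> (hcod A h)"
  and cel: "d \<in> Cel A ==> ccmp1 B (thor \<mu> (cbot A d)) (fcel F d)
        = ccmp B (fcel G d) (tobj \<mu> (corner A d)) (map (thor \<mu>) (ctop A d))"
  using laws by (simp_all add: vdtrans_laws_def Let_def)

lemma cell_path: "hpath (Obj A) (Hor A) (hdom A) (hcod A) a hs b
    ==> cell_path B (tobj \<mu> a) (map (thor \<mu>) hs) \<and> cell_path_end B (tobj \<mu> a) (map (thor \<mu>) hs) = tobj \<mu> b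
      \<and> map (cbot B) (map (thor \<mu>) hs) = map (fhor G) hs"
  by (induction hs arbitrary: a) (auto simp: hor obj)

lemma composable: "d \<in> Cel A ==> composable B (fcel G d) (tobj \<mu> (corner A d)) (map (thor \<mu>) (ctop A d))"
  using F.A.boundary[of d] cell_path[OF F.A.top_path, of d] G.cel[of d] G.ver obj F.A.vdom_vcod
  by (simp add: composable_def)

lemma composable1: "d \<in> Cel A ==> ctop B (thor \<mu> (cbot A d)) = [cbot B (fcel F d)]"
  using hor[of "cbot A d"] F.A.boundary[of d] F.cel[of d] by simp

end

lemma vd_trans_restrictI:
  assumes F: "vd_functor F A B" and G: "vd_functor G A B" and \<mu>: "vdtrans_laws \<mu>" "tsrc \<mu> = F" "ttgt \<mu> = G"
  shows "vd_trans (vdtrans_restrict \<mu>) F G A B"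
proof
  interpret F: vd_functor F A B by fact
  interpret G: vd_functor G A B by fact
  have *: "tobj (vdtrans_restrict \<mu>) a = tobj \<mu> a" if "a \<in> Obj A" for a using that \<mu> by simp
  have **: "thor (vdtrans_restrict \<mu>) a = thor \<mu> a" if "a \<in> Hor A" for a using that \<mu> by simp
  have m: "map (thor (vdtrans_restrict \<mu>)) (ctop A d) = map (thor \<mu>) (ctop A d)" if "d \<in> Cel A" for d
    using ** F.A.top_set[OF that] by auto
  have "vdtrans_laws (vdtrans_restrict \<mu>)"
    using \<mu> * ** m F.A.vdom_vcod F.A.hdom_hcod F.A.boundary by (simp add: vdtrans_laws_def Let_def cong: map_cong)
  then show "vertical_transformation (vdtrans_restrict \<mu>)"
    using \<mu> F.is_functor G.is_functor by (simp add: vertical_transformation_iff)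
qed (use assms in \<open>simp_all add: vd_functor_def\<close>)

lemma vdtrans_eqI:
  assumes "vertical_transformation \<mu>" "vertical_transformation \<nu>" "tsrc \<mu> = tsrc \<nu>" "ttgt \<mu> = ttgt \<nu>"
    "\<And>a. a \<in> Obj (fdom (tsrc \<nu>)) ==> tobj \<mu> a = tobj \<nu> a"
    "\<And>h. h \<in> Hor (fdom (tsrc \<nu>)) ==> thor \<mu> h = thor \<nu> h"
  shows "\<mu> = \<nu>"
proof -
  have "vdtrans_restrict \<mu> = vdtrans_restrict \<nu>"
    using assms(3-6) by (intro vdtrans.equality) (auto simp: vdtrans_restrict_def restrict_def)
  then show ?thesis using assms(1,2) by (simp add: vertical_transformation_iff)
qed

lemma vdtrans_id_simps [simp]:
  "tsrc (vdtrans_id F) = F" "ttgt (vdtrans_id F) = F"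
  "a \<in> Obj (fdom F) ==> tobj (vdtrans_id F) a = vide (fcod F) (fobj F a)"
  "h \<in> Hor (fdom F) ==> thor (vdtrans_id F) h = cide (fcod F) (fhor F h)"
  by (simp_all add: vdtrans_id_def)

lemma vdtrans_vcomp_simps [simp]:
  "tsrc (vdtrans_vcomp \<nu> \<mu>) = tsrc \<mu>" "ttgt (vdtrans_vcomp \<nu> \<mu>) = ttgt \<nu>"
  "a \<in> Obj (fdom (tsrc \<mu>)) ==> tobj (vdtrans_vcomp \<nu> \<mu>) a = vcmp (fcod (tsrc \<mu>)) (tobj \<nu> a) (tobj \<mu> a)"
  "h \<in> Hor (fdom (tsrc \<mu>)) ==> thor (vdtrans_vcomp \<nu> \<mu>) h = ccmp1 (fcod (tsrc \<mu>)) (thor \<nu> h) (thor \<mu> h)"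
  by (simp_all add: vdtrans_vcomp_def)

lemma vdtrans_hcomp_simps [simp]:
  "tsrc (vdtrans_hcomp \<nu> \<mu>) = vdfun_comp (tsrc \<nu>) (tsrc \<mu>)" "ttgt (vdtrans_hcomp \<nu> \<mu>) = vdfun_comp (ttgt \<nu>) (ttgt \<mu>)"
  "a \<in> Obj (fdom (tsrc \<mu>)) ==> tobj (vdtrans_hcomp \<nu> \<mu>) a
    = vcmp (fcod (tsrc \<nu>)) (tobj \<nu> (fobj (ttgt \<mu>) a)) (fver (tsrc \<nu>) (tobj \<mu> a))"
  "h \<in> Hor (fdom (tsrc \<mu>)) ==> thor (vdtrans_hcomp \<nu> \<mu>) h
    = ccmp1 (fcod (tsrc \<nu>)) (thor \<nu> (fhor (ttgt \<mu>) h)) (fcel (tsrc \<nu>) (thor \<mu> h))"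
  by (simp_all add: vdtrans_hcomp_def)

lemma vdtrans_id_trans:
  assumes "vd_functor F A B"
  shows "vd_trans (vdtrans_id F) F F A B"
proof -
  interpret F: vd_functor F A B by fact
  have "ccmp1 B (cide B (fhor F (cbot A d))) (fcel F d)
      = ccmp B (fcel F d) (vide B (fobj F (corner A d))) (map (\<lambda>h. cide B (fhor F h)) (ctop A d))" if "d \<in> Cel A" for d
  proof -
    have "map (\<lambda>h. cide B (fhor F h)) (ctop A d) = map (cide B) (ctop B (fcel F d))" using F.cel[OF that] by (simp add: comp_def)
    moreover have "corner B (fcel F d) = fobj F (corner A d)"
      using F.cel[OF that] F.ver F.A.boundary[OF that] by simp
    ultimately show ?thesis using F.cel[OF that] F.B.ccmp_cide_left[of "fcel F d"] F.B.ccmp_cide_right[of "fcel F d"] by (simp add: comp_def)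
  qed
  then show ?thesis
    unfolding vdtrans_id_def
    using F.obj F.hor F.B.vide F.B.cide F.ver F.B.vcmp_vide
    by (intro vd_trans_restrictI[OF assms assms]) (simp_all add: vdtrans_laws_def, metis)
qed

text \<open>The cell axiom: \<open>(\<nu> \<circ> \<mu>) \<circ> F d = \<nu> \<circ> (G d \<circ> \<mu>s) = (H d \<circ> \<nu>s) \<circ> \<mu>s\<close>, and associativity merges the two layers
  of unary cells.\<close>

lemma vdtrans_vcomp_trans:
  assumes "vd_trans \<mu> F G A B" "vd_trans \<nu> G H A B"
  shows "vd_trans (vdtrans_vcomp \<nu> \<mu>) F H A B"
proof -
  interpret a: vd_trans \<mu> F G A B by fact
  interpret b: vd_trans \<nu> G H A B by fact
  have cell: "ccmp1 B (ccmp1 B (thor \<nu> (cbot A d)) (thor \<mu> (cbot A d))) (fcel F d)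
    = ccmp B (fcel H d) (vcmp B (tobj \<nu> (corner A d)) (tobj \<mu> (corner A d)))
        (map (\<lambda>h. ccmp1 B (thor \<nu> h) (thor \<mu> h)) (ctop A d))" if d: "d \<in> Cel A" for d
  proof -
    let ?x = "corner A d" and ?\<Delta> = "cbot A d"
    have x: "?x \<in> Obj A" and \<Delta>: "?\<Delta> \<in> Hor A" and p: "hpath (Obj A) (Hor A) (hdom A) (hcod A) ?x (ctop A d) (vdom A (cright A d))"
      using a.F.A.boundary[OF d] a.F.A.vdom_vcod by auto
    have "ccmp1 B (ccmp1 B (thor \<nu> ?\<Delta>) (thor \<mu> ?\<Delta>)) (fcel F d) = ccmp1 B (thor \<nu> ?\<Delta>) (ccmp1 B (thor \<mu> ?\<Delta>) (fcel F d))"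
      using a.F.B.ccmp1_assoc[of "thor \<nu> ?\<Delta>" "thor \<mu> ?\<Delta>" "fcel F d"] a.hor[OF \<Delta>] b.hor[OF \<Delta>] a.F.cel[OF d] by simp
    also have "\<dots> = ccmp1 B (thor \<nu> ?\<Delta>) (ccmp B (fcel G d) (tobj \<mu> ?x) (map (thor \<mu>) (ctop A d)))"
      using a.cel[OF d] by simp
    also have "\<dots> = ccmp B (ccmp1 B (thor \<nu> ?\<Delta>) (fcel G d)) (tobj \<mu> ?x) (map (thor \<mu>) (ctop A d))"
      using a.F.B.ccmp_assoc1[OF _ b.composable1[OF d] a.composable[OF d]] b.hor[OF \<Delta>] by simp
    also have "\<dots> = ccmp B (ccmp B (fcel H d) (tobj \<nu> ?x) (map (thor \<nu>) (ctop A d))) (tobj \<mu> ?x) (map (thor \<mu>) (ctop A d))"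
      using b.cel[OF d] by simp
    also have "\<dots> = ccmp B (fcel H d) (vcmp B (tobj \<nu> ?x) (tobj \<mu> ?x)) (map2 (ccmp1 B) (map (thor \<nu>) (ctop A d)) (map (thor \<mu>) (ctop A d)))"
    proof (rule a.F.B.ccmp_assoc_unary[OF b.composable[OF d]])
      have "set (ctop A d) \<subseteq> Hor A" using hpath_set[OF p] .
      then show "list_all2 (\<lambda>d y. ctop B d = [cbot B y]) (map (thor \<nu>) (ctop A d)) (map (thor \<mu>) (ctop A d))"
        using a.hor b.hor by (auto simp: list_all2_map1 list_all2_map2 intro!: list_all2_refl list.rel_refl_strong)
    qed (use a.cell_path[OF p] a.obj[OF x] b.obj[OF x] in auto)
    also have "map2 (ccmp1 B) (map (thor \<nu>) (ctop A d)) (map (thor \<mu>) (ctop A d)) = map (\<lambda>h. ccmp1 B (thor \<nu> h) (thor \<mu> h)) (ctop A d)"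
      by (simp add: map2_map_map)
    finally show ?thesis .
  qed
  have nat: "vcmp B (vcmp B (tobj \<nu> (vcod A u)) (tobj \<mu> (vcod A u))) (fver F u)
    = vcmp B (fver H u) (vcmp B (tobj \<nu> (vdom A u)) (tobj \<mu> (vdom A u)))" if u: "u \<in> Ver A" for u
  proof -
    have x: "vdom A u \<in> Obj A" "vcod A u \<in> Obj A" using a.F.A.vdom_vcod[OF u] by auto
    note a = a.F.B.vcmp_assoc
    note t = a.obj[OF x(1)] a.obj[OF x(2)] b.obj[OF x(1)] b.obj[OF x(2)] a.F.ver[OF u] a.G.ver[OF u] b.G.ver[OF u]
    show ?thesis
      using a[of "fver F u" "tobj \<mu> (vcod A u)" "tobj \<nu> (vcod A u)"] a[of "tobj \<mu> (vdom A u)" "fver G u" "tobj \<nu> (vcod A u)"]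
        a[of "tobj \<mu> (vdom A u)" "tobj \<nu> (vdom A u)" "fver H u"] a.ver[OF u] b.ver[OF u] t by simp
  qed
  have hor: "ccmp1 B (thor \<nu> h) (thor \<mu> h) \<in> Cel B \<and> ctop B (ccmp1 B (thor \<nu> h) (thor \<mu> h)) = [fhor F h]
      \<and> cbot B (ccmp1 B (thor \<nu> h) (thor \<mu> h)) = fhor H h
      \<and> cleft B (ccmp1 B (thor \<nu> h) (thor \<mu> h)) = vcmp B (tobj \<nu> (hdom A h)) (tobj \<mu> (hdom A h))
      \<and> cright B (ccmp1 B (thor \<nu> h) (thor \<mu> h)) = vcmp B (tobj \<nu> (hcod A h)) (tobj \<mu> (hcod A h))" if "h \<in> Hor A" for h
    using a.F.B.ccmp1_typing[of "thor \<nu> h" "thor \<mu> h"] a.hor[OF that] b.hor[OF that] by simp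
  show ?thesis
    unfolding vdtrans_vcomp_def
  proof (rule vd_trans_restrictI[OF a.F b.G])
    show "vdtrans_laws \<lparr>tsrc = tsrc \<mu>, ttgt = ttgt \<nu>, tobj = \<lambda>a. vcmp (fcod (tsrc \<mu>)) (tobj \<nu> a) (tobj \<mu> a),
           thor = \<lambda>h. ccmp1 (fcod (tsrc \<mu>)) (thor \<nu> h) (thor \<mu> h)\<rparr>"
      unfolding vdtrans_laws_def Let_def
      by (use nat cell hor a.obj b.obj a.F.B.vcmp in simp_all)
  qed simp_all
qed

text \<open>Whiskering: horizontal composition with an identity, with the identities removed. A horizontal
  composite is a vertical composite of two whiskerings.\<close>

definition whisker_left :: "'v vdfun => 'v vdtrans => 'v vdtrans" where
  "whisker_left K \<mu> = vdtrans_restrict \<lparr>tsrc = vdfun_comp K (tsrc \<mu>), ttgt = vdfun_comp K (ttgt \<mu>),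
     tobj = (\<lambda>a. fver K (tobj \<mu> a)), thor = (\<lambda>h. fcel K (thor \<mu> h))\<rparr>"

definition whisker_right :: "'v vdtrans => 'v vdfun => 'v vdtrans" where
  "whisker_right \<nu> K = vdtrans_restrict \<lparr>tsrc = vdfun_comp (tsrc \<nu>) K, ttgt = vdfun_comp (ttgt \<nu>) K,
     tobj = (\<lambda>a. tobj \<nu> (fobj K a)), thor = (\<lambda>h. thor \<nu> (fhor K h))\<rparr>"

lemma whisker_left_simps [simp]:
  "tsrc (whisker_left K \<mu>) = vdfun_comp K (tsrc \<mu>)" "ttgt (whisker_left K \<mu>) = vdfun_comp K (ttgt \<mu>)"
  "a \<in> Obj (fdom (tsrc \<mu>)) ==> tobj (whisker_left K \<mu>) a = fver K (tobj \<mu> a)"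
  "h \<in> Hor (fdom (tsrc \<mu>)) ==> thor (whisker_left K \<mu>) h = fcel K (thor \<mu> h)"
  by (simp_all add: whisker_left_def)

lemma whisker_right_simps [simp]:
  "tsrc (whisker_right \<nu> K) = vdfun_comp (tsrc \<nu>) K" "ttgt (whisker_right \<nu> K) = vdfun_comp (ttgt \<nu>) K"
  "a \<in> Obj (fdom K) ==> tobj (whisker_right \<nu> K) a = tobj \<nu> (fobj K a)"
  "h \<in> Hor (fdom K) ==> thor (whisker_right \<nu> K) h = thor \<nu> (fhor K h)"
  by (simp_all add: whisker_right_def)

lemma whisker_left_trans:
  assumes "vd_trans \<mu> F G A B" "vd_functor K B C"
  shows "vd_trans (whisker_left K \<mu>) (vdfun_comp K F) (vdfun_comp K G) A C"
proof -
  interpret a: vd_trans \<mu> F G A B by fact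
  interpret K: vd_functor K B C by fact
  note a = a.F.A.boundary a.F.A.vdom_vcod a.F.A.hdom_hcod
  have nat: "vcmp C (fver K (tobj \<mu> (vcod A u))) (fver K (fver F u)) = vcmp C (fver K (fver G u)) (fver K (tobj \<mu> (vdom A u)))"
    if u: "u \<in> Ver A" for u
    using K.vcmp[of "fver F u" "tobj \<mu> (vcod A u)"] K.vcmp[of "tobj \<mu> (vdom A u)" "fver G u"] a.ver[OF u]
      a.F.ver[OF u] a.G.ver[OF u] a.obj a.F.A.vdom_vcod[OF u] by simp
  have cell: "ccmp1 C (fcel K (thor \<mu> (cbot A d))) (fcel K (fcel F d))
    = ccmp C (fcel K (fcel G d)) (fver K (tobj \<mu> (corner A d))) (map (\<lambda>h. fcel K (thor \<mu> h)) (ctop A d))"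
    if d: "d \<in> Cel A" for d
  proof -
    have t: "thor \<mu> (cbot A d) \<in> Cel B" "fcel F d \<in> Cel B" using a.hor a.F.cel a.F.A.boundary d by auto
    have m: "map (\<lambda>h. fcel K (thor \<mu> h)) (ctop A d) = map (fcel K) (map (thor \<mu>) (ctop A d))" by simp
    show ?thesis
      unfolding m
      using K.ccmp[OF a.composable[OF d]] K.ccmp[OF a.F.B.composable1[OF t a.composable1[OF d]]] a.cel[OF d] K.cel[OF t(2)]
      by simp
  qed
  show ?thesis
    unfolding whisker_left_def
    by (rule vd_trans_restrictI[OF vdfun_comp_functor[OF a.F assms(2)] vdfun_comp_functor[OF a.G assms(2)]])
      (use nat cell a.obj a.hor K.ver K.cel a in \<open>simp_all add: vdtrans_laws_def Let_def\<close>)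
qed

lemma whisker_right_trans:
  assumes "vd_trans \<nu> F G B C" "vd_functor K A B"
  shows "vd_trans (whisker_right \<nu> K) (vdfun_comp F K) (vdfun_comp G K) A C"
proof -
  interpret b: vd_trans \<nu> F G B C by fact
  interpret K: vd_functor K A B by fact
  have cell: "ccmp1 C (thor \<nu> (fhor K (cbot A d))) (fcel F (fcel K d))
    = ccmp C (fcel G (fcel K d)) (tobj \<nu> (fobj K (corner A d))) (map (\<lambda>h. thor \<nu> (fhor K h)) (ctop A d))"
    if d: "d \<in> Cel A" for d
    using b.cel[of "fcel K d"] K.cel[OF d] K.ver K.A.boundary[OF d] by (simp add: comp_def)
  have nat: "vcmp C (tobj \<nu> (fobj K (vcod A u))) (fver F (fver K u)) = vcmp C (fver G (fver K u)) (tobj \<nu> (fobj K (vdom A u)))"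
    if u: "u \<in> Ver A" for u using b.ver[of "fver K u"] K.ver[OF u] by simp
  have hor: "thor \<nu> (fhor K h) \<in> Cel C \<and> ctop C (thor \<nu> (fhor K h)) = [fhor F (fhor K h)] \<and> cbot C (thor \<nu> (fhor K h)) = fhor G (fhor K h)
    \<and> cleft C (thor \<nu> (fhor K h)) = tobj \<nu> (fobj K (hdom A h)) \<and> cright C (thor \<nu> (fhor K h)) = tobj \<nu> (fobj K (hcod A h))"
    if h: "h \<in> Hor A" for h
    using b.hor[of "fhor K h"] K.hor[OF h] by simp
  show ?thesis
    unfolding whisker_right_def
    by (rule vd_trans_restrictI[OF vdfun_comp_functor[OF assms(2) b.F] vdfun_comp_functor[OF assms(2) b.G]])
      (use nat cell hor b.obj K.obj K.A.boundary in \<open>simp_all add: vdtrans_laws_def Let_def K.A.vdom_vcod\<close>)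
qed

lemma vdtrans_hcomp_whisker:
  assumes "vd_trans \<mu> F F' A B" "vd_trans \<nu> G G' B C"
  shows "vdtrans_hcomp \<nu> \<mu> = vdtrans_vcomp (whisker_right \<nu> F') (whisker_left G \<mu>)"
proof -
  interpret a: vd_trans \<mu> F F' A B by fact
  interpret b: vd_trans \<nu> G G' B C by fact
  show ?thesis
    by (intro vdtrans.equality) (auto simp: vdtrans_hcomp_def vdtrans_vcomp_def vdtrans_restrict_def restrict_def)
qed

lemma vdtrans_hcomp_trans:
  assumes "vd_trans \<mu> F F' A B" "vd_trans \<nu> G G' B C"
  shows "vd_trans (vdtrans_hcomp \<nu> \<mu>) (vdfun_comp G F) (vdfun_comp G' F') A C"
proof -
  interpret a: vd_trans \<mu> F F' A B by fact
  interpret b: vd_trans \<nu> G G' B C by fact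
  show ?thesis
    unfolding vdtrans_hcomp_whisker[OF assms]
    using vdtrans_vcomp_trans[OF whisker_left_trans[OF assms(1) b.F] whisker_right_trans[OF assms(2) a.G]] by simp
qed

lemma vdtrans_hcomp_id_left:
  assumes "vd_trans \<mu> F G A B" "vd_functor K B C"
  shows "vdtrans_hcomp (vdtrans_id K) \<mu> = whisker_left K \<mu>"
proof -
  interpret a: vd_trans \<mu> F G A B by fact
  interpret K: vd_functor K B C by fact
  interpret h: vd_trans "vdtrans_hcomp (vdtrans_id K) \<mu>" "vdfun_comp K F" "vdfun_comp K G" A C
    by (rule vdtrans_hcomp_trans[OF assms(1) vdtrans_id_trans[OF assms(2)]])
  interpret w: vd_trans "whisker_left K \<mu>" "vdfun_comp K F" "vdfun_comp K G" A C
    by (rule whisker_left_trans[OF assms])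
  show ?thesis
  proof (rule vdtrans_eqI[OF h.trans w.trans]; simp)
    fix a assume a: "a \<in> Obj A"
    then show "vcmp C (tobj (vdtrans_id K) (fobj G a)) (fver K (tobj \<mu> a)) = fver K (tobj \<mu> a)"
      using K.ver[of "tobj \<mu> a"] a.obj[OF a] a.G.obj[OF a] K.B.vcmp_vide[of "fver K (tobj \<mu> a)"] by simp
  next
    fix h assume h: "h \<in> Hor A"
    then show "ccmp1 C (thor (vdtrans_id K) (fhor G h)) (fcel K (thor \<mu> h)) = fcel K (thor \<mu> h)"
      using K.cel[of "thor \<mu> h"] a.hor[OF h] a.G.hor[OF h] K.B.ccmp1_cide(1)[of "fcel K (thor \<mu> h)"] by simp
  qed
qed

lemma vdtrans_hcomp_id_right:
  assumes "vd_trans \<nu> F G B C" "vd_functor K A B"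
  shows "vdtrans_hcomp \<nu> (vdtrans_id K) = whisker_right \<nu> K"
proof -
  interpret b: vd_trans \<nu> F G B C by fact
  interpret K: vd_functor K A B by fact
  interpret h: vd_trans "vdtrans_hcomp \<nu> (vdtrans_id K)" "vdfun_comp F K" "vdfun_comp G K" A C
    by (rule vdtrans_hcomp_trans[OF vdtrans_id_trans[OF assms(2)] assms(1)])
  interpret w: vd_trans "whisker_right \<nu> K" "vdfun_comp F K" "vdfun_comp G K" A C
    by (rule whisker_right_trans[OF assms])
  show ?thesis
  proof (rule vdtrans_eqI[OF h.trans w.trans]; simp)
    fix a assume a: "a \<in> Obj A"
    then show "vcmp C (tobj \<nu> (fobj K a)) (fver F (vide B (fobj K a))) = tobj \<nu> (fobj K a)"
      using K.obj[OF a] b.obj[of "fobj K a"] b.F.vid[of "fobj K a"] b.F.B.vcmp_vide[of "tobj \<nu> (fobj K a)"] by simp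
  next
    fix h assume h: "h \<in> Hor A"
    then show "ccmp1 C (thor \<nu> (fhor K h)) (fcel F (cide B (fhor K h))) = thor \<nu> (fhor K h)"
      using K.hor[OF h] b.hor[of "fhor K h"] b.F.cid[of "fhor K h"] b.F.B.ccmp1_cide(2)[of "thor \<nu> (fhor K h)"] by simp
  qed
qed

lemmas vd_functor_eqI = vdfun_eqI[OF vd_functor.is_functor vd_functor.is_functor]

lemma vdfun_comp_id:
  assumes "vd_functor F A B"
  shows "vdfun_comp F (vdfun_id A) = F" "vdfun_comp (vdfun_id B) F = F"
proof -
  interpret F: vd_functor F A B by fact
  show "vdfun_comp F (vdfun_id A) = F"
    by (rule vdfun_eqI) (simp_all add: vdfun_comp_functor[OF vdfun_id_functor[OF F.A] F.vd_functor_axioms, THEN vd_functor.is_functor] F.is_functor)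
  show "vdfun_comp (vdfun_id B) F = F"
    by (rule vdfun_eqI) (simp_all add: vdfun_comp_functor[OF F.vd_functor_axioms vdfun_id_functor[OF F.B], THEN vd_functor.is_functor]
        F.is_functor F.obj F.ver F.hor F.cel)
qed

lemma vdfun_comp_assoc:
  assumes "vd_functor F A B" "vd_functor G B C" "vd_functor H C D"
  shows "vdfun_comp (vdfun_comp H G) F = vdfun_comp H (vdfun_comp G F)"
proof -
  interpret F: vd_functor F A B by fact
  interpret G: vd_functor G B C by fact
  interpret H: vd_functor H C D by fact
  show ?thesis
    by (rule vd_functor_eqI)
      (use vdfun_comp_functor[OF F.vd_functor_axioms vdfun_comp_functor[OF G.vd_functor_axioms H.vd_functor_axioms]]
        vdfun_comp_functor[OF vdfun_comp_functor[OF F.vd_functor_axioms G.vd_functor_axioms] H.vd_functor_axioms] in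
        \<open>auto simp: F.obj F.ver F.hor F.cel\<close>)
qed

subsection \<open>The 2-category of large virtual double categories\<close>

context universes
begin

definition lvdc :: "'v vdc => bool" where
  "lvdc A \<longleftrightarrow> virtual_double_category A \<and> large (Obj A) \<and> large (Ver A) \<and> large (Hor A) \<and> large (Cel A)"

lemma VDBL_simps [simp]:
  "Objs VDBL = {A. lvdc A}"
  "dom1 VDBL = fdom" "cod1 VDBL = fcod" "src2 VDBL = tsrc" "tgt2 VDBL = ttgt"
  "ide1 VDBL = vdfun_id" "cmp1 VDBL = vdfun_comp" "ide2 VDBL = vdtrans_id"
  "vcmp2 VDBL = vdtrans_vcomp" "hcmp2 VDBL = vdtrans_hcomp"
  by (simp_all add: VDBL_def Let_def lvdc_def)

lemma arr_in_VDBL: "arr_in VDBL F A B \<longleftrightarrow> vd_functor F A B \<and> lvdc A \<and> lvdc B"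
  by (auto simp: arr_in_def vd_functor_def VDBL_def Let_def lvdc_def)

lemma Arrs_VDBL: "F \<in> Arrs VDBL \<longleftrightarrow> vd_functor F (fdom F) (fcod F) \<and> lvdc (fdom F) \<and> lvdc (fcod F)"
  by (auto simp: vd_functor_def VDBL_def Let_def lvdc_def)

lemma cell_in_VDBL: "cell_in VDBL \<mu> F G \<longleftrightarrow> vd_trans \<mu> F G (fdom F) (fcod F) \<and> lvdc (fdom F) \<and> lvdc (fcod F)"
  by (auto simp: cell_in_def vd_trans_def VDBL_def Let_def lvdc_def)

lemma Cells_VDBL: "\<mu> \<in> Cells VDBL \<longleftrightarrow> cell_in VDBL \<mu> (tsrc \<mu>) (ttgt \<mu>)"
  by (simp add: cell_in_def)

lemma cell_in_VDBLE:
  assumes "cell_in VDBL \<mu> F G"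
  obtains A B where "vd_trans \<mu> F G A B" "lvdc A" "lvdc B"
  using assms by (auto simp: cell_in_VDBL)

lemma cell_in_VDBLI: "vd_trans \<mu> F G A B ==> lvdc A ==> lvdc B ==> cell_in VDBL \<mu> F G"
  by (simp add: cell_in_VDBL vd_trans_def)

text \<open>Equations between 2-cells are checked on components. Those for horizontal composites reduce to
  functoriality and naturality of the components; horizontal composites with identities are whiskerings.\<close>

lemma two_category_VDBL: "two_category VDBL"
proof
  fix F assume "F \<in> Arrs VDBL"
  then show "dom1 VDBL F \<in> Objs VDBL \<and> cod1 VDBL F \<in> Objs VDBL" by (simp add: Arrs_VDBL)
next
  fix \<mu> assume "\<mu> \<in> Cells VDBL"
  then obtain F G A B where a: "vd_trans \<mu> F G A B" "lvdc A" "lvdc B"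
    unfolding Cells_VDBL using cell_in_VDBLE by metis
  interpret a: vd_trans \<mu> F G A B by (rule a)
  show "src2 VDBL \<mu> \<in> Arrs VDBL \<and> tgt2 VDBL \<mu> \<in> Arrs VDBL \<and> dom1 VDBL (src2 VDBL \<mu>) = dom1 VDBL (tgt2 VDBL \<mu>)
      \<and> cod1 VDBL (src2 VDBL \<mu>) = cod1 VDBL (tgt2 VDBL \<mu>)"
    using a.F a.G a(2,3) by (simp add: Arrs_VDBL)
next
  fix A assume "A \<in> Objs VDBL"
  then show "arr_in VDBL (ide1 VDBL A) A A" by (simp add: arr_in_VDBL lvdc_def vdfun_id_functor)
next
  fix F A B G C assume "arr_in VDBL F A B" "arr_in VDBL G B C"
  then show "arr_in VDBL (cmp1 VDBL G F) A C" by (auto simp: arr_in_VDBL intro: vdfun_comp_functor)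
next
  fix F A B assume "arr_in VDBL F A B"
  then show "cmp1 VDBL F (ide1 VDBL A) = F \<and> cmp1 VDBL (ide1 VDBL B) F = F" using vdfun_comp_id by (auto simp: arr_in_VDBL)
next
  fix F A B G C H D assume "arr_in VDBL F A B" "arr_in VDBL G B C" "arr_in VDBL H C D"
  then show "cmp1 VDBL (cmp1 VDBL H G) F = cmp1 VDBL H (cmp1 VDBL G F)" using vdfun_comp_assoc by (auto simp: arr_in_VDBL)
next
  fix F assume "F \<in> Arrs VDBL"
  then show "cell_in VDBL (ide2 VDBL F) F F" by (simp add: cell_in_VDBL Arrs_VDBL vdtrans_id_trans)
next
  fix \<mu> F G \<nu> H assume "cell_in VDBL \<mu> F G" "cell_in VDBL \<nu> G H"
  then obtain A B where a: "vd_trans \<mu> F G A B" "vd_trans \<nu> G H (fdom G) (fcod G)" "lvdc A" "lvdc B"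
    by (elim cell_in_VDBLE) (auto simp: vd_trans_def)
  interpret a: vd_trans \<mu> F G A B by (rule a)
  show "cell_in VDBL (vcmp2 VDBL \<nu> \<mu>) F H"
    using cell_in_VDBLI[OF vdtrans_vcomp_trans[OF a(1), of \<nu> H] a(3,4)] a(2) by simp
next
  fix \<mu> F G assume "cell_in VDBL \<mu> F G"
  then obtain A B where a: "vd_trans \<mu> F G A B" by (rule cell_in_VDBLE)
  interpret a: vd_trans \<mu> F G A B by (rule a)
  have "vdtrans_vcomp \<mu> (vdtrans_id F) = \<mu>"
  proof (rule vdtrans_eqI)
    show "vertical_transformation (vdtrans_vcomp \<mu> (vdtrans_id F))"
      using vdtrans_vcomp_trans[OF vdtrans_id_trans[OF a.F] a] vd_trans.trans by blast
    fix x assume "x \<in> Obj (fdom (tsrc \<mu>))"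
    then show "tobj (vdtrans_vcomp \<mu> (vdtrans_id F)) x = tobj \<mu> x"
      using a.obj[of x] a.F.B.vcmp_vide[of "tobj \<mu> x"] by simp
  next
    fix h assume "h \<in> Hor (fdom (tsrc \<mu>))"
    then show "thor (vdtrans_vcomp \<mu> (vdtrans_id F)) h = thor \<mu> h"
      using a.hor[of h] a.F.B.ccmp1_cide(2)[of "thor \<mu> h"] by simp
  qed (simp_all add: a.trans)
  moreover have "vdtrans_vcomp (vdtrans_id G) \<mu> = \<mu>"
  proof (rule vdtrans_eqI)
    show "vertical_transformation (vdtrans_vcomp (vdtrans_id G) \<mu>)"
      using vdtrans_vcomp_trans[OF a vdtrans_id_trans[OF a.G]] vd_trans.trans by blast
    fix x assume "x \<in> Obj (fdom (tsrc \<mu>))"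
    then show "tobj (vdtrans_vcomp (vdtrans_id G) \<mu>) x = tobj \<mu> x"
      using a.obj[of x] a.F.B.vcmp_vide[of "tobj \<mu> x"] by simp
  next
    fix h assume "h \<in> Hor (fdom (tsrc \<mu>))"
    then show "thor (vdtrans_vcomp (vdtrans_id G) \<mu>) h = thor \<mu> h"
      using a.hor[of h] a.F.B.ccmp1_cide(1)[of "thor \<mu> h"] by simp
  qed (simp_all add: a.trans)
  ultimately show "vcmp2 VDBL \<mu> (ide2 VDBL F) = \<mu> \<and> vcmp2 VDBL (ide2 VDBL G) \<mu> = \<mu>" by simp
next
  fix \<mu> F G \<nu> H \<gamma> K assume "cell_in VDBL \<mu> F G" "cell_in VDBL \<nu> G H" "cell_in VDBL \<gamma> H K"
  then have a: "vd_trans \<mu> F G (fdom F) (fcod F)" "vd_trans \<nu> G H (fdom G) (fcod G)" "vd_trans \<gamma> H K (fdom H) (fcod H)"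
    by (auto simp: cell_in_VDBL)
  define A B where "A = fdom F" and "B = fcod F"
  interpret a: vd_trans \<mu> F G A B using a(1) unfolding A_def B_def .
  interpret b: vd_trans \<nu> G H A B using a(2) by simp
  interpret c: vd_trans \<gamma> H K A B using a(3) by simp
  note v = vdtrans_vcomp_trans
  show "vcmp2 VDBL (vcmp2 VDBL \<gamma> \<nu>) \<mu> = vcmp2 VDBL \<gamma> (vcmp2 VDBL \<nu> \<mu>)"
    unfolding VDBL_simps
  proof (rule vdtrans_eqI)
    show "vertical_transformation (vdtrans_vcomp (vdtrans_vcomp \<gamma> \<nu>) \<mu>)" "vertical_transformation (vdtrans_vcomp \<gamma> (vdtrans_vcomp \<nu> \<mu>))"
      using v[OF a.vd_trans_axioms v[OF b.vd_trans_axioms c.vd_trans_axioms]] v[OF v[OF a.vd_trans_axioms b.vd_trans_axioms] c.vd_trans_axioms]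
        vd_trans.trans by blast+
    fix x assume "x \<in> Obj (fdom (tsrc (vdtrans_vcomp \<gamma> (vdtrans_vcomp \<nu> \<mu>))))"
    then show "tobj (vdtrans_vcomp (vdtrans_vcomp \<gamma> \<nu>) \<mu>) x = tobj (vdtrans_vcomp \<gamma> (vdtrans_vcomp \<nu> \<mu>)) x"
      using a.obj[of x] b.obj[of x] c.obj[of x] by (simp add: a.F.B.vcmp_assoc)
  next
    fix h assume "h \<in> Hor (fdom (tsrc (vdtrans_vcomp \<gamma> (vdtrans_vcomp \<nu> \<mu>))))"
    then show "thor (vdtrans_vcomp (vdtrans_vcomp \<gamma> \<nu>) \<mu>) h = thor (vdtrans_vcomp \<gamma> (vdtrans_vcomp \<nu> \<mu>)) h"
      using a.hor[of h] b.hor[of h] c.hor[of h] a.F.B.ccmp1_assoc[of "thor \<gamma> h" "thor \<nu> h" "thor \<mu> h"] by simp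
  qed simp_all
next
  fix \<mu> F F' \<nu> G G' assume "cell_in VDBL \<mu> F F'" "cell_in VDBL \<nu> G G'" "cod1 VDBL F = dom1 VDBL G"
  then have a: "vd_trans \<mu> F F' (fdom F) (fcod F)" "vd_trans \<nu> G G' (fcod F) (fcod G)" "lvdc (fdom F)" "lvdc (fcod G)"
    by (auto simp: cell_in_VDBL)
  then show "cell_in VDBL (hcmp2 VDBL \<nu> \<mu>) (cmp1 VDBL G F) (cmp1 VDBL G' F')"
    using vdtrans_hcomp_trans[OF a(1,2)] by (simp add: cell_in_VDBL)
next
  fix F A B G C assume "arr_in VDBL F A B" "arr_in VDBL G B C"
  then have f: "vd_functor F A B" "vd_functor G B C" by (auto simp: arr_in_VDBL)
  interpret F: vd_functor F A B by (rule f)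
  interpret G: vd_functor G B C by (rule f)
  note w = whisker_left_trans[OF vdtrans_id_trans[OF f(1)] f(2)]
  have "whisker_left G (vdtrans_id F) = vdtrans_id (vdfun_comp G F)"
    by (rule vdtrans_eqI[OF w[THEN vd_trans.trans] vdtrans_id_trans[OF vdfun_comp_functor[OF f], THEN vd_trans.trans]])
      (simp_all add: F.obj F.hor G.vid G.cid)
  then show "hcmp2 VDBL (ide2 VDBL G) (ide2 VDBL F) = ide2 VDBL (cmp1 VDBL G F)"
    using vdtrans_hcomp_id_left[OF vdtrans_id_trans[OF f(1)] f(2)] by simp
next
  fix \<mu> F F1 \<mu>' F2 \<nu> G G1 \<nu>' G2
  assume "cell_in VDBL \<mu> F F1" "cell_in VDBL \<mu>' F1 F2" "cell_in VDBL \<nu> G G1" "cell_in VDBL \<nu>' G1 G2" "cod1 VDBL F = dom1 VDBL G"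
  then have a: "vd_trans \<mu> F F1 (fdom F) (fcod F)" "vd_trans \<mu>' F1 F2 (fdom F1) (fcod F1)"
    "vd_trans \<nu> G G1 (fcod F) (fcod G)" "vd_trans \<nu>' G1 G2 (fdom G1) (fcod G1)"
    by (auto simp: cell_in_VDBL)
  define A B C where "A = fdom F" and "B = fcod F" and "C = fcod G"
  interpret a: vd_trans \<mu> F F1 A B using a(1) unfolding A_def B_def .
  interpret a': vd_trans \<mu>' F1 F2 A B using a(2) by simp
  interpret b: vd_trans \<nu> G G1 B C using a(3) unfolding B_def C_def .
  interpret b': vd_trans \<nu>' G1 G2 B C using a(4) by simp
  note v = vdtrans_vcomp_trans and h = vdtrans_hcomp_trans
  note ax = a.vd_trans_axioms a'.vd_trans_axioms b.vd_trans_axioms b'.vd_trans_axioms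
  show "hcmp2 VDBL (vcmp2 VDBL \<nu>' \<nu>) (vcmp2 VDBL \<mu>' \<mu>) = vcmp2 VDBL (hcmp2 VDBL \<nu>' \<mu>') (hcmp2 VDBL \<nu> \<mu>)"
    unfolding VDBL_simps
  proof (rule vdtrans_eqI[OF h[OF v[OF ax(1,2)] v[OF ax(3,4)], THEN vd_trans.trans] v[OF h[OF ax(1,3)] h[OF ax(2,4)], THEN vd_trans.trans]];
      simp add: a'.G.obj a'.G.hor)
    fix x assume x: "x \<in> Obj A"
    note t = a.obj[OF x] a'.obj[OF x] a.F.obj[OF x] a.G.obj[OF x] a'.G.obj[OF x]
    note Gt = b.F.ver[of "tobj \<mu> x"] b.F.ver[of "tobj \<mu>' x"] b.G.ver[of "tobj \<mu>' x"]
    show "vcmp C (vcmp C (tobj \<nu>' (fobj F2 x)) (tobj \<nu> (fobj F2 x))) (fver G (vcmp B (tobj \<mu>' x) (tobj \<mu> x)))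
      = vcmp C (vcmp C (tobj \<nu>' (fobj F2 x)) (fver G1 (tobj \<mu>' x))) (vcmp C (tobj \<nu> (fobj F1 x)) (fver G (tobj \<mu> x)))"
      using b.F.vcmp[of "tobj \<mu> x" "tobj \<mu>' x"] b.ver[of "tobj \<mu>' x"] t Gt
        b.F.B.vcmp_mid[of "tobj \<nu>' (fobj F2 x)" "tobj \<nu> (fobj F2 x)" "fver G (tobj \<mu>' x)" "fver G (tobj \<mu> x)"
          "fver G1 (tobj \<mu>' x)" "tobj \<nu> (fobj F1 x)"] b.obj b'.obj by simp
  next
    fix x assume x: "x \<in> Hor A"
    note t = a.hor[OF x] a'.hor[OF x] a.F.hor[OF x] a.G.hor[OF x] a'.G.hor[OF x]
    note Gt = b.F.cel[of "thor \<mu> x"] b.F.cel[of "thor \<mu>' x"] b.G.cel[of "thor \<mu>' x"]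
    have nat: "ccmp1 C (thor \<nu> (fhor F2 x)) (fcel G (thor \<mu>' x)) = ccmp1 C (fcel G1 (thor \<mu>' x)) (thor \<nu> (fhor F1 x))"
      using b.cel[of "thor \<mu>' x"] t b.hor[of "fhor F1 x"] a'.obj a.F.A.hdom_hcod[OF x] a.G.hor[OF x] by simp
    have G: "fcel G (ccmp1 B (thor \<mu>' x) (thor \<mu> x)) = ccmp1 C (fcel G (thor \<mu>' x)) (fcel G (thor \<mu> x))"
      using b.F.ccmp[OF a.F.B.composable1[of "thor \<mu>' x" "thor \<mu> x"]] t Gt by simp
    show "ccmp1 C (ccmp1 C (thor \<nu>' (fhor F2 x)) (thor \<nu> (fhor F2 x))) (fcel G (ccmp1 B (thor \<mu>' x) (thor \<mu> x)))
      = ccmp1 C (ccmp1 C (thor \<nu>' (fhor F2 x)) (fcel G1 (thor \<mu>' x))) (ccmp1 C (thor \<nu> (fhor F1 x)) (fcel G (thor \<mu> x)))"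
      unfolding G
      by (rule b.F.B.ccmp1_mid[OF _ _ _ _ _ _ _ _ _ _ _ _ nat]) (use t Gt b.hor b'.hor in simp_all)
  qed
next
  fix \<mu> F G assume "cell_in VDBL \<mu> F G"
  then obtain A B where a: "vd_trans \<mu> F G A B" by (rule cell_in_VDBLE)
  interpret a: vd_trans \<mu> F G A B by (rule a)
  note iA = vdfun_id_functor[OF a.F.A] and iB = vdfun_id_functor[OF a.F.B]
  note F = vdfun_comp_id[OF a.F] and G = vdfun_comp_id[OF a.G]
  have "whisker_right \<mu> (vdfun_id A) = \<mu>"
    by (rule vdtrans_eqI[OF whisker_right_trans[OF a iA, THEN vd_trans.trans] a.trans]) (simp_all add: F G)
  moreover have "whisker_left (vdfun_id B) \<mu> = \<mu>"
    by (rule vdtrans_eqI[OF whisker_left_trans[OF a iB, THEN vd_trans.trans] a.trans]) (simp_all add: F G a.obj a.hor)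
  ultimately show "hcmp2 VDBL \<mu> (ide2 VDBL (ide1 VDBL (dom1 VDBL F))) = \<mu> \<and> hcmp2 VDBL (ide2 VDBL (ide1 VDBL (cod1 VDBL F))) \<mu> = \<mu>"
    using vdtrans_hcomp_id_right[OF a iA] vdtrans_hcomp_id_left[OF a iB] by simp
next
  fix \<mu> F F' \<nu> G G' \<gamma> H H'
  assume "cell_in VDBL \<mu> F F'" "cell_in VDBL \<nu> G G'" "cell_in VDBL \<gamma> H H'" "cod1 VDBL F = dom1 VDBL G" "cod1 VDBL G = dom1 VDBL H"
  then have a: "vd_trans \<mu> F F' (fdom F) (fcod F)" "vd_trans \<nu> G G' (fcod F) (fcod G)" "vd_trans \<gamma> H H' (fcod G) (fcod H)"
    by (auto simp: cell_in_VDBL)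
  define A B C D where "A = fdom F" and "B = fcod F" and "C = fcod G" and "D = fcod H"
  interpret a: vd_trans \<mu> F F' A B using a(1) unfolding A_def B_def .
  interpret b: vd_trans \<nu> G G' B C using a(2) unfolding B_def C_def .
  interpret c: vd_trans \<gamma> H H' C D using a(3) unfolding C_def D_def .
  note h = vdtrans_hcomp_trans
  note ax = a.vd_trans_axioms b.vd_trans_axioms c.vd_trans_axioms
  note F = vdfun_comp_assoc[OF a.F b.F c.F] and F' = vdfun_comp_assoc[OF a.G b.G c.G]
  show "hcmp2 VDBL (hcmp2 VDBL \<gamma> \<nu>) \<mu> = hcmp2 VDBL \<gamma> (hcmp2 VDBL \<nu> \<mu>)"
    unfolding VDBL_simps
  proof (rule vdtrans_eqI[OF h[OF ax(1) h[OF ax(2,3)], THEN vd_trans.trans] h[OF h[OF ax(1,2)] ax(3), THEN vd_trans.trans]];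
      simp add: F F' a.obj a.hor a.G.obj a.G.hor)
    fix x assume x: "x \<in> Obj A"
    note t = a.obj[OF x] a.F.obj[OF x] a.G.obj[OF x] b.F.ver[of "tobj \<mu> x"] b.obj[of "fobj F' x"] b.G.obj[of "fobj F' x"]
      c.F.ver[of "tobj \<nu> (fobj F' x)"] c.F.ver[of "fver G (tobj \<mu> x)"] c.obj[of "fobj G' (fobj F' x)"]
    show "vcmp D (vcmp D (tobj \<gamma> (fobj G' (fobj F' x))) (fver H (tobj \<nu> (fobj F' x)))) (fver H (fver G (tobj \<mu> x)))
      = vcmp D (tobj \<gamma> (fobj G' (fobj F' x))) (fver H (vcmp C (tobj \<nu> (fobj F' x)) (fver G (tobj \<mu> x))))"
      using t c.F.vcmp[of "fver G (tobj \<mu> x)" "tobj \<nu> (fobj F' x)"]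
        c.F.B.vcmp_assoc[of "fver H (fver G (tobj \<mu> x))" "fver H (tobj \<nu> (fobj F' x))" "tobj \<gamma> (fobj G' (fobj F' x))"] x
      by simp
  next
    fix x assume x: "x \<in> Hor A"
    note t = a.hor[OF x] a.F.hor[OF x] a.G.hor[OF x] b.F.cel[of "thor \<mu> x"] b.hor[of "fhor F' x"] b.G.hor[of "fhor F' x"]
      c.F.cel[of "thor \<nu> (fhor F' x)"] c.F.cel[of "fcel G (thor \<mu> x)"] c.hor[of "fhor G' (fhor F' x)"]
    have H: "fcel H (ccmp1 C (thor \<nu> (fhor F' x)) (fcel G (thor \<mu> x))) = ccmp1 D (fcel H (thor \<nu> (fhor F' x))) (fcel H (fcel G (thor \<mu> x)))"
      using c.F.ccmp[OF b.F.B.composable1[of "thor \<nu> (fhor F' x)" "fcel G (thor \<mu> x)"]] t by simp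
    show "ccmp1 D (ccmp1 D (thor \<gamma> (fhor G' (fhor F' x))) (fcel H (thor \<nu> (fhor F' x)))) (fcel H (fcel G (thor \<mu> x)))
      = ccmp1 D (thor \<gamma> (fhor G' (fhor F' x))) (fcel H (ccmp1 C (thor \<nu> (fhor F' x)) (fcel G (thor \<mu> x))))"
      unfolding H
      using t c.F.B.ccmp1_assoc[of "thor \<gamma> (fhor G' (fhor F' x))" "fcel H (thor \<nu> (fhor F' x))" "fcel H (fcel G (thor \<mu> x))"] x
      by simp
  qed
qed

end

section \<open>Coding in the large universe\<close>

context universes
begin

lemma set_of_elts: "set_of (elts x) = x"
  unfolding set_of_def by (rule the_equality) (auto dest: injD[OF extensionality])

lemma elts_set_of: "large X ==> elts (set_of X) = X"
  using set_of_elts by (auto simp: large_def)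

lemma large_elts: "large (elts x)"
  by (simp add: large_def)

lemma large_UN:
  assumes "large I" "\<And>i. i \<in> I ==> large (A i)"
  shows "large (\<Union>i\<in>I. A i)"
proof -
  obtain c where c: "I = elts c" using assms(1) by (auto simp: large_def)
  have "\<forall>f. \<exists>z. elts z = (\<Union>i\<in>elts c. elts (f i))"
    using universe2 by (simp add: grothendieck_universe_def)
  then obtain z where "elts z = (\<Union>i\<in>elts c. elts (set_of (A i)))" by metis
  then have "elts z = (\<Union>i\<in>I. A i)" using assms(2) c by (simp add: elts_set_of)
  then show ?thesis using large_elts by metis
qed

lemma large_pair: "large {x, y}"
proof -
  have "\<forall>x y. \<exists>z. elts z = {x, y}" using universe2 by (simp add: grothendieck_universe_def)
  then obtain z where "elts z = {x, y}" by metis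
  then show ?thesis using large_elts by metis
qed

lemma large_single: "large {x}"
  using large_pair[of x x] by simp

lemma large_image: "large I ==> large (f ` I)"
  using large_UN[of I "\<lambda>i. {f i}"] large_single by (simp add: image_UN[symmetric] UNION_singleton_eq_range)

lemma Pow_code: "\<exists>z. elts ` elts z = Pow (elts x)"
  using universe2 by (simp add: grothendieck_universe_def)

lemma large_subset: "large X ==> Y \<subseteq> X ==> large Y"
proof -
  assume "large X" "Y \<subseteq> X"
  then obtain x where "Y \<in> Pow (elts x)" by (auto simp: large_def)
  moreover obtain z where "elts ` elts z = Pow (elts x)" using Pow_code[of x] by auto
  ultimately have "Y \<in> elts ` elts z" by simp
  then show "large Y" unfolding large_def by blast
qed

lemma large_empty: "large {}"
  using large_subset large_single by blast

lemma large_Un: "large X ==> large Y ==> large (X \<union> Y)"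
  using large_UN[OF large_pair[of "set_of X" "set_of Y"], of elts] by (simp add: elts_set_of large_elts)

text \<open>This bounds sets of functions, as these are coded by their graphs.\<close>

lemma large_codes: "large X ==> large (set_of ` Pow X)"
proof -
  assume "large X"
  then obtain x where x: "X = elts x" by (auto simp: large_def)
  obtain z where "elts ` elts z = Pow X" using Pow_code[of x] x by auto
  then have "set_of ` Pow X = set_of ` elts ` elts z" by simp
  also have "\<dots> = elts z" by (simp add: image_image set_of_elts)
  finally have "set_of ` Pow X = elts z" .
  then show ?thesis by (simp add: large_elts)
qed

text \<open>The infinite set provided by the universe lets countable families be indexed by a large set.\<close>

lemma large_UN_nat:
  fixes A :: "nat => 'v set"
  assumes "\<And>n. large (A n)"
  shows "large (\<Union>n. A n)"
proof -
  have "\<exists>x. infinite (elts x)" using universe2 by (simp add: grothendieck_universe_def)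
  then obtain x where "infinite (elts x)" ..
  then obtain g :: "nat => 'v" where g: "inj g" "range g \<subseteq> elts x" using infinite_countable_subset by blast
  have "large (\<Union>v\<in>range g. A (inv g v))"
    by (rule large_UN[OF large_subset[OF large_elts g(2)]]) (rule assms)
  then show ?thesis using g(1) by simp
qed

lemma elts_vpair: "elts (vpair x y) = {set_of {x}, set_of {x, y}}"
  by (simp add: vpair_def elts_set_of large_pair)

lemma vpair_eq_iff: "vpair x y = vpair x' y' \<longleftrightarrow> x = x' \<and> y = y'"
proof
  assume "vpair x y = vpair x' y'"
  then have "{set_of {x}, set_of {x, y}} = {set_of {x'}, set_of {x', y'}}" by (metis elts_vpair)
  then have "elts ` {set_of {x}, set_of {x, y}} = elts ` {set_of {x'}, set_of {x', y'}}" by (rule arg_cong)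
  then have "{{x}, {x, y}} = {{x'}, {x', y'}}"
    by (simp add: elts_set_of large_pair large_single)
  then show "x = x' \<and> y = y'" by (auto simp: doubleton_eq_iff)
qed simp

lemma tup_eq_iff [simp]: "tup xs = tup ys \<longleftrightarrow> xs = ys"
proof (induction xs arbitrary: ys)
  case Nil
  have "set_of {} \<noteq> vpair x y" for x y using elts_vpair elts_set_of[OF large_empty] by (metis insert_not_empty)
  then show ?case by (cases ys) auto
next
  case (Cons x xs)
  have "vpair x y \<noteq> set_of {}" for x y using elts_vpair elts_set_of[OF large_empty] by (metis insert_not_empty)
  then show ?case using Cons by (cases ys) (auto simp: vpair_eq_iff)
qed

lemma untup_tup [simp]: "untup (tup xs) = xs"
  by (simp add: untup_def)

lemma proj_tup [simp]: "proj (tup xs) k = xs ! k"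
  by (simp add: proj_def)

declare tup.simps [simp del]

lemma in_tups: "tup xs = x ==> xs \<in> lists D ==> x \<in> tup ` lists D"
  by (metis imageI)

text \<open>Lists of bounded length over a large set form a large set by induction, and all lists are a
  countable union of these.\<close>

lemma large_tups: "large D ==> large (tup ` lists D)"
proof -
  assume D: "large D"
  have "large (tup ` {xs \<in> lists D. length xs = n})" for n
  proof (induction n)
    case 0
    have "{xs \<in> lists D. length xs = 0} = {[]}" by auto
    then show ?case using large_single by simp
  next
    case (Suc n)
    have "tup ` {xs \<in> lists D. length xs = Suc n} = (\<Union>x\<in>D. vpair x ` tup ` {xs \<in> lists D. length xs = n})" (is "?l = ?r")
    proof
      show "?l \<subseteq> ?r"
      proof
        fix v assume "v \<in> ?l"
        then obtain x xs where "v = tup (x # xs)" "x \<in> D" "xs \<in> lists D" "length xs = n"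
            by (auto simp: length_Suc_conv in_lists_conv_set)
        then show "v \<in> ?r" by (auto simp: tup.simps)
      qed
      have "vpair x (tup xs) \<in> ?l" if "x \<in> D" "xs \<in> lists D" "length xs = n" for x xs
        using that by (intro image_eqI[of _ _ "x # xs"]) (auto simp: tup.simps)
      then show "?r \<subseteq> ?l" by blast
    qed
    then show ?case using large_UN[OF D] large_image[OF Suc] by simp
  qed
  from large_UN_nat[OF this] show ?thesis by (rule large_subset) auto
qed

lemma elts_lam: "elts (lam I f) = (\<lambda>i. vpair i (f i)) ` elts I"
  by (simp add: lam_def elts_set_of large_image large_elts)

lemma app_lam [simp]: "i \<in> elts I ==> app (lam I f) i = f i"
  unfolding app_def elts_lam by (auto simp: vpair_eq_iff)

lemma lam_cong: "I = J ==> (\<And>i. i \<in> elts J ==> f i = g i) ==> lam I f = lam J g"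
  by (simp add: lam_def cong: image_cong)

lemma large_lams:
  assumes "large W" "large Z"
  shows "large {lam P f | P f. elts P \<subseteq> W \<and> f ` elts P \<subseteq> Z}"
proof (rule large_subset)
  show "large (set_of ` Pow (\<Union>w\<in>W. vpair w ` Z))"
    using assms by (intro large_codes large_UN large_image)
  have "lam P f \<in> set_of ` Pow (\<Union>w\<in>W. vpair w ` Z)" if "elts P \<subseteq> W" "f ` elts P \<subseteq> Z" for P f
    unfolding lam_def using that by (intro imageI) blast
  then show "{lam P f | P f. elts P \<subseteq> W \<and> f ` elts P \<subseteq> Z} \<subseteq> set_of ` Pow (\<Union>w\<in>W. vpair w ` Z)" by blast
qed

lemma U1_trans: "I \<in> elts U1 ==> i \<in> elts I ==> i \<in> elts U1"
  using universe1 by (auto simp: grothendieck_universe_def)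


section \<open>Elements of the families construction\<close>

lemma idx_tup [simp]: "idx (tup (I # xs)) = I"
  by (simp add: idx_def)

lemma memb_tup [simp]: "i \<in> elts I ==> memb (tup [I', lam I a]) i = a i"
  by (simp add: memb_def)

lemma fam_obj_iff: "tup [I, lam I a] \<in> fam_obj A \<longleftrightarrow> I \<in> elts U1 \<and> (\<forall>i\<in>elts I. a i \<in> Obj A)"
proof
  assume "tup [I, lam I a] \<in> fam_obj A"
  then obtain b where b: "I \<in> elts U1" "\<forall>i\<in>elts I. b i \<in> Obj A" "lam I a = lam I b"
    by (auto simp: fam_obj_def)
  then have "a i = b i" if "i \<in> elts I" for i using that app_lam by metis
  then show "I \<in> elts U1 \<and> (\<forall>i\<in>elts I. a i \<in> Obj A)" using b by auto
qed (auto simp: fam_obj_def)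

lemma fam_objD:
  assumes "X \<in> fam_obj A"
  shows "idx X \<in> elts U1" "i \<in> elts (idx X) ==> memb X i \<in> Obj A"
    and "tup [idx X, lam (idx X) (memb X)] = X"
  using assms by (auto simp: fam_obj_def intro!: lam_cong)

text \<open>The extensionality lemmas of this section reduce equality of coded data to equality of its
  components.\<close>

lemma fam_obj_eqI:
  assumes "X \<in> fam_obj A" "Y \<in> fam_obj B" "idx X = idx Y" "\<And>i. i \<in> elts (idx X) ==> memb X i = memb Y i"
  shows "X = Y"
proof -
  have "lam (idx X) (memb X) = lam (idx Y) (memb Y)" by (rule lam_cong) (use assms(3,4) in simp_all)
  then show ?thesis using fam_objD(3)[OF assms(1)] fam_objD(3)[OF assms(2)] assms(3) by metis
qed

lemma ver_tup [simp]:
  "ver_dom (tup (X # xs)) = X" "ver_cod (tup (X # Y # xs)) = Y"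
  "i \<in> elts I ==> ver_fun (tup (X # Y # lam I v # xs)) i = v i"
  "i \<in> elts I ==> ver_memb (tup (X # Y # V # lam I f # xs)) i = f i"
  by (simp_all add: ver_dom_def ver_cod_def ver_fun_def ver_memb_def)

lemma fam_verI:
  assumes "X \<in> fam_obj A" "Y \<in> fam_obj A" "I = idx X"
    and "\<And>i. i \<in> elts I ==> v i \<in> elts (idx Y) \<and> f i \<in> Ver A
        \<and> vdom A (f i) = memb X i \<and> vcod A (f i) = memb Y (v i)"
  shows "tup [X, Y, lam I v, lam I f] \<in> fam_ver A"
  using assms unfolding fam_ver_def by blast

lemma fam_verD:
  assumes "u \<in> fam_ver A"
  shows "ver_dom u \<in> fam_obj A" "ver_cod u \<in> fam_obj A"
    and "i \<in> elts (idx (ver_dom u)) ==> ver_fun u i \<in> elts (idx (ver_cod u)) \<and> ver_memb u i \<in> Ver A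
      \<and> vdom A (ver_memb u i) = memb (ver_dom u) i \<and> vcod A (ver_memb u i) = memb (ver_cod u) (ver_fun u i)"
    and "tup [ver_dom u, ver_cod u, lam (idx (ver_dom u)) (ver_fun u), lam (idx (ver_dom u)) (ver_memb u)] = u"
  using assms by (auto simp: fam_ver_def intro!: lam_cong)

lemma fam_ver_eqI:
  assumes "u \<in> fam_ver A" "w \<in> fam_ver B" "ver_dom u = ver_dom w" "ver_cod u = ver_cod w"
    and "\<And>i. i \<in> elts (idx (ver_dom u)) ==> ver_fun u i = ver_fun w i \<and> ver_memb u i = ver_memb w i"
  shows "u = w"
proof -
  have "lam (idx (ver_dom u)) (ver_fun u) = lam (idx (ver_dom w)) (ver_fun w)"
    "lam (idx (ver_dom u)) (ver_memb u) = lam (idx (ver_dom w)) (ver_memb w)"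
    by (rule lam_cong, use assms(3,5) in simp_all)+
  then show ?thesis using fam_verD(4)[OF assms(1)] fam_verD(4)[OF assms(2)] assms(3,4) by metis
qed

lemma hor_tup [simp]:
  "hor_dom (tup (X # xs)) = X" "hor_cod (tup (X # Y # xs)) = Y" "hor_apex (tup (X # Y # S # xs)) = S"
  "s \<in> elts S' ==> hor_left (tup (X # Y # S # lam S' l # xs)) s = l s"
  "s \<in> elts S' ==> hor_right (tup (X # Y # S # L # lam S' r # xs)) s = r s"
  "s \<in> elts S' ==> hor_memb (tup (X # Y # S # L # R # lam S' g # xs)) s = g s"
  by (simp_all add: hor_dom_def hor_cod_def hor_apex_def hor_left_def hor_right_def hor_memb_def)

lemma fam_horI:
  assumes "X \<in> fam_obj A" "Y \<in> fam_obj A" "S \<in> elts U1"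
    and "\<And>s. s \<in> elts S ==> l s \<in> elts (idx X) \<and> r s \<in> elts (idx Y) \<and> g s \<in> Hor A
        \<and> hdom A (g s) = memb X (l s) \<and> hcod A (g s) = memb Y (r s)"
  shows "tup [X, Y, S, lam S l, lam S r, lam S g] \<in> fam_hor A"
  using assms unfolding fam_hor_def by blast

lemma fam_horD:
  assumes "h \<in> fam_hor A"
  shows "hor_dom h \<in> fam_obj A" "hor_cod h \<in> fam_obj A" "hor_apex h \<in> elts U1"
    and "s \<in> elts (hor_apex h) ==> hor_left h s \<in> elts (idx (hor_dom h))
      \<and> hor_right h s \<in> elts (idx (hor_cod h)) \<and> hor_memb h s \<in> Hor A
      \<and> hdom A (hor_memb h s) = memb (hor_dom h) (hor_left h s)
      \<and> hcod A (hor_memb h s) = memb (hor_cod h) (hor_right h s)"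
    and "tup [hor_dom h, hor_cod h, hor_apex h, lam (hor_apex h) (hor_left h),
      lam (hor_apex h) (hor_right h), lam (hor_apex h) (hor_memb h)] = h"
  using assms by (auto simp: fam_hor_def intro!: lam_cong)

lemma fam_hor_eqI:
  assumes "h \<in> fam_hor A" "\<Delta> \<in> fam_hor B" "hor_dom h = hor_dom \<Delta>" "hor_cod h = hor_cod \<Delta>"
    and "hor_apex h = hor_apex \<Delta>"
    and "\<And>s. s \<in> elts (hor_apex h) ==> hor_left h s = hor_left \<Delta> s \<and> hor_right h s = hor_right \<Delta> s
        \<and> hor_memb h s = hor_memb \<Delta> s"
  shows "h = \<Delta>"
proof -
  have "lam (hor_apex h) (hor_left h) = lam (hor_apex \<Delta>) (hor_left \<Delta>)"
    "lam (hor_apex h) (hor_right h) = lam (hor_apex \<Delta>) (hor_right \<Delta>)"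
    "lam (hor_apex h) (hor_memb h) = lam (hor_apex \<Delta>) (hor_memb \<Delta>)"
    by (rule lam_cong, use assms(5,6) in simp_all)+
  then show ?thesis using fam_horD(5)[OF assms(1)] fam_horD(5)[OF assms(2)] assms(3,4,5) by metis
qed

subsection \<open>Points of iterated pullbacks\<close>

lemma walk_length: "walk i hs ss ==> length ss = length hs"
  by (induction i hs ss rule: walk.induct) auto

lemma walk_end_Nil [simp]: "walk_end i hs [] = i"
  by (simp add: walk_end_def)

lemma walk_end_Cons: "walk (hor_right h s) hs ss ==> walk_end i (h # hs) (s # ss) = walk_end (hor_right h s) hs ss"
  using walk_length[of "hor_right h s" hs ss] by (cases "ss = []") (auto simp: walk_end_def)

lemma walk_Nil_iff [simp]: "walk i [] ss \<longleftrightarrow> ss = []"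
  by (cases ss) auto

lemma walk_Cons_iff: "walk i (h # hs) ss \<longleftrightarrow> (\<exists>s ss'. ss = s # ss' \<and> s \<in> elts (hor_apex h)
    \<and> hor_left h s = i \<and> walk (hor_right h s) hs ss')"
  by (cases ss) auto

lemma walk_append: "walk i (hs @ \<Delta>s) ss
    \<longleftrightarrow> (\<exists>ss1 ss2. ss = ss1 @ ss2 \<and> walk i hs ss1 \<and> walk (walk_end i hs ss1) \<Delta>s ss2)"
proof (induction hs arbitrary: i ss)
  case (Cons h hs)
  show ?case
  proof
    assume "walk i ((h # hs) @ \<Delta>s) ss"
    then obtain s ss' where s: "ss = s # ss'" "s \<in> elts (hor_apex h)" "hor_left h s = i"
      "walk (hor_right h s) (hs @ \<Delta>s) ss'" by (auto simp: walk_Cons_iff)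
    then obtain ss1 ss2 where "ss' = ss1 @ ss2" "walk (hor_right h s) hs ss1"
      "walk (walk_end (hor_right h s) hs ss1) \<Delta>s ss2" using Cons by blast
    then show "\<exists>ss1 ss2. ss = ss1 @ ss2 \<and> walk i (h # hs) ss1 \<and> walk (walk_end i (h # hs) ss1) \<Delta>s ss2"
      using s by (intro exI[of _ "s # ss1"] exI[of _ ss2]) (auto simp: walk_end_Cons)
  next
    assume "\<exists>ss1 ss2. ss = ss1 @ ss2 \<and> walk i (h # hs) ss1 \<and> walk (walk_end i (h # hs) ss1) \<Delta>s ss2"
    then show "walk i ((h # hs) @ \<Delta>s) ss" using Cons by (fastforce simp: walk_Cons_iff walk_end_Cons)
  qed
qed simp

lemma walk_end_append:
  "walk i hs ss ==> walk (walk_end i hs ss) \<Delta>s ts ==> walk_end i (hs @ \<Delta>s) (ss @ ts) = walk_end (walk_end i hs ss) \<Delta>s ts"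
  using walk_length[of i hs ss] walk_length[of "walk_end i hs ss" \<Delta>s ts] by (cases "\<Delta>s = []") (auto simp: walk_end_def)

lemma walk_end_in:
  assumes "hpath (fam_obj A) (fam_hor A) hor_dom hor_cod X hs Y" "walk i hs ss" "i \<in> elts (idx X)"
  shows "walk_end i hs ss \<in> elts (idx Y)"
  using assms
proof (induction hs arbitrary: X i ss)
  case (Cons h hs)
  then obtain s ss' where s: "ss = s # ss'" "s \<in> elts (hor_apex h)" "walk (hor_right h s) hs ss'"
    by (auto simp: walk_Cons_iff)
  have "hor_right h s \<in> elts (idx (hor_cod h))" using fam_horD(4)[of h A s] Cons.prems s by simp
  then show ?case using Cons.IH[of "hor_cod h" "hor_right h s" ss'] Cons.prems(1) s by (simp add: walk_end_Cons)
qed simp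

lemma walk_lists:
  assumes "walk i hs ss" "set hs \<subseteq> fam_hor A"
  shows "ss \<in> lists (elts U1)"
  using assms
proof (induction hs arbitrary: i ss)
  case (Cons h hs)
  then show ?case using fam_horD(3)[of h A] U1_trans by (fastforce simp: walk_Cons_iff)
qed simp

lemma span_prod_subset:
  assumes "X \<in> fam_obj A" "set hs \<subseteq> fam_hor A"
  shows "{tup (i # ss) | i ss. i \<in> elts (idx X) \<and> walk i hs ss} \<subseteq> tup ` lists (elts U1)"
  using walk_lists[OF _ assms(2)] U1_trans[OF fam_objD(1)[OF assms(1)]] by (fastforce intro!: imageI)

text \<open>The iterated pullback is small enough to be coded, being a set of lists over \<open>U1\<close>.\<close>

lemma elts_span_prod:
  assumes "X \<in> fam_obj A" "set hs \<subseteq> fam_hor A"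
  shows "elts (span_prod X hs) = {tup (i # ss) | i ss. i \<in> elts (idx X) \<and> walk i hs ss}"
  unfolding span_prod_def
  using elts_set_of large_subset[OF large_tups[OF large_elts] span_prod_subset[OF assms]] by simp

lemma tup_in_span_prod:
  assumes "X \<in> fam_obj A" "set hs \<subseteq> fam_hor A"
  shows "tup (i # ss) \<in> elts (span_prod X hs) \<longleftrightarrow> i \<in> elts (idx X) \<and> walk i hs ss"
  using elts_span_prod[OF assms] by auto

lemma cel_tup [simp]:
  "cel_top (tup (tup hs # xs)) = hs" "cel_bot (tup (T # \<Delta> # xs)) = \<Delta>"
  "cel_left (tup (T # \<Delta> # u # xs)) = u" "cel_right (tup (T # \<Delta> # u # w # xs)) = w"
  "p \<in> elts P ==> cel_fun (tup (T # \<Delta> # u # w # lam P m # xs)) p = m p"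
  "p \<in> elts P ==> cel_memb (tup (T # \<Delta> # u # w # M # lam P \<phi> # xs)) p = \<phi> p"
  by (simp_all add: cel_top_def cel_bot_def cel_left_def cel_right_def cel_fun_def cel_memb_def)

text \<open>Evaluation of a multicell of a families construction at a point \<open>(i, ss)\<close> of its top.\<close>

definition cf :: "'v => 'v => 'v list => 'v" where "cf d i ss = cel_fun d (tup (i # ss))"
definition cm :: "'v => 'v => 'v list => 'v" where "cm d i ss = cel_memb d (tup (i # ss))"

abbreviation fpath :: "'v vdc => 'v => 'v list => 'v => bool" where
  "fpath A \<equiv> hpath (fam_obj A) (fam_hor A) hor_dom hor_cod"

lemma fam_celI:
  assumes "u \<in> fam_ver A" "w \<in> fam_ver A" "\<Delta> \<in> fam_hor A" "fpath A (ver_dom u) hs (ver_dom w)"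
    "ver_cod u = hor_dom \<Delta>" "ver_cod w = hor_cod \<Delta>" "P = span_prod (ver_dom u) hs"
    and "\<And>i ss. i \<in> elts (idx (ver_dom u)) ==> walk i hs ss ==>
      m (tup (i # ss)) \<in> elts (hor_apex \<Delta>) \<and>
      hor_left \<Delta> (m (tup (i # ss))) = ver_fun u i \<and>
      hor_right \<Delta> (m (tup (i # ss))) = ver_fun w (walk_end i hs ss) \<and>
      \<phi> (tup (i # ss)) \<in> Cel A \<and> ctop A (\<phi> (tup (i # ss))) = map2 hor_memb hs ss \<and>
      cbot A (\<phi> (tup (i # ss))) = hor_memb \<Delta> (m (tup (i # ss))) \<and>
      cleft A (\<phi> (tup (i # ss))) = ver_memb u i \<and>
      cright A (\<phi> (tup (i # ss))) = ver_memb w (walk_end i hs ss)"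
  shows "tup [tup hs, \<Delta>, u, w, lam P m, lam P \<phi>] \<in> fam_cel A"
  unfolding fam_cel_def Let_def using assms by blast

lemma
  assumes "X \<in> fam_obj A" "set hs \<subseteq> fam_hor A" "P = span_prod X hs" "i \<in> elts (idx X)" "walk i hs ss"
  shows cf_tup: "cf (tup (T # \<Delta> # u # w # lam P m # xs)) i ss = m (tup (i # ss))"
    and cm_tup: "cm (tup (T # \<Delta> # u # w # M # lam P \<phi> # xs)) i ss = \<phi> (tup (i # ss))"
  using assms tup_in_span_prod[OF assms(1,2)] by (simp_all add: cf_def cm_def)

lemma fam_celD:
  assumes "d \<in> fam_cel A"
  shows "cel_left d \<in> fam_ver A" "cel_right d \<in> fam_ver A" "cel_bot d \<in> fam_hor A"
    "fpath A (ver_dom (cel_left d)) (cel_top d) (ver_dom (cel_right d))"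
    "ver_cod (cel_left d) = hor_dom (cel_bot d)" "ver_cod (cel_right d) = hor_cod (cel_bot d)"
    and "i \<in> elts (idx (ver_dom (cel_left d))) ==> walk i (cel_top d) ss ==>
      cf d i ss \<in> elts (hor_apex (cel_bot d)) \<and>
      hor_left (cel_bot d) (cf d i ss) = ver_fun (cel_left d) i \<and>
      hor_right (cel_bot d) (cf d i ss) = ver_fun (cel_right d) (walk_end i (cel_top d) ss) \<and>
      cm d i ss \<in> Cel A \<and> ctop A (cm d i ss) = map2 hor_memb (cel_top d) ss \<and>
      cbot A (cm d i ss) = hor_memb (cel_bot d) (cf d i ss) \<and>
      cleft A (cm d i ss) = ver_memb (cel_left d) i \<and>
      cright A (cm d i ss) = ver_memb (cel_right d) (walk_end i (cel_top d) ss)"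
    and "\<exists>m \<phi>. d = tup [tup (cel_top d), cel_bot d, cel_left d, cel_right d,
      lam (span_prod (ver_dom (cel_left d)) (cel_top d)) m, lam (span_prod (ver_dom (cel_left d)) (cel_top d)) \<phi>]"
proof -
  obtain hs \<Delta> u w m \<phi> where d: "d = tup [tup hs, \<Delta>, u, w, lam (span_prod (ver_dom u) hs) m, lam (span_prod (ver_dom u) hs) \<phi>]"
    and *: "u \<in> fam_ver A" "w \<in> fam_ver A" "\<Delta> \<in> fam_hor A" "fpath A (ver_dom u) hs (ver_dom w)"
    "ver_cod u = hor_dom \<Delta>" "ver_cod w = hor_cod \<Delta>"
    and pt: "\<And>i ss. i \<in> elts (idx (ver_dom u)) ==> walk i hs ss ==>
      m (tup (i # ss)) \<in> elts (hor_apex \<Delta>) \<and>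
      hor_left \<Delta> (m (tup (i # ss))) = ver_fun u i \<and>
      hor_right \<Delta> (m (tup (i # ss))) = ver_fun w (walk_end i hs ss) \<and>
      \<phi> (tup (i # ss)) \<in> Cel A \<and> ctop A (\<phi> (tup (i # ss))) = map2 hor_memb hs ss \<and>
      cbot A (\<phi> (tup (i # ss))) = hor_memb \<Delta> (m (tup (i # ss))) \<and>
      cleft A (\<phi> (tup (i # ss))) = ver_memb u i \<and>
      cright A (\<phi> (tup (i # ss))) = ver_memb w (walk_end i hs ss)"
    using assms unfolding fam_cel_def Let_def by blast
  have acc: "cel_top d = hs" "cel_bot d = \<Delta>" "cel_left d = u" "cel_right d = w" by (simp_all add: d)
  show "cel_left d \<in> fam_ver A" "cel_right d \<in> fam_ver A" "cel_bot d \<in> fam_hor A"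
    "fpath A (ver_dom (cel_left d)) (cel_top d) (ver_dom (cel_right d))"
    "ver_cod (cel_left d) = hor_dom (cel_bot d)" "ver_cod (cel_right d) = hor_cod (cel_bot d)"
    using * acc by simp_all
  show "\<exists>m \<phi>. d = tup [tup (cel_top d), cel_bot d, cel_left d, cel_right d,
      lam (span_prod (ver_dom (cel_left d)) (cel_top d)) m, lam (span_prod (ver_dom (cel_left d)) (cel_top d)) \<phi>]"
    unfolding acc using d by blast
  assume i: "i \<in> elts (idx (ver_dom (cel_left d)))" "walk i (cel_top d) ss"
  have c: "cf d i ss = m (tup (i # ss))" "cm d i ss = \<phi> (tup (i # ss))"
    unfolding d using cf_tup[OF fam_verD(1)[OF *(1)] hpath_set[OF *(4)] refl] cm_tup[OF fam_verD(1)[OF *(1)] hpath_set[OF *(4)] refl] i acc by simp_all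
  show "cf d i ss \<in> elts (hor_apex (cel_bot d)) \<and>
      hor_left (cel_bot d) (cf d i ss) = ver_fun (cel_left d) i \<and>
      hor_right (cel_bot d) (cf d i ss) = ver_fun (cel_right d) (walk_end i (cel_top d) ss) \<and>
      cm d i ss \<in> Cel A \<and> ctop A (cm d i ss) = map2 hor_memb (cel_top d) ss \<and>
      cbot A (cm d i ss) = hor_memb (cel_bot d) (cf d i ss) \<and>
      cleft A (cm d i ss) = ver_memb (cel_left d) i \<and>
      cright A (cm d i ss) = ver_memb (cel_right d) (walk_end i (cel_top d) ss)"
    unfolding c acc using pt i acc by simp
qed

lemma fam_cel_eqI:
  assumes "d \<in> fam_cel A" "k \<in> fam_cel B" "cel_top d = cel_top k" "cel_bot d = cel_bot k"
    "cel_left d = cel_left k" "cel_right d = cel_right k"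
    and "\<And>i ss. i \<in> elts (idx (ver_dom (cel_left d))) ==> walk i (cel_top d) ss
      ==> cf d i ss = cf k i ss \<and> cm d i ss = cm k i ss"
  shows "d = k"
proof -
  let ?P = "span_prod (ver_dom (cel_left d)) (cel_top d)"
  obtain m \<phi> m' \<phi>' where e: "d = tup [tup (cel_top d), cel_bot d, cel_left d, cel_right d, lam ?P m, lam ?P \<phi>]"
    "k = tup [tup (cel_top k), cel_bot k, cel_left k, cel_right k, lam ?P m', lam ?P \<phi>']"
    using fam_celD(8)[OF assms(1)] fam_celD(8)[OF assms(2)] assms(3,5) by metis
  have "m p = m' p \<and> \<phi> p = \<phi>' p" if p: "p \<in> elts ?P" for p
  proof -
    obtain i ss where i: "p = tup (i # ss)" "i \<in> elts (idx (ver_dom (cel_left d)))" "walk i (cel_top d) ss"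
      using p elts_span_prod[OF fam_verD(1)[OF fam_celD(1)[OF assms(1)]] hpath_set[OF fam_celD(4)[OF assms(1)]]] by auto
    have "cel_fun d p = cel_fun k p" "cel_memb d p = cel_memb k p"
      using assms(7)[OF i(2,3)] i(1) by (simp_all add: cf_def cm_def)
    moreover have "cel_fun d p = m p" "cel_memb d p = \<phi> p" by (subst e(1), use p in simp)+
    moreover have "cel_fun k p = m' p" "cel_memb k p = \<phi>' p" by (subst e(2), use p in simp)+
    ultimately show ?thesis by simp
  qed
  then have "lam ?P m = lam ?P m'" "lam ?P \<phi> = lam ?P \<phi>'" by (auto intro!: lam_cong)
  then show ?thesis by (subst e(1), subst e(2)) (simp add: assms)
qed

subsection \<open>The sets are large\<close>

text \<open>All components of a coded datum lie in a large set: elements of \<open>U1\<close>, data of \<open>A\<close>, and functions between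
  these. Tuples of such components form a large set.\<close>

lemma large_fam_obj: "large (Obj A) ==> large (fam_obj A)"
proof -
  assume A: "large (Obj A)"
  let ?L = "{lam P f | P f. elts P \<subseteq> elts U1 \<and> f ` elts P \<subseteq> Obj A}"
  have L: "large (tup ` lists (elts U1 \<union> ?L))" by (intro large_tups large_Un large_elts large_lams A)
  have "fam_obj A \<subseteq> tup ` lists (elts U1 \<union> ?L)"
    unfolding fam_obj_def using U1_trans by (fastforce intro!: imageI)
  then show ?thesis using large_subset[OF L] by blast
qed

lemma large_fam_ver: "large (Obj A) ==> large (Ver A) ==> large (fam_ver A)"
proof -
  assume A: "large (Obj A)" "large (Ver A)"
  define L where "L = {lam P f | P f. elts P \<subseteq> elts U1 \<and> f ` elts P \<subseteq> elts U1 \<union> Ver A}"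
  have L: "large (tup ` lists (fam_obj A \<union> L))"
    unfolding L_def by (intro large_tups large_Un large_elts large_lams large_fam_obj A)
  have "u \<in> tup ` lists (fam_obj A \<union> L)" if u: "u \<in> fam_ver A" for u
  proof -
    note D = fam_verD[OF u]
    have "lam (idx (ver_dom u)) (ver_fun u) \<in> L" "lam (idx (ver_dom u)) (ver_memb u) \<in> L"
      unfolding L_def using D(3) U1_trans[OF fam_objD(1)[OF D(1)]] U1_trans[OF fam_objD(1)[OF D(2)]] by blast+
    then have "[ver_dom u, ver_cod u, lam (idx (ver_dom u)) (ver_fun u), lam (idx (ver_dom u)) (ver_memb u)] \<in> lists (fam_obj A \<union> L)"
      using D(1,2) by simp
    then show ?thesis by (rule in_tups[OF D(4)])
  qed
  then show ?thesis using large_subset[OF L] by blast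
qed

lemma large_fam_hor: "large (Obj A) ==> large (Hor A) ==> large (fam_hor A)"
proof -
  assume A: "large (Obj A)" "large (Hor A)"
  define L where "L = {lam P f | P f. elts P \<subseteq> elts U1 \<and> f ` elts P \<subseteq> elts U1 \<union> Hor A}"
  have L: "large (tup ` lists (fam_obj A \<union> elts U1 \<union> L))"
    unfolding L_def by (intro large_tups large_Un large_elts large_lams large_fam_obj A)
  have "h \<in> tup ` lists (fam_obj A \<union> elts U1 \<union> L)" if h: "h \<in> fam_hor A" for h
  proof -
    note D = fam_horD[OF h]
    have "lam (hor_apex h) (hor_left h) \<in> L" "lam (hor_apex h) (hor_right h) \<in> L" "lam (hor_apex h) (hor_memb h) \<in> L"
      unfolding L_def using D(4) U1_trans[OF D(3)] U1_trans[OF fam_objD(1)[OF D(1)]] U1_trans[OF fam_objD(1)[OF D(2)]] by blast+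
    then have "[hor_dom h, hor_cod h, hor_apex h, lam (hor_apex h) (hor_left h),
      lam (hor_apex h) (hor_right h), lam (hor_apex h) (hor_memb h)] \<in> lists (fam_obj A \<union> elts U1 \<union> L)"
      using D(1,2,3) by simp
    then show ?thesis by (rule in_tups[OF D(5)])
  qed
  then show ?thesis using large_subset[OF L] by blast
qed

lemma large_fam_cel:
  assumes A: "large (Obj A)" "large (Ver A)" "large (Hor A)" "large (Cel A)"
  shows "large (fam_cel A)"
proof -
  define L where "L = {lam P f | P f. elts P \<subseteq> tup ` lists (elts U1) \<and> f ` elts P \<subseteq> elts U1 \<union> Cel A}"
  let ?D = "tup ` lists (fam_hor A) \<union> fam_hor A \<union> fam_ver A \<union> L"
  have L: "large (tup ` lists ?D)"
    unfolding L_def by (intro large_tups large_Un large_elts large_lams large_fam_hor large_fam_ver A)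
  have "d \<in> tup ` lists ?D" if d: "d \<in> fam_cel A" for d
  proof -
    note D = fam_celD[OF d]
    let ?P = "span_prod (ver_dom (cel_left d)) (cel_top d)"
    obtain m \<phi> where e: "d = tup [tup (cel_top d), cel_bot d, cel_left d, cel_right d, lam ?P m, lam ?P \<phi>]"
      using D(8) by blast
    note X = fam_verD(1)[OF D(1)] and S = hpath_set[OF D(4)]
    have P: "elts ?P \<subseteq> tup ` lists (elts U1)" using elts_span_prod[OF X S] span_prod_subset[OF X S] by simp
    have "m p \<in> elts U1 \<and> \<phi> p \<in> Cel A" if p: "p \<in> elts ?P" for p
    proof -
      obtain i ss where i: "p = tup (i # ss)" "i \<in> elts (idx (ver_dom (cel_left d)))" "walk i (cel_top d) ss"
        using p elts_span_prod[OF X S] by auto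
      have "cel_fun d p = m p" "cel_memb d p = \<phi> p" by (subst e, use p in simp)+
      then show ?thesis using D(7)[OF i(2,3)] i(1) U1_trans[OF fam_horD(3)[OF D(3)]] by (auto simp: cf_def cm_def)
    qed
    then have "lam ?P m \<in> L" "lam ?P \<phi> \<in> L" unfolding L_def using P by blast+
    then have "[tup (cel_top d), cel_bot d, cel_left d, cel_right d, lam ?P m, lam ?P \<phi>] \<in> lists ?D"
      using D(1-3) S by auto
    then show ?thesis by (rule in_tups[OF e[symmetric]])
  qed
  then show ?thesis using large_subset[OF L] by blast
qed

end

section \<open>The families construction yields virtual double categories\<close>

context universes
begin

subsection \<open>Points of concatenated tops\<close>

text \<open>Let \<open>T d\<close> be the top of \<open>d\<close>. A point of the iterated pullback of the concatenated tops is cut into a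
  list \<open>sss\<close> of points of the individual tops, each starting where the previous one ends; \<open>bmap\<close> evaluates
  a function of \<open>d\<close> and of a point of \<open>T d\<close> on all of these, and \<open>bend\<close> is the end of the last one. The top
  is a parameter since the same cutting is needed for multicells of \<open>fam A\<close> and of a virtual double category
  mapping to it.\<close>

fun bwalk :: "('a => 'v list) => 'v => 'a list => 'v list list => bool" where
  "bwalk T i [] [] \<longleftrightarrow> True"
| "bwalk T i (d # ds) (ss # sss) \<longleftrightarrow> walk i (T d) ss \<and> bwalk T (walk_end i (T d) ss) ds sss"
| "bwalk T i _ _ \<longleftrightarrow> False"

fun bmap :: "('a => 'v list) => ('a => 'v => 'v list => 'b) => 'v => 'a list => 'v list list => 'b list" where
  "bmap T f i (d # ds) (ss # sss) = f d i ss # bmap T f (walk_end i (T d) ss) ds sss"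
| "bmap T f i _ _ = []"

fun bend :: "('a => 'v list) => 'v => 'a list => 'v list list => 'v" where
  "bend T i (d # ds) (ss # sss) = bend T (walk_end i (T d) ss) ds sss"
| "bend T i _ _ = i"

lemma bwalk_Nil_iff [simp]: "bwalk T i [] sss \<longleftrightarrow> sss = []"
  by (cases sss) auto

lemma bwalk_Cons_iff: "bwalk T i (d # ds) sss
    \<longleftrightarrow> (\<exists>ss sss'. sss = ss # sss' \<and> walk i (T d) ss \<and> bwalk T (walk_end i (T d) ss) ds sss')"
  by (cases sss) auto

lemma bwalk_concat:
  "bwalk T i ds sss ==> walk i (concat (map T ds)) (concat sss)
    \<and> walk_end i (concat (map T ds)) (concat sss) = bend T i ds sss"
  by (induction T i ds sss rule: bwalk.induct) (auto simp: walk_append walk_end_append)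

lemma bwalk_exists: "walk i (concat (map T ds)) ss ==> \<exists>sss. ss = concat sss \<and> bwalk T i ds sss"
proof (induction ds arbitrary: i ss)
  case (Cons d ds)
  then obtain ss1 ss2 where ss: "ss = ss1 @ ss2" "walk i (T d) ss1" "walk (walk_end i (T d) ss1) (concat (map T ds)) ss2"
    by (auto simp: walk_append)
  then obtain sss where "ss2 = concat sss" "bwalk T (walk_end i (T d) ss1) ds sss" using Cons.IH by blast
  then show ?case using ss by (intro exI[of _ "ss1 # sss"]) simp
qed simp

lemma bmap_map: "bmap T f i (map g ds) sss = bmap (\<lambda>d. T (g d)) (\<lambda>d. f (g d)) i ds sss"
  by (induction "\<lambda>d. T (g d)" "\<lambda>d. f (g d)" i ds sss rule: bmap.induct) auto

lemma bwalk_map: "bwalk T i (map g ds) sss = bwalk (\<lambda>d. T (g d)) i ds sss"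
  by (induction "\<lambda>d. T (g d)" i ds sss rule: bwalk.induct) auto

lemma bend_map: "bend T i (map g ds) sss = bend (\<lambda>d. T (g d)) i ds sss"
  by (induction "\<lambda>d. T (g d)" i ds sss rule: bend.induct) auto

lemma map_bmap: "map g (bmap T f i ds sss) = bmap T (\<lambda>d i ss. g (f d i ss)) i ds sss"
  by (induction T f i ds sss rule: bmap.induct) auto

lemma bT_cong:
  assumes "\<And>d. d \<in> set ds ==> T d = T' d"
  shows "bmap T f i ds sss = bmap T' f i ds sss" "bwalk T i ds sss = bwalk T' i ds sss" "bend T i ds sss = bend T' i ds sss"
  using assms
  by (induction ds arbitrary: i sss) (case_tac [!] sss, auto)

lemma walk_blocks:
  "bwalk cel_top i ds sss ==> map (\<lambda>(d, b). g d b) (walk_blocks ds i (concat sss))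
    = bmap cel_top (\<lambda>d i ss. g d (tup (i # ss))) i ds sss"
  by (induction "cel_top" i ds sss rule: bwalk.induct) (auto simp: Let_def dest: walk_length)

subsection \<open>Two layers of multicells\<close>

text \<open>The same cutting one level deeper, for the tops of the upper layer of a twofold composite: points are
  grouped first by the multicells of the lower layer, then by those of the upper one.\<close>

fun nwalk :: "'v => 'v list list => 'v list list list => bool" where
  "nwalk i [] [] \<longleftrightarrow> True"
| "nwalk i (ys # yss) (sss # ssss) \<longleftrightarrow> bwalk cel_top i ys sss \<and> nwalk (bend cel_top i ys sss) yss ssss"
| "nwalk i _ _ \<longleftrightarrow> False"

fun nmap :: "('v => 'v => 'v list => 'v) => 'v => 'v list list => 'v list list list => 'v list list" where
  "nmap f i (ys # yss) (sss # ssss) = bmap cel_top f i ys sss # nmap f (bend cel_top i ys sss) yss ssss"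
| "nmap f i _ _ = []"

lemma nwalk_exists:
  "walk i (concat (map cel_top (concat yss))) ss ==> \<exists>ssss. ss = concat (concat ssss) \<and> nwalk i yss ssss"
proof (induction yss arbitrary: i ss)
  case Nil
  then show ?case by (intro exI[of _ "[]"]) simp
next
  case (Cons ys yss)
  then obtain ss1 ss2 where ss: "ss = ss1 @ ss2" "walk i (concat (map cel_top ys)) ss1"
    "walk (walk_end i (concat (map cel_top ys)) ss1) (concat (map cel_top (concat yss))) ss2"
    by (auto simp: walk_append)
  obtain sss where s: "ss1 = concat sss" "bwalk cel_top i ys sss" using bwalk_exists[OF ss(2)] by blast
  then obtain ssss where "ss2 = concat (concat ssss)" "nwalk (bend cel_top i ys sss) yss ssss"
    using Cons.IH ss(3) bwalk_concat[OF s(2)] by metis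
  then show ?case using ss s by (intro exI[of _ "sss # ssss"]) simp
qed

lemma bwalk_append:
  assumes "bwalk T i ds sss"
  shows "bwalk T i (ds @ ys) (sss @ ttt) \<longleftrightarrow> bwalk T (bend T i ds sss) ys ttt"
    "bmap T f i (ds @ ys) (sss @ ttt) = bmap T f i ds sss @ bmap T f (bend T i ds sss) ys ttt"
  using assms by (induction T i ds sss rule: bwalk.induct) auto

lemma nwalk_bwalk:
  assumes "nwalk i yss ssss"
  shows "bwalk cel_top i (concat yss) (concat ssss) \<and> bmap cel_top f i (concat yss) (concat ssss) = concat (nmap f i yss ssss)"
  using assms
  by (induction i yss ssss rule: nwalk.induct) (auto simp: bwalk_append)

definition fam_raw :: "'v vdc => 'v vdc" where
  "fam_raw A = \<lparr>Obj = fam_obj A, Ver = fam_ver A, Hor = fam_hor A, Cel = fam_cel A,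
      vdom = ver_dom, vcod = ver_cod, vide = fam_vide A, vcmp = fam_vcmp A,
      hdom = hor_dom, hcod = hor_cod,
      ctop = cel_top, cbot = cel_bot, cleft = cel_left, cright = cel_right,
      cide = fam_cide A, ccmp = fam_ccmp A\<rparr>"

lemma fam_eq: "fam A = vdc_restrict (fam_raw A)"
  by (simp add: fam_def fam_raw_def)

lemma fam_raw_simps [simp]:
  "Obj (fam_raw A) = fam_obj A" "Ver (fam_raw A) = fam_ver A" "Hor (fam_raw A) = fam_hor A" "Cel (fam_raw A) = fam_cel A"
  "vdom (fam_raw A) = ver_dom" "vcod (fam_raw A) = ver_cod" "vide (fam_raw A) = fam_vide A" "vcmp (fam_raw A) = fam_vcmp A"
  "hdom (fam_raw A) = hor_dom" "hcod (fam_raw A) = hor_cod" "ctop (fam_raw A) = cel_top" "cbot (fam_raw A) = cel_bot"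
  "cleft (fam_raw A) = cel_left" "cright (fam_raw A) = cel_right" "cide (fam_raw A) = fam_cide A" "ccmp (fam_raw A) = fam_ccmp A"
  by (simp_all add: fam_raw_def)

end

locale families = universes elts U1 + base: vdc_laws A
  for elts :: "'v => 'v set" and U1 :: 'v and A :: "'v vdc"
begin

lemma fam_vide_in: "X \<in> fam_obj A ==> fam_vide A X \<in> fam_ver A"
  unfolding fam_vide_def using fam_objD(2)[of X A] base.vide by (intro fam_verI) auto

lemma fam_vide_simps [simp]:
  "ver_dom (fam_vide A X) = X" "ver_cod (fam_vide A X) = X"
  "i \<in> elts (idx X) ==> ver_fun (fam_vide A X) i = i"
  "i \<in> elts (idx X) ==> ver_memb (fam_vide A X) i = vide A (memb X i)"
  by (simp_all add: fam_vide_def)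

lemma fam_vcmp_simps [simp]:
  "ver_dom (fam_vcmp A w u) = ver_dom u" "ver_cod (fam_vcmp A w u) = ver_cod w"
  "i \<in> elts (idx (ver_dom u)) ==> ver_fun (fam_vcmp A w u) i = ver_fun w (ver_fun u i)"
  "i \<in> elts (idx (ver_dom u)) ==> ver_memb (fam_vcmp A w u) i = vcmp A (ver_memb w (ver_fun u i)) (ver_memb u i)"
  by (simp_all add: fam_vcmp_def Let_def)

lemma fam_vcmp_in:
  assumes "u \<in> fam_ver A" "w \<in> fam_ver A" "ver_cod u = ver_dom w"
  shows "fam_vcmp A w u \<in> fam_ver A"
  unfolding fam_vcmp_def Let_def
  using fam_verD(1)[OF assms(1)] fam_verD(2)[OF assms(2)] fam_verD(3)[OF assms(1)] fam_verD(3)[OF assms(2)] assms(3) base.vcmp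
  by (intro fam_verI) auto

lemma fam_vcmp_vide:
  assumes "u \<in> fam_ver A"
  shows "fam_vcmp A u (fam_vide A (ver_dom u)) = u" "fam_vcmp A (fam_vide A (ver_cod u)) u = u"
proof -
  note D = fam_verD[OF assms]
  show "fam_vcmp A u (fam_vide A (ver_dom u)) = u"
    using D(3) base.vcmp_vide by (intro fam_ver_eqI[OF fam_vcmp_in[OF fam_vide_in[OF D(1)] assms] assms]) (simp_all, metis)
  show "fam_vcmp A (fam_vide A (ver_cod u)) u = u"
    using D(3) base.vcmp_vide by (intro fam_ver_eqI[OF fam_vcmp_in[OF assms fam_vide_in[OF D(2)]] assms]) (simp_all, metis)
qed

lemma fam_vcmp_assoc:
  assumes "f \<in> fam_ver A" "g \<in> fam_ver A" "h \<in> fam_ver A" "ver_cod f = ver_dom g" "ver_cod g = ver_dom h"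
  shows "fam_vcmp A (fam_vcmp A h g) f = fam_vcmp A h (fam_vcmp A g f)"
proof (rule fam_ver_eqI)
  show "fam_vcmp A (fam_vcmp A h g) f \<in> fam_ver A" "fam_vcmp A h (fam_vcmp A g f) \<in> fam_ver A"
    using assms by (simp_all add: fam_vcmp_in)
  fix i assume "i \<in> elts (idx (ver_dom (fam_vcmp A (fam_vcmp A h g) f)))"
  then have i: "i \<in> elts (idx (ver_dom f))" by simp
  have j: "ver_fun f i \<in> elts (idx (ver_dom g))" using fam_verD(3)[OF assms(1) i] assms(4) by simp
  have k: "ver_fun g (ver_fun f i) \<in> elts (idx (ver_dom h))" using fam_verD(3)[OF assms(2) j] assms(5) by simp
  show "ver_fun (fam_vcmp A (fam_vcmp A h g) f) i = ver_fun (fam_vcmp A h (fam_vcmp A g f)) i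
    \<and> ver_memb (fam_vcmp A (fam_vcmp A h g) f) i = ver_memb (fam_vcmp A h (fam_vcmp A g f)) i"
    using i j fam_verD(3)[OF assms(1) i] fam_verD(3)[OF assms(2) j] fam_verD(3)[OF assms(3) k] assms(4,5)
      base.vcmp_assoc[of "ver_memb f i" "ver_memb g (ver_fun f i)" "ver_memb h (ver_fun g (ver_fun f i))"] by simp
qed simp_all

lemma fam_cide_simps [simp]:
  "cel_top (fam_cide A h) = [h]" "cel_bot (fam_cide A h) = h" "cel_left (fam_cide A h) = fam_vide A (hor_dom h)"
  "cel_right (fam_cide A h) = fam_vide A (hor_cod h)"
  by (simp_all add: fam_cide_def Let_def)

lemma fam_cide_eval:
  assumes "h \<in> fam_hor A" "s \<in> elts (hor_apex h)"
  shows "cf (fam_cide A h) (hor_left h s) [s] = s" "cm (fam_cide A h) (hor_left h s) [s] = cide A (hor_memb h s)"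
proof -
  note X = fam_horD(1)[OF assms(1)] and D = fam_horD(4)[OF assms]
  show "cf (fam_cide A h) (hor_left h s) [s] = s" "cm (fam_cide A h) (hor_left h s) [s] = cide A (hor_memb h s)"
    unfolding fam_cide_def Let_def
    using cf_tup[OF X, of "[h]"] cm_tup[OF X, of "[h]"] assms D by simp_all
qed

lemma fam_cide_in:
  assumes "h \<in> fam_hor A"
  shows "fam_cide A h \<in> fam_cel A"
  unfolding fam_cide_def Let_def
proof (rule fam_celI)
  note D = fam_horD[OF assms]
  show "fam_vide A (hor_dom h) \<in> fam_ver A" "fam_vide A (hor_cod h) \<in> fam_ver A" using D fam_vide_in by auto
  fix i ss assume i: "i \<in> elts (idx (ver_dom (fam_vide A (hor_dom h))))" "walk i [h] ss"
  then obtain s where s: "ss = [s]" "s \<in> elts (hor_apex h)" "hor_left h s = i" by (auto simp: walk_Cons_iff)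
  have e: "walk_end i [h] ss = hor_right h s" using s by (simp add: walk_end_def)
  show "proj (tup (i # ss)) 1 \<in> elts (hor_apex h) \<and>
       hor_left h (proj (tup (i # ss)) 1) = ver_fun (fam_vide A (hor_dom h)) i \<and>
       hor_right h (proj (tup (i # ss)) 1) = ver_fun (fam_vide A (hor_cod h)) (walk_end i [h] ss) \<and>
       cide A (hor_memb h (proj (tup (i # ss)) 1)) \<in> Cel A \<and>
       ctop A (cide A (hor_memb h (proj (tup (i # ss)) 1))) = map2 hor_memb [h] ss \<and>
       cbot A (cide A (hor_memb h (proj (tup (i # ss)) 1))) = hor_memb h (proj (tup (i # ss)) 1) \<and>
       cleft A (cide A (hor_memb h (proj (tup (i # ss)) 1))) = ver_memb (fam_vide A (hor_dom h)) i \<and>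
       cright A (cide A (hor_memb h (proj (tup (i # ss)) 1))) = ver_memb (fam_vide A (hor_cod h)) (walk_end i [h] ss)"
    unfolding e using s D(4)[OF s(2)] base.cide[of "hor_memb h s"] by simp
qed (use fam_horD[OF assms] assms in simp_all)

lemma fam_path_bots:
  "cell_path (fam_raw A) u ds ==> fpath A (ver_cod u) (map cel_bot ds) (ver_cod (cell_path_end (fam_raw A) u ds))"
proof (induction ds arbitrary: u)
  case (Cons d ds)
  then show ?case using fam_celD(3,5,6)[of d A] Cons.IH[of "cel_right d"] by auto
qed (simp add: fam_verD)

lemma fam_path_tops:
  "cell_path (fam_raw A) u ds ==> fpath A (ver_dom u) (concat (map cel_top ds)) (ver_dom (cell_path_end (fam_raw A) u ds))"
proof (induction ds arbitrary: u)
  case (Cons d ds)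
  then show ?case using fam_celD(4)[of d A] hpath_append Cons.IH[of "cel_right d"] by fastforce
qed (simp add: fam_verD)

lemma fam_path_start: "cell_path (fam_raw A) u ds ==> u \<in> fam_ver A"
  using fam_celD(1) by (cases ds) auto

lemma fam_path_end: "cell_path (fam_raw A) u ds ==> cell_path_end (fam_raw A) u ds \<in> fam_ver A"
  by (induction ds arbitrary: u) auto

lemma fam_ccmp_simps:
  "cel_top (fam_ccmp A k u ds) = concat (map cel_top ds)" "cel_bot (fam_ccmp A k u ds) = cel_bot k"
  "cel_left (fam_ccmp A k u ds) = fam_vcmp A (cel_left k) u"
  "cel_right (fam_ccmp A k u ds) = fam_vcmp A (cel_right k) (cell_path_end (fam_raw A) u ds)"
  by (simp_all add: fam_ccmp_def Let_def cell_path_end_def)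

text \<open>By induction along the path: since the span morphisms are compatible with the legs, the end of each value is
  the start of the next. So the values of a path of multicells can be fed to a multicell below it.\<close>

lemma fam_cell_path_eval:
  assumes "cell_path (fam_raw A) u ds" "i \<in> elts (idx (ver_dom u))" "bwalk cel_top i ds sss"
  defines "e \<equiv> cell_path_end (fam_raw A) u ds"
  shows "walk (ver_fun u i) (map cel_bot ds) (bmap cel_top cf i ds sss)
    \<and> walk_end (ver_fun u i) (map cel_bot ds) (bmap cel_top cf i ds sss) = ver_fun e (bend cel_top i ds sss)
    \<and> bend cel_top i ds sss \<in> elts (idx (ver_dom e))
    \<and> cell_path A (ver_memb u i) (bmap cel_top cm i ds sss)
    \<and> cell_path_end A (ver_memb u i) (bmap cel_top cm i ds sss) = ver_memb e (bend cel_top i ds sss)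
    \<and> map (cbot A) (bmap cel_top cm i ds sss) = map2 hor_memb (map cel_bot ds) (bmap cel_top cf i ds sss)
    \<and> concat (map (ctop A) (bmap cel_top cm i ds sss)) = map2 hor_memb (concat (map cel_top ds)) (concat sss)"
  using assms(1-3) unfolding e_def
proof (induction ds arbitrary: u i sss)
  case Nil
  then show ?case using fam_verD(3)[of u A i] by simp
next
  case (Cons d ds)
  then obtain ss sss' where s: "sss = ss # sss'" "walk i (cel_top d) ss" "bwalk cel_top (walk_end i (cel_top d) ss) ds sss'"
    by (auto simp: bwalk_Cons_iff)
  have d: "d \<in> fam_cel A" "cel_left d = u" "cell_path (fam_raw A) (cel_right d) ds" using Cons.prems by auto
  note D = fam_celD[OF d(1)]
  have i: "i \<in> elts (idx (ver_dom (cel_left d)))" using Cons.prems d by simp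
  have e: "walk_end i (cel_top d) ss \<in> elts (idx (ver_dom (cel_right d)))"
    using walk_end_in[OF D(4) s(2) i] .
  note IH = Cons.IH[OF d(3) e s(3)]
  have l: "length (cel_top d) = length ss" using walk_length[OF s(2)] by simp
  show ?case
    using IH D(7)[OF i s(2)] d s(1) l by (simp add: walk_end_Cons)
qed

lemma fam_composableD:
  assumes "composable (fam_raw A) k u ds"
  shows "k \<in> fam_cel A" "cell_path (fam_raw A) u ds" "ver_cod u = ver_dom (cel_left k)" "map cel_bot ds = cel_top k"
    "u \<in> fam_ver A" "cell_path_end (fam_raw A) u ds \<in> fam_ver A"
    "ver_cod (cell_path_end (fam_raw A) u ds) = ver_dom (cel_right k)"
proof -
  show *: "k \<in> fam_cel A" "cell_path (fam_raw A) u ds" "ver_cod u = ver_dom (cel_left k)" "map cel_bot ds = cel_top k"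
    using assms by (auto simp: composable_def)
  show "u \<in> fam_ver A" "cell_path_end (fam_raw A) u ds \<in> fam_ver A"
    using fam_path_start fam_path_end *(2) by auto
  show "ver_cod (cell_path_end (fam_raw A) u ds) = ver_dom (cel_right k)"
    using fam_path_bots[OF *(2)] fam_celD(4)[OF *(1)] *(3,4) hpath_unique by metis
qed

lemma fam_composable_eval:
  assumes c: "composable (fam_raw A) k u ds" and i: "i \<in> elts (idx (ver_dom u))" "bwalk cel_top i ds sss"
  shows "ver_fun u i \<in> elts (idx (ver_dom (cel_left k)))" "walk (ver_fun u i) (cel_top k) (bmap cel_top cf i ds sss)"
    "composable A (cm k (ver_fun u i) (bmap cel_top cf i ds sss)) (ver_memb u i) (bmap cel_top cm i ds sss)"
proof -
  note C = fam_composableD[OF c]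
  note E = fam_cell_path_eval[OF C(2) i]
  show a: "ver_fun u i \<in> elts (idx (ver_dom (cel_left k)))" "walk (ver_fun u i) (cel_top k) (bmap cel_top cf i ds sss)"
    using fam_verD(3)[OF C(5) i(1)] C(3) E C(4) by simp_all
  note D = fam_celD(7)[OF C(1) a]
  show "composable A (cm k (ver_fun u i) (bmap cel_top cf i ds sss)) (ver_memb u i) (bmap cel_top cm i ds sss)"
    unfolding composable_def
    using D E C(3,4) fam_verD(3)[OF C(5) i(1)] fam_verD(3)[OF fam_celD(1)[OF C(1)] a(1)] by simp
qed

text \<open>The value of a composite at a point is computed from the blocks of that point. Reasoning about
  composites in \<open>fam A\<close> goes through this lemma.\<close>

lemma fam_ccmp_eval:
  assumes c: "composable (fam_raw A) k u ds" and i: "i \<in> elts (idx (ver_dom u))" "bwalk cel_top i ds sss"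
  shows "cf (fam_ccmp A k u ds) i (concat sss) = cf k (ver_fun u i) (bmap cel_top cf i ds sss)"
    "cm (fam_ccmp A k u ds) i (concat sss)
      = ccmp A (cm k (ver_fun u i) (bmap cel_top cf i ds sss)) (ver_memb u i) (bmap cel_top cm i ds sss)"
proof -
  note C = fam_composableD[OF c]
  note X = fam_verD(1)[OF C(5)] and S = hpath_set[OF fam_path_tops[OF C(2)]]
  note w = bwalk_concat[OF i(2), THEN conjunct1]
  have b: "map (\<lambda>(d, y). cel_fun d y) (walk_blocks ds i (concat sss)) = bmap cel_top cf i ds sss"
    "map (\<lambda>(d, y). cel_memb d y) (walk_blocks ds i (concat sss)) = bmap cel_top cm i ds sss"
    using walk_blocks[OF i(2), of cel_fun] walk_blocks[OF i(2), of cel_memb] by (simp_all add: cf_def[abs_def] cm_def[abs_def])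
  show "cf (fam_ccmp A k u ds) i (concat sss) = cf k (ver_fun u i) (bmap cel_top cf i ds sss)"
    "cm (fam_ccmp A k u ds) i (concat sss)
      = ccmp A (cm k (ver_fun u i) (bmap cel_top cf i ds sss)) (ver_memb u i) (bmap cel_top cm i ds sss)"
    unfolding fam_ccmp_def Let_def
    by (simp_all add: cf_tup[OF X S refl i(1) w] cm_tup[OF X S refl i(1) w] b, simp_all add: cf_def cm_def)
qed

lemma fam_ccmp_in:
  assumes c: "composable (fam_raw A) k u ds"
  shows "fam_ccmp A k u ds \<in> fam_cel A"
proof -
  note C = fam_composableD[OF c] and K = fam_celD[OF C(1)]
  let ?hs = "concat (map cel_top ds)" and ?l = "fam_vcmp A (cel_left k) u"
    and ?e = "cell_path_end (fam_raw A) u ds"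
  let ?r = "fam_vcmp A (cel_right k) ?e"
  let ?P = "span_prod (ver_dom ?l) ?hs"
  obtain m \<phi> where e: "fam_ccmp A k u ds = tup [tup ?hs, cel_bot k, ?l, ?r, lam ?P m, lam ?P \<phi>]"
    unfolding fam_ccmp_def Let_def cell_path_end_def fam_vcmp_simps fam_raw_simps by blast
  note X = fam_verD(1)[OF C(5)] and S = hpath_set[OF fam_path_tops[OF C(2)]]
  show ?thesis
    unfolding e
  proof (rule fam_celI)
    show "?l \<in> fam_ver A" "?r \<in> fam_ver A" using fam_vcmp_in C K by simp_all
    fix i ss assume i: "i \<in> elts (idx (ver_dom ?l))" "walk i ?hs ss"
    then have i1: "i \<in> elts (idx (ver_dom u))" by simp
    obtain sss where s: "ss = concat sss" "bwalk cel_top i ds sss" using bwalk_exists[OF i(2)] by blast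
    note w = bwalk_concat[OF s(2), THEN conjunct2] and E = fam_cell_path_eval[OF C(2) i1 s(2)]
      and V = fam_composable_eval[OF c i1 s(2)]
    note M = fam_celD(7)[OF C(1) V(1,2)] and co = base.ccmp[OF V(3)]
    have m: "m (tup (i # ss)) = cf k (ver_fun u i) (bmap cel_top cf i ds sss)"
      "\<phi> (tup (i # ss)) = ccmp A (cm k (ver_fun u i) (bmap cel_top cf i ds sss)) (ver_memb u i) (bmap cel_top cm i ds sss)"
      using fam_ccmp_eval[OF c i1 s(2)] cf_tup[OF X S _ i1 i(2), of ?P] cm_tup[OF X S _ i1 i(2), of ?P] s(1) unfolding e by simp_all
    show "m (tup (i # ss)) \<in> elts (hor_apex (cel_bot k)) \<and>
         hor_left (cel_bot k) (m (tup (i # ss))) = ver_fun ?l i \<and>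
         hor_right (cel_bot k) (m (tup (i # ss))) = ver_fun ?r (walk_end i ?hs ss) \<and>
         \<phi> (tup (i # ss)) \<in> Cel A \<and>
         ctop A (\<phi> (tup (i # ss))) = map2 hor_memb ?hs ss \<and>
         cbot A (\<phi> (tup (i # ss))) = hor_memb (cel_bot k) (m (tup (i # ss))) \<and>
         cleft A (\<phi> (tup (i # ss))) = ver_memb ?l i \<and>
         cright A (\<phi> (tup (i # ss))) = ver_memb ?r (walk_end i ?hs ss)"
      unfolding s(1) m[unfolded s(1)] w using M co E i1 C(4) by simp
  qed (use K C fam_path_tops[OF C(2)] in simp_all)
qed

lemma vdc_ops_fam: "vdc_ops (fam_raw A)"
  by unfold_locales
    (auto simp: fam_verD fam_vide_in fam_vcmp_in fam_horD fam_cide_in fam_ccmp_in fam_ccmp_simps fam_celD)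

interpretation F: vdc_ops "fam_raw A" by (rule vdc_ops_fam)

text \<open>Evaluating at a point turns the two layers of a twofold composite in \<open>fam_raw A\<close> into two
  layers of multicells of \<open>A\<close>.\<close>

lemma nmap_eval:
  assumes "list_all2 (\<lambda>d ys. map cel_bot ys = cel_top d) ds yss"
    and "cell_path (fam_raw A) u ds" "cell_path (fam_raw A) w (concat yss)" "ver_cod w = ver_dom u"
    and "i \<in> elts (idx (ver_dom w))" "nwalk i yss ssss"
  shows "bwalk cel_top (ver_fun w i) ds (nmap cf i yss ssss)
    \<and> bwalk cel_top i (ccmp_blocks (fam_raw A) w ds yss) (map concat ssss)
    \<and> bmap cel_top cf i (ccmp_blocks (fam_raw A) w ds yss) (map concat ssss) = bmap cel_top cf (ver_fun w i) ds (nmap cf i yss ssss)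
    \<and> bmap cel_top cm i (ccmp_blocks (fam_raw A) w ds yss) (map concat ssss)
        = ccmp_blocks A (ver_memb w i) (bmap cel_top cm (ver_fun w i) ds (nmap cf i yss ssss)) (nmap cm i yss ssss)
    \<and> list_all2 (\<lambda>d ys. map (cbot A) ys = ctop A d) (bmap cel_top cm (ver_fun w i) ds (nmap cf i yss ssss)) (nmap cm i yss ssss)"
  using assms
proof (induction arbitrary: u w i ssss rule: list_all2_induct)
  case Nil
  then show ?case by (cases ssss) auto
next
  case (Cons d ds ys yss)
  then obtain sss ssss' where s: "ssss = sss # ssss'" "bwalk cel_top i ys sss" "nwalk (bend cel_top i ys sss) yss ssss'"
    by (cases ssss) auto
  have p: "cell_path (fam_raw A) w ys" "cell_path (fam_raw A) (cell_path_end (fam_raw A) w ys) (concat yss)"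
    and d: "d \<in> fam_cel A" "cel_left d = u" "cell_path (fam_raw A) (cel_right d) ds"
    using Cons.prems by (auto simp: F.cell_path_append)
  have c: "composable (fam_raw A) d w ys" using Cons p d by (simp add: composable_def)
  note E = fam_cell_path_eval[OF p(1) Cons.prems(4) s(2)] and V = fam_composable_eval[OF c Cons.prems(4) s(2)]
    and ev = fam_ccmp_eval[OF c Cons.prems(4) s(2)] and w = bwalk_concat[OF s(2)] and C = fam_composableD[OF c]
  have b: "bend cel_top i ys sss \<in> elts (idx (ver_dom (cell_path_end (fam_raw A) w ys)))" using E by simp
  note IH = Cons.IH[OF d(3) p(2) C(7) b s(3)]
  have e: "walk_end (ver_fun w i) (cel_top d) (bmap cel_top cf i ys sss)
      = ver_fun (cell_path_end (fam_raw A) w ys) (bend cel_top i ys sss)"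
    using E C(4) by simp
  have t: "map (cbot A) (bmap cel_top cm i ys sss) = ctop A (cm d (ver_fun w i) (bmap cel_top cf i ys sss))"
    using V(3) by (simp add: composable_def)
  show ?case
    using IH V ev w E e t C(4) s(1) by (simp add: fam_ccmp_simps)
qed

text \<open>The boundaries agree by the general argument. At each point, the maps agree because both evaluate the
  same blocks, and the members agree by associativity in \<open>A\<close>.\<close>

lemma fam_ccmp_assoc:
  assumes c: "composable (fam_raw A) k u ds" and w: "cell_path (fam_raw A) w (concat yss)" "ver_cod w = ver_dom u"
    and l: "list_all2 (\<lambda>d ys. map cel_bot ys = cel_top d) ds yss"
  shows "fam_ccmp A (fam_ccmp A k u ds) w (concat yss) = fam_ccmp A k (fam_vcmp A u w) (ccmp_blocks (fam_raw A) w ds yss)"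
proof -
  note C = fam_composableD[OF c]
  have l': "list_all2 (\<lambda>d ys. map (cbot (fam_raw A)) ys = ctop (fam_raw A) d) ds yss" using l by simp
  note b = F.ccmp_assoc_boundary[OF c w(1) _ l', simplified, OF w(2) fam_vcmp_assoc]
  note cc = F.composable_blocks[OF c w(1) _ l', simplified, OF w(2)]
  have W: "w \<in> fam_ver A" using fam_path_start[OF w(1)] .
  show ?thesis
  proof (rule fam_cel_eqI[OF b])
    fix i ss assume i: "i \<in> elts (idx (ver_dom (cel_left (fam_ccmp A (fam_ccmp A k u ds) w (concat yss)))))"
      "walk i (cel_top (fam_ccmp A (fam_ccmp A k u ds) w (concat yss))) ss"
    then have i1: "i \<in> elts (idx (ver_dom w))" by (simp add: fam_ccmp_simps)
    obtain ssss where s: "ss = concat (concat ssss)" "nwalk i yss ssss"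
      using i(2) nwalk_exists[of i yss ss] by (auto simp: fam_ccmp_simps)
    have "concat (concat zs) = concat (map concat zs)" for zs :: "'v list list list" by (induction zs) auto
    then have s2: "ss = concat (map concat ssss)" using s(1) by simp
    note N = nmap_eval[OF l C(2) w(1) w(2) i1 s(2)]
    note B1 = nwalk_bwalk[OF s(2), of cf] and B2 = nwalk_bwalk[OF s(2), of cm]
    have wi: "ver_fun w i \<in> elts (idx (ver_dom u))" using fam_verD(3)[OF W i1] w(2) by simp
    note N1 = N[THEN conjunct1]
    note ev1 = fam_ccmp_eval[OF cc(2) i1 B1[THEN conjunct1]] and ev2 = fam_ccmp_eval[OF c wi N1]
    have vd: "i \<in> elts (idx (ver_dom (fam_vcmp A u w)))" using i1 by simp
    note ev3 = fam_ccmp_eval[OF cc(1) vd N[THEN conjunct2, THEN conjunct1]]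
    note V = fam_composable_eval[OF c wi N1]
    have cp: "cell_path A (ver_memb w i) (concat (nmap cm i yss ssss))"
      using fam_cell_path_eval[OF w(1) i1 B1[THEN conjunct1]] B2 by simp
    have vm: "vcod A (ver_memb w i) = vdom A (ver_memb u (ver_fun w i))"
      using fam_verD(3)[OF W i1] fam_verD(3)[OF C(5) wi] w(2) by simp
    note as = base.ccmp_assoc[OF V(3) cp vm]
    show "cf (fam_ccmp A (fam_ccmp A k u ds) w (concat yss)) i ss
        = cf (fam_ccmp A k (fam_vcmp A u w) (ccmp_blocks (fam_raw A) w ds yss)) i ss
      \<and> cm (fam_ccmp A (fam_ccmp A k u ds) w (concat yss)) i ss
        = cm (fam_ccmp A k (fam_vcmp A u w) (ccmp_blocks (fam_raw A) w ds yss)) i ss"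
    proof
      show "cf (fam_ccmp A (fam_ccmp A k u ds) w (concat yss)) i ss
        = cf (fam_ccmp A k (fam_vcmp A u w) (ccmp_blocks (fam_raw A) w ds yss)) i ss"
        using ev1 ev2 ev3 B1 N i1 by (subst s(1), subst s2) simp
      show "cm (fam_ccmp A (fam_ccmp A k u ds) w (concat yss)) i ss
        = cm (fam_ccmp A k (fam_vcmp A u w) (ccmp_blocks (fam_raw A) w ds yss)) i ss"
        using ev1 ev2 ev3 B1 B2 N as i1 by (subst s(1), subst s2) simp
    qed
  qed
qed

lemma fam_cide_path:
  assumes "fpath A X hs Y"
  shows "cell_path (fam_raw A) (fam_vide A X) (map (fam_cide A) hs)"
    "cell_path_end (fam_raw A) (fam_vide A X) (map (fam_cide A) hs) = fam_vide A Y"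
  using assms by (induction hs arbitrary: X) (auto simp: fam_vide_in fam_cide_in)

lemma fam_cide_points:
  assumes "walk i hs ss" "set hs \<subseteq> fam_hor A"
  shows "bwalk cel_top i (map (fam_cide A) hs) (map (\<lambda>s. [s]) ss)
    \<and> bmap cel_top cf i (map (fam_cide A) hs) (map (\<lambda>s. [s]) ss) = ss
    \<and> bmap cel_top cm i (map (fam_cide A) hs) (map (\<lambda>s. [s]) ss) = map (cide A) (map2 hor_memb hs ss)"
  using assms
proof (induction hs arbitrary: i ss)
  case (Cons h hs)
  then obtain s ss' where s: "ss = s # ss'" "s \<in> elts (hor_apex h)" "hor_left h s = i" "walk (hor_right h s) hs ss'"
    by (auto simp: walk_Cons_iff)
  then show ?case using Cons.IH[OF s(4)] Cons.prems fam_cide_eval[of h s] by (auto simp: walk_end_def)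
qed simp

lemma fam_ccmp_units:
  assumes d: "d \<in> fam_cel A"
  shows "fam_ccmp A (fam_cide A (cel_bot d)) (cel_left d) [d] = d"
    "fam_ccmp A d (fam_vide A (ver_dom (cel_left d))) (map (fam_cide A) (cel_top d)) = d"
proof -
  note D = fam_celD[OF d]
  have c1: "composable (fam_raw A) (fam_cide A (cel_bot d)) (cel_left d) [d]"
    using d D fam_cide_in by (simp add: composable_def)
  show "fam_ccmp A (fam_cide A (cel_bot d)) (cel_left d) [d] = d"
  proof (rule fam_cel_eqI[OF fam_ccmp_in[OF c1] d])
    fix i ss assume "i \<in> elts (idx (ver_dom (cel_left (fam_ccmp A (fam_cide A (cel_bot d)) (cel_left d) [d]))))"
      "walk i (cel_top (fam_ccmp A (fam_cide A (cel_bot d)) (cel_left d) [d])) ss"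
    then have i: "i \<in> elts (idx (ver_dom (cel_left d)))" "walk i (cel_top d) ss" by (auto simp: fam_ccmp_simps)
    have b: "bwalk cel_top i [d] [ss]" using i by simp
    note ev = fam_ccmp_eval[OF c1 i(1) b] and M = D(7)[OF i]
    show "cf (fam_ccmp A (fam_cide A (cel_bot d)) (cel_left d) [d]) i ss = cf d i ss
      \<and> cm (fam_ccmp A (fam_cide A (cel_bot d)) (cel_left d) [d]) i ss = cm d i ss"
      using ev M fam_cide_eval[OF D(3), of "cf d i ss"] base.ccmp_cide_left[of "cm d i ss"] by simp
  qed (use D fam_vcmp_vide[OF D(1)] fam_vcmp_vide[OF D(2)] in \<open>simp_all add: fam_ccmp_simps\<close>)
  have c2: "composable (fam_raw A) d (fam_vide A (ver_dom (cel_left d))) (map (fam_cide A) (cel_top d))"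
    using d fam_cide_path[OF D(4)] by (simp add: composable_def comp_def)
  let ?c = "fam_ccmp A d (fam_vide A (ver_dom (cel_left d))) (map (fam_cide A) (cel_top d))"
  have tops: "concat (map cel_top (map (fam_cide A) hs)) = hs" for hs by (induction hs) auto
  show "?c = d"
  proof (rule fam_cel_eqI[OF fam_ccmp_in[OF c2] d])
    show "cel_top ?c = cel_top d" using tops by (simp add: fam_ccmp_simps)
    fix i ss assume "i \<in> elts (idx (ver_dom (cel_left ?c)))" "walk i (cel_top ?c) ss"
    then have i: "i \<in> elts (idx (ver_dom (cel_left d)))" "walk i (cel_top d) ss"
      using tops[of "cel_top d"] by (auto simp: fam_ccmp_simps)
    have i': "i \<in> elts (idx (ver_dom (fam_vide A (ver_dom (cel_left d)))))" using i by simp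
    note P = fam_cide_points[OF i(2) hpath_set[OF D(4)]]
    note ev = fam_ccmp_eval[OF c2 i' P[THEN conjunct1]] and M = D(7)[OF i] and V = fam_verD(3)[OF D(1) i(1)]
    have cc: "concat (map (\<lambda>s. [s]) ss) = ss" by (induction ss) auto
    show "cf ?c i ss = cf d i ss \<and> cm ?c i ss = cm d i ss"
      using ev[unfolded cc] P M V i base.ccmp_cide_right[of "cm d i ss"] by simp
  qed (use D fam_vcmp_vide[OF D(1)] fam_vcmp_vide[OF D(2)] fam_cide_path[OF D(4)] in \<open>simp_all add: fam_ccmp_simps\<close>)
qed

lemma vdc_laws_fam: "vdc_laws (fam_raw A)"
  by unfold_locales
    (auto simp: fam_vcmp_vide fam_vcmp_assoc fam_ccmp_units fam_ccmp_assoc)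

lemma virtual_double_category_fam: "virtual_double_category (fam A)"
  unfolding fam_eq by (rule vdc_laws.virtual_double_category_restrict[OF vdc_laws_fam])

end

context families
begin

lemma fam_simps [simp]:
  "Obj (fam A) = fam_obj A" "Ver (fam A) = fam_ver A" "Hor (fam A) = fam_hor A" "Cel (fam A) = fam_cel A"
  "u \<in> fam_ver A ==> vdom (fam A) u = ver_dom u" "u \<in> fam_ver A ==> vcod (fam A) u = ver_cod u"
  "X \<in> fam_obj A ==> vide (fam A) X = fam_vide A X"
  "f \<in> fam_ver A ==> g \<in> fam_ver A ==> ver_cod f = ver_dom g ==> vcmp (fam A) g f = fam_vcmp A g f"
  "h \<in> fam_hor A ==> hdom (fam A) h = hor_dom h" "h \<in> fam_hor A ==> hcod (fam A) h = hor_cod h"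
  "d \<in> fam_cel A ==> ctop (fam A) d = cel_top d" "d \<in> fam_cel A ==> cbot (fam A) d = cel_bot d"
  "d \<in> fam_cel A ==> cleft (fam A) d = cel_left d" "d \<in> fam_cel A ==> cright (fam A) d = cel_right d"
  "h \<in> fam_hor A ==> cide (fam A) h = fam_cide A h"
  "composable (fam_raw A) k u ds ==> ccmp (fam A) k u ds = fam_ccmp A k u ds"
  by (simp_all add: fam_eq)

lemma fam_composable [simp]: "composable (fam A) = composable (fam_raw A)"
  by (intro ext) (simp add: fam_eq vdc_ops.composable_restrict[OF vdc_ops_fam])

lemma fam_cell_path [simp]: "cell_path (fam A) = cell_path (fam_raw A)"
  by (intro ext) (simp add: fam_eq)

lemma fam_cell_path_end [simp]: "cell_path (fam_raw A) u ds ==> cell_path_end (fam A) u ds = cell_path_end (fam_raw A) u ds"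
  by (simp add: fam_eq cell_path_end_restrict)

lemma fam_path: "hpath (fam_obj A) (fam_hor A) (hdom (fam A)) (hcod (fam A)) = fpath A"
  by (intro ext hpath_cong) simp

lemma fam_ccmp1:
  assumes "k \<in> fam_cel A" "d \<in> fam_cel A" "cel_top k = [cel_bot d]"
  shows "ccmp1 (fam A) k d = fam_ccmp A k (cel_left d) [d]" "composable (fam_raw A) k (cel_left d) [d]"
proof -
  show c: "composable (fam_raw A) k (cel_left d) [d]"
    using vdc_ops.composable1[OF vdc_ops_fam, of k d] assms by simp
  show "ccmp1 (fam A) k d = fam_ccmp A k (cel_left d) [d]" using c assms by simp
qed

end

section \<open>The virtual double category of elements\<close>

context universes
begin

abbreviation points :: "'v vdfun => 'v => 'v set" where "points G x \<equiv> elts (idx (fobj G x))"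
abbreviation arcs :: "'v vdfun => 'v => 'v set" where "arcs G h \<equiv> elts (hor_apex (fhor G h))"

text \<open>Elements over data of \<open>X\<close> are coded as tuples of the datum and a point: \<open>tup [x, i]\<close>, \<open>tup [u, i]\<close>,
  \<open>tup [h, s]\<close>, and \<open>tup (d # i # ss)\<close> for a multicell with a point of its top. The projections are to the base
  datum, to the (first) point and to the remaining list \<open>ss\<close>.\<close>

definition bs :: "'v => 'v" where "bs p = hd (untup p)"
definition pt :: "'v => 'v" where "pt p = hd (tl (untup p))"
definition pts :: "'v => 'v list" where "pts p = tl (tl (untup p))"

lemma bs_tup [simp]: "bs (tup (x # xs)) = x" "pt (tup (x # i # xs)) = i" "pts (tup (x # i # xs)) = xs"
  by (simp_all add: bs_def pt_def pts_def)

text \<open>The category of elements in its form for virtual double categories: a horizontal morphism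
  comes with an element of its span, and a vertical morphism or multicell with a point at its source, from
  which \<open>G\<close> determines the one at its target.\<close>

definition el_raw :: "'v vdfun => 'v vdc" where
  "el_raw G = (let X = fdom G in
    \<lparr>Obj = {tup [x, i] | x i. x \<in> Obj X \<and> i \<in> points G x},
     Ver = {tup [u, i] | u i. u \<in> Ver X \<and> i \<in> points G (vdom X u)},
     Hor = {tup [h, s] | h s. h \<in> Hor X \<and> s \<in> arcs G h},
     Cel = {tup (d # i # ss) | d i ss. d \<in> Cel X \<and> i \<in> points G (corner X d)
       \<and> walk i (map (fhor G) (ctop X d)) ss},
     vdom = (\<lambda>p. tup [vdom X (bs p), pt p]),
     vcod = (\<lambda>p. tup [vcod X (bs p), ver_fun (fver G (bs p)) (pt p)]),
     vide = (\<lambda>p. tup [vide X (bs p), pt p]),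
     vcmp = (\<lambda>q p. tup [vcmp X (bs q) (bs p), pt p]),
     hdom = (\<lambda>p. tup [hdom X (bs p), hor_left (fhor G (bs p)) (pt p)]),
     hcod = (\<lambda>p. tup [hcod X (bs p), hor_right (fhor G (bs p)) (pt p)]),
     ctop = (\<lambda>p. map2 (\<lambda>h s. tup [h, s]) (ctop X (bs p)) (pts p)),
     cbot = (\<lambda>p. tup [cbot X (bs p), cf (fcel G (bs p)) (pt p) (pts p)]),
     cleft = (\<lambda>p. tup [cleft X (bs p), pt p]),
     cright = (\<lambda>p. tup [cright X (bs p), walk_end (pt p) (map (fhor G) (ctop X (bs p))) (pts p)]),
     cide = (\<lambda>p. tup [cide X (bs p), hor_left (fhor G (bs p)) (pt p), pt p]),
     ccmp = (\<lambda>k u ds. tup (ccmp X (bs k) (bs u) (map bs ds) # pt u # concat (map pts ds)))\<rparr>)"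

definition el :: "'v vdfun => 'v vdc" where "el G = vdc_restrict (el_raw G)"

end

locale elements = families elts U1 B + G: vd_functor G X "fam B"
  for elts :: "'v => 'v set" and U1 :: 'v and B :: "'v vdc" and G :: "'v vdfun" and X :: "'v vdc"
begin

lemma G_obj: "x \<in> Obj X ==> fobj G x \<in> fam_obj B"
  using G.obj by simp

lemma G_ver: "u \<in> Ver X ==> fver G u \<in> fam_ver B \<and> ver_dom (fver G u) = fobj G (vdom X u) \<and> ver_cod (fver G u) = fobj G (vcod X u)"
  using G.ver[of u] by auto

lemma G_hor: "h \<in> Hor X ==> fhor G h \<in> fam_hor B \<and> hor_dom (fhor G h) = fobj G (hdom X h) \<and> hor_cod (fhor G h) = fobj G (hcod X h)"
  using G.hor[of h] by auto

lemma G_cel: "d \<in> Cel X ==> fcel G d \<in> fam_cel B \<and> cel_top (fcel G d) = map (fhor G) (ctop X d)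
    \<and> cel_bot (fcel G d) = fhor G (cbot X d) \<and> cel_left (fcel G d) = fver G (cleft X d)
    \<and> cel_right (fcel G d) = fver G (cright X d)"
  using G.cel[of d] by auto

lemma G_vide: "x \<in> Obj X ==> fver G (vide X x) = fam_vide B (fobj G x)"
  using G.vid[of x] G_obj[of x] by simp

lemma G_vcmp: "f \<in> Ver X ==> g \<in> Ver X ==> vcod X f = vdom X g ==> fver G (vcmp X g f) = fam_vcmp B (fver G g) (fver G f)"
  using G.vcmp[of f g] G_ver[of f] G_ver[of g] by simp

lemma G_cide: "h \<in> Hor X ==> fcel G (cide X h) = fam_cide B (fhor G h)"
  using G.cid[of h] G_hor[of h] by simp

lemma G_composable: "composable X k u ds ==> composable (fam_raw B) (fcel G k) (fver G u) (map (fcel G) ds)"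
  using G.composable[of k u ds] by simp

lemma G_ccmp: "composable X k u ds ==> fcel G (ccmp X k u ds) = fam_ccmp B (fcel G k) (fver G u) (map (fcel G) ds)"
  using G.ccmp[of k u ds] G_composable[of k u ds] by simp

lemma G_path: "G.A.path a hs b ==> fpath B (fobj G a) (map (fhor G) hs) (fobj G b)"
  using G.hpath[of a hs b] by (simp add: fam_path)

lemma G_cell_path: "cell_path X u ds ==> cell_path (fam_raw B) (fver G u) (map (fcel G) ds)"
  "cell_path X u ds ==> cell_path_end (fam_raw B) (fver G u) (map (fcel G) ds) = fver G (cell_path_end X u ds)"
  using G.cell_path[of u ds] by auto

abbreviation top' :: "'v => 'v list" where "top' d \<equiv> map (fhor G) (ctop X d)"

lemma el_raw_simps [simp]:
  "tup [x, i] \<in> Obj (el_raw G) \<longleftrightarrow> x \<in> Obj X \<and> i \<in> points G x"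
  "tup [u, i] \<in> Ver (el_raw G) \<longleftrightarrow> u \<in> Ver X \<and> i \<in> points G (vdom X u)"
  "tup [h, s] \<in> Hor (el_raw G) \<longleftrightarrow> h \<in> Hor X \<and> s \<in> arcs G h"
  "tup (d # i # ss) \<in> Cel (el_raw G) \<longleftrightarrow> d \<in> Cel X \<and> i \<in> points G (corner X d) \<and> walk i (top' d) ss"
  "vdom (el_raw G) p = tup [vdom X (bs p), pt p]" "vcod (el_raw G) p = tup [vcod X (bs p), ver_fun (fver G (bs p)) (pt p)]"
  "vide (el_raw G) p = tup [vide X (bs p), pt p]" "vcmp (el_raw G) q p = tup [vcmp X (bs q) (bs p), pt p]"
  "hdom (el_raw G) p = tup [hdom X (bs p), hor_left (fhor G (bs p)) (pt p)]"
  "hcod (el_raw G) p = tup [hcod X (bs p), hor_right (fhor G (bs p)) (pt p)]"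
  "ctop (el_raw G) p = map2 (\<lambda>h s. tup [h, s]) (ctop X (bs p)) (pts p)"
  "cbot (el_raw G) p = tup [cbot X (bs p), cf (fcel G (bs p)) (pt p) (pts p)]"
  "cleft (el_raw G) p = tup [cleft X (bs p), pt p]"
  "cright (el_raw G) p = tup [cright X (bs p), walk_end (pt p) (top' (bs p)) (pts p)]"
  "cide (el_raw G) p = tup [cide X (bs p), hor_left (fhor G (bs p)) (pt p), pt p]"
  "ccmp (el_raw G) k u ds = tup (ccmp X (bs k) (bs u) (map bs ds) # pt u # concat (map pts ds))"
  by (simp_all add: el_raw_def Let_def)

lemma el_objE: assumes "p \<in> Obj (el_raw G)" obtains x i where "p = tup [x, i]" "x \<in> Obj X" "i \<in> points G x"
  using assms by (auto simp: el_raw_def Let_def)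
lemma el_verE: assumes "p \<in> Ver (el_raw G)" obtains u i where "p = tup [u, i]" "u \<in> Ver X" "i \<in> points G (vdom X u)"
  using assms by (auto simp: el_raw_def Let_def)
lemma el_horE: assumes "p \<in> Hor (el_raw G)" obtains h s where "p = tup [h, s]" "h \<in> Hor X" "s \<in> arcs G h"
  using assms by (auto simp: el_raw_def Let_def)
lemma el_celE: assumes "p \<in> Cel (el_raw G)" obtains d i ss where "p = tup (d # i # ss)" "d \<in> Cel X"
    "i \<in> points G (corner X d)" "walk i (top' d) ss"
  using assms by (auto simp: el_raw_def Let_def)

lemma G_fun_in: "u \<in> Ver X ==> i \<in> points G (vdom X u) ==> ver_fun (fver G u) i \<in> points G (vcod X u)"
  using G_ver[of u] fam_verD(3)[of "fver G u" B i] by simp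

lemma G_leg_in: "h \<in> Hor X ==> s \<in> arcs G h ==>
    hor_left (fhor G h) s \<in> points G (hdom X h) \<and> hor_right (fhor G h) s \<in> points G (hcod X h)"
  using G_hor[of h] fam_horD(4)[of "fhor G h" B s] by simp

lemma G_cf_in:
  assumes "d \<in> Cel X" "i \<in> points G (corner X d)" "walk i (top' d) ss"
  shows "cf (fcel G d) i ss \<in> arcs G (cbot X d)
    \<and> hor_left (fhor G (cbot X d)) (cf (fcel G d) i ss) = ver_fun (fver G (cleft X d)) i
    \<and> hor_right (fhor G (cbot X d)) (cf (fcel G d) i ss) = ver_fun (fver G (cright X d)) (walk_end i (top' d) ss)"
  using fam_celD(7)[of "fcel G d" B i ss] G_cel[OF assms(1)] G_ver[of "cleft X d"] G.A.boundary[OF assms(1)] assms by simp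

lemma el_path:
  assumes "G.A.path a hs b" "walk i (map (fhor G) hs) ss" "i \<in> points G a"
  shows "hpath (Obj (el_raw G)) (Hor (el_raw G)) (hdom (el_raw G)) (hcod (el_raw G))
    (tup [a, i]) (map2 (\<lambda>h s. tup [h, s]) hs ss) (tup [b, walk_end i (map (fhor G) hs) ss])"
  using assms
proof (induction hs arbitrary: a i ss)
  case (Cons h hs)
  then obtain s ss' where s: "ss = s # ss'" "s \<in> arcs G h" "hor_left (fhor G h) s = i"
    "walk (hor_right (fhor G h) s) (map (fhor G) hs) ss'" by (auto simp: walk_Cons_iff)
  then show ?case
    using Cons.IH[of "hcod X h" "hor_right (fhor G h) s" ss'] Cons.prems G_leg_in[of h s] by (simp add: walk_end_Cons)
qed simp

lemma G_path_end_in: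
  "G.A.path a hs b ==> walk i (map (fhor G) hs) ss ==> i \<in> points G a
    ==> walk_end i (map (fhor G) hs) ss \<in> points G b"
  using walk_end_in[OF G_path] .

subsection \<open>Paths of multicells of elements\<close>

abbreviation elc :: "'v => 'v => 'v list => 'v" where "elc d i ss \<equiv> tup (d # i # ss)"
abbreviation gcf :: "'v => 'v => 'v list => 'v" where "gcf d \<equiv> cf (fcel G d)"

lemma G_tops:
  assumes "cell_path X u ds"
  shows "bmap cel_top cf i (map (fcel G) ds) sss = bmap top' gcf i ds sss"
    "bmap cel_top cm i (map (fcel G) ds) sss = bmap top' (\<lambda>d. cm (fcel G d)) i ds sss"
    "bwalk cel_top i (map (fcel G) ds) sss = bwalk top' i ds sss"
    "bend cel_top i (map (fcel G) ds) sss = bend top' i ds sss"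
proof -
  have *: "\<And>d. d \<in> set ds ==> cel_top (fcel G d) = top' d" using cell_path_set[OF assms] G_cel by auto
  show "bmap cel_top cf i (map (fcel G) ds) sss = bmap top' gcf i ds sss"
    "bmap cel_top cm i (map (fcel G) ds) sss = bmap top' (\<lambda>d. cm (fcel G d)) i ds sss"
    "bwalk cel_top i (map (fcel G) ds) sss = bwalk top' i ds sss"
    "bend cel_top i (map (fcel G) ds) sss = bend top' i ds sss"
    unfolding bmap_map bwalk_map bend_map by (rule bT_cong[OF *], assumption)+
qed

text \<open>A path of multicells of \<open>el G\<close> is a path of \<open>X\<close> with a point of its concatenated tops; the converse follows
  below. This reduces composability in \<open>el G\<close> to composability in \<open>X\<close>.\<close>

lemma el_cell_path:
  assumes "cell_path X u ds" "i \<in> points G (vdom X u)" "bwalk top' i ds sss"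
  shows "cell_path (el_raw G) (tup [u, i]) (bmap top' elc i ds sss)
    \<and> cell_path_end (el_raw G) (tup [u, i]) (bmap top' elc i ds sss) = tup [cell_path_end X u ds, bend top' i ds sss]
    \<and> map bs (bmap top' elc i ds sss) = ds \<and> map pts (bmap top' elc i ds sss) = sss
    \<and> map (cbot (el_raw G)) (bmap top' elc i ds sss) = map2 (\<lambda>h s. tup [h, s]) (map (cbot X) ds) (bmap top' gcf i ds sss)
    \<and> concat (map (ctop (el_raw G)) (bmap top' elc i ds sss)) = map2 (\<lambda>h s. tup [h, s]) (concat (map (ctop X) ds)) (concat sss)"
  using assms
proof (induction ds arbitrary: u i sss)
  case (Cons d ds)
  then obtain ss sss' where s: "sss = ss # sss'" "walk i (top' d) ss" "bwalk top' (walk_end i (top' d) ss) ds sss'"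
    by (auto simp: bwalk_Cons_iff)
  have d: "d \<in> Cel X" "cleft X d = u" "cell_path X (cright X d) ds" using Cons.prems by auto
  have e: "walk_end i (top' d) ss \<in> points G (vdom X (cright X d))"
    using G_path_end_in[OF G.A.top_path[OF d(1)] s(2)] Cons.prems d by simp
  have l: "length (ctop X d) = length ss" using walk_length[OF s(2)] by simp
  show ?case using Cons.IH[OF d(3) e s(3)] s d Cons.prems(2) l by simp
qed simp

lemma el_cell_pathE:
  assumes "cell_path (el_raw G) U \<Theta>s"
  shows "\<exists>u i ds sss. U = tup [u, i] \<and> cell_path X u ds \<and> i \<in> points G (vdom X u)
    \<and> bwalk top' i ds sss \<and> \<Theta>s = bmap top' elc i ds sss"
  using assms
proof (induction \<Theta>s arbitrary: U)
  case Nil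
  then obtain u i where "U = tup [u, i]" "u \<in> Ver X" "i \<in> points G (vdom X u)" by (auto elim: el_verE)
  then show ?case by (intro exI[of _ u] exI[of _ i] exI[of _ "[]"]) simp
next
  case (Cons \<Theta> \<Theta>s)
  then obtain d i ss where d: "\<Theta> = tup (d # i # ss)" "d \<in> Cel X" "i \<in> points G (corner X d)" "walk i (top' d) ss"
    by (auto elim: el_celE)
  have U: "U = tup [cleft X d, i]" and p: "cell_path (el_raw G) (tup [cright X d, walk_end i (top' d) ss]) \<Theta>s"
    using Cons.prems d(1) by auto
  obtain ds sss where "cell_path X (cright X d) ds" "bwalk top' (walk_end i (top' d) ss) ds sss"
    "\<Theta>s = bmap top' elc (walk_end i (top' d) ss) ds sss"
    using Cons.IH[OF p] by auto
  then show ?case using d U by (intro exI[of _ "cleft X d"] exI[of _ i] exI[of _ "d # ds"] exI[of _ "ss # sss"]) simp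
qed

lemma el_composable:
  assumes c: "composable X k u ds" and i: "i \<in> points G (vdom X u)" "bwalk top' i ds sss"
  shows "composable (el_raw G) (tup (k # ver_fun (fver G u) i # bmap top' gcf i ds sss)) (tup [u, i]) (bmap top' elc i ds sss)"
    and "gcf (ccmp X k u ds) i (concat sss) = gcf k (ver_fun (fver G u) i) (bmap top' gcf i ds sss)"
    and "walk i (top' (ccmp X k u ds)) (concat sss)"
    and "walk_end i (top' (ccmp X k u ds)) (concat sss) = bend top' i ds sss"
    and "walk (ver_fun (fver G u) i) (top' k) (bmap top' gcf i ds sss)
      \<and> walk_end (ver_fun (fver G u) i) (top' k) (bmap top' gcf i ds sss) = ver_fun (fver G (cell_path_end X u ds)) (bend top' i ds sss)"
    and "ver_fun (fver G u) i \<in> points G (corner X k)"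
proof -
  have *: "k \<in> Cel X" "cell_path X u ds" "vcod X u = corner X k" "map (cbot X) ds = ctop X k" "u \<in> Ver X"
    using c G.A.cell_path_start by (auto simp: composable_def)
  have i': "i \<in> elts (idx (ver_dom (fver G u)))" "bwalk cel_top i (map (fcel G) ds) sss"
    using i G_ver[OF *(5)] G_tops(3)[OF *(2)] by auto
  have cl: "cleft X k \<in> Ver X" using G.A.boundary[OF *(1)] by simp
  note V = fam_composable_eval[OF G_composable[OF c] i', unfolded G_tops[OF *(2)]]
  have V1: "ver_fun (fver G u) i \<in> points G (corner X k)" using V(1) G_cel[OF *(1)] G_ver[OF cl] by simp
  then show "ver_fun (fver G u) i \<in> points G (corner X k)" .
  have V2: "walk (ver_fun (fver G u) i) (top' k) (bmap top' gcf i ds sss)" using V(2) G_cel[OF *(1)] by simp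
  have m: "map cel_bot (map (fcel G) ds) = top' k"
    using fam_composableD(4)[OF G_composable[OF c]] G_cel[OF *(1)] by simp
  show "walk (ver_fun (fver G u) i) (top' k) (bmap top' gcf i ds sss)
      \<and> walk_end (ver_fun (fver G u) i) (top' k) (bmap top' gcf i ds sss) = ver_fun (fver G (cell_path_end X u ds)) (bend top' i ds sss)"
    using V2 fam_cell_path_eval[OF G_cell_path(1)[OF *(2)] i', unfolded G_tops[OF *(2)] G_cell_path(2)[OF *(2)] m] by simp
  show "composable (el_raw G) (tup (k # ver_fun (fver G u) i # bmap top' gcf i ds sss)) (tup [u, i]) (bmap top' elc i ds sss)"
    using el_cell_path[OF *(2) i] * V1 V2 by (simp add: composable_def)
  show "gcf (ccmp X k u ds) i (concat sss) = gcf k (ver_fun (fver G u) i) (bmap top' gcf i ds sss)"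
    using fam_ccmp_eval(1)[OF G_composable[OF c] i', unfolded G_tops[OF *(2)]] G_ccmp[OF c] by simp
  have t: "top' (ccmp X k u ds) = concat (map top' ds)" using G.A.ccmp[OF c] by (simp add: map_concat comp_def)
  show "walk i (top' (ccmp X k u ds)) (concat sss)" "walk_end i (top' (ccmp X k u ds)) (concat sss) = bend top' i ds sss"
    unfolding t using bwalk_concat[OF i(2)] by auto
qed

lemma map2_tup_inject:
  assumes "map2 (\<lambda>a b. tup [a, b]) xs ys = map2 (\<lambda>a b. tup [a, b]) xs' ys'" "length xs = length ys" "length xs' = length ys'"
  shows "xs = xs'" "ys = ys'"
proof -
  have *: "map bs (map2 (\<lambda>a b. tup [a, b]) xs ys) = xs" "map pt (map2 (\<lambda>a b. tup [a, b]) xs ys) = ys"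
    if "length xs = length ys" for xs ys using that by (induction rule: list_induct2) auto
  show "xs = xs'" using *(1)[OF assms(2)] *(1)[OF assms(3)] assms(1) by metis
  show "ys = ys'" using *(2)[OF assms(2)] *(2)[OF assms(3)] assms(1) by metis
qed

lemma bmap_length: "bwalk T i ds sss ==> length (bmap T f i ds sss) = length ds"
  by (induction T i ds sss rule: bwalk.induct) auto

lemma el_composableE:
  assumes "composable (el_raw G) K U \<Theta>s"
  obtains k u i ds sss where "composable X k u ds" "i \<in> points G (vdom X u)" "bwalk top' i ds sss"
    "K = tup (k # ver_fun (fver G u) i # bmap top' gcf i ds sss)" "U = tup [u, i]" "\<Theta>s = bmap top' elc i ds sss"
proof -
  have *: "K \<in> Cel (el_raw G)" "cell_path (el_raw G) U \<Theta>s" "vcod (el_raw G) U = corner (el_raw G) K"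
    "map (cbot (el_raw G)) \<Theta>s = ctop (el_raw G) K"
    using assms by (auto simp: composable_def)
  obtain u i ds sss where u: "U = tup [u, i]" "cell_path X u ds" "i \<in> points G (vdom X u)"
    "bwalk top' i ds sss" "\<Theta>s = bmap top' elc i ds sss"
    using el_cell_pathE[OF *(2)] by blast
  obtain k j ts where K: "K = tup (k # j # ts)" "k \<in> Cel X" "walk j (top' k) ts" using *(1) by (auto elim: el_celE)
  have j: "vcod X u = corner X k" "j = ver_fun (fver G u) i" using *(3) u(1) K(1) by auto
  have "map2 (\<lambda>h s. tup [h, s]) (map (cbot X) ds) (bmap top' gcf i ds sss) = map2 (\<lambda>h s. tup [h, s]) (ctop X k) ts"
    using *(4) el_cell_path[OF u(2-4)] u(5) K(1) by simp
  moreover have "length (map (cbot X) ds) = length (bmap top' gcf i ds sss)" "length (ctop X k) = length ts"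
    using bmap_length[OF u(4), of gcf] walk_length[OF K(3)] by auto
  ultimately have "map (cbot X) ds = ctop X k" "bmap top' gcf i ds sss = ts"
    by (rule map2_tup_inject)+
  then show thesis using that[of k u ds i sss] u K j by (simp add: composable_def)
qed

lemma vdc_ops_el: "vdc_ops (el_raw G)"
proof
  fix p assume "p \<in> Ver (el_raw G)"
  then show "vdom (el_raw G) p \<in> Obj (el_raw G) \<and> vcod (el_raw G) p \<in> Obj (el_raw G)"
    by (elim el_verE) (simp add: G.A.vdom_vcod G_fun_in)
next
  fix p assume "p \<in> Obj (el_raw G)"
  then show "vide (el_raw G) p \<in> Ver (el_raw G) \<and> vdom (el_raw G) (vide (el_raw G) p) = p \<and> vcod (el_raw G) (vide (el_raw G) p) = p"
    by (elim el_objE) (simp add: G.A.vide G_vide)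
next
  fix p q assume "p \<in> Ver (el_raw G)" "q \<in> Ver (el_raw G)" "vcod (el_raw G) p = vdom (el_raw G) q"
  then show "vcmp (el_raw G) q p \<in> Ver (el_raw G) \<and> vdom (el_raw G) (vcmp (el_raw G) q p) = vdom (el_raw G) p
      \<and> vcod (el_raw G) (vcmp (el_raw G) q p) = vcod (el_raw G) q"
    using G_ver by (elim el_verE) (simp add: G.A.vcmp G_vcmp)
next
  fix p assume "p \<in> Hor (el_raw G)"
  then show "hdom (el_raw G) p \<in> Obj (el_raw G) \<and> hcod (el_raw G) p \<in> Obj (el_raw G)"
    by (elim el_horE) (simp add: G.A.hdom_hcod G_leg_in)
next
  fix p assume "p \<in> Cel (el_raw G)"
  then obtain d i ss where p: "p = tup (d # i # ss)" "d \<in> Cel X"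
    "i \<in> points G (corner X d)" "walk i (top' d) ss" by (rule el_celE)
  note b = G.A.boundary[OF p(2)]
  show "cleft (el_raw G) p \<in> Ver (el_raw G) \<and> cright (el_raw G) p \<in> Ver (el_raw G) \<and> cbot (el_raw G) p \<in> Hor (el_raw G) \<and>
       hpath (Obj (el_raw G)) (Hor (el_raw G)) (hdom (el_raw G)) (hcod (el_raw G))
        (corner (el_raw G) p) (ctop (el_raw G) p) (vdom (el_raw G) (cright (el_raw G) p)) \<and>
       vcod (el_raw G) (cleft (el_raw G) p) = hdom (el_raw G) (cbot (el_raw G) p) \<and>
       vcod (el_raw G) (cright (el_raw G) p) = hcod (el_raw G) (cbot (el_raw G) p)"
    using b p G_cf_in[OF p(2-4)] G_path_end_in[OF _ p(4,3)] el_path[OF _ p(4,3)] by simp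
next
  fix p assume "p \<in> Hor (el_raw G)"
  then obtain h s where p: "p = tup [h, s]" "h \<in> Hor X" "s \<in> arcs G h" by (rule el_horE)
  show "cide (el_raw G) p \<in> Cel (el_raw G) \<and> ctop (el_raw G) (cide (el_raw G) p) = [p] \<and> cbot (el_raw G) (cide (el_raw G) p) = p \<and>
       cleft (el_raw G) (cide (el_raw G) p) = vide (el_raw G) (hdom (el_raw G) p) \<and>
       cright (el_raw G) (cide (el_raw G) p) = vide (el_raw G) (hcod (el_raw G) p)"
    using p G.A.cide[OF p(2)] G.A.vide G.A.hdom_hcod[OF p(2)] G_leg_in[OF p(2,3)] G_hor[OF p(2)]
      fam_cide_eval(1)[of "fhor G h" s] by (simp add: G_cide walk_end_def)
next
  fix K U \<Theta>s assume "composable (el_raw G) K U \<Theta>s"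
  then obtain k u i ds sss where c: "composable X k u ds" "i \<in> points G (vdom X u)" "bwalk top' i ds sss"
    and e: "K = tup (k # ver_fun (fver G u) i # bmap top' gcf i ds sss)" "U = tup [u, i]" "\<Theta>s = bmap top' elc i ds sss"
    by (rule el_composableE)
  have *: "cell_path X u ds" "u \<in> Ver X" "k \<in> Cel X" "vcod X u = corner X k"
    using c(1) G.A.cell_path_start by (auto simp: composable_def)
  note P = el_cell_path[OF *(1) c(2,3)] and C = el_composable[OF c] and co = G.A.ccmp[OF c(1)]
  have vd: "vdom X (vcmp X (cleft X k) u) = vdom X u" using G.A.vcmp[of u "cleft X k"] * G.A.boundary[OF *(3)] by simp
  show "ccmp (el_raw G) K U \<Theta>s \<in> Cel (el_raw G) \<and>
       ctop (el_raw G) (ccmp (el_raw G) K U \<Theta>s) = concat (map (ctop (el_raw G)) \<Theta>s) \<and>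
       cbot (el_raw G) (ccmp (el_raw G) K U \<Theta>s) = cbot (el_raw G) K \<and>
       cleft (el_raw G) (ccmp (el_raw G) K U \<Theta>s) = vcmp (el_raw G) (cleft (el_raw G) K) U \<and>
       cright (el_raw G) (ccmp (el_raw G) K U \<Theta>s) = vcmp (el_raw G) (cright (el_raw G) K) (cell_path_end (el_raw G) U \<Theta>s)"
    using P C(2-) co c(2) vd unfolding e by simp
qed

lemma el_blocks:
  "length ds = length yss ==> map bs (ccmp_blocks (el_raw G) w ds yss) = ccmp_blocks X (bs w) (map bs ds) (map (map bs) yss)
    \<and> concat (map pts (ccmp_blocks (el_raw G) w ds yss)) = concat (map pts (concat yss))"
proof (induction arbitrary: w rule: list_induct2)
  case (Cons d ds ys yss)
  have "bs (cell_path_end (el_raw G) w ys) = cell_path_end X (bs w) (map bs ys)"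
    by (simp add: cell_path_end_def last_map)
  then show ?case using Cons.IH[of "cell_path_end (el_raw G) w ys"] by simp
qed simp

text \<open>As a multicell of \<open>el G\<close> is determined by its base and its point, the laws are those of \<open>X\<close> together with
  the fact that composites keep the point at the top.\<close>

lemma vdc_laws_el: "vdc_laws (el_raw G)"
proof (intro vdc_laws.intro vdc_ops_el vdc_laws_axioms.intro)
  fix p assume "p \<in> Ver (el_raw G)"
  then show "vcmp (el_raw G) p (vide (el_raw G) (vdom (el_raw G) p)) = p \<and> vcmp (el_raw G) (vide (el_raw G) (vcod (el_raw G) p)) p = p"
    by (elim el_verE) (simp add: G.A.vcmp_vide)
next
  fix f g h assume "f \<in> Ver (el_raw G)" "g \<in> Ver (el_raw G)" "h \<in> Ver (el_raw G)" "vcod (el_raw G) f = vdom (el_raw G) g"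
    "vcod (el_raw G) g = vdom (el_raw G) h"
  then show "vcmp (el_raw G) (vcmp (el_raw G) h g) f = vcmp (el_raw G) h (vcmp (el_raw G) g f)"
    by (elim el_verE) (simp add: G.A.vcmp_assoc)
next
  fix p assume "p \<in> Cel (el_raw G)"
  then obtain d i ss where p: "p = tup (d # i # ss)" "d \<in> Cel X"
    "i \<in> points G (corner X d)" "walk i (top' d) ss" by (rule el_celE)
  show "ccmp (el_raw G) (cide (el_raw G) (cbot (el_raw G) p)) (cleft (el_raw G) p) [p] = p"
    using G.A.ccmp_cide_left[OF p(2)] p(1) by simp
  have "map bs (map (cide (el_raw G)) (map2 (\<lambda>h s. tup [h, s]) hs ss)) = map (cide X) hs
    \<and> concat (map pts (map (cide (el_raw G)) (map2 (\<lambda>h s. tup [h, s]) hs ss))) = ss" if "length hs = length ss" for hs ss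
    using that by (induction rule: list_induct2) auto
  from this[of "ctop X d" ss] show "ccmp (el_raw G) p (vide (el_raw G) (corner (el_raw G) p)) (map (cide (el_raw G)) (ctop (el_raw G) p)) = p"
    using G.A.ccmp_cide_right[OF p(2)] p(1) walk_length[OF p(4)] by (simp add: comp_def)
next
  fix K U \<Theta>s w yss
  assume c: "composable (el_raw G) K U \<Theta>s" and w: "cell_path (el_raw G) w (concat yss)" "vcod (el_raw G) w = vdom (el_raw G) U"
    and l: "list_all2 (\<lambda>d ys. map (cbot (el_raw G)) ys = ctop (el_raw G) d) \<Theta>s yss"
  from c obtain k u i ds sss where d: "composable X k u ds" "i \<in> points G (vdom X u)" "bwalk top' i ds sss"
    and e: "K = tup (k # ver_fun (fver G u) i # bmap top' gcf i ds sss)" "U = tup [u, i]" "\<Theta>s = bmap top' elc i ds sss"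
    by (rule el_composableE)
  have p: "cell_path X u ds" using d(1) by (simp add: composable_def)
  have b: "bs K = k" "bs U = u" "map bs \<Theta>s = ds" using e el_cell_path[OF p d(2,3)] by auto
  obtain w' j where w': "bs w = w'" "cell_path X w' (map bs (concat yss))" "vcod X w' = vdom X u"
    using el_cell_pathE[OF w(1)] el_cell_path w(2) e(2) by fastforce
  have len: "length \<Theta>s = length yss" using l by (rule list_all2_lengthD)
  have "list_all2 (\<lambda>d ys. map (cbot X) (map bs ys) = ctop X (bs d)) \<Theta>s yss"
    unfolding list_all2_conv_all_nth
  proof (intro conjI allI impI)
    fix k assume k: "k < length \<Theta>s"
    have "\<Theta>s ! k \<in> Cel (el_raw G)" using c cell_path_set[of "el_raw G" U \<Theta>s] k by (auto simp: composable_def)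
    then obtain d i' ss where t: "\<Theta>s ! k = tup (d # i' # ss)" "walk i' (top' d) ss" by (auto elim: el_celE)
    have "map bs (map (cbot (el_raw G)) (yss ! k)) = map bs (ctop (el_raw G) (\<Theta>s ! k))"
      using list_all2_nthD[OF l k] by simp
    moreover have "map bs (map2 (\<lambda>h s. tup [h, s]) hs ss) = hs" if "length hs = length ss" for hs
      using that by (induction rule: list_induct2) auto
    ultimately show "map (cbot X) (map bs (yss ! k)) = ctop X (bs (\<Theta>s ! k))"
      using t walk_length[OF t(2)] by (simp add: comp_def)
  qed (rule len)
  then have "list_all2 (\<lambda>d ys. map (cbot X) ys = ctop X d) ds (map (map bs) yss)"
    unfolding b(3)[symmetric] list_all2_map1 list_all2_map2 .
  then have "ccmp X (ccmp X k u ds) w' (concat (map (map bs) yss)) = ccmp X k (vcmp X u w') (ccmp_blocks X w' ds (map (map bs) yss))"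
    using G.A.ccmp_assoc[OF d(1), of w' "map (map bs) yss"] w' by (simp add: map_concat)
  then show "ccmp (el_raw G) (ccmp (el_raw G) K U \<Theta>s) w (concat yss)
      = ccmp (el_raw G) K (vcmp (el_raw G) U w) (ccmp_blocks (el_raw G) w \<Theta>s yss)"
    using el_blocks[OF len, of w] b w' by (simp add: map_concat)
qed

lemma virtual_double_category_el: "virtual_double_category (el G)"
  unfolding el_def by (rule vdc_laws.virtual_double_category_restrict[OF vdc_laws_el])

lemma large_el:
  assumes X: "large (Obj X)" "large (Ver X)" "large (Hor X)" "large (Cel X)"
  shows "large (Obj (el G))" "large (Ver (el G))" "large (Hor (el G))" "large (Cel (el G))"
proof -
  let ?D = "Obj X \<union> Ver X \<union> Hor X \<union> Cel X \<union> elts U1"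
  have D: "large (tup ` lists ?D)" using X by (intro large_tups large_Un large_elts)
  have U: "i \<in> elts U1" if "x \<in> Obj X" "i \<in> points G x" for x i
    using U1_trans[OF fam_objD(1)[OF G_obj[OF that(1)]] that(2)] .
  have S: "s \<in> elts U1" if "h \<in> Hor X" "s \<in> arcs G h" for h s
    using U1_trans[OF fam_horD(3) that(2)] G_hor[OF that(1)] by blast
  have "p \<in> tup ` lists ?D" if p: "p \<in> Obj (el_raw G)" for p
    using p by (rule el_objE) (use U in auto)
  then show "large (Obj (el G))" using large_subset[OF D] by (simp add: el_def subset_iff)
  have "p \<in> tup ` lists ?D" if p: "p \<in> Ver (el_raw G)" for p
  proof -
    from p obtain u i where u: "p = tup [u, i]" "u \<in> Ver X" "i \<in> points G (vdom X u)" by (rule el_verE)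
    then have "[u, i] \<in> lists ?D" using U[OF _ u(3)] G.A.vdom_vcod[OF u(2)] by simp
    then show ?thesis unfolding u(1) by (rule imageI)
  qed
  then show "large (Ver (el G))" using large_subset[OF D] by (simp add: el_def subset_iff)
  have "p \<in> tup ` lists ?D" if p: "p \<in> Hor (el_raw G)" for p
    using p by (rule el_horE) (use S in auto)
  then show "large (Hor (el G))" using large_subset[OF D] by (simp add: el_def subset_iff)
  have "p \<in> tup ` lists ?D" if p: "p \<in> Cel (el_raw G)" for p
  proof -
    from p obtain d i ss where t: "p = tup (d # i # ss)" "d \<in> Cel X"
      "i \<in> points G (corner X d)" "walk i (top' d) ss" by (rule el_celE)
    have "ss \<in> lists (elts U1)"
      using walk_lists[OF t(4)] G_hor G.A.top_set[OF t(2)] by (metis (no_types, lifting) image_subset_iff list.set_map subsetD)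
    then have "d # i # ss \<in> lists ?D" using t(2) U[OF _ t(3)] G.A.boundary[OF t(2)] G.A.vdom_vcod by auto
    then show ?thesis unfolding t(1) by (rule imageI)
  qed
  then show "large (Cel (el G))" using large_subset[OF D] by (simp add: el_def subset_iff)
qed

end

lemma vd_functor_restrictI:
  "virtual_double_category A ==> virtual_double_category B ==> fdom F = A ==> fcod F = B ==> vdfun_laws F
    ==> vd_functor (vdfun_restrict F) A B"
  using virtual_double_functor_restrict[of F] by (simp add: vd_functor_def)

lemma vdc_restrict_cong:
  assumes A: "vdc_ops A" and A': "vdc_ops A'"
    and s: "Obj A = Obj A'" "Ver A = Ver A'" "Hor A = Hor A'" "Cel A = Cel A'"
    and ver: "\<And>u. u \<in> Ver A' ==> vdom A u = vdom A' u \<and> vcod A u = vcod A' u"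
    and vide: "\<And>a. a \<in> Obj A' ==> vide A a = vide A' a" and vcmp: "vcmp A = vcmp A'"
    and hor: "\<And>h. h \<in> Hor A' ==> hdom A h = hdom A' h \<and> hcod A h = hcod A' h \<and> cide A h = cide A' h"
    and cel: "\<And>d. d \<in> Cel A' ==> ctop A d = ctop A' d \<and> cbot A d = cbot A' d \<and> cleft A d = cleft A' d \<and> cright A d = cright A' d"
    and ccmp: "ccmp A = ccmp A'"
  shows "vdc_restrict A = vdc_restrict A'"
proof -
  interpret A: vdc_ops A by (rule A)
  interpret A': vdc_ops A' by (rule A')
  have cp: "cell_path A u ds = cell_path A' u ds" for u ds
    by (induction ds arbitrary: u) (use s cel in \<open>auto\<close>)
  have c: "composable A k u ds = composable A' k u ds" for k u ds
  proof (cases "k \<in> Cel A' \<and> cell_path A' u ds")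
    case True
    have "map (cbot A) ds = map (cbot A') ds" using cell_path_set[of A' u ds] True cel by auto
    then show ?thesis
      using True s cp cel[of k] ver[of u] ver[of "cleft A' k"] A'.cell_path_start[of u ds] A'.boundary[of k]
      by (simp add: composable_def cong: map_cong)
  next
    case False
    then show ?thesis using s cp by (auto simp: composable_def)
  qed
  show ?thesis
    unfolding vdc_restrict_def s c ccmp vcmp
    by (intro vdc.equality; simp; intro ext; use ver vide hor cel in \<open>auto simp: restrict_def\<close>)
qed

lemma map2_map_left: "map2 f (map g xs) ys = map2 (\<lambda>x y. f (g x) y) xs ys"
proof (induction xs arbitrary: ys)
  case (Cons x xs) then show ?case by (cases ys) auto
qed simp

lemma map_map2: "map g (map2 f xs ys) = map2 (\<lambda>x y. g (f x y)) xs ys"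
  by (simp add: comp_def split_def)

section \<open>Functors into a families construction\<close>

subsection \<open>Evaluation\<close>

context universes
begin

definition ev :: "'v vdc => 'v vdfun => 'v vdfun" where
  "ev B H = vdfun_restrict \<lparr>fdom = el H, fcod = B,
     fobj = (\<lambda>p. memb (fobj H (bs p)) (pt p)), fver = (\<lambda>p. ver_memb (fver H (bs p)) (pt p)),
     fhor = (\<lambda>p. hor_memb (fhor H (bs p)) (pt p)), fcel = (\<lambda>p. cm (fcel H (bs p)) (pt p) (pts p))\<rparr>"

end

context elements
begin

lemma el_simps [simp]:
  "Obj (el G) = Obj (el_raw G)" "Ver (el G) = Ver (el_raw G)" "Hor (el G) = Hor (el_raw G)" "Cel (el G) = Cel (el_raw G)"
  "p \<in> Ver (el_raw G) ==> vdom (el G) p = vdom (el_raw G) p" "p \<in> Ver (el_raw G) ==> vcod (el G) p = vcod (el_raw G) p"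
  "p \<in> Obj (el_raw G) ==> vide (el G) p = vide (el_raw G) p"
  "p \<in> Ver (el_raw G) ==> q \<in> Ver (el_raw G) ==> vcod (el_raw G) p = vdom (el_raw G) q ==> vcmp (el G) q p = vcmp (el_raw G) q p"
  "p \<in> Hor (el_raw G) ==> hdom (el G) p = hdom (el_raw G) p" "p \<in> Hor (el_raw G) ==> hcod (el G) p = hcod (el_raw G) p"
  "p \<in> Cel (el_raw G) ==> ctop (el G) p = ctop (el_raw G) p" "p \<in> Cel (el_raw G) ==> cbot (el G) p = cbot (el_raw G) p"
  "p \<in> Cel (el_raw G) ==> cleft (el G) p = cleft (el_raw G) p" "p \<in> Cel (el_raw G) ==> cright (el G) p = cright (el_raw G) p"
  "p \<in> Hor (el_raw G) ==> cide (el G) p = cide (el_raw G) p"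
  "composable (el_raw G) k u ds ==> ccmp (el G) k u ds = ccmp (el_raw G) k u ds"
  by (simp_all add: el_def)

lemma el_composable_eq [simp]: "composable (el G) = composable (el_raw G)"
  by (intro ext) (simp add: el_def vdc_ops.composable_restrict[OF vdc_ops_el])

lemma ev_simps [simp]:
  "fdom (ev B G) = el G" "fcod (ev B G) = B"
  "p \<in> Obj (el_raw G) ==> fobj (ev B G) p = memb (fobj G (bs p)) (pt p)"
  "p \<in> Ver (el_raw G) ==> fver (ev B G) p = ver_memb (fver G (bs p)) (pt p)"
  "p \<in> Hor (el_raw G) ==> fhor (ev B G) p = hor_memb (fhor G (bs p)) (pt p)"
  "p \<in> Cel (el_raw G) ==> fcel (ev B G) p = cm (fcel G (bs p)) (pt p) (pts p)"
  by (simp_all add: ev_def)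

lemma G_ver_memb:
  "u \<in> Ver X ==> i \<in> points G (vdom X u) ==> ver_memb (fver G u) i \<in> Ver B
    \<and> vdom B (ver_memb (fver G u) i) = memb (fobj G (vdom X u)) i
    \<and> vcod B (ver_memb (fver G u) i) = memb (fobj G (vcod X u)) (ver_fun (fver G u) i)"
  using G_ver[of u] fam_verD(3)[of "fver G u" B i] by simp

lemma G_hor_memb:
  "h \<in> Hor X ==> s \<in> arcs G h ==> hor_memb (fhor G h) s \<in> Hor B
    \<and> hdom B (hor_memb (fhor G h) s) = memb (fobj G (hdom X h)) (hor_left (fhor G h) s)
    \<and> hcod B (hor_memb (fhor G h) s) = memb (fobj G (hcod X h)) (hor_right (fhor G h) s)"
  using G_hor[of h] fam_horD(4)[of "fhor G h" B s] by simp

lemma G_cm_in: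
  assumes "d \<in> Cel X" "i \<in> points G (corner X d)" "walk i (top' d) ss"
  shows "cm (fcel G d) i ss \<in> Cel B \<and> ctop B (cm (fcel G d) i ss) = map2 hor_memb (top' d) ss
    \<and> cbot B (cm (fcel G d) i ss) = hor_memb (fhor G (cbot X d)) (gcf d i ss)
    \<and> cleft B (cm (fcel G d) i ss) = ver_memb (fver G (cleft X d)) i
    \<and> cright B (cm (fcel G d) i ss) = ver_memb (fver G (cright X d)) (walk_end i (top' d) ss)"
  using fam_celD(7)[of "fcel G d" B i ss] G_cel[OF assms(1)] G_ver[of "cleft X d"] G.A.boundary[OF assms(1)] assms by simp

lemma G_ccmp_memb:
  assumes c: "composable X k u ds" and i: "i \<in> points G (vdom X u)" "bwalk top' i ds sss"
  shows "cm (fcel G (ccmp X k u ds)) i (concat sss)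
    = ccmp B (cm (fcel G k) (ver_fun (fver G u) i) (bmap top' gcf i ds sss)) (ver_memb (fver G u) i)
        (bmap top' (\<lambda>d. cm (fcel G d)) i ds sss)"
proof -
  have p: "cell_path X u ds" "u \<in> Ver X" using c G.A.cell_path_start by (auto simp: composable_def)
  have i': "i \<in> elts (idx (ver_dom (fver G u)))" "bwalk cel_top i (map (fcel G) ds) sss"
    using i G_ver[OF p(2)] G_tops(3)[OF p(1)] by auto
  show ?thesis using fam_ccmp_eval(2)[OF G_composable[OF c] i', unfolded G_tops[OF p(1)]] G_ccmp[OF c] by simp
qed

lemma el_ccmp:
  assumes "composable X k u ds" "i \<in> points G (vdom X u)" "bwalk top' i ds sss"
  shows "ccmp (el G) (tup (k # ver_fun (fver G u) i # bmap top' gcf i ds sss)) (tup [u, i]) (bmap top' elc i ds sss)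
    = tup (ccmp X k u ds # i # concat sss)"
proof -
  have p: "cell_path X u ds" using assms(1) by (simp add: composable_def)
  show ?thesis using el_composable(1)[OF assms] el_cell_path[OF p assms(2,3)] by simp
qed

lemma el_elc:
  assumes "cell_path X u ds" "i \<in> points G (vdom X u)" "bwalk top' i ds sss"
    and "\<And>p. p \<in> Cel (el_raw G) ==> f p = g (bs p) (pt p) (pts p)"
  shows "map f (bmap top' elc i ds sss) = bmap top' g i ds sss"
  using assms(1-3)
proof (induction ds arbitrary: u i sss)
  case (Cons d ds)
  then obtain ss sss' where s: "sss = ss # sss'" "walk i (top' d) ss" "bwalk top' (walk_end i (top' d) ss) ds sss'"
    by (auto simp: bwalk_Cons_iff)
  have d: "d \<in> Cel X" "cleft X d = u" "cell_path X (cright X d) ds" using Cons.prems by auto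
  have e: "walk_end i (top' d) ss \<in> points G (vdom X (cright X d))"
    using G_path_end_in[OF G.A.top_path[OF d(1)] s(2)] Cons.prems d by simp
  show ?case using Cons.IH[OF d(3) e s(3)] s d Cons.prems(2) assms(4)[of "elc d i ss"] by simp
qed simp

lemma ev_functor:
  assumes B: "virtual_double_category B"
  shows "vd_functor (ev B G) (el G) B"
  unfolding ev_def
proof (rule vd_functor_restrictI[OF virtual_double_category_el B])
  let ?o = "\<lambda>p. memb (fobj G (bs p)) (pt p)" and ?v = "\<lambda>p. ver_memb (fver G (bs p)) (pt p)"
    and ?h = "\<lambda>p. hor_memb (fhor G (bs p)) (pt p)" and ?c = "\<lambda>p. cm (fcel G (bs p)) (pt p) (pts p)"
  show "vdfun_laws \<lparr>fdom = el G, fcod = B, fobj = ?o, fver = ?v, fhor = ?h, fcel = ?c\<rparr>"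
    unfolding vdfun_laws_def Let_def vdfun.simps
  proof (intro conjI ballI allI impI)
    fix p assume "p \<in> Obj (el G)"
    then obtain x i where p: "p = tup [x, i]" "x \<in> Obj X" "i \<in> points G x" by (auto elim: el_objE)
    show "?o p \<in> Obj B" using p fam_objD(2)[OF G_obj[OF p(2)] p(3)] by simp
    show "?v (vide (el G) p) = vide B (?o p)"
      using p by (simp add: G_vide)
  next
    fix p assume "p \<in> Ver (el G)"
    then obtain u i where p: "p = tup [u, i]" "u \<in> Ver X" "i \<in> points G (vdom X u)" by (auto elim: el_verE)
    note D = G_ver_memb[OF p(2,3)]
    show "?v p \<in> Ver B"
      "vdom B (?v p) = ?o (vdom (el G) p)"
      "vcod B (?v p) = ?o (vcod (el G) p)"
      using D p by simp_all
  next
    fix p q assume "p \<in> Ver (el G)" "q \<in> Ver (el G)" "vcod (el G) p = vdom (el G) q"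
    then obtain u w i j where p: "p = tup [u, i]" "u \<in> Ver X" "i \<in> points G (vdom X u)"
      "q = tup [w, j]" "w \<in> Ver X" "vcod X u = vdom X w" "j = ver_fun (fver G u) i"
      by (auto elim!: el_verE)
    then show "?v (vcmp (el G) q p)
        = vcmp B (?v q) (?v p)"
      using G_fun_in[OF p(2,3)] G_ver[OF p(2)] by (simp add: G_vcmp)
  next
    fix p assume "p \<in> Hor (el G)"
    then obtain h s where p: "p = tup [h, s]" "h \<in> Hor X" "s \<in> arcs G h" by (auto elim: el_horE)
    note D = G_hor_memb[OF p(2,3)]
    show "?h p \<in> Hor B"
      "hdom B (?h p) = ?o (hdom (el G) p)"
      "hcod B (?h p) = ?o (hcod (el G) p)"
      using D p by simp_all
    show "?c (cide (el G) p) = cide B (?h p)"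
      using p fam_cide_eval(2)[of "fhor G h" s] G_hor[OF p(2)] by (simp add: G_cide)
  next
    fix p assume "p \<in> Cel (el G)"
    then obtain d i ss where p: "p = tup (d # i # ss)" "d \<in> Cel X"
      "i \<in> points G (corner X d)" "walk i (top' d) ss" by (auto elim: el_celE)
    note D = G_cm_in[OF p(2-4)]
    have p': "p \<in> Cel (el_raw G)" using p by simp
    show "?c p \<in> Cel B"
      "cbot B (?c p) = ?h (cbot (el G) p)"
      "cleft B (?c p) = ?v (cleft (el G) p)"
      "cright B (?c p) = ?v (cright (el G) p)"
      using D p by simp_all
    show "ctop B (?c p) = map ?h (ctop (el G) p)"
      using D p p' by (simp add: map_map2 map2_map_left del: map_map)
  next
    fix K U \<Theta>s assume "composable (el G) K U \<Theta>s"
    then have c: "composable (el_raw G) K U \<Theta>s" by simp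
    then obtain k u i ds sss where d: "composable X k u ds" "i \<in> points G (vdom X u)" "bwalk top' i ds sss"
      and e: "K = tup (k # ver_fun (fver G u) i # bmap top' gcf i ds sss)" "U = tup [u, i]" "\<Theta>s = bmap top' elc i ds sss"
      by (rule el_composableE)
    have p: "cell_path X u ds" using d(1) by (simp add: composable_def)
    have "map ?c \<Theta>s = bmap top' (\<lambda>d. cm (fcel G d)) i ds sss"
      unfolding e by (rule el_elc[OF p d(2,3)]) simp
    then show "?c (ccmp (el G) K U \<Theta>s)
        = ccmp B (?c K) (?v U) (map ?c \<Theta>s)"
      using el_ccmp[OF d] G_ccmp_memb[OF d] e by simp
  qed
qed simp_all

end

subsection \<open>Functors with the same underlying spans\<close>

context universes
begin

definition span_like :: "'v => 'v => bool" where
  "span_like h \<Delta> \<longleftrightarrow> hor_apex h = hor_apex \<Delta>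
    \<and> (\<forall>s\<in>elts (hor_apex \<Delta>). hor_left h s = hor_left \<Delta> s \<and> hor_right h s = hor_right \<Delta> s)"

lemma walk_like:
  assumes "list_all2 span_like hs \<Delta>s"
  shows "walk i hs ss = walk i \<Delta>s ss" "walk i \<Delta>s ss ==> walk_end i hs ss = walk_end i \<Delta>s ss"
proof -
  have "(walk i hs ss = walk i \<Delta>s ss) \<and> (walk i \<Delta>s ss \<longrightarrow> walk_end i hs ss = walk_end i \<Delta>s ss)"
    using assms
  proof (induction arbitrary: i ss rule: list_all2_induct)
    case (Cons h hs \<Delta> \<Delta>s)
    show ?case
    proof (cases ss)
      case (Cons s ss')
      have "s \<in> elts (hor_apex \<Delta>) ==> hor_left h s = hor_left \<Delta> s \<and> hor_right h s = hor_right \<Delta> s"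
        "hor_apex h = hor_apex \<Delta>" using Cons.hyps by (auto simp: span_like_def)
      then show ?thesis
        using Cons.IH[of "hor_right \<Delta> s" ss'] Cons by (auto simp: walk_end_Cons)
    qed simp
  qed simp
  then show "walk i hs ss = walk i \<Delta>s ss" "walk i \<Delta>s ss ==> walk_end i hs ss = walk_end i \<Delta>s ss" by auto
qed

lemma span_prod_like: "list_all2 span_like hs \<Delta>s ==> idx X = idx Y ==> span_prod X hs = span_prod Y \<Delta>s"
  by (simp add: span_prod_def walk_like(1))

lemma bwalk_like:
  assumes "\<And>d. d \<in> set ds ==> list_all2 span_like (T d) (T' d)"
  shows "bwalk T i ds sss = bwalk T' i ds sss"
    "bwalk T' i ds sss ==> bmap T f i ds sss = bmap T' f i ds sss"
    "bwalk T' i ds sss ==> bend T i ds sss = bend T' i ds sss"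
proof -
  have "(bwalk T i ds sss = bwalk T' i ds sss) \<and> (bwalk T' i ds sss \<longrightarrow> bmap T f i ds sss = bmap T' f i ds sss
    \<and> bend T i ds sss = bend T' i ds sss)"
    using assms
  proof (induction ds arbitrary: i sss)
    case (Cons d ds)
    note l = Cons.prems[of d, simplified]
    show ?case
    proof (cases sss)
      case (Cons ss sss')
      then show ?thesis using Cons.IH[of "walk_end i (T' d) ss" sss'] Cons.prems walk_like[OF l, of i ss] by auto
    qed simp
  qed simp
  then show "bwalk T i ds sss = bwalk T' i ds sss"
    "bwalk T' i ds sss ==> bmap T f i ds sss = bmap T' f i ds sss"
    "bwalk T' i ds sss ==> bend T i ds sss = bend T' i ds sss" by auto
qed

text \<open>Functors into families constructions of possibly different virtual double categories are compared by the
  spans they assign. The conditions refer to indices only where these are indices of the second functor, since the coded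
  functions have no prescribed values elsewhere.\<close>

definition same_spans :: "'v vdfun => 'v vdfun => bool" where
  "same_spans G G' \<longleftrightarrow> (let X = fdom G' in fdom G = X \<and>
     (\<forall>x\<in>Obj X. idx (fobj G x) = idx (fobj G' x)) \<and>
     (\<forall>u\<in>Ver X. \<forall>i\<in>points G' (vdom X u). ver_fun (fver G u) i = ver_fun (fver G' u) i) \<and>
     (\<forall>h\<in>Hor X. span_like (fhor G h) (fhor G' h)) \<and>
     (\<forall>d\<in>Cel X. \<forall>i\<in>points G' (corner X d). \<forall>ss. walk i (map (fhor G') (ctop X d)) ss
       \<longrightarrow> cf (fcel G d) i ss = cf (fcel G' d) i ss))"

text \<open>Only the spans of \<open>G\<close> enter the construction. The operations that are not determined on all arguments by
  these are compared on the carriers, which normalisation makes sufficient.\<close>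

lemma el_cong:
  assumes "elements elts U1 B G X" "elements elts U1 B' G' X" and s: "same_spans G G'"
  shows "el G = el G'"
proof -
  interpret G: elements elts U1 B G X by fact
  interpret G': elements elts U1 B' G' X by fact
  note S = s[unfolded same_spans_def Let_def G'.G.fdom]
  have o: "\<And>x. x \<in> Obj X ==> idx (fobj G x) = idx (fobj G' x)" using S by blast
  have v: "\<And>u i. u \<in> Ver X ==> i \<in> points G' (vdom X u) ==> ver_fun (fver G u) i = ver_fun (fver G' u) i" using S by blast
  have h: "\<And>h. h \<in> Hor X ==> span_like (fhor G h) (fhor G' h)" using S by blast
  have h': "\<And>h. h \<in> Hor X ==> hor_apex (fhor G h) = hor_apex (fhor G' h)"
    "\<And>h s. h \<in> Hor X ==> s \<in> arcs G' h ==> hor_left (fhor G h) s = hor_left (fhor G' h) s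
      \<and> hor_right (fhor G h) s = hor_right (fhor G' h) s"
    using h by (auto simp: span_like_def)
  have t: "list_all2 span_like (map (fhor G) (ctop X d)) (map (fhor G') (ctop X d))" if "d \<in> Cel X" for d
    using h G.G.A.top_set[OF that] by (auto simp: list_all2_map1 list_all2_map2 intro!: list.rel_refl_strong)
  have w: "walk i (map (fhor G) (ctop X d)) ss = walk i (map (fhor G') (ctop X d)) ss" if "d \<in> Cel X" for d i ss
    using walk_like(1)[OF t[OF that]] .
  have od: "\<And>u. u \<in> Ver X ==> idx (fobj G (vdom X u)) = idx (fobj G' (vdom X u))"
    "\<And>d. d \<in> Cel X ==> idx (fobj G (corner X d)) = idx (fobj G' (corner X d))"
    using o G.G.A.vdom_vcod G.G.A.boundary by auto
  show ?thesis
    unfolding el_def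
  proof (rule vdc_restrict_cong[OF G.vdc_ops_el G'.vdc_ops_el])
    show "Obj (el_raw G) = Obj (el_raw G')" using o by (auto simp: el_raw_def Let_def)
    show "Ver (el_raw G) = Ver (el_raw G')" using od(1) by (auto simp: el_raw_def Let_def)
    show "Hor (el_raw G) = Hor (el_raw G')" using h'(1) by (auto simp: el_raw_def Let_def)
    have "p \<in> Cel (el_raw G) \<longleftrightarrow> p \<in> Cel (el_raw G')" for p
    proof
      assume "p \<in> Cel (el_raw G)" then show "p \<in> Cel (el_raw G')"
        by (rule G.el_celE) (simp add: od w)
    next
      assume "p \<in> Cel (el_raw G')" then show "p \<in> Cel (el_raw G)"
        by (rule G'.el_celE) (simp add: od w)
    qed
    then show "Cel (el_raw G) = Cel (el_raw G')" by blast
    fix p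
    show "p \<in> Ver (el_raw G') ==> vdom (el_raw G) p = vdom (el_raw G') p \<and> vcod (el_raw G) p = vcod (el_raw G') p"
      by (elim G'.el_verE) (simp add: v)
    show "p \<in> Obj (el_raw G') ==> vide (el_raw G) p = vide (el_raw G') p" by simp
    show "p \<in> Hor (el_raw G') ==> hdom (el_raw G) p = hdom (el_raw G') p \<and> hcod (el_raw G) p = hcod (el_raw G') p
      \<and> cide (el_raw G) p = cide (el_raw G') p"
      by (elim G'.el_horE) (simp add: h')
    assume "p \<in> Cel (el_raw G')"
    then obtain d i ss where p: "p = tup (d # i # ss)" "d \<in> Cel X"
      "i \<in> points G' (corner X d)" "walk i (G'.top' d) ss" by (rule G'.el_celE)
    have "cf (fcel G d) i ss = cf (fcel G' d) i ss" using S p by blast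
    then show "ctop (el_raw G) p = ctop (el_raw G') p \<and> cbot (el_raw G) p = cbot (el_raw G') p
      \<and> cleft (el_raw G) p = cleft (el_raw G') p \<and> cright (el_raw G) p = cright (el_raw G') p"
      using p walk_like(2)[OF t[OF p(2)] p(4)] by simp
  next
    show "vcmp (el_raw G) = vcmp (el_raw G')" "ccmp (el_raw G) = ccmp (el_raw G')"
      by (intro ext, simp)+
  qed
qed

subsection \<open>Transposition\<close>

text \<open>The transpose of \<open>J : el G \<rightarrow> C\<close>: the families with the spans of \<open>G\<close> and with the values of \<open>J\<close> as members.\<close>

definition tr_obj :: "'v vdfun => 'v vdfun => 'v => 'v" where
  "tr_obj G J x = tup [idx (fobj G x), lam (idx (fobj G x)) (\<lambda>i. fobj J (tup [x, i]))]"

definition tr_ver :: "'v vdfun => 'v vdfun => 'v => 'v" where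
  "tr_ver G J u = (let X = fdom G; I = idx (fobj G (vdom X u)) in
     tup [tr_obj G J (vdom X u), tr_obj G J (vcod X u), lam I (ver_fun (fver G u)), lam I (\<lambda>i. fver J (tup [u, i]))])"

definition tr_hor :: "'v vdfun => 'v vdfun => 'v => 'v" where
  "tr_hor G J h = (let X = fdom G; S = hor_apex (fhor G h) in
     tup [tr_obj G J (hdom X h), tr_obj G J (hcod X h), S, lam S (hor_left (fhor G h)), lam S (hor_right (fhor G h)),
       lam S (\<lambda>s. fhor J (tup [h, s]))])"

definition tr_cel :: "'v vdfun => 'v vdfun => 'v => 'v" where
  "tr_cel G J d = (let X = fdom G; hs = map (tr_hor G J) (ctop X d);
       P = span_prod (ver_dom (tr_ver G J (cleft X d))) hs in
     tup [tup hs, tr_hor G J (cbot X d), tr_ver G J (cleft X d), tr_ver G J (cright X d),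
       lam P (cel_fun (fcel G d)), lam P (\<lambda>p. fcel J (tup (d # untup p)))])"

definition tr :: "'v vdfun => 'v vdfun => 'v vdfun" where
  "tr G J = vdfun_restrict \<lparr>fdom = fdom G, fcod = fam (fcod J), fobj = tr_obj G J, fver = tr_ver G J,
     fhor = tr_hor G J, fcel = tr_cel G J\<rparr>"

end

locale transposes = elements elts U1 B G X + C: families elts U1 C + J: vd_functor J "el G" C
  for elts :: "'v => 'v set" and U1 :: 'v and B :: "'v vdc" and G :: "'v vdfun" and X :: "'v vdc"
    and C :: "'v vdc" and J :: "'v vdfun"
begin

lemma tr_simps [simp]:
  "idx (tr_obj G J x) = idx (fobj G x)"
  "i \<in> points G x ==> memb (tr_obj G J x) i = fobj J (tup [x, i])"
  "ver_dom (tr_ver G J u) = tr_obj G J (vdom X u)" "ver_cod (tr_ver G J u) = tr_obj G J (vcod X u)"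
  "i \<in> points G (vdom X u) ==> ver_fun (tr_ver G J u) i = ver_fun (fver G u) i"
  "i \<in> points G (vdom X u) ==> ver_memb (tr_ver G J u) i = fver J (tup [u, i])"
  "hor_dom (tr_hor G J h) = tr_obj G J (hdom X h)" "hor_cod (tr_hor G J h) = tr_obj G J (hcod X h)"
  "hor_apex (tr_hor G J h) = hor_apex (fhor G h)"
  "s \<in> arcs G h ==> hor_left (tr_hor G J h) s = hor_left (fhor G h) s"
  "s \<in> arcs G h ==> hor_right (tr_hor G J h) s = hor_right (fhor G h) s"
  "s \<in> arcs G h ==> hor_memb (tr_hor G J h) s = fhor J (tup [h, s])"
  "cel_top (tr_cel G J d) = map (tr_hor G J) (ctop X d)" "cel_bot (tr_cel G J d) = tr_hor G J (cbot X d)"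
  "cel_left (tr_cel G J d) = tr_ver G J (cleft X d)" "cel_right (tr_cel G J d) = tr_ver G J (cright X d)"
  by (simp_all add: tr_obj_def tr_ver_def tr_hor_def tr_cel_def Let_def)

lemma tr_like: "span_like (tr_hor G J h) (fhor G h)"
  by (simp add: span_like_def)

lemma tr_likes: "list_all2 span_like (map (tr_hor G J) hs) (map (fhor G) hs)"
  by (simp add: list_all2_map1 list_all2_map2 tr_like list.rel_refl_strong)

lemmas tr_walk = walk_like[OF tr_likes]

lemma tr_obj_in: "x \<in> Obj X ==> tr_obj G J x \<in> fam_obj C"
  using fam_objD(1)[OF G_obj] J.obj by (simp add: tr_obj_def fam_obj_iff)

lemma tr_ver_in: "u \<in> Ver X ==> tr_ver G J u \<in> fam_ver C"
  unfolding tr_ver_def Let_def G.fdom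
  using G.A.vdom_vcod G_fun_in J.ver by (intro fam_verI) (simp_all add: tr_obj_in)

lemma tr_hor_in: "h \<in> Hor X ==> tr_hor G J h \<in> fam_hor C"
  unfolding tr_hor_def Let_def G.fdom
  using G.A.hdom_hcod G_leg_in J.hor fam_horD(3)[of "fhor G h" B] G_hor by (intro fam_horI) (simp_all add: tr_obj_in)

lemma tr_path: "G.A.path a hs b ==> fpath C (tr_obj G J a) (map (tr_hor G J) hs) (tr_obj G J b)"
  by (induction hs arbitrary: a) (auto simp: tr_obj_in tr_hor_in)

lemma tr_cel_eval:
  assumes "d \<in> Cel X" "i \<in> points G (corner X d)" "walk i (top' d) ss"
  shows "cf (tr_cel G J d) i ss = gcf d i ss" "cm (tr_cel G J d) i ss = fcel J (elc d i ss)"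
proof -
  note X = tr_obj_in[of "corner X d"] and S = hpath_set[OF tr_path[OF G.A.top_path[OF assms(1)]]]
  have x: "corner X d \<in> Obj X" using G.A.vdom_vcod G.A.boundary[OF assms(1)] by simp
  have w: "walk i (map (tr_hor G J) (ctop X d)) ss" using tr_walk(1) assms(3) by simp
  show "cf (tr_cel G J d) i ss = gcf d i ss" "cm (tr_cel G J d) i ss = fcel J (elc d i ss)"
    unfolding tr_cel_def Let_def G.fdom tr_simps
    using cf_tup[OF X[OF x] S refl _ w] cm_tup[OF X[OF x] S refl _ w] assms(2) by (simp_all add: cf_def)
qed

lemma tr_cel_in:
  assumes d: "d \<in> Cel X"
  shows "tr_cel G J d \<in> fam_cel C"
proof -
  note b = G.A.boundary[OF d]
  obtain m \<phi> P where e: "tr_cel G J d = tup [tup (map (tr_hor G J) (ctop X d)), tr_hor G J (cbot X d), tr_ver G J (cleft X d),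
      tr_ver G J (cright X d), lam P m, lam P \<phi>]" "P = span_prod (ver_dom (tr_ver G J (cleft X d))) (map (tr_hor G J) (ctop X d))"
    unfolding tr_cel_def Let_def G.fdom by blast
  have x: "tr_obj G J (corner X d) \<in> fam_obj C" using b G.A.vdom_vcod tr_obj_in by simp
  note S = hpath_set[OF tr_path[OF G.A.top_path[OF d]]]
  show ?thesis
    unfolding e(1)
  proof (rule fam_celI)
    fix i ss assume i: "i \<in> elts (idx (ver_dom (tr_ver G J (cleft X d))))" and w: "walk i (map (tr_hor G J) (ctop X d)) ss"
    have i': "i \<in> points G (corner X d)" and w': "walk i (top' d) ss" using i w tr_walk(1) by simp_all
    note ev = tr_cel_eval[OF d i' w'] and E = G_cf_in[OF d i' w'] and we = tr_walk(2)[OF w']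
    have m: "m (tup (i # ss)) = gcf d i ss" "\<phi> (tup (i # ss)) = fcel J (elc d i ss)"
      using ev cf_tup[OF x S _ _ w, of P] cm_tup[OF x S _ _ w, of P] i' unfolding e by simp_all
    have el: "elc d i ss \<in> Cel (el_raw G)" using d i' w' by simp
    have pe: "walk_end i (top' d) ss \<in> points G (vdom X (cright X d))"
      using G_path_end_in[OF G.A.top_path[OF d] w' i'] .
    have tops: "map (fhor J) (map2 (\<lambda>h s. tup [h, s]) (ctop X d) ss) = map2 hor_memb (map (tr_hor G J) (ctop X d)) ss"
    proof -
      have "map (fhor J) (map2 (\<lambda>h s. tup [h, s]) hs ss) = map2 hor_memb (map (tr_hor G J) hs) ss"
        if "walk i (map (fhor G) hs) ss" for i hs ss
        using that by (induction hs arbitrary: i ss) (auto simp: walk_Cons_iff)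
      then show ?thesis using w' .
    qed
    show "m (tup (i # ss)) \<in> elts (hor_apex (tr_hor G J (cbot X d))) \<and>
          hor_left (tr_hor G J (cbot X d)) (m (tup (i # ss))) = ver_fun (tr_ver G J (cleft X d)) i \<and>
          hor_right (tr_hor G J (cbot X d)) (m (tup (i # ss))) =
          ver_fun (tr_ver G J (cright X d)) (walk_end i (map (tr_hor G J) (ctop X d)) ss) \<and>
          \<phi> (tup (i # ss)) \<in> Cel C \<and>
          ctop C (\<phi> (tup (i # ss))) = map2 hor_memb (map (tr_hor G J) (ctop X d)) ss \<and>
          cbot C (\<phi> (tup (i # ss))) = hor_memb (tr_hor G J (cbot X d)) (m (tup (i # ss))) \<and>
          cleft C (\<phi> (tup (i # ss))) = ver_memb (tr_ver G J (cleft X d)) i \<and>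
          cright C (\<phi> (tup (i # ss))) = ver_memb (tr_ver G J (cright X d)) (walk_end i (map (tr_hor G J) (ctop X d)) ss)"
      unfolding m we tops[symmetric] using E i' pe J.cel[of "elc d i ss"] el by simp
  qed (use b tr_ver_in tr_hor_in tr_path in \<open>simp_all add: e(2)\<close>)
qed

lemma tr_cell_path:
  "cell_path X u ds ==> cell_path (fam_raw C) (tr_ver G J u) (map (tr_cel G J) ds)
    \<and> cell_path_end (fam_raw C) (tr_ver G J u) (map (tr_cel G J) ds) = tr_ver G J (cell_path_end X u ds)"
proof (induction ds arbitrary: u)
  case (Cons d ds)
  then show ?case using tr_cel_in[of d] by auto
qed (simp add: tr_ver_in)

lemma tr_composable:
  assumes "composable X k u ds"
  shows "composable (fam_raw C) (tr_cel G J k) (tr_ver G J u) (map (tr_cel G J) ds)"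
proof -
  have *: "k \<in> Cel X" "cell_path X u ds" "vcod X u = corner X k" "map (cbot X) ds = ctop X k"
    using assms by (auto simp: composable_def)
  have "map cel_bot (map (tr_cel G J) ds) = map (tr_hor G J) (map (cbot X) ds)" by simp
  then show ?thesis using * tr_cell_path[OF *(2)] tr_cel_in[OF *(1)] by (simp add: composable_def)
qed

lemma tr_vide: "x \<in> Obj X ==> tr_ver G J (vide X x) = fam_vide C (tr_obj G J x)"
proof -
  assume x: "x \<in> Obj X"
  note v = G.A.vide[OF x]
  show ?thesis
  proof (rule fam_ver_eqI[OF tr_ver_in C.fam_vide_in[OF tr_obj_in]])
    fix i assume "i \<in> elts (idx (ver_dom (tr_ver G J (vide X x))))"
    then have i: "i \<in> points G x" using v by simp
    then show "ver_fun (tr_ver G J (vide X x)) i = ver_fun (fam_vide C (tr_obj G J x)) i \<and>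
         ver_memb (tr_ver G J (vide X x)) i = ver_memb (fam_vide C (tr_obj G J x)) i"
      using v x J.vid[of "tup [x, i]"] by (simp add: G_vide)
  qed (use v x in simp_all)
qed

lemma tr_vcmp:
  assumes f: "f \<in> Ver X" "g \<in> Ver X" "vcod X f = vdom X g"
  shows "tr_ver G J (vcmp X g f) = fam_vcmp C (tr_ver G J g) (tr_ver G J f)"
proof -
  note v = G.A.vcmp[OF f]
  show ?thesis
  proof (rule fam_ver_eqI)
    show "tr_ver G J (vcmp X g f) \<in> fam_ver C" "fam_vcmp C (tr_ver G J g) (tr_ver G J f) \<in> fam_ver C"
      using v f tr_ver_in C.fam_vcmp_in by simp_all
    fix i assume "i \<in> elts (idx (ver_dom (tr_ver G J (vcmp X g f))))"
    then have i: "i \<in> points G (vdom X f)" using v by simp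
    have j: "ver_fun (fver G f) i \<in> points G (vdom X g)" using G_fun_in[OF f(1) i] f(3) by simp
    show "ver_fun (tr_ver G J (vcmp X g f)) i = ver_fun (fam_vcmp C (tr_ver G J g) (tr_ver G J f)) i \<and>
         ver_memb (tr_ver G J (vcmp X g f)) i = ver_memb (fam_vcmp C (tr_ver G J g) (tr_ver G J f)) i"
      using v f i j G_ver[OF f(1)] J.vcmp[of "tup [f, i]" "tup [g, ver_fun (fver G f) i]"] by (simp add: G_vcmp)
  qed (use v in simp_all)
qed

lemma tr_cide:
  assumes h: "h \<in> Hor X"
  shows "tr_cel G J (cide X h) = fam_cide C (tr_hor G J h)"
proof -
  note c = G.A.cide[OF h] and hv = G.A.hdom_hcod[OF h]
  have vd: "vdom X (vide X (hdom X h)) = hdom X h" using G.A.vide hv by simp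
  show ?thesis
  proof (rule fam_cel_eqI[OF tr_cel_in C.fam_cide_in[OF tr_hor_in[OF h]]])
    fix i ss assume i: "i \<in> elts (idx (ver_dom (cel_left (tr_cel G J (cide X h)))))" "walk i (cel_top (tr_cel G J (cide X h))) ss"
    then obtain s where s: "ss = [s]" "s \<in> arcs G h" "hor_left (fhor G h) s = i"
      using c by (auto simp: walk_Cons_iff)
    have w: "walk i (top' (cide X h)) ss" "i \<in> points G (corner X (cide X h))" using s i c by simp_all
    note ev = tr_cel_eval[OF c[THEN conjunct1] w(2,1)]
    have sC: "s \<in> elts (hor_apex (tr_hor G J h))" and lf: "hor_left (tr_hor G J h) s = i" using s by simp_all
    show "cf (tr_cel G J (cide X h)) i ss = cf (fam_cide C (tr_hor G J h)) i ss \<and>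
         cm (tr_cel G J (cide X h)) i ss = cm (fam_cide C (tr_hor G J h)) i ss"
      using ev C.fam_cide_eval[OF tr_hor_in[OF h] sC] lf s fam_cide_eval(1)[of "fhor G h" s] G_hor[OF h]
        J.cid[of "tup [h, s]"] h by (simp add: G_cide)
  qed (use c hv tr_vide in simp_all)
qed

text \<open>Both sides are evaluated at a point of the concatenated tops. The maps agree since \<open>G\<close> preserves
  composites, the members since \<open>J\<close> does.\<close>

lemma tr_ccmp:
  assumes c: "composable X k u ds"
  shows "tr_cel G J (ccmp X k u ds) = fam_ccmp C (tr_cel G J k) (tr_ver G J u) (map (tr_cel G J) ds)"
proof -
  have *: "k \<in> Cel X" "cell_path X u ds" "vcod X u = corner X k" "u \<in> Ver X"
    using c G.A.cell_path_start by (auto simp: composable_def)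
  note co = G.A.ccmp[OF c] and cC = tr_composable[OF c] and b = G.A.boundary[OF *(1)] and P = tr_cell_path[OF *(2)]
  have vd: "vdom X (vcmp X (cleft X k) u) = vdom X u" using G.A.vcmp * b by simp
  show ?thesis
  proof (rule fam_cel_eqI[OF tr_cel_in C.fam_ccmp_in[OF cC]])
    show "cel_top (tr_cel G J (ccmp X k u ds)) = cel_top (fam_ccmp C (tr_cel G J k) (tr_ver G J u) (map (tr_cel G J) ds))"
      using co by (simp add: C.fam_ccmp_simps map_concat comp_def)
    fix i ss assume i: "i \<in> elts (idx (ver_dom (cel_left (tr_cel G J (ccmp X k u ds)))))" and w: "walk i (cel_top (tr_cel G J (ccmp X k u ds))) ss"
    have i': "i \<in> points G (vdom X u)" using i co vd by simp
    have "walk i (top' (ccmp X k u ds)) ss" using w tr_walk(1) by simp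
    moreover have "top' (ccmp X k u ds) = concat (map top' ds)" using co by (simp add: map_concat comp_def)
    ultimately have "walk i (concat (map top' ds)) ss" by simp
    then obtain sss where s: "ss = concat sss" "bwalk top' i ds sss" using bwalk_exists[of i top' ds ss] by blast
    note E = el_composable[OF c i' s(2)]
    have like: "list_all2 span_like (cel_top (tr_cel G J d)) (top' d)" for d using tr_likes by simp
    note L = bwalk_like[of ds "\<lambda>d. cel_top (tr_cel G J d)" top', OF like]
    have bw: "bwalk cel_top i (map (tr_cel G J) ds) sss" using L(1) s(2) by (simp add: bwalk_map)
    have bm: "bmap cel_top f i (map (tr_cel G J) ds) sss = bmap top' (\<lambda>d. f (tr_cel G J d)) i ds sss" for f :: "'v => 'v => 'v list => 'v"
      using L(2)[OF s(2)] by (simp add: bmap_map)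
    have g: "bmap top' (\<lambda>d. cf (tr_cel G J d)) i ds sss = bmap top' gcf i ds sss
      \<and> bmap top' (\<lambda>d. cm (tr_cel G J d)) i ds sss = map (fcel J) (bmap top' elc i ds sss)"
    proof -
      have "map (\<lambda>p. cf (tr_cel G J (bs p)) (pt p) (pts p)) (bmap top' elc i ds sss) = bmap top' gcf i ds sss"
      proof (rule el_elc[OF *(2) i' s(2)])
        fix p assume "p \<in> Cel (el_raw G)" then show "cf (tr_cel G J (bs p)) (pt p) (pts p) = gcf (bs p) (pt p) (pts p)"
          by (rule el_celE) (simp add: tr_cel_eval)
      qed
      moreover have "map (fcel J) (bmap top' elc i ds sss) = bmap top' (\<lambda>d. cm (tr_cel G J d)) i ds sss"
      proof (rule el_elc[OF *(2) i' s(2)])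
        fix p assume "p \<in> Cel (el_raw G)" then show "fcel J p = cm (tr_cel G J (bs p)) (pt p) (pts p)"
          by (rule el_celE) (simp add: tr_cel_eval)
      qed
      ultimately show ?thesis by (simp add: map_bmap)
    qed
    have i'': "i \<in> elts (idx (ver_dom (tr_ver G J u)))" using i' by simp
    note ev = C.fam_ccmp_eval[OF cC i'' bw, unfolded bm g[THEN conjunct1] g[THEN conjunct2]]
    have iE: "i \<in> points G (corner X (ccmp X k u ds))" using i' co vd by simp
    note ev1 = tr_cel_eval[OF co[THEN conjunct1] iE E(3)] and ev2 = tr_cel_eval[OF *(1) E(6) E(5)[THEN conjunct1]]
    show "cf (tr_cel G J (ccmp X k u ds)) i ss = cf (fam_ccmp C (tr_cel G J k) (tr_ver G J u) (map (tr_cel G J) ds)) i ss \<and>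
         cm (tr_cel G J (ccmp X k u ds)) i ss = cm (fam_ccmp C (tr_cel G J k) (tr_ver G J u) (map (tr_cel G J) ds)) i ss"
      unfolding s(1) ev ev1 using i' ev2 E(2) J.ccmp[of "tup (k # ver_fun (fver G u) i # bmap top' gcf i ds sss)" "tup [u, i]" "bmap top' elc i ds sss"]
        E(1) el_ccmp[OF c i' s(2)] by simp
  next
    show "cel_left (tr_cel G J (ccmp X k u ds)) = cel_left (fam_ccmp C (tr_cel G J k) (tr_ver G J u) (map (tr_cel G J) ds))"
      using co tr_vcmp[OF *(4) _ *(3)] b by (simp add: C.fam_ccmp_simps)
    show "cel_right (tr_cel G J (ccmp X k u ds)) = cel_right (fam_ccmp C (tr_cel G J k) (tr_ver G J u) (map (tr_cel G J) ds))"
      using co tr_vcmp[OF G.A.cell_path_end_in[OF *(2)] _ G.A.composable_end[OF c]] b P by (simp add: C.fam_ccmp_simps)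
  qed (use co in \<open>simp_all add: C.fam_ccmp_simps\<close>)
qed

lemma tr_functor: "vd_functor (tr G J) X (fam C)"
  unfolding tr_def
proof (rule vd_functor_restrictI[OF G.A C.virtual_double_category_fam])
  show "vdfun_laws \<lparr>fdom = fdom G, fcod = fam (fcod J), fobj = tr_obj G J, fver = tr_ver G J, fhor = tr_hor G J, fcel = tr_cel G J\<rparr>"
    unfolding vdfun_laws_def Let_def
    by (auto simp: tr_obj_in tr_ver_in tr_hor_in tr_cel_in tr_vide tr_vcmp tr_cide tr_ccmp tr_composable)
qed simp_all

lemma tr_fun_simps [simp]:
  "fdom (tr G J) = X" "fcod (tr G J) = fam C"
  "x \<in> Obj X ==> fobj (tr G J) x = tr_obj G J x" "u \<in> Ver X ==> fver (tr G J) u = tr_ver G J u"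
  "h \<in> Hor X ==> fhor (tr G J) h = tr_hor G J h" "d \<in> Cel X ==> fcel (tr G J) d = tr_cel G J d"
  by (simp_all add: tr_def)

lemma same_spans_tr: "same_spans (tr G J) G"
  unfolding same_spans_def Let_def using G.A.vdom_vcod G.A.boundary by (simp add: tr_like tr_cel_eval)

sublocale tr: elements elts U1 C "tr G J" X
  by (intro elements.intro C.families_axioms tr_functor)

lemma el_tr: "el (tr G J) = el G"
  by (rule el_cong[OF tr.elements_axioms elements_axioms same_spans_tr])

text \<open>With \<open>tr_ev\<close> below, evaluation and transposition are mutually inverse.\<close>

lemma ev_tr:
  assumes "virtual_double_category C"
  shows "ev C (tr G J) = J"
proof (rule vdfun_eqI)
  show "virtual_double_functor (ev C (tr G J))" using tr.ev_functor[OF assms] vd_functor.is_functor by blast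
  have sets: "Obj (el_raw (tr G J)) = Obj (el_raw G)" "Ver (el_raw (tr G J)) = Ver (el_raw G)"
    "Hor (el_raw (tr G J)) = Hor (el_raw G)" "Cel (el_raw (tr G J)) = Cel (el_raw G)"
    using el_tr tr.el_simps(1-4) el_simps(1-4) by metis+
  fix p
  show "p \<in> Obj (fdom J) ==> fobj (ev C (tr G J)) p = fobj J p"
    by (simp add: sets, elim el_objE) (simp add: sets)
  show "p \<in> Ver (fdom J) ==> fver (ev C (tr G J)) p = fver J p"
    by (simp add: sets, elim el_verE) (simp add: sets)
  show "p \<in> Hor (fdom J) ==> fhor (ev C (tr G J)) p = fhor J p"
    by (simp add: sets, elim el_horE) (simp add: sets)
  show "p \<in> Cel (fdom J) ==> fcel (ev C (tr G J)) p = fcel J p"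
    by (simp add: sets, elim el_celE) (simp add: sets tr_cel_eval)
qed (simp_all add: el_tr J.is_functor)

end

subsection \<open>Transformations\<close>

context universes
begin

text \<open>The underlying map of the span morphism \<open>thor \<nu> h\<close>, and the family of its members. A point of the unary
  iterated pullback is determined by \<open>s\<close>, so both become functions of \<open>s\<close> alone.\<close>

definition tcf :: "'v vdtrans => 'v => 'v => 'v" where
  "tcf \<nu> h s = cf (thor \<nu> h) (hor_left (fhor (tsrc \<nu>) h) s) [s]"

definition tcm :: "'v vdtrans => 'v => 'v => 'v" where
  "tcm \<nu> h s = cm (thor \<nu> h) (hor_left (fhor (tsrc \<nu>) h) s) [s]"

text \<open>The functor between elements induced by a transformation; it is the identity on base data.\<close>

definition elT :: "'v vdtrans => 'v vdfun" where
  "elT \<nu> = (let X = fdom (tsrc \<nu>) in vdfun_restrict \<lparr>fdom = el (tsrc \<nu>), fcod = el (ttgt \<nu>),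
     fobj = (\<lambda>p. tup [bs p, ver_fun (tobj \<nu> (bs p)) (pt p)]),
     fver = (\<lambda>p. tup [bs p, ver_fun (tobj \<nu> (vdom X (bs p))) (pt p)]),
     fhor = (\<lambda>p. tup [bs p, tcf \<nu> (bs p) (pt p)]),
     fcel = (\<lambda>p. tup (bs p # ver_fun (tobj \<nu> (corner X (bs p))) (pt p) # map2 (tcf \<nu>) (ctop X (bs p)) (pts p)))\<rparr>)"

text \<open>The transformation given by the members of \<open>\<nu>\<close>. Its target involves \<open>elT \<nu>\<close> because the member at \<open>i\<close>
  ends at the member of the target family whose index is the image of \<open>i\<close>.\<close>

definition evT :: "'v vdc => 'v vdtrans => 'v vdtrans" where
  "evT B \<nu> = vdtrans_restrict \<lparr>tsrc = ev B (tsrc \<nu>), ttgt = vdfun_comp (ev B (ttgt \<nu>)) (elT \<nu>),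
     tobj = (\<lambda>p. ver_memb (tobj \<nu> (bs p)) (pt p)), thor = (\<lambda>p. tcm \<nu> (bs p) (pt p))\<rparr>"

end

locale el_trans = families elts U1 B + b: elements elts U1 B b X + G: elements elts U1 B G X + T: vd_trans \<nu> b G X "fam B"
  for elts :: "'v => 'v set" and U1 :: 'v and B :: "'v vdc" and b G :: "'v vdfun" and X :: "'v vdc" and \<nu> :: "'v vdtrans"
begin

lemma T_obj: "x \<in> Obj X ==> tobj \<nu> x \<in> fam_ver B \<and> ver_dom (tobj \<nu> x) = fobj b x \<and> ver_cod (tobj \<nu> x) = fobj G x"
  using T.obj[of x] by auto

lemma T_hor: "h \<in> Hor X ==> thor \<nu> h \<in> fam_cel B \<and> cel_top (thor \<nu> h) = [fhor b h] \<and> cel_bot (thor \<nu> h) = fhor G h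
    \<and> cel_left (thor \<nu> h) = tobj \<nu> (hdom X h) \<and> cel_right (thor \<nu> h) = tobj \<nu> (hcod X h)"
  using T.hor[of h] by auto

lemma T_ver: "u \<in> Ver X ==> fam_vcmp B (tobj \<nu> (vcod X u)) (fver b u) = fam_vcmp B (fver G u) (tobj \<nu> (vdom X u))"
  using T.ver[of u] T_obj[of "vdom X u"] T_obj[of "vcod X u"] b.G_ver[of u] G.G_ver[of u] b.G.A.vdom_vcod[of u] by simp

lemma T_fun_in: "x \<in> Obj X ==> i \<in> points b x ==> ver_fun (tobj \<nu> x) i \<in> points G x
    \<and> ver_memb (tobj \<nu> x) i \<in> Ver B \<and> vdom B (ver_memb (tobj \<nu> x) i) = memb (fobj b x) i
    \<and> vcod B (ver_memb (tobj \<nu> x) i) = memb (fobj G x) (ver_fun (tobj \<nu> x) i)"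
  using T_obj[of x] fam_verD(3)[of "tobj \<nu> x" B i] by simp

lemma T_natural_ver:
  assumes u: "u \<in> Ver X" and i: "i \<in> points b (vdom X u)"
  shows "ver_fun (tobj \<nu> (vcod X u)) (ver_fun (fver b u) i) = ver_fun (fver G u) (ver_fun (tobj \<nu> (vdom X u)) i)"
    "vcmp B (ver_memb (tobj \<nu> (vcod X u)) (ver_fun (fver b u) i)) (ver_memb (fver b u) i)
      = vcmp B (ver_memb (fver G u) (ver_fun (tobj \<nu> (vdom X u)) i)) (ver_memb (tobj \<nu> (vdom X u)) i)"
proof -
  note t = T_obj[of "vdom X u"] b.G_ver[OF u] b.G.A.vdom_vcod[OF u]
  have i1: "i \<in> elts (idx (ver_dom (fver b u)))" "i \<in> elts (idx (ver_dom (tobj \<nu> (vdom X u))))" using t i by auto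
  show "ver_fun (tobj \<nu> (vcod X u)) (ver_fun (fver b u) i) = ver_fun (fver G u) (ver_fun (tobj \<nu> (vdom X u)) i)"
    using arg_cong[OF T_ver[OF u], of "\<lambda>w. ver_fun w i"] i1 by simp
  show "vcmp B (ver_memb (tobj \<nu> (vcod X u)) (ver_fun (fver b u) i)) (ver_memb (fver b u) i)
      = vcmp B (ver_memb (fver G u) (ver_fun (tobj \<nu> (vdom X u)) i)) (ver_memb (tobj \<nu> (vdom X u)) i)"
    using arg_cong[OF T_ver[OF u], of "\<lambda>w. ver_memb w i"] i1 by simp
qed

lemma T_hor_in:
  assumes h: "h \<in> Hor X" and s: "s \<in> arcs b h"
  shows "tcf \<nu> h s \<in> arcs G h
    \<and> hor_left (fhor G h) (tcf \<nu> h s) = ver_fun (tobj \<nu> (hdom X h)) (hor_left (fhor b h) s)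
    \<and> hor_right (fhor G h) (tcf \<nu> h s) = ver_fun (tobj \<nu> (hcod X h)) (hor_right (fhor b h) s)
    \<and> tcm \<nu> h s \<in> Cel B \<and> ctop B (tcm \<nu> h s) = [hor_memb (fhor b h) s]
    \<and> cbot B (tcm \<nu> h s) = hor_memb (fhor G h) (tcf \<nu> h s)
    \<and> cleft B (tcm \<nu> h s) = ver_memb (tobj \<nu> (hdom X h)) (hor_left (fhor b h) s)
    \<and> cright B (tcm \<nu> h s) = ver_memb (tobj \<nu> (hcod X h)) (hor_right (fhor b h) s)"
proof -
  note t = T_hor[OF h] T_obj[of "hdom X h"] b.G.A.hdom_hcod[OF h] b.G_leg_in[OF h s]
  have w: "walk (hor_left (fhor b h) s) (cel_top (thor \<nu> h)) [s]" using t s by simp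
  have i: "hor_left (fhor b h) s \<in> elts (idx (ver_dom (cel_left (thor \<nu> h))))" using t by simp
  have e: "walk_end (hor_left (fhor b h) s) [fhor b h] [s] = hor_right (fhor b h) s" by (simp add: walk_end_def)
  show ?thesis using fam_celD(7)[of "thor \<nu> h" B, OF _ i w] t e by (simp add: tcf_def tcm_def)
qed

lemma T_points:
  assumes "walk i (map (fhor b) hs) ss" "set hs \<subseteq> Hor X"
  shows "bwalk cel_top i (map (thor \<nu>) hs) (map (\<lambda>s. [s]) ss)
    \<and> bmap cel_top cf i (map (thor \<nu>) hs) (map (\<lambda>s. [s]) ss) = map2 (tcf \<nu>) hs ss
    \<and> bmap cel_top cm i (map (thor \<nu>) hs) (map (\<lambda>s. [s]) ss) = map2 (tcm \<nu>) hs ss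
    \<and> bend cel_top i (map (thor \<nu>) hs) (map (\<lambda>s. [s]) ss) = walk_end i (map (fhor b) hs) ss"
  using assms
proof (induction hs arbitrary: i ss)
  case (Cons h hs)
  then obtain s ss' where s: "ss = s # ss'" "s \<in> arcs b h" "hor_left (fhor b h) s = i"
    "walk (hor_right (fhor b h) s) (map (fhor b) hs) ss'"
    by (auto simp: walk_Cons_iff)
  have e: "walk_end i [fhor b h] [s] = hor_right (fhor b h) s" by (simp add: walk_end_def)
  show ?case
    using Cons.IH[OF s(4)] Cons.prems T_hor[of h] s e by (simp add: tcf_def tcm_def walk_end_Cons)
qed simp

lemma T_walk:
  assumes p: "b.G.A.path a hs c" and w: "walk i (map (fhor b) hs) ss" and i: "i \<in> points b a"
  shows "walk (ver_fun (tobj \<nu> a) i) (map (fhor G) hs) (map2 (tcf \<nu>) hs ss)"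
    "walk_end (ver_fun (tobj \<nu> a) i) (map (fhor G) hs) (map2 (tcf \<nu>) hs ss) = ver_fun (tobj \<nu> c) (walk_end i (map (fhor b) hs) ss)"
proof -
  have a: "a \<in> Obj X" using hpath_start[OF p] b.G.A.hdom_hcod by blast
  have S: "set hs \<subseteq> Hor X" using hpath_set[OF p] .
  note P = T_points[OF w S]
  have cp: "cell_path (fam_raw B) (tobj \<nu> a) (map (thor \<nu>) hs)" "cell_path_end (fam_raw B) (tobj \<nu> a) (map (thor \<nu>) hs) = tobj \<nu> c"
    using T.cell_path[OF p] by auto
  have i': "i \<in> elts (idx (ver_dom (tobj \<nu> a)))" using T_obj[OF a] i by simp
  have m: "map cel_bot (map (thor \<nu>) hs) = map (fhor G) hs" using T_hor S by auto
  show "walk (ver_fun (tobj \<nu> a) i) (map (fhor G) hs) (map2 (tcf \<nu>) hs ss)"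
    "walk_end (ver_fun (tobj \<nu> a) i) (map (fhor G) hs) (map2 (tcf \<nu>) hs ss) = ver_fun (tobj \<nu> c) (walk_end i (map (fhor b) hs) ss)"
    using fam_cell_path_eval[OF cp(1) i' P[THEN conjunct1], unfolded m cp(2)] P by simp_all
qed

text \<open>Naturality of \<open>\<nu>\<close> at a multicell, evaluated at a point: the first equation is what makes \<open>elT \<nu>\<close> a functor,
  the second what makes \<open>evT B \<nu>\<close> a transformation.\<close>

lemma T_natural_cel:
  assumes d: "d \<in> Cel X" and i: "i \<in> points b (corner X d)" and w: "walk i (b.top' d) ss"
  shows "tcf \<nu> (cbot X d) (b.gcf d i ss) = G.gcf d (ver_fun (tobj \<nu> (corner X d)) i) (map2 (tcf \<nu>) (ctop X d) ss)"
    "ccmp1 B (tcm \<nu> (cbot X d) (b.gcf d i ss)) (cm (fcel b d) i ss)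
      = ccmp B (cm (fcel G d) (ver_fun (tobj \<nu> (corner X d)) i) (map2 (tcf \<nu>) (ctop X d) ss))
          (ver_memb (tobj \<nu> (corner X d)) i) (map2 (tcm \<nu>) (ctop X d) ss)"
proof -
  let ?x = "corner X d" and ?\<Delta> = "cbot X d"
  note bd = b.G.A.boundary[OF d]
  have x: "?x \<in> Obj X" using bd b.G.A.vdom_vcod by simp
  note tD = T_hor[of ?\<Delta>] and bc = b.G_cel[OF d] and Gc = G.G_cel[OF d]
  have c1: "composable (fam_raw B) (thor \<nu> ?\<Delta>) (cel_left (fcel b d)) [fcel b d]"
    "ccmp1 (fam B) (thor \<nu> ?\<Delta>) (fcel b d) = fam_ccmp B (thor \<nu> ?\<Delta>) (cel_left (fcel b d)) [fcel b d]"
    using fam_ccmp1[of "thor \<nu> ?\<Delta>" "fcel b d"] tD bc bd by simp_all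
  have c2: "composable (fam_raw B) (fcel G d) (tobj \<nu> ?x) (map (thor \<nu>) (ctop X d))" using T.composable[OF d] by simp
  have e: "fam_ccmp B (thor \<nu> ?\<Delta>) (cel_left (fcel b d)) [fcel b d] = fam_ccmp B (fcel G d) (tobj \<nu> ?x) (map (thor \<nu>) (ctop X d))"
    using T.cel[OF d] c1 c2 by simp
  note P = T_points[OF w b.G.A.top_set[OF d]]
  have i1: "i \<in> elts (idx (ver_dom (cel_left (fcel b d))))" using i bc b.G_ver bd by simp
  have i2: "i \<in> elts (idx (ver_dom (tobj \<nu> ?x)))" using i T_obj[OF x] by simp
  have bw: "bwalk cel_top i [fcel b d] [ss]" using w bc by simp
  note ev1 = fam_ccmp_eval[OF c1(1) i1 bw] and ev2 = fam_ccmp_eval[OF c2 i2 P[THEN conjunct1]]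
  have cc: "concat (map (\<lambda>s. [s]) ss) = ss" by (induction ss) auto
  have l: "ver_fun (cel_left (fcel b d)) i = hor_left (fhor b ?\<Delta>) (b.gcf d i ss)"
    "cleft B (cm (fcel b d) i ss) = ver_memb (cel_left (fcel b d)) i"
    using b.G_cf_in[OF d i w] b.G_cm_in[OF d i w] bc by simp_all
  show "tcf \<nu> ?\<Delta> (b.gcf d i ss) = G.gcf d (ver_fun (tobj \<nu> ?x) i) (map2 (tcf \<nu>) (ctop X d) ss)"
    using arg_cong[OF e, of "\<lambda>c. cf c i ss"] ev1(1) ev2(1)[unfolded cc] P l by (simp add: tcf_def)
  show "ccmp1 B (tcm \<nu> ?\<Delta> (b.gcf d i ss)) (cm (fcel b d) i ss)
      = ccmp B (cm (fcel G d) (ver_fun (tobj \<nu> ?x) i) (map2 (tcf \<nu>) (ctop X d) ss))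
          (ver_memb (tobj \<nu> ?x) i) (map2 (tcm \<nu>) (ctop X d) ss)"
    using arg_cong[OF e, of "\<lambda>c. cm c i ss"] ev1(2) ev2(2)[unfolded cc] P l by (simp add: tcm_def)
qed

lemma elT_simps [simp]:
  "fdom (elT \<nu>) = el b" "fcod (elT \<nu>) = el G"
  "p \<in> Obj (el_raw b) ==> fobj (elT \<nu>) p = tup [bs p, ver_fun (tobj \<nu> (bs p)) (pt p)]"
  "p \<in> Ver (el_raw b) ==> fver (elT \<nu>) p = tup [bs p, ver_fun (tobj \<nu> (vdom X (bs p))) (pt p)]"
  "p \<in> Hor (el_raw b) ==> fhor (elT \<nu>) p = tup [bs p, tcf \<nu> (bs p) (pt p)]"
  "p \<in> Cel (el_raw b) ==> fcel (elT \<nu>) p = tup (bs p # ver_fun (tobj \<nu> (corner X (bs p))) (pt p)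
      # map2 (tcf \<nu>) (ctop X (bs p)) (pts p))"
  by (simp_all add: elT_def Let_def)

lemma concat_map2:
  "bwalk b.top' i ds sss ==> map2 f (concat (map (ctop X) ds)) (concat sss)
    = concat (bmap b.top' (\<lambda>d i ss. map2 f (ctop X d) ss) i ds sss)"
proof (induction ds arbitrary: i sss)
  case (Cons d ds)
  then obtain ss sss' where s: "sss = ss # sss'" "walk i (b.top' d) ss" "bwalk b.top' (walk_end i (b.top' d) ss) ds sss'"
    by (auto simp: bwalk_Cons_iff)
  have "length (ctop X d) = length ss" using walk_length[OF s(2)] by simp
  then show ?case using Cons.IH[OF s(3)] s by simp
qed simp

lemma elT_functor: "vd_functor (elT \<nu>) (el b) (el G)"
proof -
  let ?t = "\<lambda>x. ver_fun (tobj \<nu> x)"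
  let ?o = "\<lambda>p. tup [bs p, ?t (bs p) (pt p)]" and ?v = "\<lambda>p. tup [bs p, ?t (vdom X (bs p)) (pt p)]"
    and ?h = "\<lambda>p. tup [bs p, tcf \<nu> (bs p) (pt p)]"
    and ?c = "\<lambda>p. tup (bs p # ?t (corner X (bs p)) (pt p) # map2 (tcf \<nu>) (ctop X (bs p)) (pts p))"
  let ?F = "\<lparr>fdom = el b, fcod = el G, fobj = ?o, fver = ?v, fhor = ?h, fcel = ?c\<rparr>"
  have e: "elT \<nu> = vdfun_restrict ?F" by (simp add: elT_def Let_def)
  have tups: "map (\<lambda>p. tup [bs p, f (bs p) (pt p)]) (map2 (\<lambda>h s. tup [h, s]) hs ss) = map2 (\<lambda>h s. tup [h, s]) hs (map2 f hs ss)" for f hs ss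
  proof (induction hs arbitrary: ss)
    case (Cons h hs) then show ?case by (cases ss) auto
  qed simp
  have mapb: "\<And>p. p \<in> Cel (el_raw b) ==> ?c p \<in> Cel (el_raw G) \<and> cleft (el_raw G) (?c p) = tup [cleft X (bs p), ?t (corner X (bs p)) (pt p)]
    \<and> cright (el_raw G) (?c p) = tup [cright X (bs p), ?t (vdom X (cright X (bs p))) (walk_end (pt p) (b.top' (bs p)) (pts p))]
    \<and> cbot (el_raw G) (?c p) = tup [cbot X (bs p), tcf \<nu> (cbot X (bs p)) (b.gcf (bs p) (pt p) (pts p))]"
  proof -
    fix p assume "p \<in> Cel (el_raw b)"
    then obtain d i ss where p: "p = tup (d # i # ss)" "d \<in> Cel X"
      "i \<in> points b (corner X d)" "walk i (b.top' d) ss" by (auto elim: b.el_celE)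
    have x: "corner X d \<in> Obj X" using b.G.A.boundary[OF p(2)] b.G.A.vdom_vcod by simp
    note w = T_walk[OF b.G.A.top_path[OF p(2)] p(4,3)] and t = T_fun_in[OF x p(3)]
    show "?thesis p" using p w t T_natural_cel(1)[OF p(2-4)] by simp
  qed
  show ?thesis
    unfolding e
  proof (rule vd_functor_restrictI[OF b.virtual_double_category_el G.virtual_double_category_el])
    show "vdfun_laws ?F"
      unfolding vdfun_laws_def Let_def vdfun.simps
    proof (intro conjI ballI allI impI)
      fix p assume "p \<in> Obj (el b)"
      then obtain x i where p: "p = tup [x, i]" "x \<in> Obj X" "i \<in> points b x" by (auto elim: b.el_objE)
      note t = T_fun_in[OF p(2,3)]
      show "?o p \<in> Obj (el G)" using p t by simp
      show "?v (vide (el b) p)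
          = vide (el G) (?o p)"
        using p t b.G.A.vide[OF p(2)] by simp
    next
      fix p assume "p \<in> Ver (el b)"
      then obtain u i where p: "p = tup [u, i]" "u \<in> Ver X" "i \<in> points b (vdom X u)" by (auto elim: b.el_verE)
      have t: "?t (vdom X u) i \<in> points G (vdom X u)" using T_fun_in b.G.A.vdom_vcod p by simp
      show "?v p \<in> Ver (el G)"
        "vdom (el G) (?v p)
          = ?o (vdom (el b) p)"
        "vcod (el G) (?v p)
          = ?o (vcod (el b) p)"
        using p t T_natural_ver(1)[OF p(2,3)] by simp_all
    next
      fix p q assume "p \<in> Ver (el b)" "q \<in> Ver (el b)" "vcod (el b) p = vdom (el b) q"
      then obtain u w i j where p: "p = tup [u, i]" "u \<in> Ver X" "i \<in> points b (vdom X u)"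
        "q = tup [w, j]" "w \<in> Ver X" "vcod X u = vdom X w" "j = ver_fun (fver b u) i"
        by (auto elim!: b.el_verE)
      have t: "?t (vdom X u) i \<in> points G (vdom X u)" using T_fun_in b.G.A.vdom_vcod p by simp
      have j: "j \<in> points b (vdom X w)" using b.G_fun_in[OF p(2,3)] p by simp
      have t2: "?t (vdom X w) j \<in> points G (vdom X w)" using T_fun_in b.G.A.vdom_vcod p j by simp
      show "?v (vcmp (el b) q p)
        = vcmp (el G) (?v q) (?v p)"
        using p t t2 j T_natural_ver(1)[OF p(2,3)] b.G.A.vcmp[OF p(2,5,6)] by simp
    next
      fix p assume "p \<in> Hor (el b)"
      then obtain h s where p: "p = tup [h, s]" "h \<in> Hor X" "s \<in> arcs b h" by (auto elim: b.el_horE)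
      note t = T_hor_in[OF p(2,3)]
      show "?h p \<in> Hor (el G)"
        "hdom (el G) (?h p)
          = ?o (hdom (el b) p)"
        "hcod (el G) (?h p)
          = ?o (hcod (el b) p)"
        using p t by simp_all
      show "?c (cide (el b) p)
        = cide (el G) (?h p)"
        using p t b.G.A.cide[OF p(2)] b.G.A.vide b.G.A.hdom_hcod[OF p(2)] by simp
    next
      fix p assume "p \<in> Cel (el b)"
      then have pC: "p \<in> Cel (el_raw b)" by simp
      note in' = mapb[OF pC]
      show "?c p \<in> Cel (el G)" "cbot (el G) (?c p) = ?h (cbot (el b) p)"
        "cleft (el G) (?c p) = ?v (cleft (el b) p)" "cright (el G) (?c p) = ?v (cright (el b) p)"
        using in' pC by simp_all
      show "ctop (el G) (?c p)
          = map ?h (ctop (el b) p)"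
        using in' pC by (simp add: tups del: map_map)
    next
      fix K U \<Theta>s assume "composable (el b) K U \<Theta>s"
      then have c: "composable (el_raw b) K U \<Theta>s" by simp
      then obtain k u i ds sss where d: "composable X k u ds" "i \<in> points b (vdom X u)" "bwalk b.top' i ds sss"
        and e: "K = tup (k # ver_fun (fver b u) i # bmap b.top' b.gcf i ds sss)" "U = tup [u, i]" "\<Theta>s = bmap b.top' b.elc i ds sss"
        by (rule b.el_composableE)
      have cp: "cell_path X u ds" "u \<in> Ver X" "k \<in> Cel X" "vcod X u = corner X k"
        using d(1) b.G.A.cell_path_start by (auto simp: composable_def)
      let ?g = "\<lambda>d i ss. tup (d # ?t (corner X d) i # map2 (tcf \<nu>) (ctop X d) ss)"
      have m: "map ?c \<Theta>s = bmap b.top' ?g i ds sss" unfolding e by (rule b.el_elc[OF cp(1) d(2,3)]) simp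
      have m2: "concat (map pts (bmap b.top' ?g i ds sss)) = map2 (tcf \<nu>) (concat (map (ctop X) ds)) (concat sss)"
        using concat_map2[OF d(3), of "tcf \<nu>"] by (simp add: map_bmap)
      have m3: "map bs (bmap b.top' ?g i ds sss) = ds"
      proof -
        have "map bs (bmap b.top' ?g i ds sss) = map bs (bmap b.top' b.elc i ds sss)" by (simp add: map_bmap)
        then show ?thesis using b.el_cell_path[OF cp(1) d(2,3)] by simp
      qed
      have path: "cell_path (el_raw G) (tup [v, ?t (vdom X v) j]) (map ?c \<Xi>s)" if "cell_path (el_raw b) (tup [v, j]) \<Xi>s" for v j \<Xi>s
        using that
      proof (induction \<Xi>s arbitrary: v j)
        case Nil
        then show ?case using T_fun_in[of "vdom X v" j] b.G.A.vdom_vcod[of v] by simp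
      next
        case (Cons \<Xi> \<Xi>s)
        have "\<Xi> \<in> Cel (el_raw b)" "cleft (el_raw b) \<Xi> = tup [v, j]" "cell_path (el_raw b) (cright (el_raw b) \<Xi>) \<Xi>s"
          using Cons.prems unfolding cell_path.simps by blast+
        moreover from this have jj: "j = pt \<Xi>" "v = cleft X (bs \<Xi>)" by simp_all
        ultimately show ?case using mapb[of \<Xi>] Cons.IH[of "cright X (bs \<Xi>)" "walk_end (pt \<Xi>) (b.top' (bs \<Xi>)) (pts \<Xi>)"] by (simp add: jj)
      qed
      have K: "K \<in> Cel (el_raw b)" using c by (simp add: composable_def)
      have comp: "composable (el_raw G) (?c K) (tup [u, ?t (vdom X u) i]) (map ?c \<Theta>s)"
      proof -
        have cE: "cell_path (el_raw b) (tup [u, i]) \<Theta>s" "map (cbot (el_raw b)) \<Theta>s = ctop (el_raw b) K"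
          using c e(2) by (auto simp: composable_def)
        have *: "map (cbot (el_raw G)) (map ?c \<Theta>s) = map ?h (map (cbot (el_raw b)) \<Theta>s)"
          using mapb cell_path_set[OF cE(1)] by auto
        have "map (cbot (el_raw G)) (map ?c \<Theta>s) = ctop (el_raw G) (?c K)"
          unfolding * cE(2) by (simp add: tups del: map_map)
        then show ?thesis
          using mapb[OF K] path[OF cE(1)] T_natural_ver(1)[OF cp(2) d(2)] cp(4) e(1) by (simp add: composable_def del: map_map)
      qed
      have U: "tup [bs U, ?t (vdom X (bs U)) (pt U)] = tup [u, ?t (vdom X u) i]" using e(2) by simp
      have vl: "corner X (ccmp X k u ds) = vdom X u"
        using b.G.A.ccmp[OF d(1)] b.G.A.vcmp cp b.G.A.boundary by simp
      show "?c (ccmp (el b) K U \<Theta>s) = ccmp (el G) (?c K) (tup [bs U, ?t (vdom X (bs U)) (pt U)]) (map ?c \<Theta>s)"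
        using comp m m2 m3 U b.el_ccmp[OF d] b.G.A.ccmp[OF d(1)] vl e by simp
    qed
  qed simp_all
qed

lemma evT_trans:
  assumes B: "virtual_double_category B"
  shows "vd_trans (evT B \<nu>) (ev B b) (vdfun_comp (ev B G) (elT \<nu>)) (el b) B"
proof -
  let ?o = "\<lambda>p. ver_memb (tobj \<nu> (bs p)) (pt p)" and ?h = "\<lambda>p. tcm \<nu> (bs p) (pt p)"
  note E = vdfun_comp_functor[OF elT_functor G.ev_functor[OF B]]
  have obj: "tup [x, ver_fun (tobj \<nu> x) i] \<in> Obj (el_raw G)" if "x \<in> Obj X" "i \<in> points b x" for x i
    using T_fun_in[OF that] that by simp
  have ver: "tup [u, ver_fun (tobj \<nu> (vdom X u)) i] \<in> Ver (el_raw G)" if "u \<in> Ver X" "i \<in> points b (vdom X u)" for u i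
    using T_fun_in[OF _ that(2)] that(1) b.G.A.vdom_vcod by simp
  have hor: "tup [h, tcf \<nu> h s] \<in> Hor (el_raw G)" if "h \<in> Hor X" "s \<in> arcs b h" for h s
    using T_hor_in[OF that] that by simp
  have cel: "tup (d # ver_fun (tobj \<nu> (corner X d)) i # map2 (tcf \<nu>) (ctop X d) ss) \<in> Cel (el_raw G)"
    if "d \<in> Cel X" "i \<in> points b (corner X d)" "walk i (b.top' d) ss" for d i ss
    using T_walk(1)[OF b.G.A.top_path[OF that(1)] that(3,2)] T_fun_in[OF _ that(2)] b.G.A.boundary[OF that(1)] b.G.A.vdom_vcod that(1) by simp
  show ?thesis
    unfolding evT_def
  proof (rule vd_trans_restrictI[OF b.ev_functor[OF B] E])
    show "vdtrans_laws \<lparr>tsrc = ev B (tsrc \<nu>), ttgt = vdfun_comp (ev B (ttgt \<nu>)) (elT \<nu>),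
       tobj = ?o, thor = ?h\<rparr>"
      unfolding vdtrans_laws_def Let_def vdtrans.simps T.tsrc T.ttgt b.ev_simps
    proof (intro conjI ballI)
      fix p assume "p \<in> Obj (el b)"
      then obtain x i where p: "p = tup [x, i]" "x \<in> Obj X" "i \<in> points b x" by (auto elim: b.el_objE)
      show "?o p \<in> Ver B"
        "vdom B (?o p) = fobj (ev B b) p"
        "vcod B (?o p) = fobj (vdfun_comp (ev B G) (elT \<nu>)) p"
        using p T_fun_in[OF p(2,3)] by simp_all
    next
      fix p assume "p \<in> Ver (el b)"
      then obtain u i where p: "p = tup [u, i]" "u \<in> Ver X" "i \<in> points b (vdom X u)" by (auto elim: b.el_verE)
      show "vcmp B (?o (vcod (el b) p)) (fver (ev B b) p)
        = vcmp B (fver (vdfun_comp (ev B G) (elT \<nu>)) p) (?o (vdom (el b) p))"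
        using p T_natural_ver(2)[OF p(2,3)] ver[OF p(2,3)] by (simp del: G.el_raw_simps(2))
    next
      fix p assume "p \<in> Hor (el b)"
      then obtain h s where p: "p = tup [h, s]" "h \<in> Hor X" "s \<in> arcs b h" by (auto elim: b.el_horE)
      show "?h p \<in> Cel B" "ctop B (?h p) = [fhor (ev B b) p]"
        "cbot B (?h p) = fhor (vdfun_comp (ev B G) (elT \<nu>)) p"
        "cleft B (?h p) = ?o (hdom (el b) p)"
        "cright B (?h p) = ?o (hcod (el b) p)"
        using p T_hor_in[OF p(2,3)] by simp_all
    next
      fix p assume "p \<in> Cel (el b)"
      then obtain d i ss where p: "p = tup (d # i # ss)" "d \<in> Cel X"
        "i \<in> points b (corner X d)" "walk i (b.top' d) ss" by (auto elim: b.el_celE)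
      have pC: "p \<in> Cel (el_raw b)" using p by simp
      have m: "map (\<lambda>p. f (bs p) (pt p)) (map2 (\<lambda>h s. tup [h, s]) hs ss) = map2 f hs ss" for f hs ss
      proof (induction hs arbitrary: ss)
        case (Cons h hs) then show ?case by (cases ss) auto
      qed simp
      show "ccmp1 B (?h (cbot (el b) p)) (fcel (ev B b) p)
        = ccmp B (fcel (vdfun_comp (ev B G) (elT \<nu>)) p)
           (?o (corner (el b) p))
           (map ?h (ctop (el b) p))"
        using p pC T_natural_cel(2)[OF p(2-4)] cel[OF p(2-4)] m[of "tcm \<nu>"] b.G.A.boundary[OF p(2)]
        by (simp del: G.el_raw_simps(4) map_map)
    qed
  qed simp_all
qed

end

context universes
begin

text \<open>The transformation between transposes with underlying span morphisms those of \<open>\<nu>\<close> and members those of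
  \<open>\<mu> : J \<Rightarrow> J' \<circ> elT \<nu>\<close>.\<close>

definition trT_obj :: "'v vdtrans => 'v vdtrans => 'v vdfun => 'v => 'v" where
  "trT_obj \<nu> \<mu> J' x = (let I = idx (fobj (tsrc \<nu>) x) in
     tup [tr_obj (tsrc \<nu>) (tsrc \<mu>) x, tr_obj (ttgt \<nu>) J' x, lam I (ver_fun (tobj \<nu> x)), lam I (\<lambda>i. tobj \<mu> (tup [x, i]))])"

definition trT_hor :: "'v vdtrans => 'v vdtrans => 'v vdfun => 'v => 'v" where
  "trT_hor \<nu> \<mu> J' h = (let X = fdom (tsrc \<nu>); \<Delta> = tr_hor (tsrc \<nu>) (tsrc \<mu>) h;
       P = span_prod (ver_dom (trT_obj \<nu> \<mu> J' (hdom X h))) [\<Delta>] in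
     tup [tup [\<Delta>], tr_hor (ttgt \<nu>) J' h, trT_obj \<nu> \<mu> J' (hdom X h), trT_obj \<nu> \<mu> J' (hcod X h),
       lam P (\<lambda>p. tcf \<nu> h (proj p 1)), lam P (\<lambda>p. thor \<mu> (tup [h, proj p 1]))])"

definition trT :: "'v vdtrans => 'v vdtrans => 'v vdfun => 'v vdtrans" where
  "trT \<nu> \<mu> J' = vdtrans_restrict \<lparr>tsrc = tr (tsrc \<nu>) (tsrc \<mu>), ttgt = tr (ttgt \<nu>) J',
     tobj = trT_obj \<nu> \<mu> J', thor = trT_hor \<nu> \<mu> J'\<rparr>"

end

locale tr_trans = universes elts U1 + T: el_trans elts U1 B b G X \<nu> + P: transposes elts U1 B b X C J + Q: transposes elts U1 B G X C J'
    + a: vd_trans \<mu> J "vdfun_comp J' (elT \<nu>)" "el b" C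
  for elts :: "'v => 'v set" and U1 :: 'v and B :: "'v vdc" and b G :: "'v vdfun" and X :: "'v vdc" and \<nu> :: "'v vdtrans"
    and C :: "'v vdc" and J J' :: "'v vdfun" and \<mu> :: "'v vdtrans"
begin

lemma trT_obj_simps [simp]:
  "ver_dom (trT_obj \<nu> \<mu> J' x) = tr_obj b J x" "ver_cod (trT_obj \<nu> \<mu> J' x) = tr_obj G J' x"
  "i \<in> points b x ==> ver_fun (trT_obj \<nu> \<mu> J' x) i = ver_fun (tobj \<nu> x) i"
  "i \<in> points b x ==> ver_memb (trT_obj \<nu> \<mu> J' x) i = tobj \<mu> (tup [x, i])"
  by (simp_all add: trT_obj_def Let_def)

lemma trT_hor_simps [simp]:
  "cel_top (trT_hor \<nu> \<mu> J' h) = [tr_hor b J h]" "cel_bot (trT_hor \<nu> \<mu> J' h) = tr_hor G J' h"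
  "cel_left (trT_hor \<nu> \<mu> J' h) = trT_obj \<nu> \<mu> J' (hdom X h)" "cel_right (trT_hor \<nu> \<mu> J' h) = trT_obj \<nu> \<mu> J' (hcod X h)"
  by (simp_all add: trT_hor_def Let_def)

lemma trT_obj_in: "x \<in> Obj X ==> trT_obj \<nu> \<mu> J' x \<in> fam_ver C"
  unfolding trT_obj_def Let_def T.T.tsrc T.T.ttgt a.tsrc
  using T.T_fun_in[of x] a.obj by (intro fam_verI) (simp_all add: P.tr_obj_in Q.tr_obj_in)

lemma trT_hor_eval:
  assumes h: "h \<in> Hor X" and s: "s \<in> arcs b h"
  shows "cf (trT_hor \<nu> \<mu> J' h) (hor_left (fhor b h) s) [s] = tcf \<nu> h s"
    "cm (trT_hor \<nu> \<mu> J' h) (hor_left (fhor b h) s) [s] = thor \<mu> (tup [h, s])"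
proof -
  have X: "tr_obj b J (hdom X h) \<in> fam_obj C" using P.tr_obj_in T.b.G.A.hdom_hcod[OF h] by simp
  have S: "set [tr_hor b J h] \<subseteq> fam_hor C" using P.tr_hor_in[OF h] by simp
  have w: "walk (hor_left (fhor b h) s) [tr_hor b J h] [s]" using s by simp
  have i: "hor_left (fhor b h) s \<in> elts (idx (tr_obj b J (hdom X h)))" using T.b.G_leg_in[OF h s] by simp
  show "cf (trT_hor \<nu> \<mu> J' h) (hor_left (fhor b h) s) [s] = tcf \<nu> h s"
    "cm (trT_hor \<nu> \<mu> J' h) (hor_left (fhor b h) s) [s] = thor \<mu> (tup [h, s])"
    unfolding trT_hor_def Let_def T.T.tsrc a.tsrc T.T.ttgt trT_obj_simps T.b.G.fdom
    using cf_tup[OF X S refl i w] cm_tup[OF X S refl i w] by simp_all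
qed

lemma trT_hor_in:
  assumes h: "h \<in> Hor X"
  shows "trT_hor \<nu> \<mu> J' h \<in> fam_cel C"
  unfolding trT_hor_def Let_def T.T.tsrc a.tsrc T.T.ttgt T.b.G.fdom
proof (rule fam_celI)
  note hv = T.b.G.A.hdom_hcod[OF h]
  fix i ss assume i: "i \<in> elts (idx (ver_dom (trT_obj \<nu> \<mu> J' (hdom X h))))" "walk i [tr_hor b J h] ss"
  then obtain s where s: "ss = [s]" "s \<in> arcs b h" "hor_left (fhor b h) s = i" by (auto simp: walk_Cons_iff)
  have e: "walk_end i [tr_hor b J h] ss = hor_right (fhor b h) s" using s by (simp add: walk_end_def)
  note t = T.T_hor_in[OF h s(2)] and l = T.b.G_leg_in[OF h s(2)]
  have el: "tup [h, s] \<in> Hor (el_raw b)" using h s by simp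
  show "tcf \<nu> h (proj (tup (i # ss)) 1) \<in> elts (hor_apex (tr_hor G J' h)) \<and>
     hor_left (tr_hor G J' h) (tcf \<nu> h (proj (tup (i # ss)) 1)) = ver_fun (trT_obj \<nu> \<mu> J' (hdom X h)) i \<and>
     hor_right (tr_hor G J' h) (tcf \<nu> h (proj (tup (i # ss)) 1)) =
       ver_fun (trT_obj \<nu> \<mu> J' (hcod X h)) (walk_end i [tr_hor b J h] ss) \<and>
     thor \<mu> (tup [h, proj (tup (i # ss)) 1]) \<in> Cel C \<and>
     ctop C (thor \<mu> (tup [h, proj (tup (i # ss)) 1])) = map2 hor_memb [tr_hor b J h] ss \<and>
     cbot C (thor \<mu> (tup [h, proj (tup (i # ss)) 1])) = hor_memb (tr_hor G J' h) (tcf \<nu> h (proj (tup (i # ss)) 1)) \<and>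
     cleft C (thor \<mu> (tup [h, proj (tup (i # ss)) 1])) = ver_memb (trT_obj \<nu> \<mu> J' (hdom X h)) i \<and>
     cright C (thor \<mu> (tup [h, proj (tup (i # ss)) 1])) = ver_memb (trT_obj \<nu> \<mu> J' (hcod X h)) (walk_end i [tr_hor b J h] ss)"
    unfolding e using t l s a.hor[of "tup [h, s]"] el h by simp
qed (use T.b.G.A.hdom_hcod[OF h] trT_obj_in P.tr_hor_in[OF h] Q.tr_hor_in[OF h] P.tr_obj_in in simp_all)

lemma trT_natural_ver:
  assumes u: "u \<in> Ver X"
  shows "fam_vcmp C (trT_obj \<nu> \<mu> J' (vcod X u)) (tr_ver b J u) = fam_vcmp C (tr_ver G J' u) (trT_obj \<nu> \<mu> J' (vdom X u))"
proof (rule fam_ver_eqI)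
  note v = T.b.G.A.vdom_vcod[OF u]
  show "fam_vcmp C (trT_obj \<nu> \<mu> J' (vcod X u)) (tr_ver b J u) \<in> fam_ver C"
    "fam_vcmp C (tr_ver G J' u) (trT_obj \<nu> \<mu> J' (vdom X u)) \<in> fam_ver C"
    using P.C.fam_vcmp_in v u trT_obj_in P.tr_ver_in Q.tr_ver_in by simp_all
  fix i assume "i \<in> elts (idx (ver_dom (fam_vcmp C (trT_obj \<nu> \<mu> J' (vcod X u)) (tr_ver b J u))))"
  then have i: "i \<in> points b (vdom X u)" by simp
  have j: "ver_fun (fver b u) i \<in> points b (vcod X u)" using T.b.G_fun_in[OF u i] .
  have t: "ver_fun (tobj \<nu> (vdom X u)) i \<in> points G (vdom X u)" using T.T_fun_in[OF _ i] v by simp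
  show "ver_fun (fam_vcmp C (trT_obj \<nu> \<mu> J' (vcod X u)) (tr_ver b J u)) i
      = ver_fun (fam_vcmp C (tr_ver G J' u) (trT_obj \<nu> \<mu> J' (vdom X u))) i \<and>
    ver_memb (fam_vcmp C (trT_obj \<nu> \<mu> J' (vcod X u)) (tr_ver b J u)) i
      = ver_memb (fam_vcmp C (tr_ver G J' u) (trT_obj \<nu> \<mu> J' (vdom X u))) i"
    using i j t T.T_natural_ver(1)[OF u i] a.ver[of "tup [u, i]"] u by simp
qed simp_all

lemma trT_path:
  "hpath (Obj X) (Hor X) (hdom X) (hcod X) a hs c ==> cell_path (fam_raw C) (trT_obj \<nu> \<mu> J' a) (map (trT_hor \<nu> \<mu> J') hs)
    \<and> cell_path_end (fam_raw C) (trT_obj \<nu> \<mu> J' a) (map (trT_hor \<nu> \<mu> J') hs) = trT_obj \<nu> \<mu> J' c"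
  by (induction hs arbitrary: a) (auto simp: trT_obj_in trT_hor_in)

lemma trT_points:
  assumes "walk i (map (fhor b) hs) ss" "set hs \<subseteq> Hor X"
  shows "bwalk cel_top i (map (trT_hor \<nu> \<mu> J') hs) (map (\<lambda>s. [s]) ss)
    \<and> bmap cel_top cf i (map (trT_hor \<nu> \<mu> J') hs) (map (\<lambda>s. [s]) ss) = map2 (tcf \<nu>) hs ss
    \<and> bmap cel_top cm i (map (trT_hor \<nu> \<mu> J') hs) (map (\<lambda>s. [s]) ss) = map (thor \<mu>) (map2 (\<lambda>h s. tup [h, s]) hs ss)"
  using assms
proof (induction hs arbitrary: i ss)
  case (Cons h hs)
  then obtain s ss' where s: "ss = s # ss'" "s \<in> arcs b h" "hor_left (fhor b h) s = i"
    "walk (hor_right (fhor b h) s) (map (fhor b) hs) ss'"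
    by (auto simp: walk_Cons_iff)
  have e: "walk_end i [tr_hor b J h] [s] = hor_right (fhor b h) s" using s by (simp add: walk_end_def)
  show ?case
    using Cons.IH[OF s(4)] Cons.prems trT_hor_eval[of h s] s e by simp
qed simp

text \<open>Naturality at a point splits into that of \<open>\<nu>\<close>, for the maps, and that of \<open>\<mu>\<close> at an element, for the
  members.\<close>

lemma trT_natural_cel:
  assumes d: "d \<in> Cel X"
  shows "fam_ccmp C (trT_hor \<nu> \<mu> J' (cbot X d)) (tr_ver b J (cleft X d)) [tr_cel b J d]
    = fam_ccmp C (tr_cel G J' d) (trT_obj \<nu> \<mu> J' (corner X d)) (map (trT_hor \<nu> \<mu> J') (ctop X d))"
    "composable (fam_raw C) (trT_hor \<nu> \<mu> J' (cbot X d)) (tr_ver b J (cleft X d)) [tr_cel b J d]"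
    "composable (fam_raw C) (tr_cel G J' d) (trT_obj \<nu> \<mu> J' (corner X d)) (map (trT_hor \<nu> \<mu> J') (ctop X d))"
proof -
  let ?x = "corner X d" and ?\<Delta> = "cbot X d"
  note bd = T.b.G.A.boundary[OF d]
  have x: "?x \<in> Obj X" and D: "?\<Delta> \<in> Hor X" using bd T.b.G.A.vdom_vcod by auto
  note S = T.b.G.A.top_set[OF d]
  show c1: "composable (fam_raw C) (trT_hor \<nu> \<mu> J' ?\<Delta>) (tr_ver b J (cleft X d)) [tr_cel b J d]"
    using trT_hor_in[OF D] P.tr_cel_in[OF d] P.tr_ver_in bd by (simp add: composable_def)
  note tp = trT_path[OF T.b.G.A.top_path[OF d]]
  show c2: "composable (fam_raw C) (tr_cel G J' d) (trT_obj \<nu> \<mu> J' ?x) (map (trT_hor \<nu> \<mu> J') (ctop X d))"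
    using Q.tr_cel_in[OF d] tp by (simp add: composable_def)
  have tops: "concat (map cel_top (map (trT_hor \<nu> \<mu> J') hs)) = map (tr_hor b J) hs" for hs by (induction hs) auto
  show "fam_ccmp C (trT_hor \<nu> \<mu> J' ?\<Delta>) (tr_ver b J (cleft X d)) [tr_cel b J d]
    = fam_ccmp C (tr_cel G J' d) (trT_obj \<nu> \<mu> J' ?x) (map (trT_hor \<nu> \<mu> J') (ctop X d))" (is "?l = ?r")
  proof (rule fam_cel_eqI[OF P.C.fam_ccmp_in[OF c1] P.C.fam_ccmp_in[OF c2]])
    show "cel_top ?l = cel_top ?r" unfolding P.C.fam_ccmp_simps tops by simp
    show "cel_left ?l = cel_left ?r" using trT_natural_ver[of "cleft X d"] bd by (simp add: P.C.fam_ccmp_simps)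
    show "cel_right ?l = cel_right ?r" using trT_natural_ver[of "cright X d"] bd tp by (simp add: P.C.fam_ccmp_simps)
    fix i ss assume i: "i \<in> elts (idx (ver_dom (cel_left ?l)))" "walk i (cel_top ?l) ss"
    have i': "i \<in> points b ?x" using i by (simp add: P.C.fam_ccmp_simps)
    have w: "walk i (T.b.top' d) ss" using i(2) P.tr_walk(1) by (simp add: P.C.fam_ccmp_simps)
    have i1: "i \<in> elts (idx (ver_dom (tr_ver b J (cleft X d))))" "i \<in> elts (idx (ver_dom (trT_obj \<nu> \<mu> J' ?x)))" using i' by simp_all
    have bw: "bwalk cel_top i [tr_cel b J d] [ss]" using w P.tr_walk(1) by simp
    note pts = trT_points[OF w S]
    note ev1 = P.C.fam_ccmp_eval[OF c1 i1(1) bw] and ev2 = P.C.fam_ccmp_eval[OF c2 i1(2) pts[THEN conjunct1]]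
    have cc: "concat (map (\<lambda>s. [s]) ss) = ss" by (induction ss) auto
    note cfb = T.b.G_cf_in[OF d i' w] and tw = T.T_walk[OF T.b.G.A.top_path[OF d] w i'] and tn = T.T_natural_cel[OF d i' w]
    have tf: "ver_fun (tobj \<nu> ?x) i \<in> points G ?x" using T.T_fun_in[OF x i'] by simp
    note evb = P.tr_cel_eval[OF d i' w] and evG = Q.tr_cel_eval[OF d tf tw(1)]
    have hl: "hor_left (fhor b ?\<Delta>) (T.b.gcf d i ss) = ver_fun (fver b (cleft X d)) i" using cfb by simp
    note he = trT_hor_eval[OF D cfb[THEN conjunct1], unfolded hl]
    have pC: "T.b.elc d i ss \<in> Cel (el_raw b)" using d i' w by simp
    have an: "ccmp1 C (thor \<mu> (tup [?\<Delta>, T.b.gcf d i ss])) (fcel J (T.b.elc d i ss))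
      = ccmp C (fcel J' (T.b.elc d (ver_fun (tobj \<nu> ?x) i) (map2 (tcf \<nu>) (ctop X d) ss))) (tobj \<mu> (tup [?x, i]))
          (map (thor \<mu>) (map2 (\<lambda>h s. tup [h, s]) (ctop X d) ss))"
      using a.cel[of "T.b.elc d i ss"] pC bd i' by (simp del: map_map T.b.el_raw_simps(4))
    have cl: "cleft C (fcel J (T.b.elc d i ss)) = fver J (tup [cleft X d, i])"
      using P.J.cel[of "T.b.elc d i ss"] pC by (simp del: T.b.el_raw_simps(4))
    show "cf ?l i ss = cf ?r i ss \<and> cm ?l i ss = cm ?r i ss"
      using ev1 ev2[unfolded cc] pts evb evG he tn(1) an cl i' bd by (simp del: map_map)
  qed (simp_all add: P.C.fam_ccmp_simps)
qed

lemma trT_trans: "vd_trans (trT \<nu> \<mu> J') (tr b J) (tr G J') X (fam C)"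
  unfolding trT_def
proof (rule vd_trans_restrictI[OF P.tr_functor Q.tr_functor])
  show "vdtrans_laws \<lparr>tsrc = tr (tsrc \<nu>) (tsrc \<mu>), ttgt = tr (ttgt \<nu>) J', tobj = trT_obj \<nu> \<mu> J', thor = trT_hor \<nu> \<mu> J'\<rparr>"
    unfolding vdtrans_laws_def Let_def vdtrans.simps T.T.tsrc T.T.ttgt a.tsrc P.tr_fun_simps
  proof (intro conjI ballI)
    fix x assume x: "x \<in> Obj X"
    show "trT_obj \<nu> \<mu> J' x \<in> Ver (fam C)" "vdom (fam C) (trT_obj \<nu> \<mu> J' x) = fobj (tr b J) x"
      "vcod (fam C) (trT_obj \<nu> \<mu> J' x) = fobj (tr G J') x"
      using x trT_obj_in[OF x] by simp_all
  next
    fix u assume u: "u \<in> Ver X"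
    show "vcmp (fam C) (trT_obj \<nu> \<mu> J' (vcod X u)) (fver (tr b J) u)
      = vcmp (fam C) (fver (tr G J') u) (trT_obj \<nu> \<mu> J' (vdom X u))"
      using u T.b.G.A.vdom_vcod[OF u] trT_obj_in P.tr_ver_in Q.tr_ver_in trT_natural_ver by simp
  next
    fix h assume h: "h \<in> Hor X"
    show "trT_hor \<nu> \<mu> J' h \<in> Cel (fam C)" "ctop (fam C) (trT_hor \<nu> \<mu> J' h) = [fhor (tr b J) h]"
      "cbot (fam C) (trT_hor \<nu> \<mu> J' h) = fhor (tr G J') h"
      "cleft (fam C) (trT_hor \<nu> \<mu> J' h) = trT_obj \<nu> \<mu> J' (hdom X h)"
      "cright (fam C) (trT_hor \<nu> \<mu> J' h) = trT_obj \<nu> \<mu> J' (hcod X h)"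
      using h trT_hor_in[OF h] by simp_all
  next
    fix d assume d: "d \<in> Cel X"
    show "ccmp1 (fam C) (trT_hor \<nu> \<mu> J' (cbot X d)) (fcel (tr b J) d)
      = ccmp (fam C) (fcel (tr G J') d) (trT_obj \<nu> \<mu> J' (corner X d)) (map (trT_hor \<nu> \<mu> J') (ctop X d))"
      using d trT_natural_cel[OF d] P.tr_cel_in[OF d] by simp
  qed
qed simp_all

end

subsection \<open>Extensionality\<close>

context universes
begin

lemma familiesI: "virtual_double_category A ==> families elts U1 A"
  by (intro families.intro universes_axioms vdc_laws)

lemma elementsI: "virtual_double_category A ==> vd_functor H X (fam A) ==> elements elts U1 A H X"
  by (intro elements.intro familiesI)

lemma el_transI:
  assumes "virtual_double_category A" "vd_trans \<phi> P Q X (fam A)"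
  shows "el_trans elts U1 A P Q X \<phi>"
proof -
  interpret vd_trans \<phi> P Q X "fam A" by fact
  show ?thesis by (intro el_trans.intro elementsI familiesI assms F G)
qed

lemma same_spansD:
  assumes "same_spans G G'" "fdom G' = X"
  shows "x \<in> Obj X ==> idx (fobj G x) = idx (fobj G' x)"
    and "u \<in> Ver X ==> i \<in> points G' (vdom X u) ==> ver_fun (fver G u) i = ver_fun (fver G' u) i"
    and "h \<in> Hor X ==> span_like (fhor G h) (fhor G' h)"
    and "h \<in> Hor X ==> hor_apex (fhor G h) = hor_apex (fhor G' h)"
    and "h \<in> Hor X ==> s \<in> arcs G' h ==> hor_left (fhor G h) s = hor_left (fhor G' h) s
      \<and> hor_right (fhor G h) s = hor_right (fhor G' h) s"
    and "d \<in> Cel X ==> i \<in> points G' (corner X d) ==> walk i (map (fhor G') (ctop X d)) ss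
       ==> cf (fcel G d) i ss = cf (fcel G' d) i ss"
    and "fdom G = X"
  using assms unfolding same_spans_def Let_def span_like_def by auto

lemma same_spans_walk:
  assumes "same_spans G G'" "fdom G' = X" "set hs \<subseteq> Hor X"
  shows "walk i (map (fhor G) hs) ss = walk i (map (fhor G') hs) ss"
    "walk i (map (fhor G') hs) ss ==> walk_end i (map (fhor G) hs) ss = walk_end i (map (fhor G') hs) ss"
proof -
  have "list_all2 span_like (map (fhor G) hs) (map (fhor G') hs)"
    using same_spansD(3)[OF assms(1,2)] assms(3) by (auto simp: list_all2_map1 list_all2_map2 intro!: list.rel_refl_strong)
  from walk_like[OF this] show "walk i (map (fhor G) hs) ss = walk i (map (fhor G') hs) ss"
    "walk i (map (fhor G') hs) ss ==> walk_end i (map (fhor G) hs) ss = walk_end i (map (fhor G') hs) ss" by auto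
qed

lemma same_spans_sym:
  assumes A: "virtual_double_category A" "virtual_double_category A'" and P: "vd_functor P X (fam A)" and Q: "vd_functor Q X (fam A')"
    and s: "same_spans P Q"
  shows "same_spans Q P"
proof -
  interpret Q: elements elts U1 A' Q X by (rule elementsI[OF A(2) Q])
  interpret P: elements elts U1 A P X by (rule elementsI[OF A(1) P])
  note D = same_spansD[OF s Q.G.fdom]
  show ?thesis
    unfolding same_spans_def Let_def P.G.fdom
    using D same_spans_walk[OF s Q.G.fdom Q.G.A.top_set] Q.G.A.vdom_vcod Q.G.A.boundary by (auto simp: span_like_def)
qed

lemma same_spans_trans:
  assumes A: "virtual_double_category A" and Q: "vd_functor Q X (fam A)"
    and PQ: "same_spans P Q" and QR: "same_spans Q R"
  shows "same_spans P R"
proof -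
  interpret Q: elements elts U1 A Q X by (rule elementsI[OF A Q])
  have R: "fdom R = X" using QR by (simp add: same_spans_def Let_def)
  note D = same_spansD[OF PQ Q.G.fdom] and E = same_spansD[OF QR R]
  show ?thesis
    unfolding same_spans_def Let_def R
    using D E same_spans_walk[OF QR R Q.G.A.top_set] Q.G.A.vdom_vcod Q.G.A.boundary by (auto simp: span_like_def)
qed

text \<open>The functions occurring in a value are coded by their graphs, hence determined by their values at indices,
  and these are given by the spans and the members.\<close>

lemma fam_functor_eqI:
  assumes A: "virtual_double_category A" and P: "vd_functor P X (fam A)" and Q: "vd_functor Q X (fam A)"
    and s: "same_spans P Q"
    and obj: "\<And>x i. x \<in> Obj X ==> i \<in> points Q x ==> memb (fobj P x) i = memb (fobj Q x) i"
    and ver: "\<And>u i. u \<in> Ver X ==> i \<in> points Q (vdom X u) ==> ver_memb (fver P u) i = ver_memb (fver Q u) i"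
    and hor: "\<And>h s. h \<in> Hor X ==> s \<in> arcs Q h ==> hor_memb (fhor P h) s = hor_memb (fhor Q h) s"
    and cel: "\<And>d i ss. d \<in> Cel X ==> i \<in> points Q (corner X d) ==> walk i (map (fhor Q) (ctop X d)) ss
      ==> cm (fcel P d) i ss = cm (fcel Q d) i ss"
  shows "P = Q"
proof -
  interpret P: elements elts U1 A P X by (rule elementsI[OF A P])
  interpret Q: elements elts U1 A Q X by (rule elementsI[OF A Q])
  note D = same_spansD[OF s Q.G.fdom]
  have o: "fobj P x = fobj Q x" if "x \<in> Obj X" for x
    using D(1)[OF that] obj[OF that] by (intro fam_obj_eqI[OF P.G_obj[OF that] Q.G_obj[OF that]]) simp_all
  have v: "fver P u = fver Q u" if "u \<in> Ver X" for u
    by (rule fam_ver_eqI[of _ A _ A]) (use P.G_ver[OF that] Q.G_ver[OF that] o P.G.A.vdom_vcod[OF that] D(2)[OF that] ver[OF that]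
    in simp_all)
  have h: "fhor P h = fhor Q h" if "h \<in> Hor X" for h
    by (rule fam_hor_eqI[of _ A _ A]) (use P.G_hor[OF that] Q.G_hor[OF that] o P.G.A.hdom_hcod[OF that] D(4,5)[OF that] hor[OF that]
    in simp_all)
  have c: "fcel P d = fcel Q d" if t: "d \<in> Cel X" for d
  proof -
    have m: "map (fhor P) (ctop X d) = map (fhor Q) (ctop X d)" using h P.G.A.top_set[OF t] by auto
    note b = P.G.A.boundary[OF t] and pc = P.G_cel[OF t] and qc = Q.G_cel[OF t]
    have dl: "ver_dom (cel_left (fcel P d)) = fobj Q (corner X d)" using pc b P.G_ver o P.G.A.vdom_vcod by simp
    show ?thesis
    proof (rule fam_cel_eqI[of _ A _ A])
      fix i ss assume i: "i \<in> elts (idx (ver_dom (cel_left (fcel P d))))" and w: "walk i (cel_top (fcel P d)) ss"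
      have w': "walk i (map (fhor Q) (ctop X d)) ss" using w pc m by metis
      show "cf (fcel P d) i ss = cf (fcel Q d) i ss \<and> cm (fcel P d) i ss = cm (fcel Q d) i ss"
        using D(6)[OF t _ w'] cel[OF t _ w'] i dl by simp
    qed (use pc qc b h v m in \<open>simp_all cong: map_cong\<close>)
  qed
  show ?thesis
    by (rule vdfun_eqI) (simp_all add: P.G.is_functor Q.G.is_functor o v h c)
qed

lemma fam_trans_eqI:
  assumes A: "virtual_double_category A" and \<phi>: "vd_trans \<phi> P Q X (fam A)" and \<psi>: "vd_trans \<psi> P Q X (fam A)"
    and obj: "\<And>x i. x \<in> Obj X ==> i \<in> points P x ==> ver_fun (tobj \<phi> x) i = ver_fun (tobj \<psi> x) i
      \<and> ver_memb (tobj \<phi> x) i = ver_memb (tobj \<psi> x) i"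
    and hor: "\<And>h s. h \<in> Hor X ==> s \<in> arcs P h ==> tcf \<phi> h s = tcf \<psi> h s \<and> tcm \<phi> h s = tcm \<psi> h s"
  shows "\<phi> = \<psi>"
proof -
  interpret p: el_trans elts U1 A P Q X \<phi> by (rule el_transI[OF A \<phi>])
  interpret q: el_trans elts U1 A P Q X \<psi> by (rule el_transI[OF A \<psi>])
  have o: "tobj \<phi> x = tobj \<psi> x" if "x \<in> Obj X" for x
    by (rule fam_ver_eqI[of _ A _ A]) (use p.T_obj[OF that] q.T_obj[OF that] obj[OF that] in simp_all)
  have h: "thor \<phi> h = thor \<psi> h" if g: "h \<in> Hor X" for h
  proof (rule fam_cel_eqI[of _ A _ A])
    note t = p.T_hor[OF g] q.T_hor[OF g] p.b.G.A.hdom_hcod[OF g]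
    show "thor \<phi> h \<in> fam_cel A" "thor \<psi> h \<in> fam_cel A" "cel_top (thor \<phi> h) = cel_top (thor \<psi> h)"
      "cel_bot (thor \<phi> h) = cel_bot (thor \<psi> h)" "cel_left (thor \<phi> h) = cel_left (thor \<psi> h)"
      "cel_right (thor \<phi> h) = cel_right (thor \<psi> h)" using t o by simp_all
    fix i ss assume "i \<in> elts (idx (ver_dom (cel_left (thor \<phi> h))))" "walk i (cel_top (thor \<phi> h)) ss"
    then obtain s where "ss = [s]" "s \<in> arcs P h" "hor_left (fhor P h) s = i"
      using t by (auto simp: walk_Cons_iff)
    then show "cf (thor \<phi> h) i ss = cf (thor \<psi> h) i ss \<and> cm (thor \<phi> h) i ss = cm (thor \<psi> h) i ss"
      using hor[OF g, of s] by (auto simp: tcf_def tcm_def)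
  qed
  show ?thesis by (rule vdtrans_eqI) (simp_all add: p.T.trans q.T.trans o h p.T.fdom_src)
qed

subsection \<open>Members of composite transformations\<close>

lemma id_members:
  assumes A: "virtual_double_category A" and P: "vd_functor P X (fam A)"
  shows "x \<in> Obj X ==> i \<in> points P x ==> ver_fun (tobj (vdtrans_id P) x) i = i
      \<and> ver_memb (tobj (vdtrans_id P) x) i = vide A (memb (fobj P x) i)"
    "h \<in> Hor X ==> s \<in> arcs P h ==> tcf (vdtrans_id P) h s = s
      \<and> tcm (vdtrans_id P) h s = cide A (hor_memb (fhor P h) s)"
proof -
  interpret P: elements elts U1 A P X by (rule elementsI[OF A P])
  show "x \<in> Obj X ==> i \<in> points P x ==> ver_fun (tobj (vdtrans_id P) x) i = i
      \<and> ver_memb (tobj (vdtrans_id P) x) i = vide A (memb (fobj P x) i)"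
    using P.G_obj[of x] by simp
  show "h \<in> Hor X ==> s \<in> arcs P h ==> tcf (vdtrans_id P) h s = s
      \<and> tcm (vdtrans_id P) h s = cide A (hor_memb (fhor P h) s)"
    using P.G_hor[of h] P.fam_cide_eval[of "fhor P h" s] by (simp add: tcf_def tcm_def)
qed

lemma vcomp_members:
  assumes A: "virtual_double_category A" and \<phi>: "vd_trans \<phi> P Q X (fam A)" and \<psi>: "vd_trans \<psi> Q R X (fam A)"
  shows "x \<in> Obj X ==> i \<in> points P x ==>
      ver_fun (tobj (vdtrans_vcomp \<psi> \<phi>) x) i = ver_fun (tobj \<psi> x) (ver_fun (tobj \<phi> x) i)
      \<and> ver_memb (tobj (vdtrans_vcomp \<psi> \<phi>) x) i = vcmp A (ver_memb (tobj \<psi> x) (ver_fun (tobj \<phi> x) i)) (ver_memb (tobj \<phi> x) i)"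
    "h \<in> Hor X ==> s \<in> arcs P h ==>
      tcf (vdtrans_vcomp \<psi> \<phi>) h s = tcf \<psi> h (tcf \<phi> h s)
      \<and> tcm (vdtrans_vcomp \<psi> \<phi>) h s = ccmp1 A (tcm \<psi> h (tcf \<phi> h s)) (tcm \<phi> h s)"
proof -
  interpret p: el_trans elts U1 A P Q X \<phi> by (rule el_transI[OF A \<phi>])
  interpret q: el_trans elts U1 A Q R X \<psi> by (rule el_transI[OF A \<psi>])
  show "x \<in> Obj X ==> i \<in> points P x ==>
      ver_fun (tobj (vdtrans_vcomp \<psi> \<phi>) x) i = ver_fun (tobj \<psi> x) (ver_fun (tobj \<phi> x) i)
      \<and> ver_memb (tobj (vdtrans_vcomp \<psi> \<phi>) x) i = vcmp A (ver_memb (tobj \<psi> x) (ver_fun (tobj \<phi> x) i)) (ver_memb (tobj \<phi> x) i)"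
    using p.T_obj[of x] q.T_obj[of x] by (simp add: p.T.fdom_src p.T.fcod_src)
  assume g: "h \<in> Hor X" and s: "s \<in> arcs P h"
  note tp = p.T_hor[OF g] and tq = q.T_hor[OF g] and h = p.T_hor_in[OF g s] and d = p.b.G.A.hdom_hcod[OF g]
  have c: "composable (fam_raw A) (thor \<psi> h) (cel_left (thor \<phi> h)) [thor \<phi> h]"
    "ccmp1 (fam A) (thor \<psi> h) (thor \<phi> h) = fam_ccmp A (thor \<psi> h) (cel_left (thor \<phi> h)) [thor \<phi> h]"
    using p.fam_ccmp1[of "thor \<psi> h" "thor \<phi> h"] tp tq by simp_all
  have i: "hor_left (fhor P h) s \<in> elts (idx (ver_dom (cel_left (thor \<phi> h))))" using tp p.T_obj d p.b.G_leg_in[OF g s] by simp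
  have b: "bwalk cel_top (hor_left (fhor P h) s) [thor \<phi> h] [[s]]" using tp s by simp
  note ev = p.fam_ccmp_eval[OF c(1) i b, simplified]
  show "tcf (vdtrans_vcomp \<psi> \<phi>) h s = tcf \<psi> h (tcf \<phi> h s)
      \<and> tcm (vdtrans_vcomp \<psi> \<phi>) h s = ccmp1 A (tcm \<psi> h (tcf \<phi> h s)) (tcm \<phi> h s)"
    using g c(2) ev h tp by (simp add: tcf_def tcm_def p.T.fdom_src p.T.fcod_src)
qed

lemma whisker_right_members:
  assumes "vd_trans \<phi> P Q Y Z" and "vd_functor K X Y"
  shows "x \<in> Obj X ==> tobj (whisker_right \<phi> K) x = tobj \<phi> (fobj K x)"
    "h \<in> Hor X ==> tcf (whisker_right \<phi> K) h s = tcf \<phi> (fhor K h) s"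
    "h \<in> Hor X ==> tcm (whisker_right \<phi> K) h s = tcm \<phi> (fhor K h) s"
proof -
  interpret p: vd_trans \<phi> P Q Y Z by fact
  interpret K: vd_functor K X Y by fact
  show "x \<in> Obj X ==> tobj (whisker_right \<phi> K) x = tobj \<phi> (fobj K x)"
    "h \<in> Hor X ==> tcf (whisker_right \<phi> K) h s = tcf \<phi> (fhor K h) s"
    "h \<in> Hor X ==> tcm (whisker_right \<phi> K) h s = tcm \<phi> (fhor K h) s"
    by (simp_all add: tcf_def tcm_def)
qed

section \<open>The 2-functor of families\<close>

lemma famF_obj_simps [simp]:
  "idx (famF_obj F Y) = idx Y" "i \<in> elts (idx Y) ==> memb (famF_obj F Y) i = fobj F (memb Y i)"
  by (simp_all add: famF_obj_def)

lemma famF_ver_simps [simp]: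
  "ver_dom (famF_ver F u) = famF_obj F (ver_dom u)" "ver_cod (famF_ver F u) = famF_obj F (ver_cod u)"
  "ver_fun (famF_ver F u) i = ver_fun u i" "i \<in> elts (idx (ver_dom u)) ==> ver_memb (famF_ver F u) i = fver F (ver_memb u i)"
  by (simp_all add: famF_ver_def, simp add: ver_fun_def)

lemma famF_hor_simps [simp]:
  "hor_dom (famF_hor F h) = famF_obj F (hor_dom h)" "hor_cod (famF_hor F h) = famF_obj F (hor_cod h)"
  "hor_apex (famF_hor F h) = hor_apex h" "hor_left (famF_hor F h) s = hor_left h s" "hor_right (famF_hor F h) s = hor_right h s"
  "s \<in> elts (hor_apex h) ==> hor_memb (famF_hor F h) s = fhor F (hor_memb h s)"
  by (simp_all add: famF_hor_def, simp_all add: hor_left_def hor_right_def)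

lemma famF_cel_simps [simp]:
  "cel_top (famF_cel F d) = map (famF_hor F) (cel_top d)" "cel_bot (famF_cel F d) = famF_hor F (cel_bot d)"
  "cel_left (famF_cel F d) = famF_ver F (cel_left d)" "cel_right (famF_cel F d) = famF_ver F (cel_right d)"
  "cf (famF_cel F d) i ss = cf d i ss"
  by (simp_all add: famF_cel_def, simp add: cf_def cel_fun_def)

lemma famF_cel_memb [simp]:
  assumes "d \<in> fam_cel A" "i \<in> elts (idx (ver_dom (cel_left d)))" "walk i (cel_top d) ss"
  shows "cm (famF_cel F d) i ss = fcel F (cm d i ss)"
  unfolding famF_cel_def
  using cm_tup[OF fam_verD(1)[OF fam_celD(1)[OF assms(1)]] hpath_set[OF fam_celD(4)[OF assms(1)]] refl assms(2,3)]
  by (simp add: cm_def)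

lemma famF_like: "span_like (famF_hor F h) h"
  by (simp add: span_like_def)

lemma famF_walk: "walk i (map (famF_hor F) hs) ss = walk i hs ss"
  by (rule walk_like(1)) (simp add: list_all2_map1 famF_like list.rel_refl_strong)

lemma fam_ver_proj: "u \<in> fam_ver A ==> proj u 2 = lam (idx (ver_dom u)) (ver_fun u)"
  by (subst fam_verD(4)[symmetric], assumption) simp

lemma fam_hor_proj:
  "h \<in> fam_hor A ==> proj h 3 = lam (hor_apex h) (hor_left h)" "h \<in> fam_hor A ==> proj h 4 = lam (hor_apex h) (hor_right h)"
  by (subst fam_horD(5)[symmetric], assumption, simp)+

lemma fam_cel_proj:
  assumes "d \<in> fam_cel A"
  shows "proj d 4 = lam (span_prod (ver_dom (cel_left d)) (cel_top d)) (cel_fun d)"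
proof -
  obtain m \<phi> P where e: "d = tup [tup (cel_top d), cel_bot d, cel_left d, cel_right d, lam P m, lam P \<phi>]"
    and P: "P = span_prod (ver_dom (cel_left d)) (cel_top d)" using fam_celD(8)[OF assms] by blast
  have "proj d 4 = lam P m" by (subst e) simp
  also have "\<dots> = lam P (cel_fun d)" by (rule lam_cong, rule refl, subst e, simp)
  finally show ?thesis using P by simp
qed

end

text \<open>Since \<open>el\<close> of the identity of \<open>fam A\<close> consists of the families with a chosen index, \<open>ev A idf\<close> picks the
  chosen member. Transposing its composite with \<open>F\<close> applies \<open>F\<close> to every member.\<close>

locale families_functor = universes elts U1 + F: vd_functor F A B
  for elts :: "'v => 'v set" and U1 :: 'v and F :: "'v vdfun" and A B :: "'v vdc"
begin

abbreviation idf :: "'v vdfun" where "idf \<equiv> vdfun_id (fam A)"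
abbreviation J :: "'v vdfun" where "J \<equiv> vdfun_comp F (ev A idf)"

lemma idf: "vd_functor idf (fam A) (fam A)"
  by (rule vdfun_id_functor) (rule families.virtual_double_category_fam[OF familiesI[OF F.A]])

sublocale E: elements elts U1 A idf "fam A"
  by (rule elementsI[OF F.A idf])

sublocale tr: transposes elts U1 A idf "fam A" B J
  by (intro transposes.intro E.elements_axioms familiesI[OF F.B] vdfun_comp_functor[OF E.ev_functor[OF F.A] F.vd_functor_axioms])

lemma idf_simps [simp]:
  "Y \<in> fam_obj A ==> fobj idf Y = Y" "u \<in> fam_ver A ==> fver idf u = u"
  "h \<in> fam_hor A ==> fhor idf h = h" "d \<in> fam_cel A ==> fcel idf d = d"
  by simp_all

lemma tr_obj_eq: "Y \<in> fam_obj A ==> tr_obj idf J Y = famF_obj F Y"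
  unfolding tr_obj_def famF_obj_def by (simp cong: lam_cong)

lemma tr_ver_eq: "u \<in> fam_ver A ==> tr_ver idf J u = famF_ver F u"
  unfolding tr_ver_def famF_ver_def Let_def
  using fam_verD(1,2)[of u A] by (simp add: tr_obj_eq fam_ver_proj cong: lam_cong)

lemma tr_hor_eq: "h \<in> fam_hor A ==> tr_hor idf J h = famF_hor F h"
  unfolding tr_hor_def famF_hor_def Let_def
  using fam_horD(1,2)[of h A] by (simp add: tr_obj_eq fam_hor_proj cong: lam_cong)

lemma tr_cel_eq:
  assumes t: "d \<in> fam_cel A"
  shows "tr_cel idf J d = famF_cel F d"
proof -
  note D = fam_celD[OF t]
  note S = hpath_set[OF D(4)]
  have m: "map (tr_hor idf J) (cel_top d) = map (famF_hor F) (cel_top d)" using S tr_hor_eq by auto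
  have P: "span_prod (ver_dom (famF_ver F (cel_left d))) (map (famF_hor F) (cel_top d)) = span_prod (ver_dom (cel_left d)) (cel_top d)"
    by (rule span_prod_like) (simp_all add: list_all2_map1 famF_like list.rel_refl_strong)
  have "lam (span_prod (ver_dom (cel_left d)) (cel_top d)) (\<lambda>p. fcel J (tup (d # untup p)))
      = lam (span_prod (ver_dom (cel_left d)) (cel_top d)) (\<lambda>p. fcel F (cel_memb d p))"
  proof (rule lam_cong[OF refl])
    fix p assume "p \<in> elts (span_prod (ver_dom (cel_left d)) (cel_top d))"
    then obtain i ss where p: "p = tup (i # ss)" "i \<in> elts (idx (ver_dom (cel_left d)))" "walk i (cel_top d) ss"
      using elts_span_prod[OF fam_verD(1)[OF D(1)] S] by auto
    have "map (fhor idf) hs = hs" if "set hs \<subseteq> fam_hor A" for hs using that by (induction hs) auto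
    from this[OF S] have "map (fhor idf) (cel_top d) = cel_top d" .
    then have "tup (d # i # ss) \<in> Cel (el_raw idf)" using p t D(1) fam_verD(1)[OF D(1)] by simp
    then show "fcel J (tup (d # untup p)) = fcel F (cel_memb d p)" using p t by (simp add: cm_def del: E.el_raw_simps(4))
  qed
  then show ?thesis
    unfolding tr_cel_def famF_cel_def Let_def
    using t D(1-3) m P by (simp add: tr_ver_eq tr_hor_eq fam_cel_proj cong: map_cong)
qed

lemma famF_eq: "famF F = tr idf J"
proof -
  have "vdfun_restrict \<lparr>fdom = fam A, fcod = fam B, fobj = famF_obj F, fver = famF_ver F, fhor = famF_hor F, fcel = famF_cel F\<rparr>
    = vdfun_restrict \<lparr>fdom = fam A, fcod = fam B, fobj = tr_obj idf J, fver = tr_ver idf J, fhor = tr_hor idf J, fcel = tr_cel idf J\<rparr>"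
    using tr_obj_eq tr_ver_eq tr_hor_eq tr_cel_eq by (intro vdfun.equality) (auto simp: vdfun_restrict_def restrict_def)
  then show ?thesis by (simp add: famF_def tr_def)
qed

lemma famF_functor: "vd_functor (famF F) (fam A) (fam B)"
  unfolding famF_eq by (rule tr.tr_functor)

lemma famF_simps [simp]:
  "fdom (famF F) = fam A" "fcod (famF F) = fam B"
  "Y \<in> fam_obj A ==> fobj (famF F) Y = famF_obj F Y" "u \<in> fam_ver A ==> fver (famF F) u = famF_ver F u"
  "h \<in> fam_hor A ==> fhor (famF F) h = famF_hor F h" "d \<in> fam_cel A ==> fcel (famF F) d = famF_cel F d"
  by (simp_all add: famF_def)

text \<open>In particular \<open>el\<close> does not distinguish \<open>H\<close> from its composite with \<open>famF F\<close>.\<close>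

lemma famF_members:
  assumes H: "vd_functor H X (fam A)"
  shows "same_spans (vdfun_comp (famF F) H) H"
    "x \<in> Obj X ==> i \<in> points H x ==> memb (fobj (vdfun_comp (famF F) H) x) i = fobj F (memb (fobj H x) i)"
    "u \<in> Ver X ==> i \<in> points H (vdom X u) ==> ver_memb (fver (vdfun_comp (famF F) H) u) i = fver F (ver_memb (fver H u) i)"
    "h \<in> Hor X ==> s \<in> arcs H h ==> hor_memb (fhor (vdfun_comp (famF F) H) h) s = fhor F (hor_memb (fhor H h) s)"
    "d \<in> Cel X ==> i \<in> points H (corner X d) ==> walk i (map (fhor H) (ctop X d)) ss
      ==> cm (fcel (vdfun_comp (famF F) H) d) i ss = fcel F (cm (fcel H d) i ss)"
proof -
  interpret H: elements elts U1 A H X by (rule elementsI[OF F.A H])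
  show "same_spans (vdfun_comp (famF F) H) H"
    unfolding same_spans_def Let_def H.G.fdom
    using H.G_obj H.G_ver H.G_hor H.G_cel by (simp add: famF_like)
  show "x \<in> Obj X ==> i \<in> points H x ==> memb (fobj (vdfun_comp (famF F) H) x) i = fobj F (memb (fobj H x) i)"
    "u \<in> Ver X ==> i \<in> points H (vdom X u) ==> ver_memb (fver (vdfun_comp (famF F) H) u) i = fver F (ver_memb (fver H u) i)"
    "h \<in> Hor X ==> s \<in> arcs H h ==> hor_memb (fhor (vdfun_comp (famF F) H) h) s = fhor F (hor_memb (fhor H h) s)"
    using H.G_obj H.G_ver H.G_hor by simp_all
  assume t: "d \<in> Cel X" "i \<in> points H (corner X d)" "walk i (map (fhor H) (ctop X d)) ss"
  then show "cm (fcel (vdfun_comp (famF F) H) d) i ss = fcel F (cm (fcel H d) i ss)"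
    using H.G_cel[OF t(1)] famF_cel_memb[of "fcel H d" A i ss F] H.G_ver[of "cleft X d"] H.G.A.boundary[OF t(1)] by simp
qed

lemma famF_whisker_members:
  assumes \<phi>: "vd_trans \<phi> P Q X (fam A)"
  shows "x \<in> Obj X ==> ver_fun (tobj (whisker_left (famF F) \<phi>) x) i = ver_fun (tobj \<phi> x) i"
    "x \<in> Obj X ==> i \<in> points P x ==> ver_memb (tobj (whisker_left (famF F) \<phi>) x) i = fver F (ver_memb (tobj \<phi> x) i)"
    "h \<in> Hor X ==> tcf (whisker_left (famF F) \<phi>) h s = tcf \<phi> h s"
    "h \<in> Hor X ==> s \<in> arcs P h ==> tcm (whisker_left (famF F) \<phi>) h s = fcel F (tcm \<phi> h s)"
proof -
  interpret p: el_trans elts U1 A P Q X \<phi> by (rule el_transI[OF F.A \<phi>])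
  show "x \<in> Obj X ==> ver_fun (tobj (whisker_left (famF F) \<phi>) x) i = ver_fun (tobj \<phi> x) i"
    "x \<in> Obj X ==> i \<in> points P x ==> ver_memb (tobj (whisker_left (famF F) \<phi>) x) i = fver F (ver_memb (tobj \<phi> x) i)"
    using p.T_obj[of x] by (simp_all add: p.T.fdom_src)
  show "h \<in> Hor X ==> tcf (whisker_left (famF F) \<phi>) h s = tcf \<phi> h s"
    using p.T_hor[of h] p.b.G_hor[of h] by (simp add: tcf_def p.T.fdom_src)
  assume g: "h \<in> Hor X" "s \<in> arcs P h"
  then show "tcm (whisker_left (famF F) \<phi>) h s = fcel F (tcm \<phi> h s)"
    using p.T_hor[of h] p.b.G_hor[of h] p.b.G_leg_in[OF g] p.T_obj[of "hdom X h"] p.b.G.A.hdom_hcod[OF g(1)]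
      famF_cel_memb[of "thor \<phi> h" A "hor_left (fhor P h) s" "[s]" F]
    by (simp add: tcm_def p.T.fdom_src)
qed

end

context universes
begin

text \<open>A transformation that is the identity on spans, such as a 2-cell of the slice over \<open>fam one\<close>, induces the
  identity on elements, although its source and target may differ in their members.\<close>

lemma elT_eq_id:
  assumes A: "virtual_double_category A" and \<phi>: "vd_trans \<phi> P Q X (fam A)" and eq: "el P = el Q"
    and obj: "\<And>x i. x \<in> Obj X ==> i \<in> points P x ==> ver_fun (tobj \<phi> x) i = i"
    and hor: "\<And>h s. h \<in> Hor X ==> s \<in> arcs P h ==> tcf \<phi> h s = s"
  shows "elT \<phi> = vdfun_id (el P)"
proof -
  interpret p: el_trans elts U1 A P Q X \<phi> by (rule el_transI[OF A \<phi>])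
  note v = p.b.G.A.vdom_vcod and b = p.b.G.A.boundary
  have w: "map2 (tcf \<phi>) hs ss = ss" if "walk i (map (fhor P) hs) ss" "set hs \<subseteq> Hor X" for i hs ss
    using that by (induction hs arbitrary: i ss) (auto simp: walk_Cons_iff hor)
  show ?thesis
  proof (rule vd_functor_eqI[OF p.elT_functor vdfun_id_functor[OF p.b.virtual_double_category_el]])
    fix p
    show "p \<in> Obj (fdom (vdfun_id (el P))) ==> fobj (elT \<phi>) p = fobj (vdfun_id (el P)) p"
      by (simp, elim p.b.el_objE) (simp add: obj)
    show "p \<in> Ver (fdom (vdfun_id (el P))) ==> fver (elT \<phi>) p = fver (vdfun_id (el P)) p"
      by (simp, elim p.b.el_verE) (simp add: obj v)
    show "p \<in> Hor (fdom (vdfun_id (el P))) ==> fhor (elT \<phi>) p = fhor (vdfun_id (el P)) p"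
      by (simp, elim p.b.el_horE) (simp add: hor)
    show "p \<in> Cel (fdom (vdfun_id (el P))) ==> fcel (elT \<phi>) p = fcel (vdfun_id (el P)) p"
      by (simp, elim p.b.el_celE) (simp add: obj v b w p.b.G.A.top_set)
  qed (simp_all add: eq)
qed

end

locale families_trans = universes elts U1 + a: vd_trans \<mu> F G A B
  for elts :: "'v => 'v set" and U1 :: 'v and \<mu> :: "'v vdtrans" and F G :: "'v vdfun" and A B :: "'v vdc"
begin

sublocale F: families_functor elts U1 F A B
  by (intro families_functor.intro universes_axioms a.F)

sublocale G: families_functor elts U1 G A B
  by (intro families_functor.intro universes_axioms a.G)

lemma elT_idf: "elT (vdtrans_id F.idf) = vdfun_id (el F.idf)"
  using id_members[OF a.F.A F.idf] by (intro elT_eq_id[OF a.F.A vdtrans_id_trans[OF F.idf]]) simp_all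

sublocale tr: tr_trans elts U1 A F.idf F.idf "fam A" "vdtrans_id F.idf" B F.J G.J "whisker_right \<mu> (ev A F.idf)"
proof (intro tr_trans.intro universes_axioms el_transI[OF a.F.A vdtrans_id_trans[OF F.idf]] F.tr.transposes_axioms G.tr.transposes_axioms)
  have "vdfun_comp G.J (elT (vdtrans_id F.idf)) = G.J"
    unfolding elT_idf by (rule vdfun_comp_id[OF G.tr.J.vd_functor_axioms])
  then show "vd_trans (whisker_right \<mu> (ev A F.idf)) F.J (vdfun_comp G.J (elT (vdtrans_id F.idf))) (el F.idf) B"
    using whisker_right_trans[OF a.vd_trans_axioms F.E.ev_functor[OF a.F.A]] by simp
qed

lemma trT_obj_eq: "Y \<in> fam_obj A ==> trT_obj (vdtrans_id F.idf) (whisker_right \<mu> (ev A F.idf)) G.J Y = famT_obj \<mu> Y"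
  unfolding trT_obj_def famT_obj_def Let_def
  by (simp add: F.tr_obj_eq G.tr_obj_eq cong: lam_cong)

lemma trT_hor_eq:
  assumes g: "h \<in> fam_hor A"
  shows "trT_hor (vdtrans_id F.idf) (whisker_right \<mu> (ev A F.idf)) G.J h = famT_hor \<mu> h"
proof -
  note D = fam_horD[OF g]
  have P: "span_prod (ver_dom (famT_obj \<mu> (hor_dom h))) [famF_hor F h] = span_prod (hor_dom h) [h]"
    by (rule span_prod_like) (simp_all add: famF_like famT_obj_def)
  have *: "tcf (vdtrans_id F.idf) h (proj p 1) = proj p 1 \<and> thor (whisker_right \<mu> (ev A F.idf)) (tup [h, proj p 1]) = thor \<mu> (hor_memb h (proj p 1))"
    if p: "p \<in> elts (span_prod (hor_dom h) [h])" for p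
  proof -
    obtain i ss where "p = tup (i # ss)" "i \<in> elts (idx (hor_dom h))" "walk i [h] ss"
      using p elts_span_prod[OF D(1), of "[h]"] g by auto
    then obtain s where p: "p = tup [i, s]" "s \<in> elts (hor_apex h)" by (auto simp: walk_Cons_iff)
    then show ?thesis using id_members(2)[OF a.F.A F.idf, of h s] g by simp
  qed
  have l: "lam (span_prod (hor_dom h) [h]) (\<lambda>p. tcf (vdtrans_id F.idf) h (proj p 1)) = lam (span_prod (hor_dom h) [h]) (\<lambda>p. proj p 1)"
    "lam (span_prod (hor_dom h) [h]) (\<lambda>p. thor (whisker_right \<mu> (ev A F.idf)) (tup [h, proj p 1]))
      = lam (span_prod (hor_dom h) [h]) (\<lambda>p. thor \<mu> (hor_memb h (proj p 1)))"
    by (rule lam_cong[OF refl], use * in blast)+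
  show ?thesis
    unfolding trT_hor_def famT_hor_def Let_def
    using g D P l by (simp add: F.tr_hor_eq G.tr_hor_eq trT_obj_eq)
qed

lemma famT_eq: "famT \<mu> = trT (vdtrans_id F.idf) (whisker_right \<mu> (ev A F.idf)) G.J"
  unfolding famT_def trT_def
  using trT_obj_eq trT_hor_eq F.famF_eq G.famF_eq
  by (intro vdtrans.equality) (auto simp: vdtrans_restrict_def restrict_def)

lemma famT_trans: "vd_trans (famT \<mu>) (famF F) (famF G) (fam A) (fam B)"
  unfolding famT_eq F.famF_eq G.famF_eq by (rule tr.trT_trans)

lemma famT_members:
  "Y \<in> fam_obj A ==> i \<in> elts (idx Y) ==> ver_fun (tobj (famT \<mu>) Y) i = i \<and> ver_memb (tobj (famT \<mu>) Y) i = tobj \<mu> (memb Y i)"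
  "h \<in> fam_hor A ==> s \<in> elts (hor_apex h) ==> tcf (famT \<mu>) h s = s \<and> tcm (famT \<mu>) h s = thor \<mu> (hor_memb h s)"
proof -
  show "Y \<in> fam_obj A ==> i \<in> elts (idx Y) ==> ver_fun (tobj (famT \<mu>) Y) i = i \<and> ver_memb (tobj (famT \<mu>) Y) i = tobj \<mu> (memb Y i)"
    by (simp add: famT_def famT_obj_def)
  assume g: "h \<in> fam_hor A" "s \<in> elts (hor_apex h)"
  have "tsrc (famT \<mu>) = famF F" by (simp add: famT_def)
  moreover have "thor (famT \<mu>) h = trT_hor (vdtrans_id F.idf) (whisker_right \<mu> (ev A F.idf)) G.J h"
    using g trT_hor_eq by (simp add: famT_def)
  ultimately show "tcf (famT \<mu>) h s = s \<and> tcm (famT \<mu>) h s = thor \<mu> (hor_memb h s)"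
    using tr.trT_hor_eval[of h s] id_members(2)[OF a.F.A F.idf, of h s] g
    by (simp add: tcf_def[of "famT \<mu>"] tcm_def[of "famT \<mu>"])
qed

end

lemma (in families_functor) famF_in:
  "Y \<in> fam_obj A ==> famF_obj F Y \<in> fam_obj B" "u \<in> fam_ver A ==> famF_ver F u \<in> fam_ver B"
  "h \<in> fam_hor A ==> famF_hor F h \<in> fam_hor B" "d \<in> fam_cel A ==> famF_cel F d \<in> fam_cel B"
proof -
  interpret f: vd_functor "famF F" "fam A" "fam B" by (rule famF_functor)
  interpret B: families elts U1 B by (rule familiesI[OF F.B])
  show "Y \<in> fam_obj A ==> famF_obj F Y \<in> fam_obj B" using f.obj[of Y] by simp
  show "u \<in> fam_ver A ==> famF_ver F u \<in> fam_ver B" using f.ver[of u] by simp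
  show "h \<in> fam_hor A ==> famF_hor F h \<in> fam_hor B" using f.hor[of h] by simp
  show "d \<in> fam_cel A ==> famF_cel F d \<in> fam_cel B" using f.cel[of d] by simp
qed

context universes
begin

lemma lvdc_fam: "lvdc A ==> lvdc (fam A)"
proof -
  assume A: "lvdc A"
  then interpret families elts U1 A by (intro familiesI) (simp add: lvdc_def)
  show ?thesis
    using A virtual_double_category_fam large_fam_obj large_fam_ver large_fam_hor large_fam_cel by (simp add: lvdc_def)
qed

lemma families_functorI: "vd_functor F A B ==> families_functor elts U1 F A B"
  by (intro families_functor.intro universes_axioms)

lemma families_transI: "vd_trans \<mu> F G A B ==> families_trans elts U1 \<mu> F G A B"
  by (intro families_trans.intro universes_axioms)

lemma famF_id:
  assumes A: "virtual_double_category A"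
  shows "famF (vdfun_id A) = vdfun_id (fam A)"
proof -
  interpret F: families_functor elts U1 "vdfun_id A" A A by (rule families_functorI[OF vdfun_id_functor[OF A]])
  show ?thesis
  proof (rule fam_functor_eqI[OF A F.famF_functor F.idf])
    show "same_spans (famF (vdfun_id A)) F.idf"
      unfolding same_spans_def Let_def using fam_verD(1) fam_celD(1)
      by (simp add: famF_like)
    show "\<And>x i. x \<in> Obj (fam A) ==> i \<in> points F.idf x ==> memb (fobj (famF (vdfun_id A)) x) i = memb (fobj F.idf x) i"
      using fam_objD(2) by simp
    show "\<And>u i. u \<in> Ver (fam A) ==> i \<in> points F.idf (vdom (fam A) u)
      ==> ver_memb (fver (famF (vdfun_id A)) u) i = ver_memb (fver F.idf u) i"
      using fam_verD(1,3) by simp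
    show "\<And>h s. h \<in> Hor (fam A) ==> s \<in> arcs F.idf h ==> hor_memb (fhor (famF (vdfun_id A)) h) s = hor_memb (fhor F.idf h) s"
      using fam_horD(4) by simp
    fix d i ss assume t: "d \<in> Cel (fam A)" "i \<in> points F.idf (corner (fam A) d)"
      "walk i (map (fhor F.idf) (ctop (fam A) d)) ss"
    have t1: "d \<in> fam_cel A" using t by simp
    note D = fam_celD[OF t1]
    have m: "map (fhor F.idf) hs = hs" if "set hs \<subseteq> fam_hor A" for hs using that by (induction hs) auto
    have i: "i \<in> elts (idx (ver_dom (cel_left d)))" using t(2) t1 D(1) fam_verD(1)[OF D(1)] by simp
    have w: "walk i (cel_top d) ss" using t(3) t1 m[OF hpath_set[OF D(4)]] by (simp cong: map_cong)
    show "cm (fcel (famF (vdfun_id A)) d) i ss = cm (fcel F.idf d) i ss"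
      using famF_cel_memb[OF t1 i w] D(7)[OF i w] t1 by simp
  qed
qed

lemma famF_comp:
  assumes F: "vd_functor F A B" and G: "vd_functor G B C"
  shows "famF (vdfun_comp G F) = vdfun_comp (famF G) (famF F)"
proof -
  interpret F: families_functor elts U1 F A B by (rule families_functorI[OF F])
  interpret G: families_functor elts U1 G B C by (rule families_functorI[OF G])
  note GF = vdfun_comp_functor[OF F G]
  interpret GF: families_functor elts U1 "vdfun_comp G F" A C by (rule families_functorI[OF GF])
  note in' = F.famF_in
  show ?thesis
  proof (rule fam_functor_eqI[OF G.F.B GF.famF_functor vdfun_comp_functor[OF F.famF_functor G.famF_functor]])
    show "same_spans (famF (vdfun_comp G F)) (vdfun_comp (famF G) (famF F))"
      unfolding same_spans_def Let_def using fam_verD(1) fam_celD(1) in'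
      by (simp add: span_like_def)
    show "\<And>x i. x \<in> Obj (fam A) ==> i \<in> points (vdfun_comp (famF G) (famF F)) x
      ==> memb (fobj (famF (vdfun_comp G F)) x) i = memb (fobj (vdfun_comp (famF G) (famF F)) x) i"
      using fam_objD(2) in' by simp
    show "\<And>u i. u \<in> Ver (fam A) ==> i \<in> points (vdfun_comp (famF G) (famF F)) (vdom (fam A) u)
      ==> ver_memb (fver (famF (vdfun_comp G F)) u) i = ver_memb (fver (vdfun_comp (famF G) (famF F)) u) i"
      using fam_verD(1,3) in' by simp
    show "\<And>h s. h \<in> Hor (fam A) ==> s \<in> arcs (vdfun_comp (famF G) (famF F)) h
      ==> hor_memb (fhor (famF (vdfun_comp G F)) h) s = hor_memb (fhor (vdfun_comp (famF G) (famF F)) h) s"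
      using fam_horD(4) in' by simp
    fix d i ss assume t: "d \<in> Cel (fam A)" "i \<in> points (vdfun_comp (famF G) (famF F)) (corner (fam A) d)"
      "walk i (map (fhor (vdfun_comp (famF G) (famF F))) (ctop (fam A) d)) ss"
    have t1: "d \<in> fam_cel A" using t by simp
    note D = fam_celD[OF t1]
    have m: "map (fhor (vdfun_comp (famF G) (famF F))) hs = map (famF_hor G) (map (famF_hor F) hs)" if "set hs \<subseteq> fam_hor A" for hs
      using that in' by (induction hs) auto
    have i: "i \<in> elts (idx (ver_dom (cel_left d)))" using t(2) t1 D(1) fam_verD(1)[OF D(1)] in' by simp
    have w: "walk i (cel_top d) ss"
      using t(3) t1 unfolding F.E.fam_simps(11)[OF t1] m[OF hpath_set[OF D(4)]] famF_walk by simp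
    have i': "i \<in> elts (idx (ver_dom (cel_left (famF_cel F d))))" and w': "walk i (cel_top (famF_cel F d)) ss"
      using i w by (simp_all add: famF_walk)
    show "cm (fcel (famF (vdfun_comp G F)) d) i ss = cm (fcel (vdfun_comp (famF G) (famF F)) d) i ss"
      using famF_cel_memb[OF t1 i w] famF_cel_memb[OF in'(4)[OF t1] i' w'] D(7)[OF i w] t1 in' by simp
  qed
qed

lemma famT_id:
  assumes F: "vd_functor F A B"
  shows "famT (vdtrans_id F) = vdtrans_id (famF F)"
proof -
  interpret T: families_trans elts U1 "vdtrans_id F" F F A B by (rule families_transI[OF vdtrans_id_trans[OF F]])
  note M = id_members[OF T.a.F.B T.F.famF_functor]
  show ?thesis
  proof (rule fam_trans_eqI[OF T.a.F.B T.famT_trans vdtrans_id_trans[OF T.F.famF_functor]])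
    fix x i assume "x \<in> Obj (fam A)" "i \<in> points (famF F) x"
    then show "ver_fun (tobj (famT (vdtrans_id F)) x) i = ver_fun (tobj (vdtrans_id (famF F)) x) i \<and>
        ver_memb (tobj (famT (vdtrans_id F)) x) i = ver_memb (tobj (vdtrans_id (famF F)) x) i"
      using M(1)[of x i] fam_objD(2)[of x A i] by (simp add: T.famT_members)
  next
    fix h s assume "h \<in> Hor (fam A)" "s \<in> arcs (famF F) h"
    then show "tcf (famT (vdtrans_id F)) h s = tcf (vdtrans_id (famF F)) h s \<and>
        tcm (famT (vdtrans_id F)) h s = tcm (vdtrans_id (famF F)) h s"
      using M(2)[of h s] fam_horD(4)[of h A s] by (simp add: T.famT_members)
  qed
qed

lemma famT_vcomp:
  assumes a: "vd_trans \<mu> F G A B" and b: "vd_trans \<nu> G H A B"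
  shows "famT (vdtrans_vcomp \<nu> \<mu>) = vdtrans_vcomp (famT \<nu>) (famT \<mu>)"
proof -
  interpret a: families_trans elts U1 \<mu> F G A B by (rule families_transI[OF a])
  interpret b: families_trans elts U1 \<nu> G H A B by (rule families_transI[OF b])
  interpret c: families_trans elts U1 "vdtrans_vcomp \<nu> \<mu>" F H A B by (rule families_transI[OF vdtrans_vcomp_trans[OF a b]])
  show ?thesis
    by (rule fam_trans_eqI[OF a.a.F.B c.famT_trans vdtrans_vcomp_trans[OF a.famT_trans b.famT_trans]])
      (simp_all add: a.famT_members b.famT_members c.famT_members vcomp_members[OF a.a.F.B a.famT_trans b.famT_trans] fam_objD(2) fam_horD(4))
qed

lemma famT_hcomp:
  assumes a: "vd_trans \<mu> F F' A B" and b: "vd_trans \<nu> G G' B C"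
  shows "famT (vdtrans_hcomp \<nu> \<mu>) = vdtrans_hcomp (famT \<nu>) (famT \<mu>)"
proof -
  interpret a: families_trans elts U1 \<mu> F F' A B by (rule families_transI[OF a])
  interpret b: families_trans elts U1 \<nu> G G' B C by (rule families_transI[OF b])
  interpret c: families_trans elts U1 "vdtrans_hcomp \<nu> \<mu>" "vdfun_comp G F" "vdfun_comp G' F'" A C
    by (rule families_transI[OF vdtrans_hcomp_trans[OF a b]])
  note in' = a.G.famF_in
  note L = whisker_left_trans[OF a.famT_trans b.F.famF_functor] and R = whisker_right_trans[OF b.famT_trans a.G.famF_functor]
  have c: "vd_trans (famT (vdtrans_hcomp \<nu> \<mu>)) (vdfun_comp (famF G) (famF F)) (vdfun_comp (famF G') (famF F')) (fam A) (fam C)"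
    using c.famT_trans famF_comp[OF a.a.F b.a.F] famF_comp[OF a.a.G b.a.G] by simp
  show ?thesis
    unfolding vdtrans_hcomp_whisker[OF a.famT_trans b.famT_trans]
  proof (rule fam_trans_eqI[OF b.a.F.B c vdtrans_vcomp_trans[OF L R]])
    fix Y i assume Y: "Y \<in> Obj (fam A)" "i \<in> points (vdfun_comp (famF G) (famF F)) Y"
    have Y1: "Y \<in> fam_obj A" using Y by simp
    have i: "i \<in> elts (idx Y)" "i \<in> points (famF F) Y"
      using same_spansD(1)[OF b.F.famF_members(1)[OF a.F.famF_functor] a.F.famF_simps(1) Y(1)] Y Y1 by simp_all
    show "ver_fun (tobj (famT (vdtrans_hcomp \<nu> \<mu>)) Y) i
        = ver_fun (tobj (vdtrans_vcomp (whisker_right (famT \<nu>) (famF F')) (whisker_left (famF G) (famT \<mu>))) Y) i \<and>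
      ver_memb (tobj (famT (vdtrans_hcomp \<nu> \<mu>)) Y) i
        = ver_memb (tobj (vdtrans_vcomp (whisker_right (famT \<nu>) (famF F')) (whisker_left (famF G) (famT \<mu>))) Y) i"
      unfolding vcomp_members(1)[OF b.a.F.B L R Y, THEN conjunct1] vcomp_members(1)[OF b.a.F.B L R Y, THEN conjunct2]
        b.F.famF_whisker_members(1)[OF a.famT_trans Y(1)] b.F.famF_whisker_members(2)[OF a.famT_trans Y(1) i(2)]
        whisker_right_members(1)[OF b.famT_trans a.G.famF_functor Y(1)]
      using Y1 i in' by (simp add: a.famT_members b.famT_members c.famT_members fam_objD(2))
  next
    fix h s assume g: "h \<in> Hor (fam A)" "s \<in> arcs (vdfun_comp (famF G) (famF F)) h"
    have g1: "h \<in> fam_hor A" using g by simp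
    have s: "s \<in> elts (hor_apex h)" "s \<in> arcs (famF F) h"
      using same_spansD(4)[OF b.F.famF_members(1)[OF a.F.famF_functor] a.F.famF_simps(1) g(1)] g g1 by simp_all
    show "tcf (famT (vdtrans_hcomp \<nu> \<mu>)) h s
        = tcf (vdtrans_vcomp (whisker_right (famT \<nu>) (famF F')) (whisker_left (famF G) (famT \<mu>))) h s \<and>
      tcm (famT (vdtrans_hcomp \<nu> \<mu>)) h s
        = tcm (vdtrans_vcomp (whisker_right (famT \<nu>) (famF F')) (whisker_left (famF G) (famT \<mu>))) h s"
      unfolding vcomp_members(2)[OF b.a.F.B L R g, THEN conjunct1] vcomp_members(2)[OF b.a.F.B L R g, THEN conjunct2]
        b.F.famF_whisker_members(3)[OF a.famT_trans g(1)] b.F.famF_whisker_members(4)[OF a.famT_trans g(1) s(2)]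
        whisker_right_members(2,3)[OF b.famT_trans a.G.famF_functor g(1)]
      using g1 s in' by (simp add: a.famT_members b.famT_members c.famT_members fam_horD(4))
  qed
qed

lemma Fam_simps [simp]: "map0 Fam = fam" "map1 Fam = famF" "map2c Fam = famT"
  by (simp_all add: Fam_def)

lemma two_functor_Fam: "two_functor VDBL VDBL Fam"
  unfolding two_functor_def Fam_simps
proof (intro conjI allI ballI impI)
  fix A assume "A \<in> Objs VDBL"
  then have A: "lvdc A" by simp
  then show "fam A \<in> Objs VDBL" using lvdc_fam by simp
  show "famF (ide1 VDBL A) = ide1 VDBL (fam A)" using famF_id A by (simp add: lvdc_def)
next
  fix F A B assume "arr_in VDBL F A B"
  then have F: "vd_functor F A B" "lvdc A" "lvdc B" by (auto simp: arr_in_VDBL)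
  show "arr_in VDBL (famF F) (fam A) (fam B)"
    using families_functor.famF_functor[OF families_functorI[OF F(1)]] lvdc_fam F by (simp add: arr_in_VDBL)
  show "famT (ide2 VDBL F) = ide2 VDBL (famF F)" using famT_id[OF F(1)] by simp
next
  fix \<mu> F G assume "cell_in VDBL \<mu> F G"
  then obtain A B where a: "vd_trans \<mu> F G A B" "lvdc A" "lvdc B" by (rule cell_in_VDBLE)
  show "cell_in VDBL (famT \<mu>) (famF F) (famF G)"
    using cell_in_VDBLI[OF families_trans.famT_trans[OF families_transI[OF a(1)]]] lvdc_fam a by simp
next
  fix F G A B C assume "arr_in VDBL F A B" "arr_in VDBL G B C"
  then show "famF (cmp1 VDBL G F) = cmp1 VDBL (famF G) (famF F)" using famF_comp[of F A B G C] by (simp add: arr_in_VDBL)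
next
  fix \<mu> \<nu> F G H assume "cell_in VDBL \<mu> F G" "cell_in VDBL \<nu> G H"
  then obtain A B A' B' where a: "vd_trans \<mu> F G A B" "vd_trans \<nu> G H A' B'" by (elim cell_in_VDBLE)
  have "A' = A" "B' = B" using a by (auto simp: vd_trans_def vertical_transformation_iff)
  then show "famT (vcmp2 VDBL \<nu> \<mu>) = vcmp2 VDBL (famT \<nu>) (famT \<mu>)" using famT_vcomp a by simp
next
  fix \<mu> \<nu> F F' G G' assume "cell_in VDBL \<mu> F F'" "cell_in VDBL \<nu> G G'" and c: "cod1 VDBL F = dom1 VDBL G"
  then obtain A B B' C where a: "vd_trans \<mu> F F' A B" "vd_trans \<nu> G G' B' C" by (elim cell_in_VDBLE)
  have "B' = B" using a c by (auto simp: vd_trans_def)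
  then show "famT (hcmp2 VDBL \<nu> \<mu>) = hcmp2 VDBL (famT \<nu>) (famT \<mu>)" using famT_hcomp a by simp
qed

section \<open>The terminal virtual double category\<close>

definition star :: 'v where "star = set_of {}"

text \<open>One multicell for each arity: it is coded by its top, so that multicells of different arities differ.\<close>

definition one_raw :: "'v vdc" where
  "one_raw = \<lparr>Obj = {star}, Ver = {star}, Hor = {star}, Cel = range (\<lambda>n. tup (replicate n star)),
     vdom = (\<lambda>_. star), vcod = (\<lambda>_. star), vide = (\<lambda>_. star), vcmp = (\<lambda>_ _. star), hdom = (\<lambda>_. star), hcod = (\<lambda>_. star),
     ctop = untup, cbot = (\<lambda>_. star), cleft = (\<lambda>_. star), cright = (\<lambda>_. star), cide = (\<lambda>_. tup [star]),
     ccmp = (\<lambda>_ _ ds. tup (concat (map untup ds)))\<rparr>"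

definition one :: "'v vdc" where "one = vdc_restrict one_raw"

lemma one_raw_simps [simp]:
  "Obj one_raw = {star}" "Ver one_raw = {star}" "Hor one_raw = {star}" "Cel one_raw = range (\<lambda>n. tup (replicate n star))"
  "vdom one_raw = (\<lambda>_. star)" "vcod one_raw = (\<lambda>_. star)" "vide one_raw = (\<lambda>_. star)" "vcmp one_raw = (\<lambda>_ _. star)"
  "hdom one_raw = (\<lambda>_. star)" "hcod one_raw = (\<lambda>_. star)" "ctop one_raw = untup" "cbot one_raw = (\<lambda>_. star)"
  "cleft one_raw = (\<lambda>_. star)" "cright one_raw = (\<lambda>_. star)" "cide one_raw = (\<lambda>_. tup [star])"
  "ccmp one_raw = (\<lambda>_ _ ds. tup (concat (map untup ds)))"
  by (simp_all add: one_raw_def)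

lemma one_cell: "tup xs \<in> Cel one_raw \<longleftrightarrow> set xs \<subseteq> {star}"
proof
  assume "set xs \<subseteq> {star}"
  then have "xs = replicate (length xs) star" by (induction xs) auto
  then show "tup xs \<in> Cel one_raw" by (auto intro: range_eqI)
qed auto

lemma one_ops: "vdc_ops one_raw"
proof
  fix d assume "d \<in> Cel one_raw"
  moreover have "hpath {star} {star} (\<lambda>_. star) (\<lambda>_. star) star (replicate n star) star" for n by (induction n) auto
  ultimately show "cleft one_raw d \<in> Ver one_raw \<and> cright one_raw d \<in> Ver one_raw \<and> cbot one_raw d \<in> Hor one_raw \<and>
         hpath (Obj one_raw) (Hor one_raw) (hdom one_raw) (hcod one_raw) (corner one_raw d) (ctop one_raw d)
          (vdom one_raw (cright one_raw d)) \<and>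
         vcod one_raw (cleft one_raw d) = hdom one_raw (cbot one_raw d) \<and> vcod one_raw (cright one_raw d) = hcod one_raw (cbot one_raw d)"
    by auto
next
  fix k u ds assume "composable one_raw k u ds"
  then have "cell_path one_raw u ds" by (simp add: composable_def)
  from cell_path_set[OF this] have "set ds \<subseteq> range (\<lambda>n. tup (replicate n star))" by simp
  then have "set (concat (map untup ds)) \<subseteq> {star}" by auto
  then show "ccmp one_raw k u ds \<in> Cel one_raw \<and> ctop one_raw (ccmp one_raw k u ds) = concat (map (ctop one_raw) ds) \<and>
       cbot one_raw (ccmp one_raw k u ds) = cbot one_raw k \<and>
       cleft one_raw (ccmp one_raw k u ds) = vcmp one_raw (cleft one_raw k) u \<and>
       cright one_raw (ccmp one_raw k u ds) = vcmp one_raw (cright one_raw k) (cell_path_end one_raw u ds)"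
    using one_cell[of "concat (map untup ds)"] by simp
qed (use one_cell[of "[star]"] in auto)

lemma one_laws: "vdc_laws one_raw"
proof (intro vdc_laws.intro one_ops vdc_laws_axioms.intro)
  fix k u ds w yss
  assume "list_all2 (\<lambda>d ys. map (cbot one_raw) ys = ctop one_raw d) ds yss"
  then have "concat (map untup (ccmp_blocks one_raw w ds yss)) = concat (map untup (concat yss))"
    by (induction arbitrary: w rule: list_all2_induct) auto
  then show "ccmp one_raw (ccmp one_raw k u ds) w (concat yss) = ccmp one_raw k (vcmp one_raw u w) (ccmp_blocks one_raw w ds yss)"
    by simp
next
  fix d assume "d \<in> Cel one_raw"
  then obtain n where t: "d = tup (replicate n star)" by auto
  show "ccmp one_raw (cide one_raw (cbot one_raw d)) (cleft one_raw d) [d] = d" using t by simp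
  have "concat (replicate n [star]) = replicate n star" by (induction n) auto
  then show "ccmp one_raw d (vide one_raw (corner one_raw d)) (map (cide one_raw) (ctop one_raw d)) = d"
    using t by (simp add: map_replicate comp_def)
qed simp_all

lemma vdc_one: "virtual_double_category one"
  unfolding one_def by (rule vdc_laws.virtual_double_category_restrict[OF one_laws])

lemma lvdc_one: "lvdc one"
proof -
  have "large (range (\<lambda>n. tup (replicate n star)))"
    by (rule large_subset[OF large_tups[OF large_single[of star]]]) (auto intro!: imageI simp: in_lists_conv_set)
  then show ?thesis using vdc_one by (simp add: lvdc_def one_def large_single)
qed

lemma one_simps:
  "Obj one = {star}" "Ver one = {star}" "Hor one = {star}" "Cel one = Cel one_raw"
  "vdom one star = star" "vcod one star = star" "vide one star = star" "vcmp one star star = star" "hdom one star = star" "hcod one star = star"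
  "d \<in> Cel one_raw ==> ctop one d = untup d" "d \<in> Cel one_raw ==> cbot one d = star"
  "d \<in> Cel one_raw ==> cleft one d = star" "d \<in> Cel one_raw ==> cright one d = star" "cide one star = tup [star]"
  "composable one k u ds ==> ccmp one k u ds = tup (concat (map untup ds))"
  using vdc_ops.composable_restrict[OF one_ops, of k u ds] by (simp_all add: one_def del: one_raw_simps(4))

lemma one_cell_eqI: "d \<in> Cel one ==> k \<in> Cel one ==> length (ctop one d) = length (ctop one k) ==> d = k"
  by (auto simp: one_simps)

definition to_one :: "'v vdc => 'v vdfun" where
  "to_one A = vdfun_restrict \<lparr>fdom = A, fcod = one, fobj = (\<lambda>_. star), fver = (\<lambda>_. star), fhor = (\<lambda>_. star),
     fcel = (\<lambda>d. tup (replicate (length (ctop A d)) star))\<rparr>"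

lemma to_one_functor:
  assumes A: "virtual_double_category A"
  shows "vd_functor (to_one A) A one"
proof -
  interpret A: vdc_laws A by (rule vdc_laws[OF A])
  let ?F = "\<lparr>fdom = A, fcod = one, fobj = (\<lambda>_. star), fver = (\<lambda>_. star), fhor = (\<lambda>_. star),
     fcel = (\<lambda>d. tup (replicate (length (ctop A d)) star))\<rparr>"
  have cl: "tup (replicate n star) \<in> Cel one_raw" for n using one_cell by auto
  show ?thesis
    unfolding to_one_def
  proof (rule vd_functor_restrictI[OF A vdc_one])
    show "vdfun_laws ?F"
      unfolding vdfun_laws_def Let_def vdfun.simps
    proof (intro conjI allI ballI impI)
      fix k u ds assume c: "composable A k u ds"
      have cp: "cell_path one star (map (\<lambda>d. tup (replicate (length (ctop A d)) star)) ds)" for ds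
        by (induction ds) (simp_all add: one_simps cl del: one_raw_simps(4))
      have "length ds = length (ctop A k)" using c by (metis composable_def length_map)
      then have "composable one (tup (replicate (length (ctop A k)) star)) star (map (\<lambda>d. tup (replicate (length (ctop A d)) star)) ds)"
        using cp[of ds] cl by (simp add: composable_def one_simps comp_def map_replicate_const del: one_raw_simps(4))
      moreover have "concat (map (\<lambda>d. replicate (length (ctop A d)) star) ds) = replicate (length (concat (map (ctop A) ds))) star" for ds
        by (induction ds) (auto simp: replicate_add)
      ultimately show "tup (replicate (length (ctop A (ccmp A k u ds))) star)
          = ccmp one (tup (replicate (length (ctop A k)) star)) star (map (\<lambda>d. tup (replicate (length (ctop A d)) star)) ds)"
        using A.ccmp[OF c] by (simp add: one_simps comp_def)
    qed (use A.cide in \<open>simp_all add: one_simps cl map_replicate_const del: one_raw_simps(4)\<close>)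
  qed simp_all
qed

text \<open>A multicell of \<open>one\<close> is determined by its arity, which functors preserve.\<close>

lemma to_one_unique:
  assumes F: "vd_functor F A one"
  shows "F = to_one A"
proof -
  interpret F: vd_functor F A one by (rule F)
  interpret o: vd_functor "to_one A" A one by (rule to_one_functor[OF F.A])
  show ?thesis
  proof (rule vdfun_eqI[OF F.is_functor o.is_functor]; simp)
    show "\<And>a. a \<in> Obj A ==> fobj F a = fobj (to_one A) a" using F.obj o.obj by (simp add: one_simps)
    show "\<And>a. a \<in> Ver A ==> fver F a = fver (to_one A) a" using F.ver o.ver by (simp add: one_simps)
    show "\<And>a. a \<in> Hor A ==> fhor F a = fhor (to_one A) a" using F.hor o.hor by (simp add: one_simps)
    show "\<And>d. d \<in> Cel A ==> fcel F d = fcel (to_one A) d" using F.cel o.cel by (intro one_cell_eqI) auto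
  qed
qed

lemma terminal_one: "terminal2 VDBL one"
  unfolding terminal2_def
proof (intro conjI ballI allI impI)
  show "one \<in> Objs VDBL" using lvdc_one by simp
  fix A assume "A \<in> Objs VDBL"
  then have A: "lvdc A" "virtual_double_category A" by (auto simp: lvdc_def)
  show "\<exists>!F. arr_in VDBL F A one"
    using to_one_functor[OF A(2)] to_one_unique A(1) lvdc_one by (auto simp: arr_in_VDBL)
  fix F G assume "arr_in VDBL F A one" "arr_in VDBL G A one"
  then have FG: "F = to_one A" "G = to_one A" using to_one_unique by (auto simp: arr_in_VDBL)
  note i = vdtrans_id_trans[OF to_one_functor[OF A(2)]]
  show "\<exists>!\<mu>. cell_in VDBL \<mu> F G"
  proof (intro ex1I)
    show "cell_in VDBL (vdtrans_id (to_one A)) F G" unfolding FG by (rule cell_in_VDBLI[OF i A(1) lvdc_one])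
    fix \<mu> assume "cell_in VDBL \<mu> F G"
    then have "vd_trans \<mu> (to_one A) (to_one A) A one" by (simp add: FG cell_in_VDBL to_one_def)
    then interpret a: vd_trans \<mu> "to_one A" "to_one A" A one .
    interpret i: vd_trans "vdtrans_id (to_one A)" "to_one A" "to_one A" A one by (rule i)
    show "\<mu> = vdtrans_id (to_one A)"
    proof (rule vdtrans_eqI[OF a.trans i.trans])
      fix a assume "a \<in> Obj (fdom (tsrc (vdtrans_id (to_one A))))"
      then have a: "a \<in> Obj A" by simp
      show "tobj \<mu> a = tobj (vdtrans_id (to_one A)) a"
        using a.obj[OF a] i.obj[OF a] by (simp only: one_simps) auto
    next
      fix a assume "a \<in> Hor (fdom (tsrc (vdtrans_id (to_one A))))"
      then have a: "a \<in> Hor A" by simp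
      show "thor \<mu> a = thor (vdtrans_id (to_one A)) a"
        using a.hor[OF a] i.hor[OF a] by (intro one_cell_eqI) auto
    qed simp_all
  qed
qed

lemma bang_one: "lvdc A ==> bang VDBL one A = to_one A"
  using bang_arr[OF terminal_one, of A] to_one_unique by (simp add: arr_in_VDBL)

end

context universes
begin

section \<open>The universal property of the virtual double category of elements\<close>

lemma transposesI:
  assumes "virtual_double_category B" "vd_functor G X (fam B)" "vd_functor J (el G) C"
  shows "transposes elts U1 B G X C J"
  by (intro transposes.intro elementsI assms familiesI vd_functor.B[OF assms(3)])

lemma same_spans_el:
  assumes "virtual_double_category A" "virtual_double_category A'" "vd_functor P X (fam A)" "vd_functor Q X (fam A')" "same_spans P Q"
  shows "el P = el Q"
  by (rule el_cong[OF elementsI[OF assms(1,3)] elementsI[OF assms(2,4)] assms(5)])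

text \<open>Both sides have the same spans and the same members.\<close>

lemma tr_ev:
  assumes B: "virtual_double_category B" and A: "virtual_double_category A" and G: "vd_functor G X (fam B)"
    and H: "vd_functor H X (fam A)" and s: "same_spans G H"
  shows "tr G (ev A H) = H"
proof -
  have e: "el G = el H" by (rule same_spans_el[OF B A G H s])
  interpret H: elements elts U1 A H X by (rule elementsI[OF A H])
  interpret t: transposes elts U1 B G X A "ev A H"
    using H.ev_functor[OF A] e by (intro transposesI B G) simp
  note D = same_spansD[OF s H.G.fdom]
  show ?thesis
  proof (rule fam_functor_eqI[OF A t.tr_functor H])
    show "same_spans (tr G (ev A H)) H" by (rule same_spans_trans[OF B G t.same_spans_tr s])
    fix d i ss assume t: "d \<in> Cel X" "i \<in> points H (corner X d)" "walk i (map (fhor H) (ctop X d)) ss"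
    have "i \<in> points G (corner X d)" "walk i (map (fhor G) (ctop X d)) ss"
      using t D(1) same_spans_walk(1)[OF s H.G.fdom H.G.A.top_set] H.G.A.boundary H.G.A.vdom_vcod by simp_all
    from t.tr_cel_eval(2)[OF t(1) this] show "cm (fcel (tr G (ev A H)) d) i ss = cm (fcel H d) i ss"
      using t by simp
  qed (use D H.G.A.vdom_vcod in simp_all)
qed

text \<open>By \<open>tr_ev\<close>, both are transposes along \<open>Q\<close> of functors to the terminal \<open>one\<close>.\<close>

lemma one_functor_eqI:
  assumes P: "vd_functor P X (fam one)" and Q: "vd_functor Q X (fam one)" and s: "same_spans P Q"
  shows "P = Q"
proof -
  have "ev one P = ev one Q"
    using to_one_unique elements.ev_functor[OF elementsI[OF vdc_one P] vdc_one] elements.ev_functor[OF elementsI[OF vdc_one Q] vdc_one]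
      same_spans_el[OF vdc_one vdc_one P Q s] by metis
  then show ?thesis
    using tr_ev[OF vdc_one vdc_one Q P same_spans_sym[OF vdc_one vdc_one P Q s]] tr_ev[OF vdc_one vdc_one Q Q]
      same_spans_sym[OF vdc_one vdc_one P Q s] same_spans_trans[OF vdc_one P _ s] by metis
qed

lemma ev_famF:
  assumes F: "vd_functor F A B" and H: "vd_functor H X (fam A)"
  shows "ev B (vdfun_comp (famF F) H) = vdfun_comp F (ev A H)"
proof -
  interpret F: families_functor elts U1 F A B by (rule families_functorI[OF F])
  note M = F.famF_members[OF H] and K = vdfun_comp_functor[OF H F.famF_functor]
  interpret H: elements elts U1 A H X by (rule elementsI[OF F.F.A H])
  interpret K: elements elts U1 B "vdfun_comp (famF F) H" X by (rule elementsI[OF F.F.B K])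
  have e: "el (vdfun_comp (famF F) H) = el H" by (rule same_spans_el[OF F.F.B F.F.A K H M(1)])
  note R = vdfun_comp_functor[OF H.ev_functor[OF F.F.A] F]
  have sets: "Obj (el_raw (vdfun_comp (famF F) H)) = Obj (el_raw H)" "Ver (el_raw (vdfun_comp (famF F) H)) = Ver (el_raw H)"
    "Hor (el_raw (vdfun_comp (famF F) H)) = Hor (el_raw H)" "Cel (el_raw (vdfun_comp (famF F) H)) = Cel (el_raw H)"
    using e K.el_simps(1-4) H.el_simps(1-4) by metis+
  have c: "cm (famF_cel F (fcel H d)) i ss = fcel F (cm (fcel H d) i ss)"
    if "d \<in> Cel X" "i \<in> points H (corner X d)" "walk i (H.top' d) ss" for d i ss
    using M(5)[OF that] H.G_cel[OF that(1)] that(1) by simp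
  show ?thesis
  proof (rule vd_functor_eqI[OF K.ev_functor[OF F.F.B] R])
    fix p
    show "p \<in> Obj (fdom (vdfun_comp F (ev A H))) ==> fobj (ev B (vdfun_comp (famF F) H)) p = fobj (vdfun_comp F (ev A H)) p"
      by (simp add: sets, elim H.el_objE) (simp add: sets H.G_obj)
    show "p \<in> Ver (fdom (vdfun_comp F (ev A H))) ==> fver (ev B (vdfun_comp (famF F) H)) p = fver (vdfun_comp F (ev A H)) p"
      by (simp add: sets, elim H.el_verE) (simp add: sets H.G_ver)
    show "p \<in> Hor (fdom (vdfun_comp F (ev A H))) ==> fhor (ev B (vdfun_comp (famF F) H)) p = fhor (vdfun_comp F (ev A H)) p"
      by (simp add: sets, elim H.el_horE) (simp add: sets H.G_hor)
    show "p \<in> Cel (fdom (vdfun_comp F (ev A H))) ==> fcel (ev B (vdfun_comp (famF F) H)) p = fcel (vdfun_comp F (ev A H)) p"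
      by (simp add: sets, elim H.el_celE) (simp add: sets H.G_cel c)
  qed (simp_all add: e)
qed

text \<open>Both sides have the spans of \<open>G\<close>, and \<open>ev\<close> takes both to \<open>F \<circ> J\<close>.\<close>

lemma famF_tr:
  assumes B: "virtual_double_category B" and G: "vd_functor G X (fam B)" and J: "vd_functor J (el G) C" and F: "vd_functor F C D"
  shows "vdfun_comp (famF F) (tr G J) = tr G (vdfun_comp F J)"
proof -
  interpret t: transposes elts U1 B G X C J by (rule transposesI[OF B G J])
  interpret F: families_functor elts U1 F C D by (rule families_functorI[OF F])
  note K = vdfun_comp_functor[OF t.tr_functor F.famF_functor]
  have "same_spans (vdfun_comp (famF F) (tr G J)) G"
    by (rule same_spans_trans[OF F.F.A t.tr_functor F.famF_members(1)[OF t.tr_functor] t.same_spans_tr])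
  then have "same_spans G (vdfun_comp (famF F) (tr G J))" by (rule same_spans_sym[OF F.F.B B K G])
  from tr_ev[OF B F.F.B G K this] show ?thesis
    using ev_famF[OF F t.tr_functor] t.ev_tr[OF F.F.A] by simp
qed

lemma lvdc_el: "lvdc X ==> virtual_double_category B ==> vd_functor G X (fam B) ==> lvdc (el G)"
  using elements.virtual_double_category_el[OF elementsI] elements.large_el[OF elementsI] by (simp add: lvdc_def)

text \<open>\<open>unit G\<close> is the family of all elements of \<open>G\<close>, each indexed by itself.\<close>

definition unit :: "'v vdfun => 'v vdfun" where "unit G = tr G (vdfun_id (el G))"

lemma unit_functor:
  assumes "virtual_double_category B" "vd_functor G X (fam B)"
  shows "vd_functor (unit G) X (fam (el G))" "same_spans (unit G) G"
proof -
  interpret elements elts U1 B G X by (rule elementsI[OF assms])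
  interpret t: transposes elts U1 B G X "el G" "vdfun_id (el G)"
    by (rule transposesI[OF assms vdfun_id_functor[OF virtual_double_category_el]])
  show "vd_functor (unit G) X (fam (el G))" "same_spans (unit G) G"
    unfolding unit_def by (rule t.tr_functor, rule t.same_spans_tr)
qed

lemma famF_unit:
  assumes B: "virtual_double_category B" and G: "vd_functor G X (fam B)" and J: "vd_functor J (el G) C"
  shows "vdfun_comp (famF J) (unit G) = tr G J"
  unfolding unit_def using famF_tr[OF B G vdfun_id_functor[OF vd_functor.A[OF J]] J] vdfun_comp_id(1)[OF J] by simp

text \<open>By \<open>famF_unit\<close>, composing \<open>famF h\<close> with \<open>unit G\<close> is transposing \<open>h\<close>, so the inverse is \<open>ev A\<close>.\<close>

lemma ex1_famF_unit:
  assumes B: "virtual_double_category B" and A: "virtual_double_category A" and G: "vd_functor G X (fam B)"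
    and H: "vd_functor H X (fam A)" and s: "same_spans G H"
  shows "\<exists>!h. vd_functor h (el G) A \<and> vdfun_comp (famF h) (unit G) = H"
proof (intro ex1I conjI)
  have e: "el G = el H" by (rule same_spans_el[OF B A G H s])
  show h: "vd_functor (ev A H) (el G) A" unfolding e by (rule elements.ev_functor[OF elementsI[OF A H] A])
  show "vdfun_comp (famF (ev A H)) (unit G) = H" using famF_unit[OF B G h] tr_ev[OF B A G H s] by simp
  fix h assume h: "vd_functor h (el G) A \<and> vdfun_comp (famF h) (unit G) = H"
  interpret t: transposes elts U1 B G X A h by (rule transposesI[OF B G h[THEN conjunct1]])
  show "h = ev A H" using t.ev_tr[OF A] famF_unit[OF B G h[THEN conjunct1]] h by simp
qed

lemma famT_unit_members:
  assumes B: "virtual_double_category B" and G: "vd_functor G X (fam B)" and \<gamma>: "vd_trans \<gamma> h k (el G) A"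
  shows "x \<in> Obj X ==> i \<in> points G x ==> ver_fun (tobj (whisker_right (famT \<gamma>) (unit G)) x) i = i
      \<and> ver_memb (tobj (whisker_right (famT \<gamma>) (unit G)) x) i = tobj \<gamma> (tup [x, i])"
    "\<Gamma> \<in> Hor X ==> s \<in> arcs G \<Gamma> ==> tcf (whisker_right (famT \<gamma>) (unit G)) \<Gamma> s = s
      \<and> tcm (whisker_right (famT \<gamma>) (unit G)) \<Gamma> s = thor \<gamma> (tup [\<Gamma>, s])"
proof -
  interpret f: families_trans elts U1 \<gamma> h k "el G" A by (rule families_transI[OF \<gamma>])
  interpret t: transposes elts U1 B G X "el G" "vdfun_id (el G)" by (rule transposesI[OF B G vdfun_id_functor[OF f.a.F.A]])
  note M = whisker_right_members[OF f.famT_trans unit_functor(1)[OF B G]]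
  show "x \<in> Obj X ==> i \<in> points G x ==> ver_fun (tobj (whisker_right (famT \<gamma>) (unit G)) x) i = i
      \<and> ver_memb (tobj (whisker_right (famT \<gamma>) (unit G)) x) i = tobj \<gamma> (tup [x, i])"
    using M(1)[of x] f.famT_members(1)[of "tr_obj G (vdfun_id (el G)) x" i] t.tr_obj_in[of x] by (simp add: unit_def)
  show "\<Gamma> \<in> Hor X ==> s \<in> arcs G \<Gamma> ==> tcf (whisker_right (famT \<gamma>) (unit G)) \<Gamma> s = s
      \<and> tcm (whisker_right (famT \<gamma>) (unit G)) \<Gamma> s = thor \<gamma> (tup [\<Gamma>, s])"
    using M(2,3)[of \<Gamma> s] f.famT_members(2)[of "tr_hor G (vdfun_id (el G)) \<Gamma>" s] t.tr_hor_in[of \<Gamma>] by (simp add: unit_def)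
qed

text \<open>The members of the whiskered transformation are the components of \<open>\<gamma>\<close>, so the only candidate is \<open>evT A \<mu>\<close>;
  it runs between \<open>h\<close> and \<open>k\<close> because \<open>elT \<mu>\<close> is the identity.\<close>

lemma ex1_famT_unit:
  assumes B: "virtual_double_category B" and A: "virtual_double_category A" and G: "vd_functor G X (fam B)"
    and h: "vd_functor h (el G) A" and k: "vd_functor k (el G) A"
    and \<mu>: "vd_trans \<mu> (vdfun_comp (famF h) (unit G)) (vdfun_comp (famF k) (unit G)) X (fam A)"
    and obj: "\<And>x i. x \<in> Obj X ==> i \<in> points G x ==> ver_fun (tobj \<mu> x) i = i"
    and hor: "\<And>\<Gamma> s. \<Gamma> \<in> Hor X ==> s \<in> arcs G \<Gamma> ==> tcf \<mu> \<Gamma> s = s"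
  shows "\<exists>!\<gamma>. vd_trans \<gamma> h k (el G) A \<and> whisker_right (famT \<gamma>) (unit G) = \<mu>"
proof -
  let ?P = "vdfun_comp (famF h) (unit G)" and ?Q = "vdfun_comp (famF k) (unit G)"
  interpret h: transposes elts U1 B G X A h by (rule transposesI[OF B G h])
  interpret k: transposes elts U1 B G X A k by (rule transposesI[OF B G k])
  note PQ = famF_unit[OF B G h] famF_unit[OF B G k]
  interpret a: el_trans elts U1 A ?P ?Q X \<mu> by (rule el_transI[OF A \<mu>])
  have PG: "same_spans ?P G" unfolding PQ by (rule h.same_spans_tr)
  note S = same_spansD[OF PG h.G.fdom]
  have eP: "el ?P = el G" and eQ: "el ?Q = el G" unfolding PQ by (rule h.el_tr, rule k.el_tr)
  have evP: "ev A ?P = h" and evQ: "ev A ?Q = k" unfolding PQ by (rule h.ev_tr[OF A], rule k.ev_tr[OF A])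
  have "elT \<mu> = vdfun_id (el G)"
    using elT_eq_id[OF A \<mu>] eP eQ obj hor S by simp
  then have ga: "vd_trans (evT A \<mu>) h k (el G) A"
    using a.evT_trans[OF A] eP evP evQ vdfun_comp_id(1)[OF k] by simp
  have raw: "Obj (el_raw ?P) = Obj (el_raw G)" "Hor (el_raw ?P) = Hor (el_raw G)"
    using eP a.b.el_simps(1,3) h.el_simps(1,3) by metis+
  have e: "\<And>p. p \<in> Obj (el G) ==> tobj (evT A \<mu>) p = ver_memb (tobj \<mu> (bs p)) (pt p)"
    "\<And>p. p \<in> Hor (el G) ==> thor (evT A \<mu>) p = tcm \<mu> (bs p) (pt p)"
    using raw by (simp_all add: evT_def evP[unfolded PQ] evP)
  show ?thesis
  proof (intro ex1I conjI)
    show "vd_trans (evT A \<mu>) h k (el G) A" by (rule ga)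
    note M = famT_unit_members[OF B G ga]
    interpret f: families_trans elts U1 "evT A \<mu>" h k "el G" A by (rule families_transI[OF ga])
    show "whisker_right (famT (evT A \<mu>)) (unit G) = \<mu>"
      by (rule fam_trans_eqI[OF A whisker_right_trans[OF f.famT_trans unit_functor(1)[OF B G]] \<mu>])
        (use M obj hor S e in simp_all)
    fix \<gamma> assume c: "vd_trans \<gamma> h k (el G) A \<and> whisker_right (famT \<gamma>) (unit G) = \<mu>"
    then interpret c: vd_trans \<gamma> h k "el G" A by simp
    note N = famT_unit_members[OF B G c.vd_trans_axioms, unfolded c[THEN conjunct2]]
    show "\<gamma> = evT A \<mu>"
    proof (rule vdtrans_eqI[OF c.trans f.a.trans])
      fix p
      show "p \<in> Obj (fdom (tsrc (evT A \<mu>))) ==> tobj \<gamma> p = tobj (evT A \<mu>) p"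
        using N(1) e(1) by (simp, elim h.el_objE) simp
      show "p \<in> Hor (fdom (tsrc (evT A \<mu>))) ==> thor \<gamma> p = thor (evT A \<mu>) p"
        using N(2) e(2) by (simp, elim h.el_horE) simp
    qed simp_all
  qed
qed

text \<open>A 2-cell of the slice lies over an identity, that is, it is the identity on spans; this is the hypothesis
  under which \<open>ex1_famT_unit\<close> applies.\<close>

lemma parametric_right_two_adjoint_Fam: "parametric_right_two_adjoint VDBL one VDBL Fam"
  unfolding parametric_right_two_adjoint_def Fam_simps
proof (rule has_left_two_adjointI[OF two_category_VDBL two_category_slice2[OF two_category_VDBL]])
  let ?R = "slice_lift VDBL one Fam" and ?S = "slice2 VDBL (fam one)" and ?p = "\<lambda>A. famF (to_one A)"
  let ?\<eta> = "\<lambda>G. (G, unit G, ?p (el G))"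
  show "two_functor VDBL ?S ?R"
    using two_functor_slice_lift[OF two_category_VDBL two_category_VDBL two_functor_Fam terminal_one] by simp
  have G: "vd_functor G (fdom G) (fam one)" "lvdc (fdom G)" if "G \<in> Objs ?S" for G
    using that by (auto simp: slice2_def Arrs_VDBL)
  have p: "vd_functor (?p A) (fam A) (fam one)" if "lvdc A" for A
    using that families_functor.famF_functor[OF families_functorI[OF to_one_functor]] by (simp add: lvdc_def)
  have lel: "lvdc (el G)" if "G \<in> Objs ?S" for G using G[OF that] lvdc_el vdc_one by blast
  have span: "same_spans (vdfun_comp (?p A) H) H" if "lvdc A" "vd_functor H X (fam A)" for A H X
    using that families_functor.famF_members(1)[OF families_functorI[OF to_one_functor]] by (simp add: lvdc_def)
  show "el G \<in> Objs VDBL" if "G \<in> Objs ?S" for G using lel[OF that] by simp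
  show "arr_in ?S (?\<eta> G) G (map0 ?R (el G))" if "G \<in> Objs ?S" for G
  proof -
    note U = unit_functor[OF vdc_one G(1)[OF that]] and K = vdfun_comp_functor[OF unit_functor(1)[OF vdc_one G(1)[OF that]] p[OF lel[OF that]]]
    have v: "virtual_double_category (el G)" using lel[OF that] by (simp add: lvdc_def)
    have "vdfun_comp (?p (el G)) (unit G) = G"
      using one_functor_eqI[OF K G(1)[OF that]] same_spans_trans[OF v U(1) span[OF lel[OF that] U(1)] U(2)] by blast
    then show ?thesis
      using U(1) p[OF lel[OF that]] G[OF that] lel[OF that] lvdc_fam lvdc_one vd_functor.fdom[OF p[OF lel[OF that]]]
      by (simp add: arr_in_slice2 slice_lift_def bang_one arr_in_VDBL)
  qed
  fix G A assume GO: "G \<in> Objs ?S" and "A \<in> Objs VDBL"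
  then have A: "lvdc A" "virtual_double_category A" by (auto simp: lvdc_def)
  note G' = G[OF GO] and U = unit_functor[OF vdc_one G(1)[OF GO]] and E = lel[OF GO]
  have harr: "arr_in VDBL h (el G) A \<longleftrightarrow> vd_functor h (el G) A" for h using A E by (simp add: arr_in_VDBL)
  have hR: "cmp1 ?S (map1 ?R h) (?\<eta> G) = (G, vdfun_comp (famF h) (unit G), ?p A)" if "vd_functor h (el G) A" for h
    using that A vd_functor.fdom[OF that] vd_functor.fcod[OF that] by (simp add: slice2_def slice_lift_def bang_one)
  fix f assume "arr_in ?S f G (map0 ?R A)"
  then obtain H where f: "f = (G, H, ?p A)" "vd_functor H (fdom G) (fam A)" "vdfun_comp (?p A) H = G"
    using vd_functor.fdom[OF p[OF A(1)]] by (auto simp: arr_in_slice2 slice_lift_def bang_one A(1) arr_in_VDBL)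
  have "same_spans G H" using span[OF A(1) f(2)] f(3) by simp
  from ex1_famF_unit[OF vdc_one A(2) G'(1) f(2) this]
  show "\<exists>!h. arr_in VDBL h (el G) A \<and> cmp1 ?S (map1 ?R h) (?\<eta> G) = f"
    unfolding harr f(1) by (metis (no_types, lifting) prod.inject hR)
next
  let ?R = "slice_lift VDBL one Fam" and ?S = "slice2 VDBL (fam one)" and ?p = "\<lambda>A. famF (to_one A)"
  let ?\<eta> = "\<lambda>G. (G, unit G, ?p (el G))"
  fix G A h k a assume "G \<in> Objs ?S" and "A \<in> Objs VDBL" and "arr_in VDBL h (el G) A" "arr_in VDBL k (el G) A"
    and a: "cell_in ?S a (cmp1 ?S (map1 ?R h) (?\<eta> G)) (cmp1 ?S (map1 ?R k) (?\<eta> G))"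
  then have G: "vd_functor G (fdom G) (fam one)" "lvdc (fdom G)" and A: "lvdc A" "virtual_double_category A"
    and h: "vd_functor h (el G) A" and k: "vd_functor k (el G) A" and E: "lvdc (el G)"
    by (auto simp: slice2_def Arrs_VDBL arr_in_VDBL lvdc_def)
  interpret h: vd_functor h "el G" A by (rule h)
  interpret k: vd_functor k "el G" A by (rule k)
  interpret p: families_functor elts U1 "to_one A" A one by (rule families_functorI[OF to_one_functor[OF A(2)]])
  obtain \<mu> where \<mu>: "a = (G, \<mu>, ?p A)" "cell_in VDBL \<mu> (vdfun_comp (famF h) (unit G)) (vdfun_comp (famF k) (unit G))"
    "vdtrans_hcomp (vdtrans_id (?p A)) \<mu> = vdtrans_id G"
    using a by (auto simp: cell_in_slice2 slice_lift_def bang_one A(1)) (auto simp: slice2_def)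
  have c: "vd_trans \<mu> (vdfun_comp (famF h) (unit G)) (vdfun_comp (famF k) (unit G)) (fdom G) (fam A)"
  proof -
    have "fdom (unit G) = fdom G" using vd_functor.fdom[OF unit_functor(1)[OF vdc_one G(1)]] .
    moreover have "fcod (famF h) = fam A"
      using vd_functor.fcod[OF families_functor.famF_functor[OF families_functorI[OF h]]] .
    ultimately show ?thesis using \<mu>(2) by (simp add: cell_in_VDBL)
  qed
  have w: "whisker_left (?p A) \<mu> = vdtrans_id G" using \<mu>(3) vdtrans_hcomp_id_left[OF c p.famF_functor] by simp
  have PG: "same_spans (vdfun_comp (famF h) (unit G)) G"
    unfolding famF_unit[OF vdc_one G(1) h] by (rule transposes.same_spans_tr[OF transposesI[OF vdc_one G(1) h]])
  note S = same_spansD[OF PG vd_functor.fdom[OF G(1)]] and W = p.famF_whisker_members[OF c, unfolded w]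
    and I = id_members[OF vdc_one G(1)]
  have ex: "\<exists>!\<gamma>. vd_trans \<gamma> h k (el G) A \<and> whisker_right (famT \<gamma>) (unit G) = \<mu>"
  proof (rule ex1_famT_unit[OF vdc_one A(2) G(1) h k c])
    fix x i assume x: "x \<in> Obj (fdom G)" "i \<in> points G x"
    show "ver_fun (tobj \<mu> x) i = i" by (rule trans[OF sym[OF W(1)[OF x(1)]] conjunct1[OF I(1)[OF x]]])
  next
    fix \<Gamma> s assume g: "\<Gamma> \<in> Hor (fdom G)" "s \<in> arcs G \<Gamma>"
    show "tcf \<mu> \<Gamma> s = s" by (rule trans[OF sym[OF W(3)[OF g(1)]] conjunct1[OF I(2)[OF g]]])
  qed
  have cc: "cell_in VDBL \<gamma> h k \<longleftrightarrow> vd_trans \<gamma> h k (el G) A" for \<gamma> using E A by (simp add: cell_in_VDBL)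
  have wr: "hcmp2 ?S (map2c ?R \<gamma>) (ide2 ?S (?\<eta> G)) = (G, whisker_right (famT \<gamma>) (unit G), ?p A)" if "vd_trans \<gamma> h k (el G) A" for \<gamma>
  proof -
    interpret g: families_trans elts U1 \<gamma> h k "el G" A by (rule families_transI[OF that])
    show ?thesis
      using vdtrans_hcomp_id_right[OF g.famT_trans unit_functor(1)[OF vdc_one G(1)]] A(1)
      by (simp add: slice2_def slice_lift_def bang_one)
  qed
  have "(vd_trans \<gamma> h k (el G) A \<and> hcmp2 ?S (map2c ?R \<gamma>) (ide2 ?S (?\<eta> G)) = a)
      \<longleftrightarrow> (vd_trans \<gamma> h k (el G) A \<and> whisker_right (famT \<gamma>) (unit G) = \<mu>)" for \<gamma>
    using wr[of \<gamma>] unfolding \<mu>(1) by (intro conj_cong[OF refl]) (simp only: prod.inject simp_thms)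
  then show "\<exists>!\<gamma>. cell_in VDBL \<gamma> h k \<and> hcmp2 ?S (map2c ?R \<gamma>) (ide2 ?S (?\<eta> G)) = a"
    using ex unfolding cc by presburger
qed

end

section \<open>The split fibrations\<close>

text \<open>Applied to \<open>evT A \<phi>\<close>, this determines the source of a transformation \<open>\<phi>\<close> whose members are identities.\<close>

lemma vd_trans_identity:
  assumes \<mu>: "vd_trans \<mu> F G A B" and obj: "\<And>a. a \<in> Obj A ==> tobj \<mu> a = vide B (fobj G a)"
    and hor: "\<And>h. h \<in> Hor A ==> thor \<mu> h = cide B (fhor G h)"
  shows "F = G"
proof -
  interpret a: vd_trans \<mu> F G A B by (rule \<mu>)
  have o: "fobj F a = fobj G a" if "a \<in> Obj A" for a using a.obj[OF that] obj[OF that] a.G.obj[OF that] a.F.B.vide by metis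
  have h: "fhor F h = fhor G h" if "h \<in> Hor A" for h
    using a.hor[OF that] hor[OF that] a.G.hor[OF that] a.F.B.cide[of "fhor G h"] by simp
  have v: "fver F u = fver G u" if u: "u \<in> Ver A" for u
    using a.ver[OF u] obj a.F.A.vdom_vcod[OF u] a.F.ver[OF u] a.G.ver[OF u] o
      a.F.B.vcmp_vide[of "fver F u"] a.F.B.vcmp_vide[of "fver G u"] by simp
  have c: "fcel F d = fcel G d" if t: "d \<in> Cel A" for d
  proof -
    note b = a.F.A.boundary[OF t] and f = a.F.cel[OF t] and g = a.G.cel[OF t]
    have m: "map (thor \<mu>) (ctop A d) = map (cide B) (ctop B (fcel G d))"
      using hor a.F.A.top_set[OF t] g by auto
    have x: "tobj \<mu> (corner A d) = vide B (corner B (fcel G d))"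
      using obj b a.F.A.vdom_vcod g a.G.ver by simp
    have "ccmp1 B (cide B (cbot B (fcel F d))) (fcel F d) = fcel F d"
      using a.F.B.ccmp_cide_left[of "fcel F d"] f by simp
    moreover have "thor \<mu> (cbot A d) = cide B (cbot B (fcel F d))" using hor b f h by simp
    ultimately show ?thesis using a.cel[OF t] m x a.F.B.ccmp_cide_right[of "fcel G d"] g by simp
  qed
  show ?thesis by (rule vdfun_eqI) (simp_all add: a.F.is_functor a.G.is_functor o v h c)
qed

context universes
begin

text \<open>The members lie in \<open>one\<close>, where data with equal boundaries are equal.\<close>

lemma one_trans_eqI:
  assumes \<phi>: "vd_trans \<phi> P Q X (fam one)" and \<psi>: "vd_trans \<psi> P Q X (fam one)"
    and obj: "\<And>x i. x \<in> Obj X ==> i \<in> points P x ==> ver_fun (tobj \<phi> x) i = ver_fun (tobj \<psi> x) i"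
    and hor: "\<And>h s. h \<in> Hor X ==> s \<in> arcs P h ==> tcf \<phi> h s = tcf \<psi> h s"
  shows "\<phi> = \<psi>"
proof -
  interpret p: el_trans elts U1 one P Q X \<phi> by (rule el_transI[OF vdc_one \<phi>])
  interpret q: el_trans elts U1 one P Q X \<psi> by (rule el_transI[OF vdc_one \<psi>])
  show ?thesis
  proof (rule fam_trans_eqI[OF vdc_one \<phi> \<psi>])
    show "ver_fun (tobj \<phi> x) i = ver_fun (tobj \<psi> x) i \<and> ver_memb (tobj \<phi> x) i = ver_memb (tobj \<psi> x) i"
      if "x \<in> Obj X" "i \<in> points P x" for x i
      using obj[OF that] p.T_fun_in[OF that] q.T_fun_in[OF that] by (simp add: one_simps)
    show "tcf \<phi> h s = tcf \<psi> h s \<and> tcm \<phi> h s = tcm \<psi> h s" if "h \<in> Hor X" "s \<in> arcs P h" for h s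
      using hor[OF that] p.T_hor_in[OF that] q.T_hor_in[OF that] one_cell_eqI[of "tcm \<phi> h s" "tcm \<psi> h s"] by simp
  qed
qed

text \<open>Hence \<open>elT\<close> does not distinguish \<open>\<phi>\<close> from its whiskering with the projection to \<open>fam one\<close>.\<close>

lemma elT_cong:
  assumes A: "virtual_double_category A" "virtual_double_category B" and \<phi>: "vd_trans \<phi> P Q X (fam A)" and \<psi>: "vd_trans \<psi> P' Q' X (fam B)"
    and P: "same_spans P P'" and Q: "same_spans Q Q'"
    and obj: "\<And>x i. x \<in> Obj X ==> i \<in> points P x ==> ver_fun (tobj \<phi> x) i = ver_fun (tobj \<psi> x) i"
    and hor: "\<And>h s. h \<in> Hor X ==> s \<in> arcs P h ==> tcf \<phi> h s = tcf \<psi> h s"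
  shows "elT \<phi> = elT \<psi>"
proof -
  interpret p: el_trans elts U1 A P Q X \<phi> by (rule el_transI[OF A(1) \<phi>])
  interpret q: el_trans elts U1 B P' Q' X \<psi> by (rule el_transI[OF A(2) \<psi>])
  have eP: "el P = el P'" by (rule same_spans_el[OF A p.b.G.vd_functor_axioms q.b.G.vd_functor_axioms P])
  have eQ: "el Q = el Q'" by (rule same_spans_el[OF A p.G.G.vd_functor_axioms q.G.G.vd_functor_axioms Q])
  have raw: "Obj (el_raw P') = Obj (el_raw P)" "Ver (el_raw P') = Ver (el_raw P)"
    "Hor (el_raw P') = Hor (el_raw P)" "Cel (el_raw P') = Cel (el_raw P)"
    using eP p.b.el_simps(1-4) q.b.el_simps(1-4) by metis+
  note v = p.b.G.A.vdom_vcod and b = p.b.G.A.boundary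
  have w: "map2 (tcf \<phi>) hs ss = map2 (tcf \<psi>) hs ss" if "walk i (map (fhor P) hs) ss" "set hs \<subseteq> Hor X" for i hs ss
    using that by (induction hs arbitrary: i ss) (auto simp: walk_Cons_iff hor simp del: map_eq_conv)
  show ?thesis
  proof (rule vd_functor_eqI[OF p.elT_functor q.elT_functor])
    fix p
    show "p \<in> Obj (fdom (elT \<psi>)) ==> fobj (elT \<phi>) p = fobj (elT \<psi>) p"
      by (simp add: raw, elim p.b.el_objE) (simp add: raw obj)
    show "p \<in> Ver (fdom (elT \<psi>)) ==> fver (elT \<phi>) p = fver (elT \<psi>) p"
      by (simp add: raw, elim p.b.el_verE) (simp add: raw obj v)
    show "p \<in> Hor (fdom (elT \<psi>)) ==> fhor (elT \<phi>) p = fhor (elT \<psi>) p"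
      by (simp add: raw, elim p.b.el_horE) (simp add: raw hor)
    show "p \<in> Cel (fdom (elT \<psi>)) ==> fcel (elT \<phi>) p = fcel (elT \<psi>) p"
      by (simp add: raw, elim p.b.el_celE) (use w[OF _ p.b.G.A.top_set] in \<open>simp add: raw obj v b\<close>)
  qed (simp_all add: eP eQ)
qed

lemma elT_vcomp:
  assumes A: "virtual_double_category A" and \<phi>: "vd_trans \<phi> P Q X (fam A)" and \<psi>: "vd_trans \<psi> Q R X (fam A)"
  shows "elT (vdtrans_vcomp \<psi> \<phi>) = vdfun_comp (elT \<psi>) (elT \<phi>)"
proof -
  note c = vdtrans_vcomp_trans[OF \<phi> \<psi>]
  interpret p: el_trans elts U1 A P Q X \<phi> by (rule el_transI[OF A \<phi>])
  interpret q: el_trans elts U1 A Q R X \<psi> by (rule el_transI[OF A \<psi>])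
  interpret c: el_trans elts U1 A P R X "vdtrans_vcomp \<psi> \<phi>" by (rule el_transI[OF A c])
  note M = vcomp_members[OF A \<phi> \<psi>]
  note v = p.b.G.A.vdom_vcod and b = p.b.G.A.boundary
  have w: "map2 (tcf (vdtrans_vcomp \<psi> \<phi>)) hs ss = map2 (tcf \<psi>) hs (map2 (tcf \<phi>) hs ss)"
    if "walk i (map (fhor P) hs) ss" "set hs \<subseteq> Hor X" for i hs ss
    using that by (induction hs arbitrary: i ss) (auto simp: walk_Cons_iff M(2)[THEN conjunct1])
  have in': "x \<in> Obj X ==> i \<in> points P x ==> ver_fun (tobj \<phi> x) i \<in> points Q x"
    "h \<in> Hor X ==> s \<in> arcs P h ==> tcf \<phi> h s \<in> arcs Q h"
    "d \<in> Cel X ==> i \<in> points P (corner X d) ==> walk i (p.b.top' d) ss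
      ==> walk (ver_fun (tobj \<phi> (corner X d)) i) (map (fhor Q) (ctop X d)) (map2 (tcf \<phi>) (ctop X d) ss)" for x i h s d ss
    using p.T_fun_in[of x i] p.T_hor_in[of h s] p.T_walk(1)[OF p.b.G.A.top_path, of d i ss] by auto
  have m: "ver_fun (tobj (vdtrans_vcomp \<psi> \<phi>) x) i = ver_fun (tobj \<psi> x) (ver_fun (tobj \<phi> x) i)"
    if "x \<in> Obj X" "i \<in> points P x" for x i using M(1)[OF that] by blast
  have n: "tcf (vdtrans_vcomp \<psi> \<phi>) h s = tcf \<psi> h (tcf \<phi> h s)" if "h \<in> Hor X" "s \<in> arcs P h" for h s
    using M(2)[OF that] by blast
  show ?thesis
  proof (rule vd_functor_eqI[OF c.elT_functor vdfun_comp_functor[OF p.elT_functor q.elT_functor]])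
    fix p
    show "p \<in> Obj (fdom (vdfun_comp (elT \<psi>) (elT \<phi>))) ==> fobj (elT (vdtrans_vcomp \<psi> \<phi>)) p = fobj (vdfun_comp (elT \<psi>) (elT \<phi>)) p"
      by (simp, elim p.b.el_objE) (simp add: m in' del: vdtrans_vcomp_simps)
    show "p \<in> Ver (fdom (vdfun_comp (elT \<psi>) (elT \<phi>))) ==> fver (elT (vdtrans_vcomp \<psi> \<phi>)) p = fver (vdfun_comp (elT \<psi>) (elT \<phi>)) p"
      by (simp, elim p.b.el_verE) (simp add: m v in' del: vdtrans_vcomp_simps)
    show "p \<in> Hor (fdom (vdfun_comp (elT \<psi>) (elT \<phi>))) ==> fhor (elT (vdtrans_vcomp \<psi> \<phi>)) p = fhor (vdfun_comp (elT \<psi>) (elT \<phi>)) p"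
      by (simp, elim p.b.el_horE) (simp add: n in' del: vdtrans_vcomp_simps)
    show "p \<in> Cel (fdom (vdfun_comp (elT \<psi>) (elT \<phi>))) ==> fcel (elT (vdtrans_vcomp \<psi> \<phi>)) p = fcel (vdfun_comp (elT \<psi>) (elT \<phi>)) p"
      by (simp, elim p.b.el_celE) (simp add: m v b w[OF _ p.b.G.A.top_set] in' del: vdtrans_vcomp_simps)
  qed simp_all
qed

text \<open>The members of \<open>\<phi>\<close> are identities. As these are identities of the members of \<open>e\<close>, the members of \<open>P\<close> are
  members of \<open>e\<close> too, reindexed along \<open>\<phi>\<close>.\<close>

definition unit_lift :: "'v vdc => 'v vdc => 'v vdfun => 'v vdfun => 'v vdtrans => bool" where
  "unit_lift A X P e \<phi> \<longleftrightarrow> vd_trans \<phi> P e X (fam A) \<and>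
     (\<forall>x\<in>Obj X. \<forall>i\<in>points P x. ver_memb (tobj \<phi> x) i = vide A (memb (fobj e x) (ver_fun (tobj \<phi> x) i))) \<and>
     (\<forall>h\<in>Hor X. \<forall>s\<in>arcs P h. tcm \<phi> h s = cide A (hor_memb (fhor e h) (tcf \<phi> h s)))"

lemma unit_lift_ev:
  assumes A: "virtual_double_category A" and \<phi>: "unit_lift A X P e \<phi>"
  shows "ev A P = vdfun_comp (ev A e) (elT \<phi>)"
proof -
  have t: "vd_trans \<phi> P e X (fam A)" using \<phi> by (simp add: unit_lift_def)
  interpret p: el_trans elts U1 A "P" e X \<phi> by (rule el_transI[OF A t])
  interpret E: vd_functor "elT \<phi>" "el P" "el e" by (rule p.elT_functor)
  have o: "p \<in> Obj (el P) ==> tobj (evT A \<phi>) p = ver_memb (tobj \<phi> (bs p)) (pt p)"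
    and h: "p \<in> Hor (el P) ==> thor (evT A \<phi>) p = tcm \<phi> (bs p) (pt p)" for p
    by (simp_all add: evT_def)
  show ?thesis
  proof (rule vd_trans_identity[OF p.evT_trans[OF A]])
    fix p assume p: "p \<in> Obj (el P)"
    then show "tobj (evT A \<phi>) p = vide A (fobj (vdfun_comp (ev A e) (elT \<phi>)) p)"
      using o[OF p] E.obj[OF p] \<phi> by (simp, elim p.b.el_objE) (simp add: unit_lift_def)
  next
    fix p assume p: "p \<in> Hor (el P)"
    then show "thor (evT A \<phi>) p = cide A (fhor (vdfun_comp (ev A e) (elT \<phi>)) p)"
      using h[OF p] E.hor[OF p] \<phi> by (simp, elim p.b.el_horE) (simp add: unit_lift_def)
  qed
qed

end

text \<open>The split fibration \<open>p : fam A \<rightarrow> fam one\<close>, for large \<open>A\<close>.\<close>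

locale families_over_one = universes elts U1 for elts :: "'v => 'v set" and U1 :: 'v +
  fixes A :: "'v vdc"
  assumes lvdc_A: "lvdc A"
begin

lemma A: "virtual_double_category A"
  using lvdc_A by (simp add: lvdc_def)

abbreviation p :: "'v vdfun" where "p \<equiv> famF (to_one A)"

sublocale F: families_functor elts U1 "to_one A" A one
  by (rule families_functorI[OF to_one_functor[OF A]])

lemma p: "vd_functor p (fam A) (fam one)"
  by (rule F.famF_functor)

lemma comp_p: "vd_functor P X (fam A) ==> vd_functor (vdfun_comp p P) X (fam one)"
  by (rule vdfun_comp_functor[OF _ p])

lemma span_p: "vd_functor P X (fam A) ==> same_spans (vdfun_comp p P) P"
  by (rule F.famF_members(1))

lemma el_p: "vd_functor P X (fam A) ==> el (vdfun_comp p P) = el P"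
  by (rule same_spans_el[OF vdc_one A comp_p _ span_p])

lemma tr_p: "vd_functor P X (fam A) ==> tr (vdfun_comp p P) (ev A P) = P"
  by (rule tr_ev[OF vdc_one A comp_p _ span_p])

lemma elT_p:
  assumes \<phi>: "vd_trans \<phi> P Q X (fam A)"
  shows "elT (whisker_left p \<phi>) = elT \<phi>"
proof (rule elT_cong[OF vdc_one A whisker_left_trans[OF \<phi> p] \<phi>])
  note PQ = vd_trans.F[OF \<phi>] vd_trans.G[OF \<phi>]
  show "same_spans (vdfun_comp p P) P" "same_spans (vdfun_comp p Q) Q" using span_p PQ by blast+
qed (rule F.famF_whisker_members[OF \<phi>], assumption)+

text \<open>The image of \<open>\<phi>\<close> in \<open>fam one\<close> determines \<open>elT \<phi>\<close>, hence the members of the source by \<open>unit_lift_ev\<close>, hence the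
  source.\<close>

lemma unit_lift_unique:
  assumes \<phi>: "unit_lift A X P e \<phi>" and \<psi>: "unit_lift A X P' e \<psi>" and eq: "whisker_left p \<phi> = whisker_left p \<psi>"
  shows "\<phi> = \<psi>"
proof -
  have t: "vd_trans \<phi> P e X (fam A)" "vd_trans \<psi> P' e X (fam A)" using \<phi> \<psi> by (simp_all add: unit_lift_def)
  have s: "vdfun_comp p P = vdfun_comp p P'" using arg_cong[OF eq, of tsrc] vd_trans.tsrc[OF t(1)] vd_trans.tsrc[OF t(2)] by simp
  have "elT \<phi> = elT \<psi>" using elT_p t eq by metis
  then have "ev A P = ev A P'" using unit_lift_ev[OF A \<phi>] unit_lift_ev[OF A \<psi>] by simp
  then have src: "P = P'" using tr_p[OF vd_trans.F[OF t(1)]] tr_p[OF vd_trans.F[OF t(2)]] s by metis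
  note M = F.famF_whisker_members[OF t(1)] and N = F.famF_whisker_members[OF t(2)]
  have f: "ver_fun (tobj \<phi> x) i = ver_fun (tobj \<psi> x) i" if "x \<in> Obj X" for x i using M(1)[OF that] N(1)[OF that] eq by metis
  have g: "tcf \<phi> h s = tcf \<psi> h s" if "h \<in> Hor X" for h s using M(3)[OF that] N(3)[OF that] eq by metis
  show ?thesis
    by (rule fam_trans_eqI[OF A t(1)]) (use t(2) src f g \<phi> \<psi> in \<open>simp_all add: unit_lift_def\<close>)
qed

text \<open>The lift is the transpose of the identity of \<open>ev A e \<circ> elT \<nu>\<close>.\<close>

lemma unit_lift_exists:
  assumes e: "vd_functor e X (fam A)" and \<nu>: "vd_trans \<nu> b (vdfun_comp p e) X (fam one)"
  shows "\<exists>P \<phi>. unit_lift A X P e \<phi> \<and> whisker_left p \<phi> = \<nu>"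
proof -
  let ?J = "vdfun_comp (ev A e) (elT \<nu>)"
  interpret b: el_trans elts U1 one b "vdfun_comp p e" X \<nu> by (rule el_transI[OF vdc_one \<nu>])
  interpret e: elements elts U1 A e X by (rule elementsI[OF A e])
  note ev = e.ev_functor[OF A, folded el_p[OF e]]
  note J = vdfun_comp_functor[OF b.elT_functor ev]
  note id = vdtrans_id_trans[OF J]
  interpret t: tr_trans elts U1 one b "vdfun_comp p e" X \<nu> A ?J "ev A e" "vdtrans_id ?J"
    by (intro tr_trans.intro universes_axioms b.el_trans_axioms transposesI vdc_one b.T.F b.T.G J ev id)
  let ?\<phi> = "trT \<nu> (vdtrans_id ?J) (ev A e)"
  have tr: "vd_trans ?\<phi> (tr b ?J) e X (fam A)" using t.trT_trans tr_p[OF e] by simp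
  interpret T: vd_trans ?\<phi> "tr b ?J" e X "fam A" by (rule tr)
  have raw: "Obj (el_raw (vdfun_comp p e)) = Obj (el_raw e)" "Hor (el_raw (vdfun_comp p e)) = Hor (el_raw e)"
    using el_p[OF e] b.G.el_simps(1,3) e.el_simps(1,3) by metis+
  have ob: "tobj ?\<phi> x = trT_obj \<nu> (vdtrans_id ?J) (ev A e) x" if "x \<in> Obj X" for x
    using that by (simp add: trT_def b.T.fdom_src)
  have ho: "thor ?\<phi> h = trT_hor \<nu> (vdtrans_id ?J) (ev A e) h" if "h \<in> Hor X" for h
    using that by (simp add: trT_def b.T.fdom_src)
  have cf: "tcf ?\<phi> h s = tcf \<nu> h s" and cm: "tcm ?\<phi> h s = thor (vdtrans_id ?J) (tup [h, s])"
    if "h \<in> Hor X" "s \<in> arcs b h" for h s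
    using t.trT_hor_eval[OF that] ho[OF that(1)] that by (simp_all add: tcf_def[of ?\<phi>] tcm_def[of ?\<phi>])
  have u: "unit_lift A X (tr b ?J) e ?\<phi>"
    unfolding unit_lift_def
  proof (intro conjI ballI tr)
    fix x i assume x: "x \<in> Obj X" "i \<in> points (tr b ?J) x"
    then have i: "i \<in> points b x" by simp
    show "ver_memb (tobj ?\<phi> x) i = vide A (memb (fobj e x) (ver_fun (tobj ?\<phi> x) i))"
      using x(1) i ob[OF x(1)] b.T_fun_in[OF x(1) i] b.elT_functor[THEN vd_functor.obj, of "tup [x, i]"]
      by (simp add: raw)
  next
    fix h s assume g: "h \<in> Hor X" "s \<in> arcs (tr b ?J) h"
    then have s: "s \<in> arcs b h" by simp
    show "tcm ?\<phi> h s = cide A (hor_memb (fhor e h) (tcf ?\<phi> h s))"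
      using g(1) s cf[OF g(1) s] cm[OF g(1) s] b.T_hor_in[OF g(1) s] b.elT_functor[THEN vd_functor.hor, of "tup [h, s]"]
      by (simp add: raw)
  qed
  have src: "vdfun_comp p (tr b ?J) = b"
    by (rule one_functor_eqI[OF comp_p[OF T.F] b.T.F same_spans_trans[OF A T.F span_p[OF T.F] t.P.same_spans_tr]])
  note W = F.famF_whisker_members[OF tr]
  have "whisker_left p ?\<phi> = \<nu>"
  proof (rule one_trans_eqI[OF whisker_left_trans[OF tr p, unfolded src] \<nu>])
    show "ver_fun (tobj (whisker_left p ?\<phi>) x) i = ver_fun (tobj \<nu> x) i" if "x \<in> Obj X" "i \<in> points b x" for x i
      using W(1)[OF that(1), of i] ob[OF that(1)] that(2) by simp
    show "tcf (whisker_left p ?\<phi>) h s = tcf \<nu> h s" if "h \<in> Hor X" "s \<in> arcs b h" for h s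
      using W(3)[OF that(1), of s] cf[OF that] by simp
  qed
  with u show ?thesis by blast
qed

subsection \<open>Closure properties of the chosen lifts\<close>

lemma unit_lift_id:
  assumes e: "vd_functor e X (fam A)"
  shows "unit_lift A X e e (vdtrans_id e)"
proof -
  note I = id_members[OF A e]
  show ?thesis
    unfolding unit_lift_def
  proof (intro conjI ballI vdtrans_id_trans[OF e])
    fix x i assume x: "x \<in> Obj X" "i \<in> points e x"
    show "ver_memb (tobj (vdtrans_id e) x) i = vide A (memb (fobj e x) (ver_fun (tobj (vdtrans_id e) x) i))"
      using I(1)[OF x] by presburger
  next
    fix h s assume x: "h \<in> Hor X" "s \<in> arcs e h"
    show "tcm (vdtrans_id e) h s = cide A (hor_memb (fhor e h) (tcf (vdtrans_id e) h s))"
      using I(2)[OF x] by presburger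
  qed
qed

text \<open>The identity that is composed with a member of \<open>\<delta>\<close> must be the identity of its target.\<close>

lemma unit_lift_comp_members:
  assumes \<phi>: "unit_lift A X P e \<phi>" and \<delta>: "vd_trans \<delta> Q P X (fam A)"
  shows "x \<in> Obj X ==> i \<in> points Q x ==> ver_fun (tobj (vdtrans_vcomp \<phi> \<delta>) x) i = ver_fun (tobj \<phi> x) (ver_fun (tobj \<delta> x) i)
      \<and> ver_memb (tobj (vdtrans_vcomp \<phi> \<delta>) x) i = ver_memb (tobj \<delta> x) i"
    "h \<in> Hor X ==> s \<in> arcs Q h ==> tcf (vdtrans_vcomp \<phi> \<delta>) h s = tcf \<phi> h (tcf \<delta> h s)
      \<and> tcm (vdtrans_vcomp \<phi> \<delta>) h s = tcm \<delta> h s"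
proof -
  have t: "vd_trans \<phi> P e X (fam A)" using \<phi> by (simp add: unit_lift_def)
  interpret f: el_trans elts U1 A P e X \<phi> by (rule el_transI[OF A t])
  interpret d: el_trans elts U1 A Q P X \<delta> by (rule el_transI[OF A \<delta>])
  show "ver_fun (tobj (vdtrans_vcomp \<phi> \<delta>) x) i = ver_fun (tobj \<phi> x) (ver_fun (tobj \<delta> x) i)
      \<and> ver_memb (tobj (vdtrans_vcomp \<phi> \<delta>) x) i = ver_memb (tobj \<delta> x) i" if x: "x \<in> Obj X" "i \<in> points Q x"
  proof -
    note hi = d.T_fun_in[OF x]
    note fi = f.T_fun_in[OF x(1) hi[THEN conjunct1]]
    have "ver_memb (tobj \<phi> x) (ver_fun (tobj \<delta> x) i) = vide A (memb (fobj e x) (ver_fun (tobj \<phi> x) (ver_fun (tobj \<delta> x) i)))"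
      using \<phi> x(1) hi by (simp add: unit_lift_def)
    moreover have "memb (fobj e x) (ver_fun (tobj \<phi> x) (ver_fun (tobj \<delta> x) i)) \<in> Obj A"
      using fi fam_objD(2)[OF f.G.G_obj[OF x(1)]] by simp
    ultimately have "ver_memb (tobj \<phi> x) (ver_fun (tobj \<delta> x) i) = vide A (vcod A (ver_memb (tobj \<delta> x) i))"
      using fi hi F.F.A.vide by metis
    then show ?thesis using vcomp_members(1)[OF A \<delta> t x] hi F.F.A.vcmp_vide[of "ver_memb (tobj \<delta> x) i"] by simp
  qed
  show "tcf (vdtrans_vcomp \<phi> \<delta>) h s = tcf \<phi> h (tcf \<delta> h s) \<and> tcm (vdtrans_vcomp \<phi> \<delta>) h s = tcm \<delta> h s"
    if x: "h \<in> Hor X" "s \<in> arcs Q h"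
  proof -
    note hi = d.T_hor_in[OF x]
    note fi = f.T_hor_in[OF x(1) hi[THEN conjunct1]]
    have "tcm \<phi> h (tcf \<delta> h s) = cide A (hor_memb (fhor e h) (tcf \<phi> h (tcf \<delta> h s)))"
      using \<phi> x(1) hi by (simp add: unit_lift_def)
    moreover have "hor_memb (fhor e h) (tcf \<phi> h (tcf \<delta> h s)) \<in> Hor A" using fi f.G.G_hor_memb[OF x(1)] by simp
    ultimately have "tcm \<phi> h (tcf \<delta> h s) = cide A (cbot A (tcm \<delta> h s))"
      using fi hi F.F.A.cide[of "hor_memb (fhor e h) (tcf \<phi> h (tcf \<delta> h s))"] by simp
    then show ?thesis using vcomp_members(2)[OF A \<delta> t x] F.F.A.ccmp1_cide(1)[of "tcm \<delta> h s"] hi by simp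
  qed
qed

lemma unit_lift_vcomp:
  assumes \<psi>: "unit_lift A X Q e \<psi>" and \<phi>: "unit_lift A X P Q \<phi>"
  shows "unit_lift A X P e (vdtrans_vcomp \<psi> \<phi>)"
proof -
  have t: "vd_trans \<phi> P Q X (fam A)" "vd_trans \<psi> Q e X (fam A)" using \<phi> \<psi> by (simp_all add: unit_lift_def)
  interpret f: el_trans elts U1 A P Q X \<phi> by (rule el_transI[OF A t(1)])
  interpret g: el_trans elts U1 A Q e X \<psi> by (rule el_transI[OF A t(2)])
  have m: "memb (fobj Q x) j = memb (fobj e x) (ver_fun (tobj \<psi> x) j)" if "x \<in> Obj X" "j \<in> points Q x" for x j
    using \<psi> g.T_fun_in[OF that] that fam_objD(2)[OF g.G.G_obj[OF that(1)]] F.F.A.vide unfolding unit_lift_def by metis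
  have n: "hor_memb (fhor Q h) s = hor_memb (fhor e h) (tcf \<psi> h s)" if "h \<in> Hor X" "s \<in> arcs Q h" for h s
    using \<psi> g.T_hor_in[OF that] that g.G.G_hor_memb[OF that(1)] F.F.A.cide unfolding unit_lift_def by (metis list.inject)
  note M = unit_lift_comp_members[OF \<psi> t(1)]
  show ?thesis
    unfolding unit_lift_def
  proof (intro conjI ballI vdtrans_vcomp_trans[OF t])
    fix x i assume x: "x \<in> Obj X" "i \<in> points P x"
    show "ver_memb (tobj (vdtrans_vcomp \<psi> \<phi>) x) i = vide A (memb (fobj e x) (ver_fun (tobj (vdtrans_vcomp \<psi> \<phi>) x) i))"
      using M(1)[OF x] m[OF x(1)] f.T_fun_in[OF x] \<phi> x unfolding unit_lift_def by metis
  next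
    fix h s assume x: "h \<in> Hor X" "s \<in> arcs P h"
    show "tcm (vdtrans_vcomp \<psi> \<phi>) h s = cide A (hor_memb (fhor e h) (tcf (vdtrans_vcomp \<psi> \<phi>) h s))"
      using M(2)[OF x] n[OF x(1)] f.T_hor_in[OF x] \<phi> x unfolding unit_lift_def by metis
  qed
qed

lemma unit_lift_whisker_right:
  assumes \<phi>: "unit_lift A X P e \<phi>" and K: "vd_functor K Y X"
  shows "unit_lift A Y (vdfun_comp P K) (vdfun_comp e K) (whisker_right \<phi> K)"
proof -
  have t: "vd_trans \<phi> P e X (fam A)" using \<phi> by (simp add: unit_lift_def)
  interpret t: vd_trans \<phi> P e X "fam A" by (rule t)
  interpret K: vd_functor K Y X by (rule K)
  note M = whisker_right_members[OF t K]
  show ?thesis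
    using whisker_right_trans[OF t K] M K.obj K.hor \<phi> by (simp add: unit_lift_def)
qed

text \<open>Functors preserve identities, so applying \<open>F\<close> to identity members gives identity members.\<close>

lemma unit_lift_famF:
  assumes \<phi>: "unit_lift A X P e \<phi>" and F: "vd_functor F A B"
  shows "unit_lift B X (vdfun_comp (famF F) P) (vdfun_comp (famF F) e) (whisker_left (famF F) \<phi>)"
proof -
  interpret F': families_functor elts U1 F A B by (rule families_functorI[OF F])
  have t: "vd_trans \<phi> P e X (fam A)" using \<phi> by (simp add: unit_lift_def)
  interpret f: el_trans elts U1 A P e X \<phi> by (rule el_transI[OF A t])
  note W = F'.famF_whisker_members[OF t] and M = F'.famF_members[OF f.T.G]
    and S = same_spansD[OF F'.famF_members(1)[OF f.T.F] f.b.G.fdom]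
  show ?thesis
    unfolding unit_lift_def
  proof (intro conjI ballI whisker_left_trans[OF t F'.famF_functor])
    fix x i assume x: "x \<in> Obj X" "i \<in> points (vdfun_comp (famF F) P) x"
    have i: "i \<in> points P x" using x(2) S(1)[OF x(1)] by simp
    note fi = f.T_fun_in[OF x(1) i]
    have "fver F (vide A a) = vide B (fobj F a)" if "a \<in> Obj A" for a using F'.F.vid[OF that] .
    moreover have "memb (fobj e x) (ver_fun (tobj \<phi> x) i) \<in> Obj A"
      using fi fam_objD(2)[OF f.G.G_obj[OF x(1)]] by simp
    moreover have "ver_memb (tobj \<phi> x) i = vide A (memb (fobj e x) (ver_fun (tobj \<phi> x) i))"
      using \<phi> x(1) i by (simp add: unit_lift_def)
    ultimately show "ver_memb (tobj (whisker_left (famF F) \<phi>) x) i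
        = vide B (memb (fobj (vdfun_comp (famF F) e) x) (ver_fun (tobj (whisker_left (famF F) \<phi>) x) i))"
      unfolding W(1)[OF x(1)] W(2)[OF x(1) i] M(2)[OF x(1) fi[THEN conjunct1]] by simp
  next
    fix h s assume x: "h \<in> Hor X" "s \<in> arcs (vdfun_comp (famF F) P) h"
    have s: "s \<in> arcs P h" using x(2) S(4)[OF x(1)] by simp
    note fi = f.T_hor_in[OF x(1) s]
    have "fcel F (cide A a) = cide B (fhor F a)" if "a \<in> Hor A" for a using F'.F.cid[OF that] .
    moreover have "hor_memb (fhor e h) (tcf \<phi> h s) \<in> Hor A"
      using fi f.G.G_hor_memb[OF x(1)] by simp
    moreover have "tcm \<phi> h s = cide A (hor_memb (fhor e h) (tcf \<phi> h s))"
      using \<phi> x(1) s by (simp add: unit_lift_def)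
    ultimately show "tcm (whisker_left (famF F) \<phi>) h s
        = cide B (hor_memb (fhor (vdfun_comp (famF F) e) h) (tcf (whisker_left (famF F) \<phi>) h s))"
      unfolding W(3)[OF x(1)] W(4)[OF x(1) s] M(4)[OF x(1) fi[THEN conjunct1]] by simp
  qed
qed

text \<open>As the members of \<open>\<phi>\<close> are identities, those of a factorisation of \<open>\<gamma>\<close> through \<open>\<phi>\<close> must be the members of
  \<open>\<gamma>\<close>. They fit since \<open>ev A e \<circ> elT \<gamma> = ev A e \<circ> elT \<phi> \<circ> elT \<delta> = ev A P \<circ> elT \<delta>\<close>, so \<open>trT \<delta>\<close> of \<open>evT A \<gamma>\<close> is the
  factorisation.\<close>

lemma unit_lift_cartesian:
  assumes \<phi>: "unit_lift A X P e \<phi>" and \<gamma>: "vd_trans \<gamma> Q e X (fam A)"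
    and \<delta>: "vd_trans \<delta> (vdfun_comp p Q) (vdfun_comp p P) X (fam one)"
    and eq: "vdtrans_vcomp (whisker_left p \<phi>) \<delta> = whisker_left p \<gamma>"
  shows "\<exists>!\<delta>'. vd_trans \<delta>' Q P X (fam A) \<and> whisker_left p \<delta>' = \<delta> \<and> vdtrans_vcomp \<phi> \<delta>' = \<gamma>"
proof -
  have t: "vd_trans \<phi> P e X (fam A)" using \<phi> by (simp add: unit_lift_def)
  interpret f: el_trans elts U1 A P e X \<phi> by (rule el_transI[OF A t])
  interpret g: el_trans elts U1 A Q e X \<gamma> by (rule el_transI[OF A \<gamma>])
  interpret d: el_trans elts U1 one "vdfun_comp p Q" "vdfun_comp p P" X \<delta> by (rule el_transI[OF vdc_one \<delta>])
  have SQ: "idx (fobj (vdfun_comp p Q) x) = idx (fobj Q x)" if "x \<in> Obj X" for x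
    by (rule same_spansD(1)[OF span_p[OF g.T.F] g.b.G.fdom that])
  have SQ': "hor_apex (fhor (vdfun_comp p Q) h) = hor_apex (fhor Q h)" if "h \<in> Hor X" for h
    by (rule same_spansD(4)[OF span_p[OF g.T.F] g.b.G.fdom that])
  have SP: "idx (fobj (vdfun_comp p P) x) = idx (fobj P x)" if "x \<in> Obj X" for x
    by (rule same_spansD(1)[OF span_p[OF f.T.F] f.b.G.fdom that])
  have SP': "hor_apex (fhor (vdfun_comp p P) h) = hor_apex (fhor P h)" if "h \<in> Hor X" for h
    by (rule same_spansD(4)[OF span_p[OF f.T.F] f.b.G.fdom that])
  note E = vcomp_members[OF vdc_one \<delta> whisker_left_trans[OF t p], unfolded eq]
  have gf: "ver_fun (tobj \<gamma> x) i = ver_fun (tobj \<phi> x) (ver_fun (tobj \<delta> x) i)" if "x \<in> Obj X" "i \<in> points Q x" for x i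
    using E(1)[of x i] F.famF_whisker_members(1)[OF t, of x] F.famF_whisker_members(1)[OF \<gamma>, of x] SQ that by metis
  have gh: "tcf \<gamma> h s = tcf \<phi> h (tcf \<delta> h s)" if "h \<in> Hor X" "s \<in> arcs Q h" for h s
    using E(2)[of h s] F.famF_whisker_members(3)[OF t, of h] F.famF_whisker_members(3)[OF \<gamma>, of h] SQ' that by metis
  have elg: "elT \<gamma> = vdfun_comp (elT \<phi>) (elT \<delta>)"
    using elT_vcomp[OF vdc_one \<delta> whisker_left_trans[OF t p], unfolded eq] elT_p[OF t] elT_p[OF \<gamma>] by simp
  have dP: "vd_functor (elT \<delta>) (el Q) (el P)" using d.elT_functor el_p[OF g.T.F] el_p[OF f.T.F] by simp
  have comp: "vdfun_comp (ev A e) (elT \<gamma>) = vdfun_comp (ev A P) (elT \<delta>)"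
    unfolding elg unit_lift_ev[OF A \<phi>]
    by (rule vdfun_comp_assoc[OF dP f.elT_functor f.G.ev_functor[OF A], symmetric])
  have evg: "vd_trans (evT A \<gamma>) (ev A Q) (vdfun_comp (ev A P) (elT \<delta>)) (el (vdfun_comp p Q)) A"
    using g.evT_trans[OF A] comp el_p[OF g.T.F] by simp
  interpret t: tr_trans elts U1 one "vdfun_comp p Q" "vdfun_comp p P" X \<delta> A "ev A Q" "ev A P" "evT A \<gamma>"
  proof (intro tr_trans.intro universes_axioms d.el_trans_axioms transposesI vdc_one d.T.F d.T.G)
    show "vd_functor (ev A Q) (el (vdfun_comp p Q)) A" "vd_functor (ev A P) (el (vdfun_comp p P)) A"
      using g.b.ev_functor[OF A] f.b.ev_functor[OF A] el_p[OF g.T.F] el_p[OF f.T.F] by simp_all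
  qed (rule evg)
  let ?\<delta> = "trT \<delta> (evT A \<gamma>) (ev A P)"
  have tr: "vd_trans ?\<delta> Q P X (fam A)" using t.trT_trans tr_p[OF g.T.F] tr_p[OF f.T.F] by simp
  interpret D: vd_trans ?\<delta> Q P X "fam A" by (rule tr)
  have ob: "tobj ?\<delta> x = trT_obj \<delta> (evT A \<gamma>) (ev A P) x" if "x \<in> Obj X" for x
    using that by (simp add: trT_def d.T.fdom_src del: vdfun_comp_simps)
  have ho: "thor ?\<delta> h = trT_hor \<delta> (evT A \<gamma>) (ev A P) h" if "h \<in> Hor X" for h
    using that by (simp add: trT_def d.T.fdom_src del: vdfun_comp_simps)
  have fn: "ver_fun (tobj ?\<delta> x) i = ver_fun (tobj \<delta> x) i" and fm: "ver_memb (tobj ?\<delta> x) i = ver_memb (tobj \<gamma> x) i"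
    if x: "x \<in> Obj X" "i \<in> points Q x" for x i
    using t.trT_obj_simps(3,4)[of i x] x ob[OF x(1)] SQ[OF x(1)] by (simp_all add: evT_def)
  have cf: "tcf ?\<delta> h s = tcf \<delta> h s" and cm: "tcm ?\<delta> h s = tcm \<gamma> h s"
    if g: "h \<in> Hor X" "s \<in> arcs Q h" for h s
  proof -
    have l: "hor_left (fhor (vdfun_comp p Q) h) s = hor_left (fhor Q h) s"
      using same_spansD(5)[OF span_p[OF g.T.F] g.b.G.fdom g] by simp
    have s: "s \<in> arcs (vdfun_comp p Q) h" using g SQ' by simp
    have "thor (evT A \<gamma>) (tup [h, s]) = tcm \<gamma> h s" using g by (simp add: evT_def)
    then show "tcf ?\<delta> h s = tcf \<delta> h s" "tcm ?\<delta> h s = tcm \<gamma> h s"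
      using t.trT_hor_eval[OF g(1) s] l ho[OF g(1)] by (simp_all add: tcf_def[of ?\<delta>] tcm_def[of ?\<delta>])
  qed
  show ?thesis
  proof (intro ex1I conjI)
    show "vd_trans ?\<delta> Q P X (fam A)" by (rule tr)
    show "whisker_left p ?\<delta> = \<delta>"
    proof (rule one_trans_eqI[OF whisker_left_trans[OF tr p] \<delta>])
      show "ver_fun (tobj (whisker_left p ?\<delta>) x) i = ver_fun (tobj \<delta> x) i" if "x \<in> Obj X" "i \<in> points (vdfun_comp p Q) x" for x i
        using F.famF_whisker_members(1)[OF tr that(1), of i] fn[OF that(1), of i] SQ[OF that(1)] that(2) by simp
      show "tcf (whisker_left p ?\<delta>) h s = tcf \<delta> h s" if "h \<in> Hor X" "s \<in> arcs (vdfun_comp p Q) h" for h s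
        using F.famF_whisker_members(3)[OF tr that(1), of s] cf[OF that(1), of s] SQ'[OF that(1)] that(2) by simp
    qed
    show "vdtrans_vcomp \<phi> ?\<delta> = \<gamma>"
    proof (rule fam_trans_eqI[OF A vdtrans_vcomp_trans[OF tr t] \<gamma>])
      fix x i assume x: "x \<in> Obj X" "i \<in> points Q x"
      show "ver_fun (tobj (vdtrans_vcomp \<phi> ?\<delta>) x) i = ver_fun (tobj \<gamma> x) i
          \<and> ver_memb (tobj (vdtrans_vcomp \<phi> ?\<delta>) x) i = ver_memb (tobj \<gamma> x) i"
        using unit_lift_comp_members(1)[OF \<phi> tr x] fn[OF x] fm[OF x] gf[OF x] by presburger
    next
      fix h s assume x: "h \<in> Hor X" "s \<in> arcs Q h"
      show "tcf (vdtrans_vcomp \<phi> ?\<delta>) h s = tcf \<gamma> h s \<and> tcm (vdtrans_vcomp \<phi> ?\<delta>) h s = tcm \<gamma> h s"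
        using unit_lift_comp_members(2)[OF \<phi> tr x] cf[OF x] cm[OF x] gh[OF x] by presburger
    qed
    fix \<epsilon> assume "vd_trans \<epsilon> Q P X (fam A) \<and> whisker_left p \<epsilon> = \<delta> \<and> vdtrans_vcomp \<phi> \<epsilon> = \<gamma>"
    then have \<epsilon>: "vd_trans \<epsilon> Q P X (fam A)" and pe: "whisker_left p \<epsilon> = \<delta>" and fe: "vdtrans_vcomp \<phi> \<epsilon> = \<gamma>" by auto
    note M = unit_lift_comp_members[OF \<phi> \<epsilon>, unfolded fe] and W = F.famF_whisker_members[OF \<epsilon>, unfolded pe]
    show "\<epsilon> = ?\<delta>"
    proof (rule fam_trans_eqI[OF A \<epsilon> tr])
      fix x i assume x: "x \<in> Obj X" "i \<in> points Q x"
      show "ver_fun (tobj \<epsilon> x) i = ver_fun (tobj ?\<delta> x) i \<and> ver_memb (tobj \<epsilon> x) i = ver_memb (tobj ?\<delta> x) i"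
        using M(1)[OF x] W(1)[OF x(1), of i] fn[OF x] fm[OF x] by presburger
    next
      fix h s assume x: "h \<in> Hor X" "s \<in> arcs Q h"
      show "tcf \<epsilon> h s = tcf ?\<delta> h s \<and> tcm \<epsilon> h s = tcm ?\<delta> h s"
        using M(2)[OF x] W(3)[OF x(1), of s] cf[OF x] cm[OF x] by presburger
    qed
  qed
qed

end

context universes
begin

definition lift :: "'v vdc => 'v vdfun => 'v vdtrans => 'v vdtrans" where
  "lift A e \<nu> = (if lift_problem VDBL (famF (to_one A)) e \<nu>
     then THE \<phi>. (\<exists>P. unit_lift A (fdom e) P e \<phi>) \<and> whisker_left (famF (to_one A)) \<phi> = \<nu> else undefined)"

end

context families_over_one
begin

lemma lvdc_X: "lvdc X ==> vd_functor P X (fam A) ==> arr_in VDBL P X (fam A)"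
  using lvdc_fam[OF lvdc_A] by (simp add: arr_in_VDBL)

lemma p_arr: "arr_in VDBL p (fam A) (fam one)"
  using p lvdc_fam[OF lvdc_A] lvdc_fam[OF lvdc_one] by (simp add: arr_in_VDBL)

lemma hcmp_p: "vd_trans \<phi> P Q X (fam A) ==> vdtrans_hcomp (vdtrans_id p) \<phi> = whisker_left p \<phi>"
  by (rule vdtrans_hcomp_id_left[OF _ p])

lemma lift_problemD:
  assumes "lift_problem VDBL p e \<nu>"
  shows "vd_functor e (fdom e) (fam A)" "lvdc (fdom e)" "vd_trans \<nu> (tsrc \<nu>) (vdfun_comp p e) (fdom e) (fam one)"
proof -
  show e: "vd_functor e (fdom e) (fam A)" "lvdc (fdom e)" using assms by (auto simp: lift_problem_def Arrs_VDBL)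
  obtain Y Z where b: "vd_trans \<nu> (tsrc \<nu>) (vdfun_comp p e) Y Z" using assms
    by (auto simp: lift_problem_def Cells_VDBL cell_in_VDBL)
  then interpret b: vd_trans \<nu> "tsrc \<nu>" "vdfun_comp p e" Y Z .
  interpret c: vd_functor "vdfun_comp p e" "fdom e" "fam one" by (rule comp_p[OF e(1)])
  show "vd_trans \<nu> (tsrc \<nu>) (vdfun_comp p e) (fdom e) (fam one)"
    using b b.G.fdom b.G.fcod c.fdom c.fcod by metis
qed

lemma lift_problemI:
  assumes "vd_functor e X (fam A)" "lvdc X" "vd_trans \<nu> b (vdfun_comp p e) X (fam one)"
  shows "lift_problem VDBL p e \<nu>"
proof -
  interpret e: vd_functor e X "fam A" by fact
  interpret b: vd_trans \<nu> b "vdfun_comp p e" X "fam one" by fact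
  show ?thesis
    using cell_in_VDBLI[OF assms(3,2) lvdc_fam[OF lvdc_one]] lvdc_X[OF assms(2,1)]
    by (simp add: lift_problem_def arr_in_def cell_in_def)
qed

text \<open>Every law below is proved by exhibiting one side as a transformation with identity members over the
  right 2-cell.\<close>

lemma lift_eqI:
  assumes \<phi>: "unit_lift A X P e \<phi>" and X: "lvdc X" and eq: "whisker_left p \<phi> = \<nu>"
  shows "lift A e \<nu> = \<phi>"
proof -
  have t: "vd_trans \<phi> P e X (fam A)" using \<phi> by (simp add: unit_lift_def)
  have e: "fdom e = X" using vd_functor.fdom[OF vd_trans.G[OF t]] .
  have "lift_problem VDBL p e \<nu>"
    using lift_problemI[OF vd_trans.G[OF t] X] whisker_left_trans[OF t p] eq by simp
  moreover have "(THE \<phi>. (\<exists>P. unit_lift A (fdom e) P e \<phi>) \<and> whisker_left p \<phi> = \<nu>) = \<phi>"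
    using \<phi> eq e unit_lift_unique by (intro the_equality) auto
  ultimately show ?thesis by (simp add: lift_def)
qed

lemma lift:
  assumes "lift_problem VDBL p e \<nu>"
  shows "unit_lift A (fdom e) (tsrc (lift A e \<nu>)) e (lift A e \<nu>)" "whisker_left p (lift A e \<nu>) = \<nu>"
proof -
  note D = lift_problemD[OF assms]
  obtain P \<phi> where \<phi>: "unit_lift A (fdom e) P e \<phi>" "whisker_left p \<phi> = \<nu>" using unit_lift_exists[OF D(1,3)] by blast
  have "tsrc \<phi> = P" using \<phi>(1) vd_trans.tsrc by (auto simp: unit_lift_def)
  then show "unit_lift A (fdom e) (tsrc (lift A e \<nu>)) e (lift A e \<nu>)" "whisker_left p (lift A e \<nu>) = \<nu>"
    using lift_eqI[OF \<phi>(1) D(2) \<phi>(2)] \<phi> by simp_all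
qed

lemma lift_trans: "lift_problem VDBL p e \<nu> ==> vd_trans (lift A e \<nu>) (tsrc (lift A e \<nu>)) e (fdom e) (fam A)"
  using lift(1) by (simp add: unit_lift_def)

lemma split_fibration_lift: "split_fibration VDBL p (lift A)"
  unfolding split_fibration_def
proof (intro conjI allI impI)
  show "p \<in> Arrs VDBL" using p_arr by (simp add: arr_in_def)
  show "lift A e \<nu> = undefined" if "\<not> lift_problem VDBL p e \<nu>" for e \<nu> using that by (simp add: lift_def)
next
  fix e \<nu> assume l: "lift_problem VDBL p e \<nu>"
  note D = lift_problemD[OF l] and L = lift[OF l] and t = lift_trans[OF l]
  have c: "cell_in VDBL (lift A e \<nu>) (tsrc (lift A e \<nu>)) e" by (rule cell_in_VDBLI[OF t D(2) lvdc_fam[OF lvdc_A]])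
  then show "lift A e \<nu> \<in> Cells VDBL" "tgt2 VDBL (lift A e \<nu>) = e" by (simp_all only: cell_in_def)
  show "hcmp2 VDBL (ide2 VDBL p) (lift A e \<nu>) = \<nu>" using hcmp_p[OF t] L(2) by simp
  show "cartesian_cell VDBL p (lift A e \<nu>)"
    unfolding cartesian_cell_def VDBL_simps
  proof (intro allI impI, elim conjE)
    fix \<gamma> \<delta> assume a: "\<gamma> \<in> Cells VDBL" "ttgt \<gamma> = ttgt (lift A e \<nu>)"
      and d: "cell_in VDBL \<delta> (vdfun_comp p (tsrc \<gamma>)) (vdfun_comp p (tsrc (lift A e \<nu>)))"
      and eq: "vdtrans_vcomp (vdtrans_hcomp (vdtrans_id p) (lift A e \<nu>)) \<delta> = vdtrans_hcomp (vdtrans_id p) \<gamma>"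
    obtain Y Z where g0: "vd_trans \<gamma> (tsrc \<gamma>) e Y Z" using a vd_trans.ttgt[OF t] by (auto simp: Cells_VDBL elim!: cell_in_VDBLE)
    have g: "vd_trans \<gamma> (tsrc \<gamma>) e (fdom e) (fam A)"
      using g0 unfolding vd_functor.fdom[OF vd_trans.G[OF g0]] vd_functor.fcod[OF vd_trans.G[OF g0], symmetric] vd_functor.fcod[OF D(1)] .
    have fd: "fdom (vdfun_comp p (tsrc \<gamma>)) = fdom e" "fcod (vdfun_comp p (tsrc \<gamma>)) = fam one"
      using vd_functor.fdom[OF comp_p[OF vd_trans.F[OF g]]] vd_functor.fcod[OF comp_p[OF vd_trans.F[OF g]]] .
    have d': "vd_trans \<delta> (vdfun_comp p (tsrc \<gamma>)) (vdfun_comp p (tsrc (lift A e \<nu>))) (fdom e) (fam one)"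
      using d fd by (simp only: cell_in_VDBL)
    have eq': "vdtrans_vcomp (whisker_left p (lift A e \<nu>)) \<delta> = whisker_left p \<gamma>" using eq hcmp_p[OF t] hcmp_p[OF g] by simp
    have "(cell_in VDBL \<delta>' (tsrc \<gamma>) (tsrc (lift A e \<nu>)) \<and> vdtrans_hcomp (vdtrans_id p) \<delta>' = \<delta> \<and> vdtrans_vcomp (lift A e \<nu>) \<delta>' = \<gamma>)
      \<longleftrightarrow> (vd_trans \<delta>' (tsrc \<gamma>) (tsrc (lift A e \<nu>)) (fdom e) (fam A) \<and> whisker_left p \<delta>' = \<delta> \<and> vdtrans_vcomp (lift A e \<nu>) \<delta>' = \<gamma>)" for \<delta>'
    proof -
      have "cell_in VDBL \<delta>' (tsrc \<gamma>) (tsrc (lift A e \<nu>)) \<longleftrightarrow> vd_trans \<delta>' (tsrc \<gamma>) (tsrc (lift A e \<nu>)) (fdom e) (fam A)"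
        unfolding cell_in_VDBL vd_functor.fdom[OF vd_trans.F[OF g]] vd_functor.fcod[OF vd_trans.F[OF g]]
        using D(2) lvdc_fam[OF lvdc_A] by blast
      then show ?thesis using hcmp_p by metis
    qed
    then show "\<exists>!\<delta>'. cell_in VDBL \<delta>' (tsrc \<gamma>) (tsrc (lift A e \<nu>)) \<and> vdtrans_hcomp (vdtrans_id p) \<delta>' = \<delta>
        \<and> vdtrans_vcomp (lift A e \<nu>) \<delta>' = \<gamma>"
      using unit_lift_cartesian[OF L(1) g d' eq'] by presburger
  qed
next
  fix e assume "e \<in> Arrs VDBL \<and> cod1 VDBL e = dom1 VDBL p"
  then have e: "vd_functor e (fdom e) (fam A)" "lvdc (fdom e)" by (auto simp: Arrs_VDBL)
  have "whisker_left p (vdtrans_id e) = vdtrans_id (vdfun_comp p e)"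
    using hcmp_p[OF vdtrans_id_trans[OF e(1)]] two_category.hcmp2_ide2[OF two_category_VDBL lvdc_X[OF e(2,1)] p_arr] by simp
  from lift_eqI[OF unit_lift_id[OF e(1)] e(2) this] show "lift A e (ide2 VDBL (cmp1 VDBL p e)) = ide2 VDBL e" by simp
next
  fix e \<nu> \<nu>' assume "lift_problem VDBL p e \<nu> \<and> \<nu>' \<in> Cells VDBL \<and> tgt2 VDBL \<nu>' = src2 VDBL \<nu>"
  then have l: "lift_problem VDBL p e \<nu>" and b': "\<nu>' \<in> Cells VDBL" "ttgt \<nu>' = tsrc \<nu>" by auto
  note D = lift_problemD[OF l] and L = lift[OF l] and t = lift_trans[OF l]
  let ?P = "tsrc (lift A e \<nu>)"
  have P: "vd_functor ?P (fdom e) (fam A)" using vd_trans.F[OF t] .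
  have src: "tsrc \<nu> = vdfun_comp p ?P" using arg_cong[OF L(2), of tsrc] by simp
  have l': "lift_problem VDBL p ?P \<nu>'"
    using b' src lvdc_X[OF D(2) P] by (simp add: lift_problem_def arr_in_def)
  note D' = lift_problemD[OF l'] and L' = lift[OF l'] and t' = lift_trans[OF l']
  have dP: "fdom ?P = fdom e" using vd_functor.fdom[OF P] .
  let ?\<phi> = "vdtrans_vcomp (lift A e \<nu>) (lift A ?P \<nu>')"
  note t'' = t'[unfolded dP]
  have u: "unit_lift A (fdom e) (tsrc (lift A ?P \<nu>')) e ?\<phi>"
    by (rule unit_lift_vcomp[OF L(1) L'(1)[unfolded dP]])
  have "whisker_left p ?\<phi> = vdtrans_vcomp \<nu> \<nu>'"
    using two_category.whisker_vcmp[OF two_category_VDBL cell_in_VDBLI[OF t'' D(2) lvdc_fam[OF lvdc_A]] cell_in_VDBLI[OF t D(2) lvdc_fam[OF lvdc_A]]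
        lvdc_X[OF D(2) vd_trans.F[OF t'']] p_arr] hcmp_p[OF t] hcmp_p[OF t''] hcmp_p[OF vdtrans_vcomp_trans[OF t'' t]] L(2) L'(2) by simp
  from lift_eqI[OF u D(2) this]
  show "lift A e (vcmp2 VDBL \<nu> \<nu>') = vcmp2 VDBL (lift A e \<nu>) (lift A (src2 VDBL (lift A e \<nu>)) \<nu>')" by simp
next
  fix e \<nu> f assume "lift_problem VDBL p e \<nu> \<and> f \<in> Arrs VDBL \<and> cod1 VDBL f = dom1 VDBL e"
  then have l: "lift_problem VDBL p e \<nu>" and f: "vd_functor f (fdom f) (fdom e)" "lvdc (fdom f)" by (auto simp: Arrs_VDBL)
  note D = lift_problemD[OF l] and L = lift[OF l] and t = lift_trans[OF l]
  have fa: "arr_in VDBL f (fdom f) (fdom e)" using f D(2) by (simp add: arr_in_VDBL)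
  have r: "vdtrans_hcomp (lift A e \<nu>) (vdtrans_id f) = whisker_right (lift A e \<nu>) f" by (rule vdtrans_hcomp_id_right[OF t f(1)])
  have u: "unit_lift A (fdom f) (vdfun_comp (tsrc (lift A e \<nu>)) f) (vdfun_comp e f) (whisker_right (lift A e \<nu>) f)"
    by (rule unit_lift_whisker_right[OF L(1) f(1)])
  have "whisker_left p (whisker_right (lift A e \<nu>) f) = vdtrans_hcomp (vdtrans_id p) (vdtrans_hcomp (lift A e \<nu>) (vdtrans_id f))"
    unfolding r by (rule hcmp_p[OF whisker_right_trans[OF t f(1)], symmetric])
  also have "\<dots> = vdtrans_hcomp (vdtrans_hcomp (vdtrans_id p) (lift A e \<nu>)) (vdtrans_id f)"
    using two_category.hcmp_assoc[OF two_category_VDBL two_category.ide2_cell[OF two_category_VDBL fa] fa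
        cell_in_VDBLI[OF t D(2) lvdc_fam[OF lvdc_A]] lvdc_X[OF D(2) vd_trans.F[OF t]]
        two_category.ide2_cell[OF two_category_VDBL p_arr] p_arr] by simp
  finally have "whisker_left p (whisker_right (lift A e \<nu>) f) = vdtrans_hcomp \<nu> (vdtrans_id f)" using hcmp_p[OF t] L(2) by simp
  from lift_eqI[OF u f(2) this]
  show "hcmp2 VDBL (lift A e \<nu>) (ide2 VDBL f) = lift A (cmp1 VDBL e f) (hcmp2 VDBL \<nu> (ide2 VDBL f))" using r by simp
qed

end

context universes
begin

text \<open>Since \<open>p \<circ> famF F = p\<close>, applying \<open>famF F\<close> to the lift gives a transformation over the same 2-cell.\<close>

lemma preserves_lifts_famF:
  assumes F: "arr_in VDBL F A B"
  shows "preserves_lifts VDBL (famF (to_one A), lift A) (famF F) (famF (to_one B), lift B)"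
  unfolding preserves_lifts_def fst_conv snd_conv
proof (intro allI impI)
  have F': "vd_functor F A B" "lvdc A" "lvdc B" using F by (auto simp: arr_in_VDBL)
  interpret a: families_over_one elts U1 A by (intro families_over_one.intro universes_axioms families_over_one_axioms.intro F')
  interpret b: families_over_one elts U1 B by (intro families_over_one.intro universes_axioms families_over_one_axioms.intro F')
  interpret F: families_functor elts U1 F A B by (rule families_functorI[OF F'(1)])
  fix e \<nu> assume l: "lift_problem VDBL (famF (to_one A)) e \<nu>"
  note D = a.lift_problemD[OF l] and L = a.lift[OF l] and t = a.lift_trans[OF l]
  have Fa: "arr_in VDBL (famF F) (fam A) (fam B)" using F.famF_functor lvdc_fam F' by (simp add: arr_in_VDBL)
  have pp: "vdfun_comp (famF (to_one B)) (famF F) = famF (to_one A)"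
    using famF_comp[OF F'(1) to_one_functor[OF b.A]] to_one_unique[OF vdfun_comp_functor[OF F'(1) to_one_functor[OF b.A]]] by simp
  have r: "vdtrans_hcomp (vdtrans_id (famF F)) (lift A e \<nu>) = whisker_left (famF F) (lift A e \<nu>)"
    by (rule vdtrans_hcomp_id_left[OF t F.famF_functor])
  have "whisker_left (famF (to_one B)) (whisker_left (famF F) (lift A e \<nu>))
      = vdtrans_hcomp (vdtrans_id (famF (to_one B))) (vdtrans_hcomp (vdtrans_id (famF F)) (lift A e \<nu>))"
    unfolding r by (rule b.hcmp_p[OF whisker_left_trans[OF t F.famF_functor], symmetric])
  also have "\<dots> = vdtrans_hcomp (vdtrans_hcomp (vdtrans_id (famF (to_one B))) (vdtrans_id (famF F))) (lift A e \<nu>)"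
    using two_category.hcmp_assoc[OF two_category_VDBL cell_in_VDBLI[OF t D(2) lvdc_fam[OF F'(2)]] a.lvdc_X[OF D(2) vd_trans.F[OF t]]
        two_category.ide2_cell[OF two_category_VDBL Fa] Fa two_category.ide2_cell[OF two_category_VDBL b.p_arr] b.p_arr] by simp
  also have "vdtrans_hcomp (vdtrans_id (famF (to_one B))) (vdtrans_id (famF F)) = vdtrans_id (famF (to_one A))"
    using two_category.hcmp2_ide2[OF two_category_VDBL Fa b.p_arr] pp by simp
  finally have "whisker_left (famF (to_one B)) (whisker_left (famF F) (lift A e \<nu>)) = \<nu>" using a.hcmp_p[OF t] L(2) by simp
  from b.lift_eqI[OF a.unit_lift_famF[OF L(1) F'(1)] D(2) this]
  show "hcmp2 VDBL (ide2 VDBL (famF F)) (lift A e \<nu>) = lift B (cmp1 VDBL (famF F) e) \<nu>" using r by simp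
qed

end

theorem proposition8p1:
  fixes elts :: "'v => 'v set" and U1 :: 'v
  assumes "universes elts U1"
  shows "familial (universes.VDBL elts) (universes.VDBL elts) (universes.Fam elts U1)"
proof -
  interpret universes elts U1 by fact
  have "\<exists>S. two_functor VDBL (Spl VDBL (map0 Fam one)) S \<and> twofun_eq VDBL (twofun_comp Spl_forget S) (slice_lift VDBL one Fam)"
  proof (rule slice_lift_factors_through_Spl[OF two_category_VDBL two_category_VDBL two_functor_Fam terminal_one])
    fix A assume "A \<in> Objs VDBL"
    then have A: "lvdc A" by simp
    interpret families_over_one elts U1 A by (intro families_over_one.intro universes_axioms families_over_one_axioms.intro A)
    show "split_fibration VDBL (map1 Fam (bang VDBL one A)) (lift A)"
      unfolding Fam_simps bang_one[OF lvdc_A] by (rule split_fibration_lift)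
  next
    fix F A B assume F: "arr_in VDBL F A B"
    then have "lvdc A" "lvdc B" by (auto simp: arr_in_VDBL)
    then show "preserves_lifts VDBL (map1 Fam (bang VDBL one A), lift A) (map1 Fam F) (map1 Fam (bang VDBL one B), lift B)"
      using preserves_lifts_famF[OF F] by (simp add: bang_one)
  qed
  then show ?thesis
    unfolding familial_def
    using two_category_VDBL two_functor_Fam terminal_one parametric_right_two_adjoint_Fam by blast
qed

end
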